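(* Let $q\in(0,1)$ and let $a,b\in\mathbb{R}$ be such that $0<|a|<1$ and $|b|<1$. Let $H$ be the operator on $\ell^{2}(\mathbb{N}_{0})$ with matrix entries (with respect to the standard basis) \[ H_{m,n}=\frac{(-a)^{m+n}q^{m(m-1)/2+n(n-1)/2}}{\sqrt{(q,ab;q)_{m}\,(q,ab;q)_{n}}}\;{}_{0}\phi_{1}\!\left(-;\,qb/a;\,q,\,\frac{q^{2-m-n}}{a^{2}}\right),\qquad m,n\in\mathbb{N}_{0}. \] Then $H$ is unitarily equivalent to the operator of multiplication by the function \[ h(x)=\frac{(ae^{-\mathrm{i}\theta},ae^{\mathrm{i}\theta},qe^{-\mathrm{i}\theta}/a,qe^{\mathrm{i}\theta}/a;q)_{\infty}}{(ab,qb/a;q)_{\infty}},\qquad x=\cos\theta,\ \theta\in(0,\pi), \] acting on $L^{2}((-1,1),\mathrm{d}\mu)$, where $\mu$ is the absolutely continuous measure on $(-1,1)$ with density \[ \frac{\mathrm{d}\mu}{\mathrm{d}x}(\cos\theta)=\frac{(q,ab;q)_{\infty}}{2\pi\sin\theta}\left|\frac{(e^{2\mathrm{i}\theta};q)_{\infty}}{(ae^{\mathrm{i}\theta},be^{\mathrm{i}\theta};q)_{\infty}}\right|^{2},\qquad \theta\in(0,\pi). \] In particular, the spectrum of $H$ is simple, purely absolutely continuous, and fills the interval \[ \sigma_{\mathrm{ac}}(H)=\frac{1}{(ab,qb/a;q)_{\infty}}\Big[(|a|,q/|a|;q)_{\infty}^{2},\,(-|a|,-q/|a|;q)_{\infty}^{2}\Big].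 \] Consequently, the operator norm of $H$ is \[ \|H\|=\frac{(-|a|,-q/|a|;q)_{\infty}^{2}}{|(ab,qb/a;q)_{\infty}|}. \]
   Context: For $q\in(0,1)$: $(c;q)_{n}:=\prod_{j=0}^{n-1}(1-cq^{j})$ for $n\in\mathbb{N}_0\cup\{\infty\}$ and $(c_{1},\dots,c_{p};q)_{n}:=(c_{1};q)_{n}\cdots(c_{p};q)_{n}$. The basic hypergeometric series used is \[ {}_{0}\phi_{1}(-;c;q,z)=\sum_{k=0}^{\infty}\frac{q^{k(k-1)}z^{k}}{(c;q)_{k}(q;q)_{k}}. \] For a real number $\lambda$ and an interval $[s,t]$, $\lambda[s,t]$ denotes the set $\{\lambda u\mid u\in[s,t]\}$. $\mathbb{N}_0=\{0,1,2,\dots\}$. *)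

theory Defs
  imports "HOL-Analysis.Analysis"
begin

section \<open>q-Pochhammer symbols and the basic hypergeometric series\<close>

definition qpoch :: "'a::comm_ring_1 list \<Rightarrow> 'a \<Rightarrow> nat \<Rightarrow> 'a" where
  "qpoch cs q n = (\<Prod>c\<leftarrow>cs. \<Prod>j<n. 1 - c * q ^ j)"

definition qpoch_inf :: "'a::{t2_space, comm_ring_1} list \<Rightarrow> 'a \<Rightarrow> 'a" where
  "qpoch_inf cs q = (\<Prod>c\<leftarrow>cs. \<Prod>j. 1 - c * q ^ j)"

definition phi_0_1 :: "real \<Rightarrow> real \<Rightarrow> real \<Rightarrow> real" where
  "phi_0_1 c q z = (\<Sum>k. q ^ (k * (k - 1)) * z ^ k / (qpoch [c] q k * qpoch [q] q k))"


section \<open>Complex L2 spaces and their bounded operators\<close>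

text \<open>
  Elements of an L2 space are represented by functions, with equality almost everywhere.
  The space of square-summable sequences is the L2 space of the counting measure, for
  which almost everywhere means everywhere.
\<close>

definition L2 :: "'a measure \<Rightarrow> ('a \<Rightarrow> complex) set" where
  "L2 M = {f \<in> borel_measurable M. integrable M (\<lambda>x. (cmod (f x))\<^sup>2)}"

definition L2_inner :: "'a measure \<Rightarrow> ('a \<Rightarrow> complex) \<Rightarrow> ('a \<Rightarrow> complex) \<Rightarrow> complex" where
  "L2_inner M f g = (LINT x|M. cnj (f x) * g x)"

definition L2_norm :: "'a measure \<Rightarrow> ('a \<Rightarrow> complex) \<Rightarrow> real" where
  "L2_norm M f = sqrt (LINT x|M. (cmod (f x))\<^sup>2)"

text \<open>
  Linear bounded maps from a subspace \<open>V\<close> of \<open>L2 M\<close> to a subspace \<open>W\<close> of \<open>L2 N\<close>. Linearity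
  and boundedness together make the map respect equality almost everywhere.
\<close>

definition L2_bounded_linear ::
  "'a measure \<Rightarrow> ('a \<Rightarrow> complex) set \<Rightarrow> 'b measure \<Rightarrow> ('b \<Rightarrow> complex) set
    \<Rightarrow> (('a \<Rightarrow> complex) \<Rightarrow> ('b \<Rightarrow> complex)) \<Rightarrow> bool" where
  "L2_bounded_linear M V N W T \<longleftrightarrow>
     (\<forall>f\<in>V. T f \<in> W) \<and>
     (\<forall>f\<in>V. \<forall>g\<in>V. AE x in N. T (\<lambda>y. f y + g y) x = T f x + T g x) \<and>
     (\<forall>c. \<forall>f\<in>V. AE x in N. T (\<lambda>y. c * f y) x = c * T f x) \<and>
     (\<exists>C. \<forall>f\<in>V. L2_norm N (T f) \<le> C * L2_norm M f)"

definition L2_bounded_op ::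
  "'a measure \<Rightarrow> (('a \<Rightarrow> complex) \<Rightarrow> ('a \<Rightarrow> complex)) \<Rightarrow> bool" where
  "L2_bounded_op M T \<longleftrightarrow> L2_bounded_linear M (L2 M) M (L2 M) T"

definition L2_opnorm ::
  "'a measure \<Rightarrow> (('a \<Rightarrow> complex) \<Rightarrow> ('a \<Rightarrow> complex)) \<Rightarrow> real" where
  "L2_opnorm M T = (SUP f\<in>{f \<in> L2 M. L2_norm M f \<le> 1}. L2_norm M (T f))"

definition L2_unitary ::
  "'a measure \<Rightarrow> 'b measure \<Rightarrow> (('a \<Rightarrow> complex) \<Rightarrow> ('b \<Rightarrow> complex)) \<Rightarrow> bool" where
  "L2_unitary M N U \<longleftrightarrow>
     L2_bounded_linear M (L2 M) N (L2 N) U \<and>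
     (\<forall>f\<in>L2 M. \<forall>g\<in>L2 M. L2_inner N (U f) (U g) = L2_inner M f g) \<and>
     (\<forall>g\<in>L2 N. \<exists>f\<in>L2 M. AE x in N. U f x = g x)"

definition L2_unitarily_equivalent ::
  "'a measure \<Rightarrow> (('a \<Rightarrow> complex) \<Rightarrow> ('a \<Rightarrow> complex))
    \<Rightarrow> 'b measure \<Rightarrow> (('b \<Rightarrow> complex) \<Rightarrow> ('b \<Rightarrow> complex)) \<Rightarrow> bool" where
  "L2_unitarily_equivalent M T N S \<longleftrightarrow>
     (\<exists>U. L2_unitary M N U \<and> (\<forall>f\<in>L2 M. AE x in N. U (T f) x = S (U f) x))"

definition mult_op :: "('a \<Rightarrow> complex) \<Rightarrow> ('a \<Rightarrow> complex) \<Rightarrow> ('a \<Rightarrow> complex)" where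
  "mult_op h f = (\<lambda>x. h x * f x)"


section \<open>Spectral notions\<close>

text \<open>
  The spectrum of the restriction of \<open>T\<close> to an invariant subspace \<open>V\<close>; the spectrum of
  \<open>T\<close> itself is the case \<open>V = L2 M\<close>.
\<close>

definition L2_spectrum_on ::
  "'a measure \<Rightarrow> ('a \<Rightarrow> complex) set \<Rightarrow> (('a \<Rightarrow> complex) \<Rightarrow> ('a \<Rightarrow> complex)) \<Rightarrow> complex set" where
  "L2_spectrum_on M V T =
     {z. \<not> (\<exists>R. L2_bounded_linear M V M V R \<and>
            (\<forall>f\<in>V. AE x in M. R (\<lambda>y. T f y - z * f y) x = f x) \<and>
            (\<forall>f\<in>V. AE x in M. T (R f) x - z * R f x = f x))}"

definition L2_spectrum ::
  "'a measure \<Rightarrow> (('a \<Rightarrow> complex) \<Rightarrow> ('a \<Rightarrow> complex)) \<Rightarrow> complex set" where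
  "L2_spectrum M T = L2_spectrum_on M (L2 M) T"

definition projection_valued_measure ::
  "'a measure \<Rightarrow> (real set \<Rightarrow> ('a \<Rightarrow> complex) \<Rightarrow> ('a \<Rightarrow> complex)) \<Rightarrow> bool" where
  "projection_valued_measure M E \<longleftrightarrow>
     (\<forall>A\<in>sets borel.
        L2_bounded_op M (E A) \<and>
        (\<forall>f\<in>L2 M. AE x in M. E A (E A f) x = E A f x) \<and>
        (\<forall>f\<in>L2 M. \<forall>g\<in>L2 M. L2_inner M (E A f) g = L2_inner M f (E A g))) \<and>
     (\<forall>f\<in>L2 M. AE x in M. E UNIV f x = f x) \<and>
     (\<forall>A::nat \<Rightarrow> real set. range A \<subseteq> sets borel \<longrightarrow> disjoint_family A \<longrightarrow>
        (\<forall>f\<in>L2 M. \<forall>g\<in>L2 M.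
           (\<lambda>i. L2_inner M f (E (A i) g)) sums L2_inner M f (E (\<Union>i. A i) g)))"

definition spectral_measure_at ::
  "'a measure \<Rightarrow> (real set \<Rightarrow> ('a \<Rightarrow> complex) \<Rightarrow> ('a \<Rightarrow> complex)) \<Rightarrow> ('a \<Rightarrow> complex) \<Rightarrow> real measure"
  where
  "spectral_measure_at M E f =
     measure_of UNIV (sets borel) (\<lambda>A. ennreal (Re (L2_inner M f (E A f))))"

text \<open>
  \<open>T\<close> is the integral of the identity against \<open>E\<close>; by polarization the quadratic forms suffice.
  Such an \<open>E\<close> exists precisely when the bounded operator \<open>T\<close> is self-adjoint; it is then unique on Borel sets up
  to equality almost everywhere.
\<close>

definition spectral_resolution ::
  "'a measure \<Rightarrow> (('a \<Rightarrow> complex) \<Rightarrow> ('a \<Rightarrow> complex))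
    \<Rightarrow> (real set \<Rightarrow> ('a \<Rightarrow> complex) \<Rightarrow> ('a \<Rightarrow> complex)) \<Rightarrow> bool" where
  "spectral_resolution M T E \<longleftrightarrow>
     projection_valued_measure M E \<and>
     (\<forall>f\<in>L2 M.
        integrable (spectral_measure_at M E f) (\<lambda>t. t) \<and>
        L2_inner M f (T f) = of_real (LINT t|spectral_measure_at M E f. t))"

definition ac_subspace ::
  "'a measure \<Rightarrow> (('a \<Rightarrow> complex) \<Rightarrow> ('a \<Rightarrow> complex)) \<Rightarrow> ('a \<Rightarrow> complex) set" where
  "ac_subspace M T =
     {f \<in> L2 M. \<exists>E. spectral_resolution M T E \<and>
                    absolutely_continuous lborel (spectral_measure_at M E f)}"

definition ac_spectrum ::
  "'a measure \<Rightarrow> (('a \<Rightarrow> complex) \<Rightarrow> ('a \<Rightarrow> complex)) \<Rightarrow> complex set" where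
  "ac_spectrum M T = L2_spectrum_on M (ac_subspace M T) T"

definition purely_ac_spectrum ::
  "'a measure \<Rightarrow> (('a \<Rightarrow> complex) \<Rightarrow> ('a \<Rightarrow> complex)) \<Rightarrow> bool" where
  "purely_ac_spectrum M T \<longleftrightarrow> ac_subspace M T = L2 M"

text \<open>
  Simplicity (multiplicity one) of the spectrum of a bounded self-adjoint operator:
  existence of a cyclic vector.
\<close>

definition simple_spectrum ::
  "'a measure \<Rightarrow> (('a \<Rightarrow> complex) \<Rightarrow> ('a \<Rightarrow> complex)) \<Rightarrow> bool" where
  "simple_spectrum M T \<longleftrightarrow>
     (\<exists>f\<in>L2 M. \<forall>g\<in>L2 M. \<forall>\<epsilon>>0. \<exists>n (c::nat \<Rightarrow> complex).
        L2_norm M (\<lambda>x. g x - (\<Sum>k<n. c k * (T ^^ k) f x)) < \<epsilon>)"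


section \<open>Operators on square-summable sequences given by matrices\<close>

abbreviation ell2_measure :: "nat measure" where
  "ell2_measure \<equiv> count_space UNIV"

definition std_basis :: "nat \<Rightarrow> nat \<Rightarrow> complex" where
  "std_basis n = (\<lambda>k. if k = n then 1 else 0)"

definition has_matrix ::
  "((nat \<Rightarrow> complex) \<Rightarrow> (nat \<Rightarrow> complex)) \<Rightarrow> (nat \<Rightarrow> nat \<Rightarrow> complex) \<Rightarrow> bool" where
  "has_matrix T A \<longleftrightarrow>
     L2_bounded_op ell2_measure T \<and>
     (\<forall>m n. L2_inner ell2_measure (std_basis m) (T (std_basis n)) = A m n)"


section \<open>The matrix, the multiplier and the orthogonality measure\<close>

definition H_entry :: "real \<Rightarrow> real \<Rightarrow> real \<Rightarrow> nat \<Rightarrow> nat \<Rightarrow> real" where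
  "H_entry q a b m n =
     (- a) ^ (m + n) * q ^ (m * (m - 1) div 2 + n * (n - 1) div 2)
       / sqrt (qpoch [q, a * b] q m * qpoch [q, a * b] q n)
     * phi_0_1 (q * b / a) q (q powi (2 - int m - int n) / a\<^sup>2)"

text \<open>Both functions of \<open>x = cos \<theta>\<close> are expressed through \<open>\<theta> = arccos x\<close>.\<close>

definition h_fun :: "real \<Rightarrow> real \<Rightarrow> real \<Rightarrow> real \<Rightarrow> complex" where
  "h_fun q a b x =
     (let \<theta> = arccos x in
       qpoch_inf [of_real a * cis (- \<theta>), of_real a * cis \<theta>,
                  of_real q * cis (- \<theta>) / of_real a, of_real q * cis \<theta> / of_real a] (of_real q)
       / of_real (qpoch_inf [a * b, q * b / a] q))"

definition mu_density :: "real \<Rightarrow> real \<Rightarrow> real \<Rightarrow> real \<Rightarrow> real" where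
  "mu_density q a b x =
     (let \<theta> = arccos x in
       qpoch_inf [q, a * b] q / (2 * pi * sin \<theta>)
       * (cmod (qpoch_inf [cis (2 * \<theta>)] (of_real q)
                / qpoch_inf [of_real a * cis \<theta>, of_real b * cis \<theta>] (of_real q)))\<^sup>2)"

definition mu_measure :: "real \<Rightarrow> real \<Rightarrow> real \<Rightarrow> real measure" where
  "mu_measure q a b =
     density (restrict_space lborel {-1<..<1}) (\<lambda>x. ennreal (mu_density q a b x))"

end

theory Submission
  imports Defs
begin

text \<open>
  The Al-Salam--Chihara polynomials \<open>Q\<^sub>n\<close> with parameters \<open>a, b\<close> are orthogonal with respect to
  \<open>\<mu>\<close> with squared norms \<open>(q, ab; q)\<^sub>n\<close>, so the coefficients with respect to the normalized
  polynomials define a unitary map from \<open>L\<^sup>2(\<mu>)\<close> onto \<open>\<ell>\<^sup>2\<close>. It conjugates multiplication by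
  \<open>h\<close> to \<open>H\<close>: up to constants, \<open>h d\<mu>\<close> is the \<open>q\<close>-Hermite measure weighted by the quotient of
  \<open>|(q e\<^sup>i\<^sup>\<theta>/a; q)\<^sub>\<infinity>|\<^sup>2\<close> and \<open>|(b e\<^sup>i\<^sup>\<theta>; q)\<^sub>\<infinity>|\<^sup>2\<close>. The integral of this weight is found by expanding
  numerator and reciprocal denominator in \<open>q\<close>-Hermite polynomials, its integrals against \<open>Q\<^sub>n\<close>
  follow by passing from \<open>a\<close> to \<open>aq\<close>, and those against \<open>Q\<^sub>m Q\<^sub>n\<close> because multiplication by \<open>x\<close>
  is symmetric and acts on the \<open>Q\<^sub>n\<close> by a three-term recurrence.

  As a function of \<open>x = cos \<theta>\<close>, \<open>h\<close> is strictly monotone, and for fixed \<open>x\<close> the difference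
  \<open>|h x - h y|\<close> is at least a positive multiple of \<open>|x - y|\<close>. Hence polynomials in \<open>h\<close> are dense in \<open>L\<^sup>2(\<mu>)\<close>, preimages of
  null sets under \<open>h\<close> are null sets, and the spectrum is the closed range of \<open>h\<close>.
\<close>

section \<open>Infinite q-products and Euler's series\<close>

text \<open>The condition |a| < 1 leaves q/a free to have modulus 1 or more, where the reciprocal
  product has no convergent q-Hermite series. The pair belonging to q/a stands in the numerator,
  however, and is entire in its parameter; its coefficients turn out to be values of Ramanujan's
  function and are verified through a q-difference equation in the parameter. For the same reason
  \<open>gauss_series\<close> keeps the factor (qb/a; q)_inf inside its terms: the contiguous
  relations then hold without exceptional parameters, and the division happens once, when the matrix
  entries are compared. The q-Hermite measure rests on the Fourier coefficients of |(z; q)_inf|^2 on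
  the unit circle, that is, on Jacobi's triple product. Monotonicity of h comes from splitting off
  one linear factor of the product; the remaining factor, which supplies the expansion constant, can
  tend to 0 at an endpoint (for |a| = q^k with k > 0), so this constant is allowed to depend on
  x.\<close>

definition qinf :: "real \<Rightarrow> 'a::{real_normed_field, banach} \<Rightarrow> 'a" where
  "qinf q x = (\<Prod>j. 1 - x * of_real q ^ j)"

definition qfac :: "real \<Rightarrow> nat \<Rightarrow> real" where
  "qfac q n = (\<Prod>j<n. 1 - q ^ Suc j)"

lemma qfac_0 [simp]: "qfac q 0 = 1"
  by (simp add: qfac_def)

lemma qfac_Suc: "qfac q (Suc n) = qfac q n * (1 - q ^ Suc n)"
  by (simp add: qfac_def)

lemma qpoch_single_q: "qpoch [q] q n = qfac q n"
  by (simp add: qpoch_def qfac_def)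

lemma Suc_choose_2: "Suc n choose 2 = n + (n choose 2)"
  by (simp add: numeral_2_eq_2)

lemma zero_choose_2 [simp]: "0 choose 2 = 0"
  by (simp add: numeral_2_eq_2)

lemma add_choose_2: "(m + n) choose 2 = (m choose 2) + (n choose 2) + m * n"
  by (induction m) (simp_all add: Suc_choose_2)

text \<open>Unrolling the equation n times leaves the partial product times \<open>F n\<close>,
  whose second factor tends to 1. With F sampled along x q^n this shows that a solution of a
  q-difference equation, normalised at 0, is an infinite product.\<close>

lemma prod_functional_equation:
  fixes F u :: "nat \<Rightarrow> 'a::{real_normed_field}"
  assumes "\<And>n. F n = u n * F (Suc n)" and "F \<longlonglongrightarrow> 1" and "(\<lambda>n. \<Prod>j<n. u j) \<longlonglongrightarrow> P"
  shows "F 0 = P"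
proof -
  have "F 0 = (\<Prod>j<n. u j) * F n" for n
    by (induction n) (simp, metis assms(1) mult.assoc prod.lessThan_Suc)
  moreover have "(\<lambda>n. (\<Prod>j<n. u j) * F n) \<longlonglongrightarrow> P * 1"
    by (intro tendsto_intros assms)
  ultimately have "(\<lambda>n::nat. F 0) \<longlonglongrightarrow> P" by simp
  thus ?thesis by (simp add: LIMSEQ_const_iff)
qed

text \<open>Consecutive terms have ratio \<open>q ^ n * r\<close>, which tends to 0. This Gaussian
  majorant dominates most of the series below.\<close>

lemma summable_gauss:
  fixes q r :: real
  assumes q: "0 < q" "q < 1"
  shows "summable (\<lambda>n. q ^ (n choose 2) * r ^ n)"
proof -
  have "(\<lambda>n. q ^ n * \<bar>r\<bar>) \<longlonglongrightarrow> 0 * \<bar>r\<bar>"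
    using q by (intro tendsto_intros LIMSEQ_power_zero) auto
  hence "\<forall>\<^sub>F n in sequentially. q ^ n * \<bar>r\<bar> < 1/2"
    by (rule order_tendstoD) auto
  then obtain N where N: "\<And>n. n \<ge> N \<Longrightarrow> q ^ n * \<bar>r\<bar> < 1/2"
    by (auto simp: eventually_sequentially)
  show ?thesis
  proof (rule summable_ratio_test[of "1/2" N])
    fix n assume "N \<le> n"
    have "norm (q ^ (Suc n choose 2) * r ^ Suc n) = (q ^ n * \<bar>r\<bar>) * norm (q ^ (n choose 2) * r ^ n)"
      using q by (simp add: Suc_choose_2 power_add abs_mult power_abs)
    also have "\<dots> \<le> 1/2 * norm (q ^ (n choose 2) * r ^ n)"
      using N[OF \<open>N \<le> n\<close>] by (intro mult_right_mono) auto
    finally show "norm (q ^ (Suc n choose 2) * r ^ Suc n) \<le> 1/2 * norm (q ^ (n choose 2) * r ^ n)" .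
  qed auto
qed

context
  fixes q :: real
  assumes q: "0 < q" "q < 1"
begin

lemma q_power_less_1: "q ^ Suc n < 1"
  using q by (intro power_Suc_less_one) auto

lemma qfac_pos [simp]: "0 < qfac q n"
  unfolding qfac_def using q_power_less_1 by (intro prod_pos) (simp del: power_Suc)

lemma qfac_nonzero [simp]: "qfac q n \<noteq> 0"
  using qfac_pos[of n] by linarith

lemma qfac_nonneg [simp]: "0 \<le> qfac q n"
  using qfac_pos[of n] by linarith

lemma convergent_qinf: "convergent_prod (\<lambda>j. 1 - (x::'a::{real_normed_field, banach}) * of_real q ^ j)"
proof -
  have "summable (\<lambda>j. norm ((1 - x * of_real q ^ j) - 1))"
    using q by (auto simp: norm_mult norm_power intro!: summable_mult summable_geometric)
  thus ?thesis
    by (intro abs_convergent_prod_imp_convergent_prod summable_imp_abs_convergent_prod)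
qed

lemma qinf_tendsto:
  "(\<lambda>n. \<Prod>j<n. 1 - (x::'a::{real_normed_field, banach}) * of_real q ^ j) \<longlonglongrightarrow> qinf q x"
proof -
  have "(\<lambda>n. \<Prod>j\<le>n. 1 - x * of_real q ^ j) \<longlonglongrightarrow> qinf q x"
    unfolding qinf_def by (rule convergent_prod_LIMSEQ[OF convergent_qinf])
  hence "(\<lambda>n. \<Prod>j<Suc n. 1 - x * of_real q ^ j) \<longlonglongrightarrow> qinf q x"
    by (simp add: lessThan_Suc_atMost)
  thus ?thesis by (subst (asm) filterlim_sequentially_Suc)
qed

lemma qinf_rec: "qinf q (x::'a::{real_normed_field, banach}) = (1 - x) * qinf q (x * of_real q)"
proof -
  have "(\<lambda>n. \<Prod>j<Suc n. 1 - x * of_real q ^ j) \<longlonglongrightarrow> qinf q x"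
    using qinf_tendsto[of x] by (subst filterlim_sequentially_Suc)
  moreover have "(\<Prod>j<Suc n. 1 - x * of_real q ^ j) = (1 - x) * (\<Prod>j<n. 1 - (x * of_real q) * of_real q ^ j)" for n
    by (subst prod.lessThan_Suc_shift) (simp add: mult.assoc)
  moreover have "(\<lambda>n. (1 - x) * (\<Prod>j<n. 1 - (x * of_real q) * of_real q ^ j)) \<longlonglongrightarrow> (1 - x) * qinf q (x * of_real q)"
    by (intro tendsto_intros qinf_tendsto)
  ultimately show ?thesis by (metis (no_types, lifting) LIMSEQ_unique ext)
qed

lemma qinf_split:
  "qinf q (x::'a::{real_normed_field, banach}) = (\<Prod>j<n. 1 - x * of_real q ^ j) * qinf q (x * of_real q ^ n)"
proof (induction n)
  case (Suc n)
  show ?case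
    by (subst Suc, subst qinf_rec[of "x * of_real q ^ n"]) (simp add: mult_ac)
qed simp

lemma qinf_0 [simp]: "qinf q (0::'a::{real_normed_field, banach}) = 1"
  by (simp add: qinf_def)

lemma qinf_eq_0_iff:
  "qinf q (x::'a::{real_normed_field, banach}) = 0 \<longleftrightarrow> (\<exists>j. x * of_real q ^ j = 1)"
proof
  assume "qinf q x = 0"
  hence "(\<lambda>j. 1 - x * of_real q ^ j) has_prod 0"
    using convergent_prod_has_prod[OF convergent_qinf[of x]] by (simp add: qinf_def)
  then obtain i where "1 - x * of_real q ^ i = 0" by (auto simp: has_prod_0_iff)
  thus "\<exists>j. x * of_real q ^ j = 1" by auto
next
  assume "\<exists>j. x * of_real q ^ j = 1"
  then obtain j where "x * of_real q ^ j = 1" by blast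
  thus "qinf q x = 0" by (subst qinf_split[of x "Suc j"]) auto
qed

lemma qinf_nonzero:
  assumes "norm (x::'a::{real_normed_field, banach}) < 1"
  shows "qinf q x \<noteq> 0"
proof
  assume "qinf q x = 0"
  then obtain j where j: "x * of_real q ^ j = 1" by (auto simp: qinf_eq_0_iff)
  have "norm (x * of_real q ^ j) = norm x * q ^ j" using q by (simp add: norm_mult norm_power)
  also have "\<dots> \<le> norm x * 1" using q by (intro mult_left_mono power_le_one) auto
  also have "\<dots> < 1" using assms by simp
  finally show False using j by simp
qed

lemma qinf_of_real: "qinf q (of_real x :: 'a::{real_normed_field, banach}) = of_real (qinf q x)"
proof -
  have "(\<lambda>n. of_real (\<Prod>j<n. 1 - x * of_real q ^ j) :: 'a) \<longlonglongrightarrow> of_real (qinf q x)"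
    by (intro tendsto_of_real qinf_tendsto)
  hence "(\<lambda>n. \<Prod>j<n. 1 - of_real x * of_real q ^ j :: 'a) \<longlonglongrightarrow> of_real (qinf q x)"
    by simp
  from LIMSEQ_unique[OF this qinf_tendsto] show ?thesis by simp
qed

lemma qinf_cnj: "qinf q (cnj x) = cnj (qinf q x)"
proof -
  have "(\<lambda>n. cnj (\<Prod>j<n. 1 - x * of_real q ^ j)) \<longlonglongrightarrow> cnj (qinf q x)"
    by (intro tendsto_cnj qinf_tendsto)
  hence "(\<lambda>n. \<Prod>j<n. 1 - cnj x * of_real q ^ j) \<longlonglongrightarrow> cnj (qinf q x)"
    by (simp add: cnj_prod)
  from LIMSEQ_unique[OF this qinf_tendsto] show ?thesis by simp
qed

lemma qinf_pos:
  assumes "x < 1" shows "0 < qinf q (x::real)"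
proof -
  have *: "x * q ^ j < 1" for j
  proof (cases "x \<ge> 0")
    case True
    have "x * q ^ j \<le> x * 1" using q True by (intro mult_left_mono power_le_one) auto
    thus ?thesis using assms by simp
  next
    case False
    hence "x * q ^ j \<le> 0" using q by (intro mult_nonpos_nonneg) auto
    thus ?thesis by simp
  qed
  have "0 \<le> qinf q x"
  proof (rule LIMSEQ_le_const[OF qinf_tendsto])
    show "\<exists>N. \<forall>n\<ge>N. 0 \<le> (\<Prod>j<n. 1 - x * of_real q ^ j)"
      using * by (intro exI allI impI prod_nonneg) (simp add: less_imp_le)
  qed
  moreover have "qinf q x \<noteq> 0"
  proof
    assume "qinf q x = 0"
    then obtain j where "x * of_real q ^ j = 1" by (auto simp: qinf_eq_0_iff)
    thus False using *[of j] by simp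
  qed
  ultimately show ?thesis by linarith
qed

lemma qfac_tendsto: "(\<lambda>n. qfac q n) \<longlonglongrightarrow> qinf q q"
proof -
  have "(\<lambda>n. \<Prod>j<n. 1 - q * of_real q ^ j) = (\<lambda>n. qfac q n)"
    by (simp add: qfac_def fun_eq_iff)
  thus ?thesis using qinf_tendsto[of q] by simp
qed

lemma qfac_decseq: "decseq (\<lambda>n. qfac q n)"
proof (rule decseq_SucI)
  fix n
  have "qfac q n * (1 - q ^ Suc n) \<le> qfac q n * 1"
    using q by (intro mult_left_mono) auto
  thus "qfac q (Suc n) \<le> qfac q n" by (simp add: qfac_Suc)
qed

lemma inverse_qfac_le: "1 / qfac q n \<le> 1 / qinf q q"
  using decseq_ge[OF qfac_decseq qfac_tendsto, of n] qinf_pos[OF q(2)]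
  by (intro divide_left_mono) auto

lemma qinf_q_pos [simp]: "0 < qinf q q"
  using qinf_pos[OF q(2)] .

section \<open>Euler's series for (x; q)_inf and its reciprocal\<close>

definition euler_coeff :: "nat \<Rightarrow> real" where
  "euler_coeff n = (- 1) ^ n * q ^ (n choose 2) / qfac q n"

lemma abs_euler_coeff_le: "\<bar>euler_coeff n\<bar> \<le> q ^ (n choose 2) / qinf q q"
proof -
  have "\<bar>euler_coeff n\<bar> = q ^ (n choose 2) * (1 / qfac q n)"
    using q by (simp add: euler_coeff_def abs_mult)
  also have "\<dots> \<le> q ^ (n choose 2) * (1 / qinf q q)"
    using q inverse_qfac_le[of n] by (intro mult_left_mono) auto
  finally show ?thesis by simp
qed

lemma euler_coeff_Suc: "euler_coeff (Suc n) * (1 - q ^ Suc n) = - (q ^ n) * euler_coeff n"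
proof -
  have "1 - q ^ Suc n \<noteq> 0" using q_power_less_1[of n] by linarith
  thus ?thesis
    by (simp add: euler_coeff_def qfac_Suc Suc_choose_2 power_add divide_simps del: power_Suc)
       (simp add: mult_ac)
qed

text \<open>The functional equation \<open>qinf_rec\<close> compared coefficientwise.\<close>

lemma euler_coeff_rec: "euler_coeff (Suc n) = q ^ Suc n * euler_coeff (Suc n) - q ^ n * euler_coeff n"
  using euler_coeff_Suc[of n] by (simp add: algebra_simps)

lemma summable_abs_euler_coeff: "summable (\<lambda>n. \<bar>euler_coeff n\<bar> * r ^ n)"
proof (rule summable_comparison_test'[where N = 0])
  show "summable (\<lambda>n. q ^ (n choose 2) * \<bar>r\<bar> ^ n / qinf q q)"
    by (intro summable_divide summable_gauss q)
  fix n
  have "norm (\<bar>euler_coeff n\<bar> * r ^ n) = \<bar>euler_coeff n\<bar> * \<bar>r\<bar> ^ n"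
    by (simp add: abs_mult power_abs)
  also have "\<dots> \<le> q ^ (n choose 2) / qinf q q * \<bar>r\<bar> ^ n"
    by (intro mult_right_mono abs_euler_coeff_le) auto
  finally show "norm (\<bar>euler_coeff n\<bar> * r ^ n) \<le> q ^ (n choose 2) * \<bar>r\<bar> ^ n / qinf q q" by simp
qed

lemma summable_norm_euler:
  "summable (\<lambda>n. norm (of_real (euler_coeff n) * (x::'a::{real_normed_field, banach}) ^ n))"
  using summable_abs_euler_coeff[of "norm x"] by (simp add: norm_mult norm_power)

lemma of_real_q_power_tendsto_0: "(\<lambda>n. (x::'a::{real_normed_field, banach}) * of_real q ^ n) \<longlonglongrightarrow> 0"
proof -
  have "(\<lambda>n. x * of_real q ^ n) \<longlonglongrightarrow> x * 0"
    using q by (intro tendsto_intros LIMSEQ_power_zero) auto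
  thus ?thesis by simp
qed

lemma powser_q_tendsto:
  fixes c :: "nat \<Rightarrow> 'a::{real_normed_field, banach}"
  assumes "summable (\<lambda>n. c n * K ^ n)" "K \<noteq> 0"
  shows "(\<lambda>N. \<Sum>n. c n * (x * of_real q ^ N) ^ n) \<longlonglongrightarrow> c 0"
proof -
  have "isCont (\<lambda>y. \<Sum>n. c n * y ^ n) 0"
    using assms by (intro isCont_powser[where K = K]) auto
  from isCont_tendsto_compose[OF this of_real_q_power_tendsto_0[of x]]
  show ?thesis by simp
qed

text \<open>The series satisfies the functional equation of the product and tends to 1 along x q^n,
  so \<open>prod_functional_equation\<close> identifies the two.\<close>

lemma euler_sums: "(\<lambda>n. of_real (euler_coeff n) * x ^ n) sums qinf q (x::'a::{real_normed_field, banach})"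
proof -
  define f where "f = (\<lambda>y::'a. \<Sum>n. of_real (euler_coeff n) * y ^ n)"
  have sm: "summable (\<lambda>n. of_real (euler_coeff n) * y ^ n)" for y :: 'a
    using summable_norm_euler by (rule summable_norm_cancel)
  have rec: "f y = (1 - y) * f (y * of_real q)" for y
  proof -
    let ?e = "\<lambda>n. of_real (euler_coeff n) :: 'a"
    have s2: "summable (\<lambda>n. ?e n * (y * of_real q) ^ n)" by (rule sm)
    have "f y = 1 + (\<Sum>n. ?e (Suc n) * y ^ Suc n)"
      unfolding f_def using suminf_split_head[OF sm[of y]] by (simp add: euler_coeff_def)
    also have "(\<Sum>n. ?e (Suc n) * y ^ Suc n) =
        (\<Sum>n. ?e (Suc n) * (y * of_real q) ^ Suc n - y * (?e n * (y * of_real q) ^ n))"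
    proof (intro suminf_cong)
      fix n
      have "?e (Suc n) = of_real q ^ Suc n * ?e (Suc n) - of_real q ^ n * ?e n"
        by (subst euler_coeff_rec) simp
      from arg_cong[OF this, of "\<lambda>t. t * y ^ Suc n"]
      show "?e (Suc n) * y ^ Suc n = ?e (Suc n) * (y * of_real q) ^ Suc n - y * (?e n * (y * of_real q) ^ n)"
        by (simp add: power_mult_distrib ring_distribs mult_ac)
    qed
    also have "\<dots> = (\<Sum>n. ?e (Suc n) * (y * of_real q) ^ Suc n) - (\<Sum>n. y * (?e n * (y * of_real q) ^ n))"
      by (intro suminf_diff[symmetric] summable_mult s2) (subst summable_Suc_iff, rule s2)
    also have "(\<Sum>n. ?e (Suc n) * (y * of_real q) ^ Suc n) = f (y * of_real q) - 1"
      unfolding f_def using suminf_split_head[OF s2] by (simp add: euler_coeff_def)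
    also have "(\<Sum>n. y * (?e n * (y * of_real q) ^ n)) = y * f (y * of_real q)"
      unfolding f_def by (intro suminf_mult s2)
    finally show ?thesis by (simp add: algebra_simps)
  qed
  have "f (x * of_real q ^ 0) = qinf q x"
  proof (rule prod_functional_equation[of "\<lambda>n. f (x * of_real q ^ n)"])
    show "f (x * of_real q ^ n) = (1 - x * of_real q ^ n) * f (x * of_real q ^ Suc n)" for n
      by (subst rec) (simp add: mult_ac)
    show "(\<lambda>n. f (x * of_real q ^ n)) \<longlonglongrightarrow> 1"
      using powser_q_tendsto[OF sm[of 1], of x] unfolding f_def by (simp add: euler_coeff_def)
  qed (rule qinf_tendsto)
  thus ?thesis using summable_sums[OF sm[of x]] by (simp add: f_def)
qed

lemma qinf_eq_suminf: "qinf q (x::'a::{real_normed_field, banach}) = (\<Sum>n. of_real (euler_coeff n) * x ^ n)"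
  using euler_sums by (rule sums_unique)

text \<open>The power series gives continuity at every point, which the infinite product does not
  show directly.\<close>

lemma isCont_qinf: "isCont (qinf q) (x::'a::{real_normed_field, banach})"
proof -
  have "isCont (\<lambda>y::'a. \<Sum>n. of_real (euler_coeff n) * y ^ n) x"
  proof (rule isCont_powser[where K = "of_real (norm x + 1)"])
    show "norm x < norm (of_real (norm x + 1) :: 'a)"
      by (subst norm_of_real) auto
  qed (rule sums_summable[OF euler_sums])
  thus ?thesis by (simp add: qinf_eq_suminf[abs_def])
qed

lemma continuous_on_qinf [continuous_intros]:
  "continuous_on S f \<Longrightarrow> continuous_on S (\<lambda>x. qinf q (f x :: 'a::{real_normed_field, banach}))"
  by (rule continuous_on_compose2[OF _ _ subset_UNIV])
     (auto intro!: continuous_at_imp_continuous_on simp: isCont_qinf)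

lemma summable_inverse_qfac:
  assumes "norm (x::'a::{real_normed_field, banach}) < 1"
  shows "summable (\<lambda>n. norm (of_real (1 / qfac q n) * x ^ n))"
proof (rule summable_comparison_test'[where N = 0])
  show "summable (\<lambda>n. 1 / qinf q q * norm x ^ n)"
    using assms by (intro summable_mult summable_geometric) auto
  fix n
  have "norm (norm (of_real (1 / qfac q n) * x ^ n)) = 1 / qfac q n * norm x ^ n"
    by (simp add: norm_mult norm_power norm_divide)
  also have "\<dots> \<le> 1 / qinf q q * norm x ^ n"
    by (intro mult_right_mono inverse_qfac_le) auto
  finally show "norm (norm (of_real (1 / qfac q n) * x ^ n)) \<le> 1 / qinf q q * norm x ^ n" .
qed

text \<open>Here the series satisfies \<open>(1 - y) * f y = f (y * q)\<close>, but only inside the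
  unit disc. Iterating it from x stays in the disc and multiplies \<open>f x\<close> by partial
  products of \<open>qinf q x\<close>; in the limit \<open>qinf q x * f x = 1\<close>.\<close>

lemma euler_inverse_sums:
  assumes x: "norm (x::'a::{real_normed_field, banach}) < 1"
  shows "(\<lambda>n. of_real (1 / qfac q n) * x ^ n) sums (1 / qinf q x)"
proof -
  define c :: "nat \<Rightarrow> 'a" where "c = (\<lambda>n. of_real (1 / qfac q n))"
  define f where "f = (\<lambda>y::'a. \<Sum>n. c n * y ^ n)"
  have sm: "summable (\<lambda>n. c n * y ^ n)" if "norm y < 1" for y :: 'a
    unfolding c_def using summable_inverse_qfac[OF that] by (rule summable_norm_cancel)
  have rec: "(1 - y) * f y = f (y * of_real q)" if y: "norm y < 1" for y
  proof -
    have "norm y * q \<le> norm y * 1" using q by (intro mult_left_mono) auto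
    hence yq: "norm (y * of_real q) < 1" using q y by (simp add: norm_mult)
    have cS: "c (Suc n) - of_real (q ^ Suc n) * c (Suc n) = c n" for n
    proof -
      have "1 - q ^ Suc n \<noteq> 0" using q_power_less_1[of n] by linarith
      hence "1 / qfac q (Suc n) - q ^ Suc n * (1 / qfac q (Suc n)) = 1 / qfac q n"
        by (simp add: qfac_Suc divide_simps del: power_Suc)
      from arg_cong[OF this, of "of_real :: real \<Rightarrow> 'a"] show ?thesis
        by (simp only: of_real_diff of_real_mult c_def)
    qed
    have "f y - f (y * of_real q) = (\<Sum>n. c n * y ^ n - c n * (y * of_real q) ^ n)"
      unfolding f_def by (intro suminf_diff sm y yq)
    also have "\<dots> = (\<Sum>n. c (Suc n) * y ^ Suc n - c (Suc n) * (y * of_real q) ^ Suc n)"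
      using suminf_split_head[OF summable_diff[OF sm[OF y] sm[OF yq]]] by simp
    also have "\<dots> = (\<Sum>n. y * (c n * y ^ n))"
    proof (intro suminf_cong)
      fix n
      have "c (Suc n) * y ^ Suc n - c (Suc n) * (y * of_real q) ^ Suc n
          = (c (Suc n) - of_real (q ^ Suc n) * c (Suc n)) * y ^ Suc n"
        by (simp only: power_mult_distrib of_real_power) (simp add: algebra_simps)
      thus "c (Suc n) * y ^ Suc n - c (Suc n) * (y * of_real q) ^ Suc n = y * (c n * y ^ n)"
        by (simp only: cS) simp
    qed
    also have "\<dots> = y * f y" unfolding f_def by (intro suminf_mult sm y)
    finally show ?thesis by (simp add: algebra_simps)
  qed
  have *: "(\<Prod>j<n. 1 - x * of_real q ^ j) * f x = f (x * of_real q ^ n)" for n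
  proof (induction n)
    case (Suc n)
    have "norm x * q ^ n \<le> norm x * 1" using q by (intro mult_left_mono power_le_one) auto
    hence xq: "norm (x * of_real q ^ n) < 1" using q x by (simp add: norm_mult norm_power)
    have "(\<Prod>j<Suc n. 1 - x * of_real q ^ j) * f x = (1 - x * of_real q ^ n) * f (x * of_real q ^ n)"
      using Suc by (metis (no_types, lifting) mult.assoc mult.commute prod.lessThan_Suc)
    also have "\<dots> = f (x * of_real q ^ n * of_real q)" by (rule rec[OF xq])
    finally show ?case by (simp only: power_Suc2 mult.assoc)
  qed simp
  have "(\<lambda>n. (\<Prod>j<n. 1 - x * of_real q ^ j) * f x) \<longlonglongrightarrow> qinf q x * f x"
    by (intro tendsto_intros qinf_tendsto)
  moreover have "(\<lambda>n. f (x * of_real q ^ n)) \<longlonglongrightarrow> 1"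
  proof -
    have "summable (\<lambda>n. c n * (of_real (1/2)) ^ n)" by (intro sm) (simp add: norm_divide)
    from powser_q_tendsto[OF this, of x] show ?thesis by (simp add: f_def c_def)
  qed
  ultimately have "qinf q x * f x = 1" unfolding * by (rule LIMSEQ_unique)
  hence "f x = 1 / qinf q x" using qinf_nonzero[OF x] by (simp add: field_simps)
  thus ?thesis using summable_sums[OF sm[OF x]] by (simp add: f_def c_def)
qed

end

section \<open>Trigonometric moments of the q-Hermite weight\<close>

lemma (in finite_measure) sums_integral_dominated:
  fixes f :: "nat \<Rightarrow> 'a \<Rightarrow> 'b::{banach, second_countable_topology}"
  assumes meas: "\<And>n. f n \<in> borel_measurable M"
    and bound: "\<And>n x. x \<in> space M \<Longrightarrow> norm (f n x) \<le> b n" and "summable b"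
  shows "(\<lambda>n. LINT x|M. f n x) sums (LINT x|M. (\<Sum>n. f n x))"
proof (rule sums_integral)
  show int: "integrable M (f n)" for n
    using bound meas by (intro integrable_const_bound[of _ "b n"]) auto
  show "AE x in M. summable (\<lambda>n. norm (f n x))"
    using bound by (intro AE_I2 summable_comparison_test'[OF \<open>summable b\<close>]) auto
  show "summable (\<lambda>n. LINT x|M. norm (f n x))"
  proof (rule summable_comparison_test')
    show "summable (\<lambda>n. b n * measure M (space M))" using \<open>summable b\<close> by (rule summable_mult2)
    fix n
    have "(LINT x|M. norm (f n x)) \<le> (LINT x|M. b n)"
      using bound int by (intro integral_mono integrable_norm) auto
    thus "norm (LINT x|M. norm (f n x)) \<le> b n * measure M (space M)"
      by (simp add: mult.commute)
  qed
qed

definition pi_measure :: "real measure" where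
  "pi_measure = restrict_space lborel {0..pi}"

lemma finite_pi_measure: "finite_measure pi_measure"
  unfolding pi_measure_def
  by (intro finite_measureI) (simp add: emeasure_restrict_space space_restrict_space)

lemma space_pi_measure [simp]: "space pi_measure = {0..pi}"
  by (simp add: pi_measure_def space_restrict_space)

lemma measurable_pi_measure:
  "continuous_on {0..pi} f \<Longrightarrow> f \<in> borel_measurable pi_measure"
proof -
  assume "continuous_on {0..pi} f"
  hence "f \<in> borel_measurable (restrict_space borel {0..pi})"
    by (rule borel_measurable_continuous_on_restrict)
  moreover have "sets pi_measure = sets (restrict_space borel {0..pi})"
    unfolding pi_measure_def by (rule sets_restrict_space_cong) simp
  ultimately show ?thesis by (simp cong: measurable_cong_sets)
qed

lemma integral_pi_measure:
  fixes f :: "real \<Rightarrow> 'b::{banach, second_countable_topology}"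
  shows "integral\<^sup>L pi_measure f = (LINT \<theta>|lborel. indicator {0..pi} \<theta> *\<^sub>R f \<theta>)"
  unfolding pi_measure_def by (rule integral_restrict_space) auto

text \<open>On the half circle only the even frequencies are orthogonal to the constants. Odd ones
  are never integrated this way; the reflection of \<theta> to pi - \<theta> handles them in
  \<open>hermite_mean\<close>.\<close>

lemma integral_cis_even:
  fixes k :: int
  shows "(LINT \<theta>|pi_measure. cis (2 * of_int k * \<theta>)) = (if k = 0 then of_real pi else 0)"
proof (cases "k = 0")
  case True
  have "(LINT \<theta>|pi_measure. (1::complex)) = of_real (measure pi_measure (space pi_measure))"
    by (subst Bochner_Integration.lebesgue_integral_const) (simp add: scaleR_conv_of_real)
  also have "measure pi_measure (space pi_measure) = pi"
    unfolding space_pi_measure by (simp add: pi_measure_def measure_restrict_space)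
  finally show ?thesis using True by simp
next
  case False
  define F where "F = (\<lambda>\<theta>::real. cis (2 * of_int k * \<theta>) / (2 * \<i> * of_int k))"
  have "(LINT \<theta>|pi_measure. cis (2 * of_int k * \<theta>)) = F pi - F 0"
    unfolding integral_pi_measure
  proof (rule integral_FTC_Icc)
    show "continuous_on {0..pi} (\<lambda>\<theta>. cis (2 * of_int k * \<theta>))"
      by (intro continuous_intros)
    fix x :: real
    have eq: "cis (2 * of_int k * \<theta>) = exp (\<theta> *\<^sub>R (2 * \<i> * of_int k))" for \<theta>
      by (simp add: cis_conv_exp scaleR_conv_of_real mult_ac)
    have "((\<lambda>\<theta>. cis (2 * of_int k * \<theta>)) has_vector_derivative cis (2 * of_int k * x) * (2 * \<i> * of_int k)) (at x within {0..pi})"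
      unfolding eq by (rule exp_scaleR_has_vector_derivative_right)
    hence "(F has_vector_derivative cis (2 * of_int k * x) * (2 * \<i> * of_int k) / (2 * \<i> * of_int k)) (at x within {0..pi})"
      unfolding F_def by (rule has_vector_derivative_divide)
    thus "(F has_vector_derivative cis (2 * of_int k * x)) (at x within {0..pi})"
      using False by simp
  qed simp
  also have "cis (2 * of_int k * pi) = 1"
    using cis_multiple_2pi[of "of_int k"] by (simp add: mult_ac)
  hence "F pi - F 0 = 0" by (simp add: F_def)
  finally show ?thesis using False by simp
qed

context
  fixes q :: real
  assumes q: "0 < q" "q < 1"
begin

abbreviation e_coeff :: "nat \<Rightarrow> real" where "e_coeff \<equiv> euler_coeff q"

lemma q_power_le_1: "q ^ n \<le> 1"
  using q by (intro power_le_one) auto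

lemma abs_euler_coeff_le_const: "\<bar>e_coeff n\<bar> \<le> 1 / qinf q q"
proof -
  have "q ^ (n choose 2) / qinf q q \<le> 1 / qinf q q"
    using q_power_le_1 qinf_q_pos[OF q] by (intro divide_right_mono) auto
  thus ?thesis using abs_euler_coeff_le[OF q, of n] by linarith
qed

lemma summable_euler_shift:
  assumes "\<And>j. \<bar>c j\<bar> \<le> 1"
  shows "summable (\<lambda>j. e_coeff (j + k) * e_coeff j * c j)"
proof (rule summable_comparison_test'[where N = 0])
  show "summable (\<lambda>j. 1 / qinf q q * \<bar>e_coeff j\<bar>)"
    using summable_abs_euler_coeff[OF q, of 1] by (intro summable_mult) simp
  fix j
  have "norm (e_coeff (j + k) * e_coeff j * c j) = \<bar>e_coeff (j + k)\<bar> * \<bar>e_coeff j\<bar> * \<bar>c j\<bar>"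
    by (simp add: abs_mult)
  also have "\<dots> \<le> (1 / qinf q q) * \<bar>e_coeff j\<bar> * 1"
    using qinf_q_pos[OF q] by (intro mult_mono abs_euler_coeff_le_const assms) auto
  finally show "norm (e_coeff (j + k) * e_coeff j * c j) \<le> 1 / qinf q q * \<bar>e_coeff j\<bar>" by simp
qed

text \<open>The coefficient of \<open>y\<^sup>k\<close> in \<open>(y; q)\<^sub>\<infinity> (q/y; q)\<^sub>\<infinity>\<close>.\<close>

definition theta_coeff :: "nat \<Rightarrow> real" where
  "theta_coeff k = (\<Sum>j. e_coeff (j + k) * e_coeff j * q ^ j)"

lemma summable_theta: "summable (\<lambda>j. e_coeff (j + k) * e_coeff j * q ^ j)"
  using q q_power_le_1 by (intro summable_euler_shift) auto

text \<open>Coefficient form of the quasi-periodicity theta(q y) = - theta(y) / y. The recurrence of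
  the Euler coefficients, applied once to each factor, turns \<open>q ^ k\<close> times the j-th
  term for k plus the j-th term for k + 1 into a telescoping difference.\<close>

lemma theta_coeff_Suc: "theta_coeff (Suc k) = - (q ^ k) * theta_coeff k"
proof -
  define t where "t = (\<lambda>j. q ^ (2 * j + k + 1) * e_coeff (Suc (j + k)) * e_coeff j)"
  \<comment> \<open>The shift of t by one place, started with 0, so that the telescoping series has
    no boundary term.\<close>
  define s where "s = (\<lambda>j. case j of 0 \<Rightarrow> 0 | Suc i \<Rightarrow> t i)"
  have t_eq: "t = (\<lambda>j. (q ^ (k + 1)) * (e_coeff (j + Suc k) * e_coeff j * q ^ (2 * j)))"
    by (simp add: t_def fun_eq_iff power_add mult_ac)
  have "summable t"
    unfolding t_eq using q q_power_le_1 by (intro summable_mult summable_euler_shift) auto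
  hence "t \<longlonglongrightarrow> 0" by (rule summable_LIMSEQ_zero)
  hence "(\<lambda>j. s (Suc j)) \<longlonglongrightarrow> 0" by (simp add: s_def)
  hence "s \<longlonglongrightarrow> 0" by (subst (asm) filterlim_sequentially_Suc)
  from telescope_sums[OF this] have "(\<lambda>j. s (Suc j) - s j) sums 0" by (simp add: s_def)
  moreover have "s (Suc j) - s j =
      q ^ k * (e_coeff (j + k) * e_coeff j * q ^ j) + e_coeff (j + Suc k) * e_coeff j * q ^ j" for j
  proof (cases j)
    case 0
    show ?thesis
    proof -
      have "e_coeff 0 = 1" by (simp add: euler_coeff_def[OF q])
      thus ?thesis
        using euler_coeff_rec[OF q, of k] unfolding 0 s_def t_def by (simp add: algebra_simps)
    qed
  next
    case (Suc i)
    have A: "e_coeff (Suc i) * q ^ Suc i = e_coeff (Suc i) + q ^ i * e_coeff i"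
      using euler_coeff_rec[OF q, of i] by (simp add: algebra_simps)
    have B: "e_coeff (Suc (j + k)) = q ^ Suc (j + k) * e_coeff (Suc (j + k)) - q ^ (j + k) * e_coeff (j + k)"
      by (rule euler_coeff_rec[OF q])
    have "q ^ k * (e_coeff (j + k) * e_coeff j * q ^ j) + e_coeff (j + Suc k) * e_coeff j * q ^ j
       = e_coeff j * q ^ j * (q ^ k * e_coeff (j + k) + e_coeff (Suc (j + k)))"
      by (simp add: algebra_simps)
    also have "\<dots> = e_coeff j * q ^ j * (q ^ Suc (j + k) * e_coeff (Suc (j + k)) + q ^ k * e_coeff (j + k) * (1 - q ^ j))"
    proof -
      have "q ^ k * e_coeff (j + k) + e_coeff (Suc (j + k)) =
          q ^ Suc (j + k) * e_coeff (Suc (j + k)) + q ^ k * e_coeff (j + k) * (1 - q ^ j)"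
        using B by (simp add: algebra_simps power_add)
      thus ?thesis by (rule arg_cong)
    qed
    also have "\<dots> = t j + e_coeff (j + k) * q ^ (k + j) * (e_coeff j - e_coeff j * q ^ j)"
      by (simp add: t_def algebra_simps power_add mult_2 mult_2_right)
    also have "e_coeff j - e_coeff j * q ^ j = - (q ^ i * e_coeff i)"
      unfolding Suc using A by simp
    also have "t j + e_coeff (j + k) * q ^ (k + j) * - (q ^ i * e_coeff i) = t j - t i"
      unfolding Suc by (simp add: t_def power_add mult_2 mult_2_right mult_ac)
    finally show ?thesis unfolding s_def Suc by simp
  qed
  ultimately have "(\<lambda>j. q ^ k * (e_coeff (j + k) * e_coeff j * q ^ j) + e_coeff (j + Suc k) * e_coeff j * q ^ j) sums 0"
    by simp
  moreover have "(\<lambda>j. q ^ k * (e_coeff (j + k) * e_coeff j * q ^ j) + e_coeff (j + Suc k) * e_coeff j * q ^ j)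
      sums (q ^ k * theta_coeff k + theta_coeff (Suc k))"
    unfolding theta_coeff_def by (intro sums_add sums_mult summable_sums summable_theta)
  ultimately have "q ^ k * theta_coeff k + theta_coeff (Suc k) = 0"
    using sums_unique2 by blast
  thus ?thesis by simp
qed

lemma theta_coeff_eq_0: "theta_coeff k = (- 1) ^ k * q ^ (k choose 2) * theta_coeff 0"
  by (induction k) (simp_all add: theta_coeff_Suc Suc_choose_2 power_add)

text \<open>The constant in Jacobi's triple product. By \<open>theta_coeff_eq_0\<close> the value at
  0 can be computed from \<open>theta_coeff k\<close> for any k, which gives the series of
  \<open>a j k\<close> independently of k. As k grows, Tannery's theorem removes every term except j
  = 0, and that one tends to \<open>1 / qinf q q\<close>.\<close>

lemma theta_coeff_0: "theta_coeff 0 = 1 / qinf q q"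
proof -
  define a where "a = (\<lambda>j k. q ^ (2 * (j choose 2) + j + k * j) / (qfac q j * qfac q (j + k)))"
  have eq: "theta_coeff 0 = (\<Sum>j. a j k)" for k
  proof -
    have "e_coeff (j + k) * e_coeff j * q ^ j = ((- 1) ^ k * q ^ (k choose 2)) * a j k" for j
    proof -
      have "(- 1 :: real) ^ (j + k) * (- 1) ^ j = (- 1) ^ k"
        by (simp add: power_add mult.assoc mult.commute[of "(- 1) ^ k"] mult.left_commute[of "(- 1) ^ j"])
      moreover have "q ^ ((j + k) choose 2) * q ^ (j choose 2) * q ^ j = q ^ (k choose 2) * q ^ (2 * (j choose 2) + j + k * j)"
        by (simp add: power_add[symmetric] add_choose_2 mult.commute mult_2 ac_simps)
      moreover have "e_coeff (j + k) * e_coeff j * q ^ j =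
          (((- 1) ^ (j + k) * (- 1) ^ j) * (q ^ ((j + k) choose 2) * q ^ (j choose 2) * q ^ j)) / (qfac q j * qfac q (j + k))"
        by (simp add: euler_coeff_def[OF q] mult_ac)
      ultimately show ?thesis by (simp add: a_def)
    qed
    hence "theta_coeff k = (\<Sum>j. ((- 1) ^ k * q ^ (k choose 2)) * a j k)"
      by (simp add: theta_coeff_def)
    moreover have "summable (\<lambda>j. ((- 1) ^ k * q ^ (k choose 2)) * a j k)"
      using summable_theta[of k] \<open>\<And>j. e_coeff (j + k) * e_coeff j * q ^ j = _\<close> by simp
    ultimately have "theta_coeff k = ((- 1) ^ k * q ^ (k choose 2)) * (\<Sum>j. a j k)"
      using q by (simp add: suminf_mult summable_cmult_iff)
    thus ?thesis using theta_coeff_eq_0[of k] q by simp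
  qed
  have "((\<lambda>k. \<Sum>j. a j k) \<longlonglongrightarrow> (\<Sum>j. if j = 0 then 1 / qinf q q else 0))"
  proof -
    have lim: "(\<lambda>k. a j k) \<longlonglongrightarrow> (if j = 0 then 1 / qinf q q else 0)" for j
    proof (cases "j = 0")
      case True
      have "(\<lambda>k. 1 / qfac q k) \<longlonglongrightarrow> 1 / qinf q q"
        using qinf_q_pos[OF q] by (intro tendsto_intros qfac_tendsto q) auto
      thus ?thesis using True by (simp add: a_def)
    next
      case False
      have "(\<lambda>k. q ^ (2 * (j choose 2) + j) * (q ^ j) ^ k / (qfac q j * qfac q (j + k)))
          \<longlonglongrightarrow> q ^ (2 * (j choose 2) + j) * 0 / (qfac q j * qinf q q)"
      proof (rule tendsto_divide[OF tendsto_mult[OF tendsto_const] tendsto_mult[OF tendsto_const]])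
        have "q ^ j < 1" using q False by (simp add: power_less_one_iff)
        thus "(\<lambda>k. (q ^ j) ^ k) \<longlonglongrightarrow> 0" using q by (intro LIMSEQ_power_zero) auto
        show "(\<lambda>k. qfac q (j + k)) \<longlonglongrightarrow> qinf q q"
          using LIMSEQ_ignore_initial_segment[OF qfac_tendsto[OF q], of j] by (simp add: add.commute)
        show "qfac q j * qinf q q \<noteq> 0" using qinf_q_pos[OF q] qfac_pos[OF q, of j] by simp
      qed
      moreover have "(q ^ j) ^ k = q ^ (k * j)" for k
        by (simp add: power_mult[symmetric] mult.commute)
      ultimately show ?thesis using False by (simp add: a_def power_add)
    qed
    have "norm (a j k) \<le> q ^ (j choose 2) * (1 / qinf q q * (1 / qinf q q))" for j k
    proof -
      have "norm (a j k) = q ^ (2 * (j choose 2) + j + k * j) * ((1 / qfac q j) * (1 / qfac q (j + k)))"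
        using q qfac_pos[OF q] by (simp add: a_def abs_mult less_imp_le)
      also have "\<dots> \<le> q ^ (j choose 2) * (1 / qinf q q * (1 / qinf q q))"
        using q qinf_q_pos[OF q] qfac_pos[OF q]
        by (intro mult_mono inverse_qfac_le power_decreasing) (auto intro!: mult_nonneg_nonneg simp: less_imp_le)
      finally show ?thesis .
    qed
    hence ev: "\<forall>\<^sub>F (j, k) in at_top \<times>\<^sub>F sequentially. norm (a j k) \<le> q ^ (j choose 2) * (1 / qinf q q * (1 / qinf q q))"
      by (intro always_eventually) auto
    have "summable (\<lambda>j. q ^ (j choose 2) * (1 / qinf q q * (1 / qinf q q)))"
      using summable_gauss[OF q, of 1] by (intro summable_mult2) simp
    from tannerys_theorem[OF lim ev this] show ?thesis by simp
  qed
  hence "(\<lambda>k. theta_coeff 0) \<longlonglongrightarrow> (\<Sum>j. if j = 0 then 1 / qinf q q else 0)"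
    unfolding eq[symmetric] .
  moreover have "(\<Sum>j. if j = 0 then 1 / qinf q q else 0) = 1 / qinf q q"
    using suminf_finite[of "{0::nat}" "\<lambda>j. if j = 0 then 1 / qinf q q else 0"] by simp
  ultimately show ?thesis by (simp add: LIMSEQ_const_iff)
qed

text \<open>The sum is the coefficient of z^k in (z; q)_inf (1/z; q)_inf = (1 - 1/z) theta(z), hence
  \<open>theta_coeff k - theta_coeff (Suc k)\<close>. In terms of the series, the factor 1 - q^j
  lowers the index of one Euler coefficient.\<close>

lemma euler_coeff_autocorrelation:
  "(\<lambda>j. e_coeff (j + k) * e_coeff j) sums ((- 1) ^ k * (q ^ (k choose 2) + q ^ (Suc k choose 2)) / qinf q q)"
proof -
  let ?u = "\<lambda>j. e_coeff (j + k) * e_coeff j"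
  have s: "summable ?u" using summable_euler_shift[of "\<lambda>_. 1" k] by simp
  have sd: "summable (\<lambda>j. ?u j - ?u j * q ^ j)"
    by (intro summable_diff s summable_theta)
  have "suminf ?u - theta_coeff k = (\<Sum>j. ?u j - ?u j * q ^ j)"
    unfolding theta_coeff_def by (intro suminf_diff s summable_theta)
  also have "\<dots> = (\<Sum>j. ?u (Suc j) - ?u (Suc j) * q ^ Suc j)"
    using suminf_split_head[OF sd] by simp
  also have "\<dots> = (\<Sum>j. - (e_coeff (j + Suc k) * e_coeff j * q ^ j))"
  proof (rule suminf_cong)
    fix j
    have "?u (Suc j) - ?u (Suc j) * q ^ Suc j = e_coeff (j + Suc k) * (e_coeff (Suc j) * (1 - q ^ Suc j))"
      by (simp add: algebra_simps)
    also have "\<dots> = - (e_coeff (j + Suc k) * e_coeff j * q ^ j)"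
      by (subst euler_coeff_Suc[OF q]) simp
    finally show "?u (Suc j) - ?u (Suc j) * q ^ Suc j = - (e_coeff (j + Suc k) * e_coeff j * q ^ j)" .
  qed
  also have "\<dots> = - theta_coeff (Suc k)"
    unfolding theta_coeff_def by (intro suminf_minus summable_theta)
  finally have "suminf ?u = (- 1) ^ k * (q ^ (k choose 2) + q ^ (Suc k choose 2)) / qinf q q"
    using theta_coeff_eq_0[of k] theta_coeff_eq_0[of "Suc k"] theta_coeff_0
    by (simp add: algebra_simps add_divide_distrib)
  thus ?thesis using s by (simp add: sums_iff)
qed

text \<open>Up to the constant (q; q)_inf / (2 pi), the q-Hermite weight in the angle
  \<theta>.\<close>

definition circle_weight :: "real \<Rightarrow> real" where
  "circle_weight \<theta> = (cmod (qinf q (cis (2 * \<theta>))))\<^sup>2"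

lemma continuous_circle_weight [continuous_intros]:
  "continuous_on S f \<Longrightarrow> continuous_on S (\<lambda>x. circle_weight (f x))"
  unfolding circle_weight_def by (intro continuous_intros q)

lemma integral_cis_qinf:
  "(LINT \<theta>|pi_measure. cis (2 * real m * \<theta>) * cnj (qinf q (cis (2 * \<theta>)))) = of_real (pi * e_coeff m)"
proof -
  interpret finite_measure pi_measure by (rule finite_pi_measure)
  let ?f = "\<lambda>j \<theta>. cis (2 * real m * \<theta>) * (of_real (e_coeff j) * cis (- 2 * \<theta>) ^ j)"
  have cis_eq: "cis (2 * real m * \<theta>) * cis (- 2 * \<theta>) ^ j = cis (2 * of_int (int m - int j) * \<theta>)" for j \<theta>
    by (simp add: Complex.DeMoivre cis_mult algebra_simps)
  have "(\<lambda>j. LINT \<theta>|pi_measure. ?f j \<theta>) sums (LINT \<theta>|pi_measure. (\<Sum>j. ?f j \<theta>))"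
  proof (rule sums_integral_dominated)
    show "?f n \<in> borel_measurable pi_measure" for n
      by (intro measurable_pi_measure continuous_intros)
    show "norm (?f n \<theta>) \<le> \<bar>e_coeff n\<bar>" for n \<theta>
      by (simp add: norm_mult norm_power)
    show "summable (\<lambda>n. \<bar>e_coeff n\<bar>)"
      using summable_abs_euler_coeff[OF q, of 1] by simp
  qed
  moreover have "(\<Sum>j. ?f j \<theta>) = cis (2 * real m * \<theta>) * cnj (qinf q (cis (2 * \<theta>)))" for \<theta>
  proof -
    have "(\<lambda>j. of_real (e_coeff j) * cis (- 2 * \<theta>) ^ j) sums qinf q (cis (- 2 * \<theta>))"
      by (rule euler_sums[OF q])
    moreover have "qinf q (cis (- 2 * \<theta>)) = cnj (qinf q (cis (2 * \<theta>)))"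
      by (simp add: qinf_cnj[OF q, symmetric] cis_cnj)
    ultimately have "(\<lambda>j. of_real (e_coeff j) * cis (- 2 * \<theta>) ^ j) sums cnj (qinf q (cis (2 * \<theta>)))"
      by simp
    from sums_mult[OF this, of "cis (2 * real m * \<theta>)"] show ?thesis by (simp only: sums_iff)
  qed
  moreover have "(LINT \<theta>|pi_measure. ?f j \<theta>) = (if j = m then of_real (pi * e_coeff m) else 0)" for j
  proof -
    have "(LINT \<theta>|pi_measure. ?f j \<theta>) = (LINT \<theta>|pi_measure. of_real (e_coeff j) * cis (2 * of_int (int m - int j) * \<theta>))"
      unfolding cis_eq[symmetric] by (simp add: mult_ac)
    also have "\<dots> = of_real (e_coeff j) * (LINT \<theta>|pi_measure. cis (2 * of_int (int m - int j) * \<theta>))"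
      by (rule integral_mult_right_zero)
    also have "\<dots> = (if j = m then of_real (pi * e_coeff m) else 0)"
      unfolding integral_cis_even by auto
    finally show ?thesis .
  qed
  ultimately have "(\<lambda>j. if j = m then of_real (pi * e_coeff m) else 0) sums
      (LINT \<theta>|pi_measure. cis (2 * real m * \<theta>) * cnj (qinf q (cis (2 * \<theta>))))" by simp
  moreover have "(\<lambda>j. if j = m then of_real (pi * e_coeff m) else 0) sums (of_real (pi * e_coeff m) :: complex)"
    by (rule sums_single)
  ultimately show ?thesis by (rule sums_unique2)
qed

text \<open>The two conjugate factors are expanded one after the other.
  \<open>integral_cis_qinf\<close> has already integrated against the conjugate factor, so expanding
  the other one leaves the single autocorrelation series; the bound B of the unexpanded factor
  provides the dominating series.\<close>

lemma circle_weight_moment: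
  "(LINT \<theta>|pi_measure. of_real (circle_weight \<theta>) * cis (2 * real l * \<theta>)) =
     of_real (pi / qinf q q * ((- 1) ^ l * (q ^ (l choose 2) + q ^ (Suc l choose 2))))"
proof -
  interpret finite_measure pi_measure by (rule finite_pi_measure)
  let ?f = "\<lambda>j \<theta>. of_real (e_coeff j) * (cis (2 * real (j + l) * \<theta>) * cnj (qinf q (cis (2 * \<theta>))))"
  have cont: "continuous_on {0..pi} (\<lambda>\<theta>. cnj (qinf q (cis (2 * \<theta>))))"
    by (intro continuous_intros q)
  have "compact ((\<lambda>\<theta>. cnj (qinf q (cis (2 * \<theta>)))) ` {0..pi})"
    by (intro compact_continuous_image cont) simp
  then obtain B where B: "\<And>\<theta>. \<theta> \<in> {0..pi} \<Longrightarrow> norm (cnj (qinf q (cis (2 * \<theta>)))) \<le> B"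
    by (meson bounded_iff compact_imp_bounded imageI)
  have "(\<lambda>j. LINT \<theta>|pi_measure. ?f j \<theta>) sums (LINT \<theta>|pi_measure. (\<Sum>j. ?f j \<theta>))"
  proof (rule sums_integral_dominated)
    show "?f n \<in> borel_measurable pi_measure" for n
      by (intro measurable_pi_measure continuous_intros q)
    show "norm (?f n \<theta>) \<le> \<bar>e_coeff n\<bar> * B" if "\<theta> \<in> space pi_measure" for n \<theta>
      using B[of \<theta>] that by (auto simp: norm_mult intro!: mult_left_mono)
    show "summable (\<lambda>n. \<bar>e_coeff n\<bar> * B)"
      using summable_abs_euler_coeff[OF q, of 1] by (intro summable_mult2) simp
  qed
  moreover have "(\<Sum>j. ?f j \<theta>) = of_real (circle_weight \<theta>) * cis (2 * real l * \<theta>)" for \<theta>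
  proof -
    have "(\<lambda>j. of_real (e_coeff j) * cis (2 * \<theta>) ^ j) sums qinf q (cis (2 * \<theta>))"
      by (rule euler_sums[OF q])
    hence "(\<lambda>j. (of_real (e_coeff j) * cis (2 * \<theta>) ^ j) * (cis (2 * real l * \<theta>) * cnj (qinf q (cis (2 * \<theta>)))))
       sums (qinf q (cis (2 * \<theta>)) * (cis (2 * real l * \<theta>) * cnj (qinf q (cis (2 * \<theta>)))))"
      by (rule sums_mult2)
    moreover have "(of_real (e_coeff j) * cis (2 * \<theta>) ^ j) * (cis (2 * real l * \<theta>) * cnj (qinf q (cis (2 * \<theta>)))) = ?f j \<theta>" for j
    proof -
      have "cis (2 * \<theta>) ^ j * cis (2 * real l * \<theta>) = cis (2 * real (j + l) * \<theta>)"
        by (simp add: Complex.DeMoivre cis_mult algebra_simps)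
      from arg_cong[OF this, of "\<lambda>t. of_real (e_coeff j) * (t * cnj (qinf q (cis (2 * \<theta>))))"]
      show ?thesis by (simp only: mult.assoc)
    qed
    ultimately have "(\<lambda>j. ?f j \<theta>) sums (qinf q (cis (2 * \<theta>)) * (cis (2 * real l * \<theta>) * cnj (qinf q (cis (2 * \<theta>)))))"
      by simp
    hence "(\<Sum>j. ?f j \<theta>) = (qinf q (cis (2 * \<theta>)) * cnj (qinf q (cis (2 * \<theta>)))) * cis (2 * real l * \<theta>)"
      by (simp only: sums_iff mult_ac)
    thus ?thesis by (simp only: circle_weight_def complex_norm_square)
  qed
  moreover have "(LINT \<theta>|pi_measure. ?f j \<theta>) = of_real (pi * (e_coeff (j + l) * e_coeff j))" for j
    by (subst integral_mult_right_zero, subst integral_cis_qinf) (simp add: mult_ac)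
  ultimately have "(\<lambda>j. of_real (pi * (e_coeff (j + l) * e_coeff j))) sums
      (LINT \<theta>|pi_measure. of_real (circle_weight \<theta>) * cis (2 * real l * \<theta>))" by (simp only:)
  moreover have "(\<lambda>j. complex_of_real (pi * (e_coeff (j + l) * e_coeff j))) sums
      of_real (pi * ((- 1) ^ l * (q ^ (l choose 2) + q ^ (Suc l choose 2)) / qinf q q))"
    by (intro sums_of_real sums_mult euler_coeff_autocorrelation)
  ultimately have "(LINT \<theta>|pi_measure. of_real (circle_weight \<theta>) * cis (2 * real l * \<theta>)) =
      of_real (pi * ((- 1) ^ l * (q ^ (l choose 2) + q ^ (Suc l choose 2)) / qinf q q))"
    by (rule sums_unique2)
  thus ?thesis by (simp only: times_divide_eq_right times_divide_eq_left)
qed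

end

section \<open>Al-Salam--Chihara polynomials and the orthogonality measure\<close>

lemma square_choose_2: "n * n = 2 * (n choose 2) + n"
  by (induction n) (simp_all add: Suc_choose_2)

lemma integrable_pi_measure:
  fixes f :: "real \<Rightarrow> 'b::{banach, second_countable_topology}"
  assumes c: "continuous_on {0..pi} f"
  shows "integrable pi_measure f"
proof -
  interpret finite_measure pi_measure by (rule finite_pi_measure)
  have "compact (f ` {0..pi})" by (intro compact_continuous_image c) simp
  then obtain B where B: "\<And>\<theta>. \<theta> \<in> {0..pi} \<Longrightarrow> norm (f \<theta>) \<le> B"
    by (meson bounded_iff compact_imp_bounded imageI)
  show ?thesis
    by (rule integrable_const_bound[of _ B]) (use B in \<open>auto intro!: measurable_pi_measure c\<close>)
qed

lemma qpoch_inf_eq_qinf_real: "qpoch_inf cs (q::real) = (\<Prod>c\<leftarrow>cs. qinf q c)"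
  by (simp add: qpoch_inf_def qinf_def)

lemma qpoch_inf_eq_qinf_complex: "qpoch_inf cs (of_real q :: complex) = (\<Prod>c\<leftarrow>cs. qinf q c)"
  by (simp add: qpoch_inf_def qinf_def)

text \<open>Al-Salam--Chihara polynomials; for \<open>a = b = 0\<close> the continuous \<open>q\<close>-Hermite polynomials.\<close>

fun asc_poly :: "real \<Rightarrow> real \<Rightarrow> real \<Rightarrow> nat \<Rightarrow> real \<Rightarrow> real" where
  "asc_poly q a b 0 x = 1"
| "asc_poly q a b (Suc 0) x = 2 * x - (a + b)"
| "asc_poly q a b (Suc (Suc n)) x =
     (2 * x - (a + b) * q ^ Suc n) * asc_poly q a b (Suc n) x
     - (1 - q ^ Suc n) * (1 - a * b * q ^ n) * asc_poly q a b n x"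

lemma continuous_on_asc_poly [continuous_intros]:
  "continuous_on S f \<Longrightarrow> continuous_on S (\<lambda>x. asc_poly q a b n (f x))"
  by (induction n rule: induct_nat_012) (auto intro!: continuous_intros)

text \<open>For \<open>x = cos \<theta>\<close> this is \<open>(t e\<^sup>i\<^sup>\<theta>, t e\<^sup>-\<^sup>i\<^sup>\<theta>; q)\<^sub>\<infinity>\<close>.\<close>

definition askey_pair :: "real \<Rightarrow> real \<Rightarrow> real \<Rightarrow> real" where
  "askey_pair q t x = (cmod (qinf q (of_real t * cis (arccos x))))\<^sup>2"

section \<open>Continuous q-Hermite polynomials on the circle\<close>

context
  fixes q :: real
  assumes q: "0 < q" "q < 1"
begin

lemma qinf_1: "qinf q (1::'a::{real_normed_field, banach}) = 0"
  by (subst qinf_eq_0_iff[OF q]) (auto intro: exI[of _ 0])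

text \<open>The coefficient of t^n in 1 / ((tz; q)_inf (tw; q)_inf). For z, w the exponentials of i
  \<theta> and - i \<theta> it is the continuous q-Hermite polynomial divided by (q; q)_n.\<close>

definition hermite_sum :: "complex \<Rightarrow> complex \<Rightarrow> nat \<Rightarrow> complex" where
  "hermite_sum z w n = (\<Sum>j\<le>n. of_real (1 / qfac q (n - j)) * z ^ (n - j) * (of_real (1 / qfac q j) * w ^ j))"

lemma inverse_qfac_Suc: "(1 - q ^ Suc j) * (1 / qfac q (Suc j)) = 1 / qfac q j"
proof -
  have "1 - q ^ Suc j \<noteq> 0" using q_power_less_1[OF q, of j] by linarith
  thus ?thesis by (simp add: qfac_Suc divide_simps del: power_Suc)
qed

text \<open>Cauchy's q-binomial theorem, used for its zeros at x = q^(-s). In the induction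
  \<open>1 - q ^ Suc n\<close> is written as (1 - q^(n+1-j)) + q^(n+1-j) (1 - q^j); the first
  summand cancels a factor of the reciprocal q-factorial, the second lowers the Euler coefficient,
  and both sums become multiples of the sum for n.\<close>

lemma finite_q_binomial:
  "(\<Sum>j\<le>n. euler_coeff q j * x ^ j * (1 / qfac q (n - j))) = (\<Prod>j<n. 1 - x * q ^ j) / qfac q n"
proof (induction n)
  case 0
  show ?case by (simp add: euler_coeff_def[OF q])
next
  case (Suc n)
  let ?a = "\<lambda>j. euler_coeff q j * x ^ j" and ?b = "\<lambda>j. 1 / qfac q j"
  let ?P = "\<Sum>j\<le>n. ?a j * ?b (n - j)"
  have "(1 - q ^ Suc n) * (\<Sum>j\<le>Suc n. ?a j * ?b (Suc n - j)) =
      (\<Sum>j\<le>Suc n. ?a j * ((1 - q ^ (Suc n - j)) * ?b (Suc n - j)))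
    + (\<Sum>j\<le>Suc n. q ^ (Suc n - j) * ((1 - q ^ j) * ?a j) * ?b (Suc n - j))"
    unfolding sum_distrib_left sum.distrib[symmetric]
  proof (rule sum.cong[OF refl])
    fix j assume "j \<in> {..Suc n}"
    hence "q ^ Suc n = q ^ (Suc n - j) * q ^ j" by (simp flip: power_add)
    moreover have "(1 - r * s) * (A * B) = A * ((1 - r) * B) + r * ((1 - s) * A) * B" for r s A B :: real
      by (simp add: algebra_simps)
    ultimately show "(1 - q ^ Suc n) * (?a j * ?b (Suc n - j)) =
        ?a j * ((1 - q ^ (Suc n - j)) * ?b (Suc n - j)) + q ^ (Suc n - j) * ((1 - q ^ j) * ?a j) * ?b (Suc n - j)"
      by (simp only:)
  qed
  also have "(\<Sum>j\<le>Suc n. ?a j * ((1 - q ^ (Suc n - j)) * ?b (Suc n - j))) = ?P"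
  proof -
    have "(\<Sum>j\<le>Suc n. ?a j * ((1 - q ^ (Suc n - j)) * ?b (Suc n - j))) =
        (\<Sum>j\<le>n. ?a j * ((1 - q ^ (Suc n - j)) * ?b (Suc n - j)))" by simp
    also have "\<dots> = ?P"
      using inverse_qfac_Suc by (intro sum.cong) (auto simp: Suc_diff_le simp del: power_Suc times_divide_eq_right)
    finally show ?thesis .
  qed
  also have "(\<Sum>j\<le>Suc n. q ^ (Suc n - j) * ((1 - q ^ j) * ?a j) * ?b (Suc n - j)) = - (x * q ^ n) * ?P"
  proof -
    have "(\<Sum>j\<le>Suc n. q ^ (Suc n - j) * ((1 - q ^ j) * ?a j) * ?b (Suc n - j)) =
       (\<Sum>j\<le>n. q ^ (n - j) * ((1 - q ^ Suc j) * ?a (Suc j)) * ?b (n - j))"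
      by (subst sum.atMost_Suc_shift) simp
    also have "\<dots> = (\<Sum>j\<le>n. - (x * q ^ n) * (?a j * ?b (n - j)))"
    proof (rule sum.cong[OF refl])
      fix j assume "j \<in> {..n}"
      hence *: "q ^ n = q ^ (n - j) * q ^ j" by (simp flip: power_add)
      have "(1 - q ^ Suc j) * ?a (Suc j) = (euler_coeff q (Suc j) * (1 - q ^ Suc j)) * x ^ Suc j" by simp
      also have "\<dots> = - x * q ^ j * ?a j" by (subst euler_coeff_Suc[OF q]) simp
      finally show "q ^ (n - j) * ((1 - q ^ Suc j) * ?a (Suc j)) * ?b (n - j) = - (x * q ^ n) * (?a j * ?b (n - j))"
        unfolding * by (simp only:) (simp add: mult_ac)
    qed
    finally show ?thesis by (simp only: sum_distrib_left)
  qed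
  finally have "(1 - q ^ Suc n) * (\<Sum>j\<le>Suc n. ?a j * ?b (Suc n - j)) = (1 - x * q ^ n) * ?P"
    by (simp add: algebra_simps)
  also have "?P = (\<Prod>j<n. 1 - x * q ^ j) / qfac q n" by (rule Suc.IH)
  finally have eq: "(1 - q ^ Suc n) * (\<Sum>j\<le>Suc n. ?a j * ?b (Suc n - j)) = (\<Prod>j<Suc n. 1 - x * q ^ j) / qfac q n"
    by (simp add: mult_ac)
  have "1 - q ^ Suc n \<noteq> 0" using q_power_less_1[OF q, of n] by linarith
  hence "(\<Sum>j\<le>Suc n. ?a j * ?b (Suc n - j)) = ((1 - q ^ Suc n) * (\<Sum>j\<le>Suc n. ?a j * ?b (Suc n - j))) / (1 - q ^ Suc n)"
    by (rule nonzero_mult_div_cancel_left[symmetric])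
  thus ?case unfolding eq by (simp only: qfac_Suc divide_divide_eq_left)
qed

text \<open>The factor 1 - q^(n+2) is split as (1 - q^j) + q^j (1 - q^(n+2-j)). The two parts lower
  the power of w and of z respectively; the second leaves the auxiliary sum g with weights q^j,
  which \<open>g_eq\<close> expresses through \<open>hermite_sum\<close> again.\<close>

lemma hermite_sum_rec:
  assumes zw: "z * w = 1"
  shows "of_real (1 - q ^ Suc (Suc n)) * hermite_sum z w (Suc (Suc n)) = (z + w) * hermite_sum z w (Suc n) - hermite_sum z w n"
proof -
  define b where "b = (\<lambda>j. of_real (1 / qfac q j) :: complex)"
  define g where "g = (\<lambda>n. \<Sum>j\<le>n. of_real (q ^ j) * (b (n - j) * z ^ (n - j) * (b j * w ^ j)))"
  have h: "hermite_sum z w n = (\<Sum>j\<le>n. b (n - j) * z ^ (n - j) * (b j * w ^ j))" for n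
    by (simp add: hermite_sum_def b_def)
  have b: "of_real (1 - q ^ Suc j) * b (Suc j) = b j" for j
    unfolding b_def of_real_mult[symmetric] inverse_qfac_Suc ..
  have w_part: "(\<Sum>j\<le>Suc n. of_real (1 - q ^ j) * (b (Suc n - j) * z ^ (Suc n - j) * (b j * w ^ j))) = w * hermite_sum z w n" for n
  proof -
    have "(\<Sum>j\<le>Suc n. of_real (1 - q ^ j) * (b (Suc n - j) * z ^ (Suc n - j) * (b j * w ^ j))) =
       (\<Sum>j\<le>n. b (n - j) * z ^ (n - j) * ((of_real (1 - q ^ Suc j) * b (Suc j)) * w ^ Suc j))"
      by (subst sum.atMost_Suc_shift) (simp add: mult_ac)
    thus ?thesis unfolding b h by (simp add: sum_distrib_left mult_ac)
  qed
  have z_part: "(\<Sum>j\<le>Suc n. of_real (q ^ j) * (of_real (1 - q ^ (Suc n - j)) * (b (Suc n - j) * z ^ (Suc n - j) * (b j * w ^ j)))) = z * g n" for n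
  proof -
    have "(\<Sum>j\<le>Suc n. of_real (q ^ j) * (of_real (1 - q ^ (Suc n - j)) * (b (Suc n - j) * z ^ (Suc n - j) * (b j * w ^ j)))) =
       (\<Sum>j\<le>n. of_real (q ^ j) * ((of_real (1 - q ^ (Suc n - j)) * b (Suc n - j)) * z ^ (Suc n - j) * (b j * w ^ j)))"
      by (simp add: mult_ac)
    also have "\<dots> = z * g n"
      unfolding g_def sum_distrib_left
    proof (rule sum.cong[OF refl])
      fix j assume "j \<in> {..n}"
      hence "Suc n - j = Suc (n - j)" by auto
      thus "of_real (q ^ j) * ((of_real (1 - q ^ (Suc n - j)) * b (Suc n - j)) * z ^ (Suc n - j) * (b j * w ^ j)) =
          z * (of_real (q ^ j) * (b (n - j) * z ^ (n - j) * (b j * w ^ j)))"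
        by (simp only: b) (simp add: mult_ac)
    qed
    finally show ?thesis .
  qed
  have g_eq: "g (Suc n) = hermite_sum z w (Suc n) - w * hermite_sum z w n" for n
    unfolding w_part[symmetric] unfolding g_def h sum_subtractf[symmetric]
    by (intro sum.cong refl) (simp add: algebra_simps)
  have "of_real (1 - q ^ Suc (Suc n)) * hermite_sum z w (Suc (Suc n)) = w * hermite_sum z w (Suc n) + z * g (Suc n)"
    unfolding w_part[symmetric] z_part[symmetric] unfolding h sum_distrib_left sum.distrib[symmetric]
  proof (rule sum.cong[OF refl])
    fix j assume "j \<in> {..Suc (Suc n)}"
    hence "q ^ Suc (Suc n) = q ^ j * q ^ (Suc (Suc n) - j)" by (simp flip: power_add)
    moreover have "of_real (1 - r * s) * X = of_real (1 - r) * X + of_real r * (of_real (1 - s) * X)" for r s :: real and X :: complex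
      by (simp add: algebra_simps)
    ultimately show "of_real (1 - q ^ Suc (Suc n)) * (b (Suc (Suc n) - j) * z ^ (Suc (Suc n) - j) * (b j * w ^ j)) =
       of_real (1 - q ^ j) * (b (Suc (Suc n) - j) * z ^ (Suc (Suc n) - j) * (b j * w ^ j)) +
       of_real (q ^ j) * (of_real (1 - q ^ (Suc (Suc n) - j)) * (b (Suc (Suc n) - j) * z ^ (Suc (Suc n) - j) * (b j * w ^ j)))"
      by (simp only:)
  qed
  also have "\<dots> = (z + w) * hermite_sum z w (Suc n) - (z * w) * hermite_sum z w n"
    unfolding g_eq by (simp add: algebra_simps)
  finally show ?thesis unfolding zw by simp
qed

lemma asc_poly_hermite:
  assumes zw: "z * w = 1" and x: "z + w = 2 * of_real x"
  shows "of_real (asc_poly q 0 0 n x) = of_real (qfac q n) * hermite_sum z w n"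
proof (induction n rule: induct_nat_012)
  case 0
  show ?case by (simp add: hermite_sum_def)
next
  case 1
  have "hermite_sum z w (Suc 0) = of_real (1 / qfac q (Suc 0)) * (z + w)"
    by (simp add: hermite_sum_def ring_distribs)
  thus ?case using x by (simp add: qfac_nonzero[OF q])
next
  case (ge2 n)
  have "of_real (qfac q (Suc (Suc n))) * hermite_sum z w (Suc (Suc n)) =
     of_real (qfac q (Suc n)) * (of_real (1 - q ^ Suc (Suc n)) * hermite_sum z w (Suc (Suc n)))"
    by (simp only: qfac_Suc[of q "Suc n"] of_real_mult mult.assoc)
  also have "\<dots> = 2 * of_real x * (of_real (qfac q (Suc n)) * hermite_sum z w (Suc n))
      - of_real (1 - q ^ Suc n) * (of_real (qfac q n) * hermite_sum z w n)"
    unfolding hermite_sum_rec[OF zw] x by (simp add: qfac_Suc algebra_simps)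
  also have "\<dots> = of_real (asc_poly q 0 0 (Suc (Suc n)) x)"
    unfolding ge2[symmetric] by simp
  finally show ?case ..
qed

text \<open>Each moment is a sum of two Gaussian powers of q, interchanged by reflecting j to 2s -
  j, so one of them suffices. Completing the square in the exponent turns the sum over j into the
  finite q-binomial sum at x = q^(-s), whose product contains the vanishing factor with index s,
  because s < 2s.\<close>

lemma circle_weight_hermite_even:
  assumes "s > 0"
  shows "(LINT \<theta>|pi_measure. of_real (circle_weight q \<theta>) * hermite_sum (cis \<theta>) (cis (- \<theta>)) (2 * s)) = 0"
proof -
  interpret finite_measure pi_measure by (rule finite_pi_measure)
  \<comment> \<open>The distance of j from s, half the absolute frequency of the j-th term.\<close>
  define N where "N = (\<lambda>j. if j \<le> s then s - j else j - s)"
  define \<beta> where "\<beta> = (\<lambda>j. 1 / qfac q j)"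
  \<comment> \<open>Both branches equal q to the power (j - s)(j - s - 1)/2. The two Gaussian terms
    of the j-th moment are \<open>T j\<close> and \<open>T (2 * s - j)\<close>, a choice made so
    that one quadratic exponent serves on both sides of s.\<close>
  define T where "T = (\<lambda>j. if j \<le> s then q ^ (Suc (s - j) choose 2) else q ^ ((j - s) choose 2))"
  define M where "M = (\<lambda>l. pi / qinf q q * ((- 1) ^ l * (q ^ (l choose 2) + q ^ (Suc l choose 2))))"
  have mom: "(LINT \<theta>|pi_measure. of_real (circle_weight q \<theta>) * (cis \<theta> ^ (2 * s - j) * cis (- \<theta>) ^ j)) = of_real (M (N j))"
    if "j \<le> 2 * s" for j
  proof (cases "j \<le> s")
    case True
    have "cis \<theta> ^ (2 * s - j) * cis (- \<theta>) ^ j = cis (2 * real (s - j) * \<theta>)" for \<theta>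
      using True by (simp add: Complex.DeMoivre cis_mult of_nat_diff algebra_simps)
    thus ?thesis using True circle_weight_moment[OF q, of "s - j"] by (simp add: M_def N_def)
  next
    case False
    have "of_real (circle_weight q \<theta>) * (cis \<theta> ^ (2 * s - j) * cis (- \<theta>) ^ j) =
        cnj (of_real (circle_weight q \<theta>) * cis (2 * real (j - s) * \<theta>))" for \<theta>
    proof -
      have "cis \<theta> ^ (2 * s - j) * cis (- \<theta>) ^ j = cis (- (2 * real (j - s) * \<theta>))"
        using False that by (simp add: Complex.DeMoivre cis_mult of_nat_diff algebra_simps)
      thus ?thesis by (simp add: cis_cnj)
    qed
    hence "(LINT \<theta>|pi_measure. of_real (circle_weight q \<theta>) * (cis \<theta> ^ (2 * s - j) * cis (- \<theta>) ^ j)) =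
       cnj (LINT \<theta>|pi_measure. of_real (circle_weight q \<theta>) * cis (2 * real (j - s) * \<theta>))"
      by (simp only: Bochner_Integration.integral_cnj)
    thus ?thesis using False circle_weight_moment[OF q, of "j - s"] by (simp add: M_def N_def)
  qed
  have "(LINT \<theta>|pi_measure. of_real (circle_weight q \<theta>) * hermite_sum (cis \<theta>) (cis (- \<theta>)) (2 * s)) =
      (LINT \<theta>|pi_measure. (\<Sum>j\<le>2 * s. of_real (\<beta> (2 * s - j) * \<beta> j) * (of_real (circle_weight q \<theta>) * (cis \<theta> ^ (2 * s - j) * cis (- \<theta>) ^ j))))"
    unfolding hermite_sum_def sum_distrib_left by (intro Bochner_Integration.integral_cong refl sum.cong) (simp add: \<beta>_def mult_ac)
  also have "\<dots> = (\<Sum>j\<le>2 * s. LINT \<theta>|pi_measure. of_real (\<beta> (2 * s - j) * \<beta> j) * (of_real (circle_weight q \<theta>) * (cis \<theta> ^ (2 * s - j) * cis (- \<theta>) ^ j)))"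
  proof (rule Bochner_Integration.integral_sum)
    fix j
    let ?f = "\<lambda>\<theta>. complex_of_real (\<beta> (2 * s - j) * \<beta> j) * (of_real (circle_weight q \<theta>) * (cis \<theta> ^ (2 * s - j) * cis (- \<theta>) ^ j))"
    have c: "continuous_on {0..pi} ?f" by (intro continuous_intros q)

    show "integrable pi_measure ?f" by (rule integrable_pi_measure[OF c])
  qed
  also have "\<dots> = (\<Sum>j\<le>2 * s. of_real (\<beta> (2 * s - j) * \<beta> j * M (N j)))"
    by (intro sum.cong refl) (simp add: mom)
  also have "\<dots> = of_real (\<Sum>j\<le>2 * s. \<beta> (2 * s - j) * \<beta> j * M (N j))" by simp
  also have "(\<Sum>j\<le>2 * s. \<beta> (2 * s - j) * \<beta> j * M (N j)) =
      pi / qinf q q * ((\<Sum>j\<le>2 * s. (- 1) ^ (s + j) * \<beta> (2 * s - j) * \<beta> j * T j) + (\<Sum>j\<le>2 * s. (- 1) ^ (s + j) * \<beta> (2 * s - j) * \<beta> j * T (2 * s - j)))"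
    unfolding sum.distrib[symmetric] sum_distrib_left
  proof (rule sum.cong[OF refl])
    fix j assume j: "j \<in> {..2 * s}"
    have "(- 1 :: real) ^ N j = (- 1) ^ (s + j)"
      by (auto simp: N_def minus_one_power_iff)
    moreover have "q ^ (N j choose 2) + q ^ (Suc (N j) choose 2) = T j + T (2 * s - j)"
    proof -
      consider "j < s" | "j = s" | "j > s" by linarith
      thus ?thesis
      proof cases
        case 1
        hence "2 * s - j - s = s - j" "\<not> 2 * s - j \<le> s" by auto
        thus ?thesis using 1 by (simp add: N_def T_def)
      next
        case 2 thus ?thesis by (simp add: N_def T_def Suc_choose_2)
      next
        case 3
        hence "s - (2 * s - j) = j - s" "2 * s - j \<le> s" using j by auto
        thus ?thesis using 3 by (simp add: N_def T_def)
      qed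
    qed
    ultimately show "\<beta> (2 * s - j) * \<beta> j * M (N j) = pi / qinf q q * ((- 1) ^ (s + j) * \<beta> (2 * s - j) * \<beta> j * T j + (- 1) ^ (s + j) * \<beta> (2 * s - j) * \<beta> j * T (2 * s - j))"
      unfolding M_def by (simp add: algebra_simps)
  qed
  also have "(\<Sum>j\<le>2 * s. (- 1) ^ (s + j) * \<beta> (2 * s - j) * \<beta> j * T (2 * s - j)) =
      (\<Sum>j\<le>2 * s. (- 1) ^ (s + j) * \<beta> (2 * s - j) * \<beta> j * T j)"
    by (rule sum.reindex_bij_witness[of _ "\<lambda>j. 2 * s - j" "\<lambda>j. 2 * s - j"]) (auto simp: minus_one_power_iff)
  also have "(\<Sum>j\<le>2 * s. (- 1) ^ (s + j) * \<beta> (2 * s - j) * \<beta> j * T j) =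
      (- 1) ^ s * q ^ (Suc s choose 2) * (\<Sum>j\<le>2 * s. euler_coeff q j * (1 / q ^ s) ^ j * (1 / qfac q (2 * s - j)))"
    unfolding sum_distrib_left
  proof (rule sum.cong[OF refl])
    fix j assume j: "j \<in> {..2 * s}"
    have "T j * q ^ (s * j) = q ^ (Suc s choose 2) * q ^ (j choose 2)"
    proof (cases "j \<le> s")
      case True
      then obtain l where l: "s = j + l" using le_Suc_ex by blast
      have "(Suc l choose 2) + s * j = (Suc s choose 2) + (j choose 2)"
        unfolding l using square_choose_2[of j] by (simp add: Suc_choose_2 add_choose_2 algebra_simps)
      thus ?thesis using True by (simp add: T_def l flip: power_add)
    next
      case False
      then obtain l where l: "j = s + l" by (metis nat_le_linear le_Suc_ex)
      have "(l choose 2) + s * j = (Suc s choose 2) + (j choose 2)"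
        unfolding l using square_choose_2[of s] by (simp add: Suc_choose_2 add_choose_2 algebra_simps)
      thus ?thesis using False by (simp add: T_def l flip: power_add)
    qed
    hence "T j * (q ^ s) ^ j = q ^ (Suc s choose 2) * q ^ (j choose 2)"
      by (simp only: power_mult)
    hence "T j = q ^ (Suc s choose 2) * (q ^ (j choose 2) * (1 / q ^ s) ^ j)"
      using q by (simp add: power_one_over field_simps)
    thus "(- 1) ^ (s + j) * \<beta> (2 * s - j) * \<beta> j * T j =
        (- 1) ^ s * q ^ (Suc s choose 2) * (euler_coeff q j * (1 / q ^ s) ^ j * (1 / qfac q (2 * s - j)))"
      by (simp add: \<beta>_def euler_coeff_def[OF q] power_add mult_ac)
  qed
  also have "(\<Sum>j\<le>2 * s. euler_coeff q j * (1 / q ^ s) ^ j * (1 / qfac q (2 * s - j))) = 0"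
  proof -
    have "(\<Prod>j<2 * s. 1 - 1 / q ^ s * q ^ j) = 0"
      using q assms by (intro prod_zero bexI[of _ s]) auto
    thus ?thesis by (subst finite_q_binomial) simp
  qed
  finally show ?thesis by simp
qed

end

section \<open>Recurrences, change of variables and the orthogonality measure\<close>

text \<open>The relation determines row \<open>Suc m\<close> from the rows m and m - 1, hence
  everything from row 0. At m = 0 the truncated index m - 1 is harmless since \<beta> vanishes
  there.\<close>

lemma symmetric_recurrence_unique:
  fixes F G :: "nat \<Rightarrow> nat \<Rightarrow> real"
  assumes F: "\<And>m n. F (Suc m) n + \<alpha> m * F m n + \<beta> m * F (m - 1) n = F m (Suc n) + \<alpha> n * F m n + \<beta> n * F m (n - 1)"
    and G: "\<And>m n. G (Suc m) n + \<alpha> m * G m n + \<beta> m * G (m - 1) n = G m (Suc n) + \<alpha> n * G m n + \<beta> n * G m (n - 1)"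
    and 0: "\<And>n. F 0 n = G 0 n"
    and "\<beta> 0 = 0"
  shows "F m n = G m n"
proof (induction m arbitrary: n rule: less_induct)
  case (less m)
  show ?case
  proof (cases m)
    case 0
    thus ?thesis using assms(3) by simp
  next
    case (Suc k)
    have k: "F k i = G k i" for i using less Suc by simp
    have "\<beta> k * F (k - 1) n = \<beta> k * G (k - 1) n"
      using less[of "k - 1"] Suc \<open>\<beta> 0 = 0\<close> by (cases k) auto
    thus ?thesis using F[of k n] G[of k n] unfolding Suc k by linarith
  qed
qed

text \<open>A single formula for all n: at n = 0 the factor \<open>1 - q ^ n\<close> removes the
  term with the truncated index.\<close>

lemma asc_poly_Suc:
  "asc_poly q a b (Suc n) x = (2 * x - (a + b) * q ^ n) * asc_poly q a b n x
     - (1 - q ^ n) * (1 - a * b * q ^ (n - 1)) * asc_poly q a b (n - 1) x"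
  by (cases n) simp_all

lemma asc_poly_uminus: "asc_poly q 0 0 n (- x) = (- 1) ^ n * asc_poly q 0 0 n x"
  by (induction n rule: induct_nat_012) (simp_all add: algebra_simps)

lemma cmod_one_minus_cis: "(cmod (1 - of_real t * cis \<theta>))\<^sup>2 = 1 - 2 * t * cos \<theta> + t\<^sup>2"
proof -
  have "(cmod (1 - of_real t * cis \<theta>))\<^sup>2 = 1 - 2 * t * cos \<theta> + t\<^sup>2 * ((cos \<theta>)\<^sup>2 + (sin \<theta>)\<^sup>2)"
    unfolding cmod_power2 by (simp add: power2_eq_square algebra_simps del: sin_cos_squared_add sin_cos_squared_add2 sin_cos_squared_add3)
  thus ?thesis by simp
qed

lemma integral_pi_measure_reflect:
  fixes f :: "real \<Rightarrow> real"
  shows "(LINT \<theta>|pi_measure. f (pi - \<theta>)) = (LINT \<theta>|pi_measure. f \<theta>)"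
proof -
  have "(LINT \<theta>|pi_measure. f \<theta>) = (LINT \<theta>|lborel. indicator {0..pi} (pi + (-1) * \<theta>) *\<^sub>R f (pi + (-1) * \<theta>))"
    unfolding integral_pi_measure by (subst lborel_integral_real_affine[of "-1" _ pi]) auto
  also have "\<dots> = (LINT \<theta>|pi_measure. f (pi - \<theta>))"
    unfolding integral_pi_measure
    by (intro Bochner_Integration.integral_cong refl) (auto simp: indicator_def)
  finally show ?thesis ..
qed

lemma space_mu_measure [simp]: "space (mu_measure q a b) = {-1<..<1}"
  by (simp add: mu_measure_def space_restrict_space)

lemma sets_mu_measure: "sets (mu_measure q a b) = sets (restrict_space borel {-1<..<1})"
  by (simp add: mu_measure_def sets_restrict_space)

lemma measurable_mu_continuous:
  assumes "continuous_on {-1<..<1} f"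
  shows "f \<in> borel_measurable (mu_measure q a b)"
  using borel_measurable_continuous_on_restrict[OF assms] sets_mu_measure
  by (simp cong: measurable_cong_sets)

context
  fixes q :: real
  assumes q: "0 < q" "q < 1"
begin

lemma askey_pair_rec:
  assumes "x \<in> {-1..1}"
  shows "askey_pair q t x = (1 - 2 * t * x + t\<^sup>2) * askey_pair q (t * q) x"
proof -
  have "qinf q (of_real t * cis (arccos x)) =
      (1 - of_real t * cis (arccos x)) * qinf q (of_real (t * q) * cis (arccos x))"
    by (subst qinf_rec[OF q]) (simp add: mult_ac)
  thus ?thesis
    unfolding askey_pair_def using assms by (simp add: norm_mult power_mult_distrib cmod_one_minus_cis)
qed

lemma askey_pair_nonneg: "0 \<le> askey_pair q t x"
  by (simp add: askey_pair_def)

lemma askey_pair_pos: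
  assumes "\<bar>t\<bar> < 1"
  shows "0 < askey_pair q t x"
proof -
  have "qinf q (of_real t * cis (arccos x)) \<noteq> 0"
    using assms by (intro qinf_nonzero[OF q]) (simp add: norm_mult)
  thus ?thesis by (simp add: askey_pair_def)
qed

lemma continuous_on_askey_pair [continuous_intros]:
  "continuous_on {-1..1} (askey_pair q t)"
  unfolding askey_pair_def[abs_def]
  by (intro continuous_intros q continuous_on_arccos') auto

lemma sin_arccos_nonneg': "x \<in> {-1..1} \<Longrightarrow> 0 \<le> sin (arccos x)"
  by (rule sin_ge_zero) (auto intro: arccos_lbound arccos_ubound)

text \<open>The first factor of the product contributes |1 - exp(2 i \<theta>)|^2 = 4 (sin
  \<theta>)^2, which cancels the sine in the denominator. The density is thereby continuous on the
  closed interval; at the endpoints, where the definition divides by zero, both sides are 0.\<close>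

lemma mu_density_hermite:
  assumes x: "x \<in> {-1..1}"
  shows "mu_density q 0 0 x = 2 * qinf q q / pi * sqrt (1 - x\<^sup>2) * (cmod (qinf q (of_real q * cis (2 * arccos x))))\<^sup>2"
proof -
  let ?\<theta> = "arccos x"
  have s: "sin ?\<theta> = sqrt (1 - x\<^sup>2)" using x by (simp add: sin_arccos)
  have c: "cos ?\<theta> = x" using x by simp
  have "(cmod (qinf q (cis (2 * ?\<theta>))))\<^sup>2 = (cmod (1 - cis (2 * ?\<theta>)))\<^sup>2 * (cmod (qinf q (of_real q * cis (2 * ?\<theta>))))\<^sup>2"
    by (subst qinf_rec[OF q]) (simp add: norm_mult power_mult_distrib mult.commute)
  also have "(cmod (1 - cis (2 * ?\<theta>)))\<^sup>2 = 2 - 2 * cos (2 * ?\<theta>)"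
    using cmod_one_minus_cis[of 1 "2 * ?\<theta>"] by simp
  also have "\<dots> = 4 * (sin ?\<theta>)\<^sup>2"
    by (simp add: cos_double sin_squared_eq)
  finally show ?thesis
    unfolding mu_density_def Let_def qpoch_inf_eq_qinf_real qpoch_inf_eq_qinf_complex
    by (simp add: s qinf_0[OF q] power2_eq_square divide_simps)
qed

lemma mu_density_eq:
  "mu_density q a b x = qinf q (a * b) * mu_density q 0 0 x / (askey_pair q a x * askey_pair q b x)"
  unfolding mu_density_def Let_def qpoch_inf_eq_qinf_real qpoch_inf_eq_qinf_complex
  by (simp add: askey_pair_def qinf_0[OF q] norm_mult norm_divide power_mult_distrib power_divide mult_ac)

lemma continuous_on_mu_density:
  assumes "\<bar>a\<bar> < 1" "\<bar>b\<bar> < 1"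
  shows "continuous_on {-1..1} (mu_density q a b)"
proof -
  have "continuous_on {-1..1} (\<lambda>x. 2 * qinf q q / pi * sqrt (1 - x\<^sup>2) * (cmod (qinf q (of_real q * cis (2 * arccos x))))\<^sup>2)"
    by (intro continuous_intros q continuous_on_arccos') auto
  hence "continuous_on {-1..1} (mu_density q 0 0)"
    by (rule continuous_on_eq) (simp add: mu_density_hermite)
  hence "continuous_on {-1..1} (\<lambda>x. qinf q (a * b) * mu_density q 0 0 x / (askey_pair q a x * askey_pair q b x))"
    using askey_pair_pos[OF assms(1)] askey_pair_pos[OF assms(2)]
    by (intro continuous_intros) (auto simp: less_imp_neq[symmetric])
  thus ?thesis by (rule continuous_on_eq) (rule mu_density_eq[symmetric])
qed

lemma mu_density_nonneg:
  assumes "\<bar>a\<bar> < 1" "\<bar>b\<bar> < 1" "x \<in> {-1..1}"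
  shows "0 \<le> mu_density q a b x"
proof -
  have "\<bar>a * b\<bar> < 1" using assms abs_mult_less[of a 1 b 1] by (simp add: abs_mult)
  hence "0 < qinf q (a * b)" by (intro qinf_pos[OF q]) auto
  moreover have "0 \<le> mu_density q 0 0 x"
    using assms(3) qinf_q_pos[OF q] sin_arccos_nonneg'[OF assms(3)]
    by (subst mu_density_hermite) (auto simp: sin_arccos intro!: mult_nonneg_nonneg)
  ultimately show ?thesis
    by (subst mu_density_eq) (auto intro!: divide_nonneg_nonneg mult_nonneg_nonneg askey_pair_nonneg simp: less_imp_le)
qed

lemma measurable_mu_density:
  assumes "\<bar>a\<bar> < 1" "\<bar>b\<bar> < 1"
  shows "mu_density q a b \<in> borel_measurable (restrict_space lborel {-1<..<1})"
proof -
  have "continuous_on {-1<..<1} (mu_density q a b)"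
    by (rule continuous_on_subset[OF continuous_on_mu_density[OF assms]]) auto
  from borel_measurable_continuous_on_restrict[OF this]
  have "mu_density q a b \<in> borel_measurable (restrict_space borel {-1<..<1})" .
  moreover have "sets (restrict_space lborel {-1<..<1::real}) = sets (restrict_space borel {-1<..<1})"
    by (rule sets_restrict_space_cong) simp
  ultimately show ?thesis by (simp cong: measurable_cong_sets)
qed

lemma finite_mu_measure:
  assumes "\<bar>a\<bar> < 1" "\<bar>b\<bar> < 1"
  shows "finite_measure (mu_measure q a b)"
proof (rule finite_measureI)
  have "compact (mu_density q a b ` {-1..1})"
    by (intro compact_continuous_image continuous_on_mu_density assms) simp
  then obtain B where B: "\<And>x. x \<in> {-1..1} \<Longrightarrow> norm (mu_density q a b x) \<le> B"
    by (meson bounded_iff compact_imp_bounded imageI)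
  let ?M = "restrict_space lborel {-1<..<1::real}"
  have "emeasure (mu_measure q a b) (space (mu_measure q a b)) =
      (\<integral>\<^sup>+x. ennreal (mu_density q a b x) * indicator {-1<..<1} x \<partial>?M)"
    unfolding space_mu_measure unfolding mu_measure_def using measurable_mu_density[OF assms]
    by (subst emeasure_density) (auto simp: sets_restrict_space)
  also have "\<dots> \<le> (\<integral>\<^sup>+x. ennreal B \<partial>?M)"
  proof (rule nn_integral_mono)
    fix x assume "x \<in> space ?M"
    hence "mu_density q a b x \<le> B" using B[of x] by (auto simp: space_restrict_space)
    thus "ennreal (mu_density q a b x) * indicator {-1<..<1} x \<le> ennreal B"
      by (auto simp: indicator_def intro: ennreal_leI)
  qed
  also have "\<dots> < \<infinity>"
    by (simp add: space_restrict_space emeasure_restrict_space ennreal_mult_less_top)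
  finally show "emeasure (mu_measure q a b) (space (mu_measure q a b)) \<noteq> \<infinity>" by simp
qed

lemma integrable_mu_continuous:
  fixes f :: "real \<Rightarrow> 'b::{banach, second_countable_topology}"
  assumes ab: "\<bar>a\<bar> < 1" "\<bar>b\<bar> < 1" and f: "continuous_on {-1..1} f"
  shows "integrable (mu_measure q a b) f"
proof -
  interpret finite_measure "mu_measure q a b" by (rule finite_mu_measure[OF ab])
  have "compact (f ` {-1..1})" by (intro compact_continuous_image f) simp
  then obtain B where B: "\<And>x. x \<in> {-1..1} \<Longrightarrow> norm (f x) \<le> B"
    by (meson bounded_iff compact_imp_bounded imageI)
  have "f \<in> borel_measurable (mu_measure q a b)"
    by (intro measurable_mu_continuous continuous_on_subset[OF f]) auto
  thus ?thesis using B by (intro integrable_const_bound[of _ B]) auto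
qed

lemma integral_mu_measure:
  fixes f :: "real \<Rightarrow> 'b::{banach, second_countable_topology}"
  assumes ab: "\<bar>a\<bar> < 1" "\<bar>b\<bar> < 1" and f: "f \<in> borel_measurable (mu_measure q a b)"
  shows "(LINT x|mu_measure q a b. f x) = (LINT x|lborel. indicator {-1..1} x *\<^sub>R (mu_density q a b x *\<^sub>R f x))"
proof -
  have f': "f \<in> borel_measurable (restrict_space lborel {-1<..<1})"
    using f by (simp add: mu_measure_def)
  have "(LINT x|mu_measure q a b. f x) = (LINT x|restrict_space lborel {-1<..<1}. mu_density q a b x *\<^sub>R f x)"
    unfolding mu_measure_def
    by (intro integral_density f' measurable_mu_density ab)
       (auto intro!: AE_I2 mu_density_nonneg ab simp: space_restrict_space)
  also have "\<dots> = (LINT x|lborel. indicator {-1<..<1} x *\<^sub>R (mu_density q a b x *\<^sub>R f x))"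
    by (rule integral_restrict_space) auto
  also have "\<dots> = (LINT x|lborel. indicator {-1..1} x *\<^sub>R (mu_density q a b x *\<^sub>R f x))"
  proof (intro Bochner_Integration.integral_cong refl)
    fix x :: real
    have "mu_density q a b x = 0" if "x = -1 \<or> x = 1"
      using that by (auto simp: mu_density_def)
    thus "indicator {-1<..<1} x *\<^sub>R (mu_density q a b x *\<^sub>R f x) = indicator {-1..1} x *\<^sub>R (mu_density q a b x *\<^sub>R f x)"
      by (cases "x = -1 \<or> x = 1") (auto simp: indicator_def)
  qed
  finally show ?thesis .
qed

text \<open>Moves integrals to the q-Hermite measure, where the parameters a and b enter only
  through quotients of \<open>askey_pair\<close>. All Gram matrices are computed there.\<close>

lemma integral_mu_eq_hermite:
  fixes f :: "real \<Rightarrow> real"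
  assumes ab: "\<bar>a\<bar> < 1" "\<bar>b\<bar> < 1" and f: "continuous_on {-1..1} f"
  shows "(LINT x|mu_measure q a b. f x) =
    qinf q (a * b) * (LINT x|mu_measure q 0 0. f x / (askey_pair q a x * askey_pair q b x))"
proof -
  have cont: "continuous_on {-1..1} (\<lambda>x. f x / (askey_pair q a x * askey_pair q b x))"
    using askey_pair_pos[OF ab(1)] askey_pair_pos[OF ab(2)]
    by (intro continuous_intros f) (auto simp: less_imp_neq[symmetric])
  have "(LINT x|mu_measure q a b. f x) = (LINT x|lborel. indicator {-1..1} x *\<^sub>R (mu_density q a b x *\<^sub>R f x))"
    by (intro integral_mu_measure ab measurable_mu_continuous continuous_on_subset[OF f]) auto
  also have "\<dots> = (LINT x|lborel. qinf q (a * b) * (indicator {-1..1} x *\<^sub>R (mu_density q 0 0 x *\<^sub>R (f x / (askey_pair q a x * askey_pair q b x)))))"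
    by (intro Bochner_Integration.integral_cong refl) (simp add: mu_density_eq[of a b])
  also have "\<dots> = qinf q (a * b) * (LINT x|lborel. (indicator {-1..1} x *\<^sub>R (mu_density q 0 0 x *\<^sub>R (f x / (askey_pair q a x * askey_pair q b x)))))"
    by (rule integral_mult_right_zero)
  also have "(LINT x|lborel. (indicator {-1..1} x *\<^sub>R (mu_density q 0 0 x *\<^sub>R (f x / (askey_pair q a x * askey_pair q b x))))) =
     (LINT x|mu_measure q 0 0. f x / (askey_pair q a x * askey_pair q b x))"
    by (rule integral_mu_measure[symmetric]) (auto intro!: measurable_mu_continuous continuous_on_subset[OF cont])
  finally show ?thesis .
qed

lemma integral_hermite_angle:
  fixes g :: "real \<Rightarrow> real"
  assumes g: "continuous_on {-1..1} g"
  shows "(LINT x|mu_measure q 0 0. g x) = qinf q q / (2 * pi) * (LINT \<theta>|pi_measure. circle_weight q \<theta> * g (cos \<theta>))"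
proof -
  let ?f = "\<lambda>x. mu_density q 0 0 x * g x"
  have cont: "continuous_on {-1..1} ?f"
    by (intro continuous_intros continuous_on_mu_density g) auto
  \<comment> \<open>The substitution rule asks for a nonnegative derivative, so x = - cos \<theta>
    is used; \<open>integral_pi_measure_reflect\<close> removes the sign at the end.\<close>
  have "(LINT x|mu_measure q 0 0. g x) = (LBINT x. ?f x * indicator {- cos 0..- cos pi} x)"
    by (subst integral_mu_measure)
       (auto intro!: measurable_mu_continuous continuous_on_subset[OF g] Bochner_Integration.integral_cong simp: mult_ac)
  also have "\<dots> = (LBINT \<theta>. ?f (- cos \<theta>) * sin \<theta> * indicator {0..pi} \<theta>)"
  proof (rule integral_substitution(2))
    show "set_integrable lborel {- cos 0..- cos pi} ?f"
      using borel_integrable_atLeastAtMost'[OF cont] by simp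
    show "((\<lambda>\<theta>. - cos \<theta>) has_real_derivative sin \<theta>) (at \<theta>)" for \<theta>
      by (auto intro!: derivative_eq_intros)
    show "continuous_on {0..pi} sin" by (intro continuous_intros)
    show "0 \<le> sin \<theta>" if "\<theta> \<in> {0..pi}" for \<theta>
      using that by (auto intro: sin_ge_zero)
  qed simp
  also have "\<dots> = (LINT \<theta>|pi_measure. qinf q q / (2 * pi) * (circle_weight q (pi - \<theta>) * g (cos (pi - \<theta>))))"
    unfolding integral_pi_measure
  proof (intro Bochner_Integration.integral_cong refl)
    fix \<theta> :: real
    show "?f (- cos \<theta>) * sin \<theta> * indicator {0..pi} \<theta> =
      indicator {0..pi} \<theta> *\<^sub>R (qinf q q / (2 * pi) * (circle_weight q (pi - \<theta>) * g (cos (pi - \<theta>))))"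
    proof (cases "\<theta> \<in> {0..pi}")
      case True
      have ac: "arccos (- cos \<theta>) = pi - \<theta>"
        using True arccos_cos[of "pi - \<theta>"] by simp
      have "mu_density q 0 0 (- cos \<theta>) * sin \<theta> = qinf q q / (2 * pi) * circle_weight q (pi - \<theta>)"
      proof (cases "sin \<theta> = 0")
        case sin0: True
        have "\<theta> = 0 \<or> \<theta> = pi"
          using sin0 True by (metis atLeastAtMost_iff less_eq_real_def sin_gt_zero less_irrefl)
        hence "cis (2 * (pi - \<theta>)) = 1" by (auto simp: cis_multiple_2pi)
        thus ?thesis using sin0 by (simp add: circle_weight_def[OF q] qinf_1[OF q])
      next
        case False
        thus ?thesis
          unfolding mu_density_def Let_def ac qpoch_inf_eq_qinf_real qpoch_inf_eq_qinf_complex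
          by (simp add: circle_weight_def[OF q] qinf_0[OF q])
      qed
      hence "mu_density q 0 0 (- cos \<theta>) * sin \<theta> * g (- cos \<theta>) = qinf q q / (2 * pi) * circle_weight q (pi - \<theta>) * g (- cos \<theta>)"
        by (rule arg_cong)
      thus ?thesis using True by (simp add: mult_ac)
    qed simp
  qed
  also have "\<dots> = qinf q q / (2 * pi) * (LINT \<theta>|pi_measure. circle_weight q (pi - \<theta>) * g (cos (pi - \<theta>)))"
    by (rule integral_mult_right_zero)
  also have "(LINT \<theta>|pi_measure. circle_weight q (pi - \<theta>) * g (cos (pi - \<theta>))) = (LINT \<theta>|pi_measure. circle_weight q \<theta> * g (cos \<theta>))"
    by (rule integral_pi_measure_reflect)
  finally show ?thesis .
qed

lemma circle_weight_reflect: "circle_weight q (pi - \<theta>) = circle_weight q \<theta>"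
proof -
  have "cis (2 * (pi - \<theta>)) = cnj (cis (2 * \<theta>))"
    by (simp add: complex_eq_iff cos_diff sin_diff right_diff_distrib)
  thus ?thesis by (simp add: circle_weight_def[OF q] qinf_cnj[OF q])
qed

text \<open>The total mass is the zeroth moment of the circle weight, odd degrees vanish by the
  reflection of \<theta>, and positive even degrees by the q-binomial zero. Orthogonality of all the
  polynomials is derived from this first row.\<close>

lemma hermite_mean: "(LINT x|mu_measure q 0 0. asc_poly q 0 0 n x) = (if n = 0 then 1 else 0)"
proof -
  have eq: "(LINT x|mu_measure q 0 0. asc_poly q 0 0 n x) =
      qinf q q / (2 * pi) * (LINT \<theta>|pi_measure. circle_weight q \<theta> * asc_poly q 0 0 n (cos \<theta>))"
    by (intro integral_hermite_angle continuous_intros)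
  consider "n = 0" | "odd n" | s where "n = 2 * s" "s > 0"
    by (cases "n = 0"; cases "even n") (auto elim!: evenE)
  thus ?thesis
  proof cases
    case 1
    have "complex_of_real (LINT \<theta>|pi_measure. circle_weight q \<theta>) = of_real (2 * pi / qinf q q)"
      using circle_weight_moment[OF q, of 0] by (simp add: integral_complex_of_real Suc_choose_2)
    hence "(LINT \<theta>|pi_measure. circle_weight q \<theta>) = 2 * pi / qinf q q"
      by (simp only: of_real_eq_iff)
    thus ?thesis unfolding eq using 1 qinf_q_pos[OF q] by simp
  next
    case 2
    have "(LINT \<theta>|pi_measure. circle_weight q \<theta> * asc_poly q 0 0 n (cos \<theta>)) =
        (LINT \<theta>|pi_measure. circle_weight q (pi - \<theta>) * asc_poly q 0 0 n (cos (pi - \<theta>)))"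
      by (rule integral_pi_measure_reflect[symmetric])
    also have "\<dots> = (LINT \<theta>|pi_measure. - (circle_weight q \<theta> * asc_poly q 0 0 n (cos \<theta>)))"
      using 2 by (simp add: circle_weight_reflect asc_poly_uminus)
    also have "\<dots> = - (LINT \<theta>|pi_measure. circle_weight q \<theta> * asc_poly q 0 0 n (cos \<theta>))"
      by (rule Bochner_Integration.integral_minus)
    finally have "(LINT \<theta>|pi_measure. circle_weight q \<theta> * asc_poly q 0 0 n (cos \<theta>)) = 0" by linarith
    thus ?thesis unfolding eq using 2 by (auto elim: oddE)
  next
    case 3
    have "complex_of_real (LINT \<theta>|pi_measure. circle_weight q \<theta> * asc_poly q 0 0 n (cos \<theta>)) =
        (LINT \<theta>|pi_measure. of_real (qfac q n) * (of_real (circle_weight q \<theta>) * hermite_sum q (cis \<theta>) (cis (- \<theta>)) n))"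
      unfolding integral_complex_of_real[symmetric]
    proof (intro Bochner_Integration.integral_cong refl)
      fix \<theta>
      have "cis \<theta> + cis (- \<theta>) = 2 * of_real (cos \<theta>)" by (simp add: complex_eq_iff)
      from asc_poly_hermite[OF q _ this, of n]
      show "complex_of_real (circle_weight q \<theta> * asc_poly q 0 0 n (cos \<theta>)) =
         of_real (qfac q n) * (of_real (circle_weight q \<theta>) * hermite_sum q (cis \<theta>) (cis (- \<theta>)) n)"
        by (simp add: cis_mult)
    qed
    also have "\<dots> = 0"
      by (subst integral_mult_right_zero) (simp add: 3 circle_weight_hermite_even[OF q])
    finally show ?thesis unfolding eq using 3 by simp
  qed
qed

text \<open>Since multiplication by \<open>x\<close> is symmetric, the matrix of a weight is determined by its first row.\<close>

lemma asc_gram_unique: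
  assumes w: "continuous_on {-1..1} w"
    and G: "\<And>m n. G (Suc m) n + (a + b) * q ^ m * G m n + (1 - q ^ m) * (1 - a * b * q ^ (m - 1)) * G (m - 1) n
                 = G m (Suc n) + (a + b) * q ^ n * G m n + (1 - q ^ n) * (1 - a * b * q ^ (n - 1)) * G m (n - 1)"
    and G0: "\<And>n. (LINT x|mu_measure q 0 0. w x * asc_poly q a b n x) = G 0 n"
  shows "(LINT x|mu_measure q 0 0. w x * (asc_poly q a b m x * asc_poly q a b n x)) = G m n"
proof -
  define F where "F = (\<lambda>m n. LINT x|mu_measure q 0 0. w x * (asc_poly q a b m x * asc_poly q a b n x))"
  have int: "integrable (mu_measure q 0 0) (\<lambda>x. w x * (asc_poly q a b m x * asc_poly q a b n x))" for m n
    by (intro integrable_mu_continuous continuous_intros w) auto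
  have sym: "F m n = F n m" for m n
    unfolding F_def by (simp add: mult_ac)
  have F: "F (Suc m) n + (a + b) * q ^ m * F m n + (1 - q ^ m) * (1 - a * b * q ^ (m - 1)) * F (m - 1) n =
      (LINT x|mu_measure q 0 0. 2 * x * (w x * (asc_poly q a b m x * asc_poly q a b n x)))" for m n
  proof -
    have "(LINT x|mu_measure q 0 0. 2 * x * (w x * (asc_poly q a b m x * asc_poly q a b n x))) =
       (LINT x|mu_measure q 0 0. w x * (asc_poly q a b (Suc m) x * asc_poly q a b n x)
         + (a + b) * q ^ m * (w x * (asc_poly q a b m x * asc_poly q a b n x))
         + (1 - q ^ m) * (1 - a * b * q ^ (m - 1)) * (w x * (asc_poly q a b (m - 1) x * asc_poly q a b n x)))"
      by (intro Bochner_Integration.integral_cong refl, subst asc_poly_Suc) (simp add: algebra_simps)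
    also have "\<dots> = F (Suc m) n + (a + b) * q ^ m * F m n + (1 - q ^ m) * (1 - a * b * q ^ (m - 1)) * F (m - 1) n"
      unfolding F_def
      by (subst Bochner_Integration.integral_add Bochner_Integration.integral_add
            | intro Bochner_Integration.integrable_add integrable_mult_right int
            | subst integral_mult_right_zero)+ simp
    finally show ?thesis ..
  qed
  have "F m n = G m n"
  proof (rule symmetric_recurrence_unique[where \<alpha> = "\<lambda>n. (a + b) * q ^ n" and \<beta> = "\<lambda>n. (1 - q ^ n) * (1 - a * b * q ^ (n - 1))"])
    fix m n
    have "F m (Suc n) + (a + b) * q ^ n * F m n + (1 - q ^ n) * (1 - a * b * q ^ (n - 1)) * F m (n - 1)
      = F (Suc n) m + (a + b) * q ^ n * F n m + (1 - q ^ n) * (1 - a * b * q ^ (n - 1)) * F (n - 1) m"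
      by (simp only: sym[of m])
    also have "\<dots> = (LINT x|mu_measure q 0 0. 2 * x * (w x * (asc_poly q a b n x * asc_poly q a b m x)))"
      by (rule F)
    also have "\<dots> = (LINT x|mu_measure q 0 0. 2 * x * (w x * (asc_poly q a b m x * asc_poly q a b n x)))"
      by (simp add: mult_ac)
    finally show "F (Suc m) n + (a + b) * q ^ m * F m n + (1 - q ^ m) * (1 - a * b * q ^ (m - 1)) * F (m - 1) n
       = F m (Suc n) + (a + b) * q ^ n * F m n + (1 - q ^ n) * (1 - a * b * q ^ (n - 1)) * F m (n - 1)"
      unfolding F by simp
    show "F 0 n = G 0 n" using G0[of n] by (simp add: F_def)
  qed (rule G, simp)
  thus ?thesis by (simp add: F_def)
qed

lemma hermite_orthogonal:
  "(LINT x|mu_measure q 0 0. asc_poly q 0 0 m x * asc_poly q 0 0 n x) = (if m = n then qfac q n else 0)"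
proof -
  have "(LINT x|mu_measure q 0 0. 1 * (asc_poly q 0 0 m x * asc_poly q 0 0 n x)) = (if m = n then qfac q n else 0)"
  proof (rule asc_gram_unique)
    fix m n :: nat
    let ?G = "\<lambda>m n. if m = n then qfac q n else 0"
    show "?G (Suc m) n + (0 + 0) * q ^ m * ?G m n + (1 - q ^ m) * (1 - 0 * 0 * q ^ (m - 1)) * ?G (m - 1) n =
      ?G m (Suc n) + (0 + 0) * q ^ n * ?G m n + (1 - q ^ n) * (1 - 0 * 0 * q ^ (n - 1)) * ?G m (n - 1)"
      by (cases m; cases n) (auto simp: qfac_Suc mult.commute)
    show "(LINT x|mu_measure q 0 0. 1 * asc_poly q 0 0 n x) = (if 0 = n then qfac q n else 0)"
      by (simp add: hermite_mean)
  qed simp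
  thus ?thesis by simp
qed

end

section \<open>Expansions in q-Hermite polynomials\<close>

text \<open>A product majorant makes the double series absolutely convergent; one index is treated
  as integration over the counting measure.\<close>

lemma suminf_swap_dominated:
  fixes f :: "nat \<Rightarrow> nat \<Rightarrow> real"
  assumes bound: "\<And>n k. \<bar>f n k\<bar> \<le> u n * v k" and u: "summable u" "\<And>n. 0 \<le> u n" and v: "summable v" "\<And>k. 0 \<le> v k"
  shows "(\<lambda>n. \<Sum>k. f n k) sums (\<Sum>k. \<Sum>n. f n k)"
proof -
  have si: "summable (\<lambda>k. \<bar>f n k\<bar>)" for n
    by (rule summable_comparison_test'[of "\<lambda>k. u n * v k" 0]) (auto intro!: summable_mult v bound)
  have sj: "summable (\<lambda>n. \<bar>f n k\<bar>)" for k
    by (rule summable_comparison_test'[of "\<lambda>n. u n * v k" 0]) (auto intro!: summable_mult2 u bound)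
  have int: "integrable (count_space UNIV) (f n)" for n
    using si by (simp add: integrable_count_space_nat_iff)
  have *: "(\<lambda>n. LINT k|count_space UNIV. f n k) sums (LINT k|count_space UNIV. (\<Sum>n. f n k))"
  proof (rule sums_integral)
    show "summable (\<lambda>n. LINT k|count_space UNIV. norm (f n k))"
    proof (rule summable_comparison_test'[of "\<lambda>n. u n * suminf v" 0])
      show "summable (\<lambda>n. u n * suminf v)" by (intro summable_mult2 u)
      fix n
      have "(LINT k|count_space UNIV. norm (f n k)) = (\<Sum>k. \<bar>f n k\<bar>)"
        using si[of n] by (subst integral_count_space_nat) (auto simp: integrable_count_space_nat_iff)
      also have "\<dots> \<le> (\<Sum>k. u n * v k)" by (intro suminf_le bound si summable_mult v)
      also have "\<dots> = u n * suminf v" by (intro suminf_mult v)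
      finally show "norm (LINT k|count_space UNIV. norm (f n k)) \<le> u n * suminf v" by simp
    qed
  qed (use sj int in auto)
  have "integrable (count_space UNIV) (\<lambda>k. \<Sum>n. f n k)"
    unfolding integrable_count_space_nat_iff
  proof (rule summable_comparison_test'[of "\<lambda>k. suminf u * v k" 0])
    show "summable (\<lambda>k. suminf u * v k)" by (intro summable_mult v)
    fix k
    have "\<bar>\<Sum>n. f n k\<bar> \<le> (\<Sum>n. \<bar>f n k\<bar>)" by (rule summable_rabs[OF sj])
    also have "\<dots> \<le> (\<Sum>n. u n * v k)" by (intro suminf_le bound sj summable_mult2 u)
    also have "\<dots> = suminf u * v k" by (intro suminf_mult2[symmetric] u)
    finally show "norm (norm (\<Sum>n. f n k)) \<le> suminf u * v k" by simp
  qed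
  thus ?thesis using * by (simp add: integral_count_space_nat int)
qed

context
  fixes q :: real
  assumes q: "0 < q" "q < 1"
begin

text \<open>In this normalisation the q-Hermite polynomials are the coefficients of their generating
  function and are biorthogonal to \<open>asc_poly q 0 0\<close>, see
  \<open>eta_orthogonal\<close>.\<close>

definition eta :: "nat \<Rightarrow> real \<Rightarrow> real" where
  "eta n x = asc_poly q 0 0 n x / qfac q n"

lemma continuous_on_eta [continuous_intros]: "continuous_on S (eta n)"
  unfolding eta_def[abs_def] by (intro continuous_intros) (simp add: qfac_nonzero[OF q])

lemma of_real_eta:
  assumes "x \<in> {-1..1}"
  shows "of_real (eta n x) = hermite_sum q (cis (arccos x)) (cis (- arccos x)) n"
proof -
  have "cis (arccos x) + cis (- arccos x) = 2 * of_real x" using assms by (simp add: complex_eq_iff)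
  from asc_poly_hermite[OF q _ this, of n] show ?thesis
    by (simp add: eta_def cis_mult qfac_nonzero[OF q])
qed

lemma abs_eta_le:
  assumes "x \<in> {-1..1}"
  shows "\<bar>eta n x\<bar> \<le> real (Suc n) * (1 / qinf q q)\<^sup>2"
proof -
  have "\<bar>eta n x\<bar> = norm (complex_of_real (eta n x))" by simp
  also have "\<dots> \<le> (\<Sum>j\<le>n. (1 / qfac q (n - j)) * (1 / qfac q j))"
    unfolding of_real_eta[OF assms] hermite_sum_def[OF q]
    by (rule order_trans[OF norm_sum])
       (intro sum_mono, simp add: norm_mult norm_power norm_divide qfac_nonneg[OF q])
  also have "\<dots> \<le> (\<Sum>j\<le>n. (1 / qinf q q) * (1 / qinf q q))"
    using qinf_q_pos[OF q] by (intro sum_mono mult_mono inverse_qfac_le q) (auto simp: qfac_nonneg[OF q])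
  finally show ?thesis by (simp add: power2_eq_square)
qed

lemma eta_three_term: "2 * x * eta n x = (1 - q ^ Suc n) * eta (Suc n) x + (if n = 0 then 0 else eta (n - 1) x)"
proof (cases n)
  case 0
  show ?thesis using q unfolding 0 by (simp add: eta_def qfac_Suc)
next
  case (Suc k)
  have ne: "1 - q ^ Suc n \<noteq> 0" "1 - q ^ Suc k \<noteq> 0" using q_power_less_1[OF q, of n] q_power_less_1[OF q, of k] by linarith+
  have "(1 - q ^ Suc n) * eta (Suc n) x = asc_poly q 0 0 (Suc n) x / qfac q n"
    using ne by (simp add: eta_def qfac_Suc del: power_Suc asc_poly.simps)
  also have "\<dots> = 2 * x * eta n x - (1 - q ^ Suc k) * asc_poly q 0 0 k x / qfac q n"
    unfolding Suc by (simp add: eta_def diff_divide_distrib)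
  also have "(1 - q ^ Suc k) * asc_poly q 0 0 k x / qfac q n = eta k x"
    using ne unfolding Suc by (simp add: eta_def qfac_Suc del: power_Suc)
  finally show ?thesis using Suc by simp
qed

text \<open>The Cauchy product of Euler's reciprocal series for the two conjugate factors of
  \<open>askey_pair q t x\<close>.\<close>

lemma hermite_generating_function:
  assumes t: "\<bar>t\<bar> < 1" and x: "x \<in> {-1..1}"
  shows "(\<lambda>n. t ^ n * eta n x) sums (1 / askey_pair q t x)"
proof -
  define z where "z = of_real t * cis (arccos x)"
  define w where "w = of_real t * cis (- arccos x)"
  have zw: "w = cnj z" by (simp add: z_def w_def cis_cnj)
  have nz: "norm z < 1" "norm w < 1" using t by (auto simp: z_def w_def norm_mult)
  have "(\<lambda>k. \<Sum>i\<le>k. (of_real (1 / qfac q i) * w ^ i) * (of_real (1 / qfac q (k - i)) * z ^ (k - i))) sums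
     ((\<Sum>k. of_real (1 / qfac q k) * w ^ k) * (\<Sum>k. of_real (1 / qfac q k) * z ^ k))"
    by (intro Cauchy_product_sums summable_inverse_qfac q nz)
  also have "(\<Sum>k. of_real (1 / qfac q k) * w ^ k) * (\<Sum>k. of_real (1 / qfac q k) * z ^ k) = (1 / qinf q w) * (1 / qinf q z)"
    using sums_unique[OF euler_inverse_sums[OF q nz(1)]] sums_unique[OF euler_inverse_sums[OF q nz(2)]] by simp
  also have "(1 / qinf q w) * (1 / qinf q z) = of_real (1 / askey_pair q t x)"
    unfolding zw qinf_cnj[OF q] by (simp add: askey_pair_def z_def complex_norm_square mult.commute del: of_real_power)
  also have "(\<lambda>k. \<Sum>i\<le>k. (of_real (1 / qfac q i) * w ^ i) * (of_real (1 / qfac q (k - i)) * z ^ (k - i))) =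
      (\<lambda>k. of_real (t ^ k * eta k x))"
  proof
    fix k
    show "(\<Sum>i\<le>k. (of_real (1 / qfac q i) * w ^ i) * (of_real (1 / qfac q (k - i)) * z ^ (k - i))) = of_real (t ^ k * eta k x)"
      unfolding of_real_mult of_real_eta[OF x] hermite_sum_def[OF q] sum_distrib_left
    proof (rule sum.cong[OF refl])
      fix i assume "i \<in> {..k}"
      hence "complex_of_real (t ^ k) = of_real t ^ (k - i) * of_real t ^ i" by (simp flip: power_add)
      thus "(of_real (1 / qfac q i) * w ^ i) * (of_real (1 / qfac q (k - i)) * z ^ (k - i)) =
         complex_of_real (t ^ k) * (of_real (1 / qfac q (k - i)) * cis (arccos x) ^ (k - i) * (of_real (1 / qfac q i) * cis (- arccos x) ^ i))"
        by (simp only: z_def w_def power_mult_distrib) (simp only: mult_ac)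
    qed
  qed
  finally show ?thesis by (simp only: sums_of_real_iff)
qed

text \<open>Ramanujan's entire function \<open>A\<^sub>q\<close> at \<open>-y/q\<close>.\<close>

definition ramanujan :: "real \<Rightarrow> real" where
  "ramanujan y = (\<Sum>k. q ^ (2 * (k choose 2)) / qfac q k * y ^ k)"

lemma gauss_coeff_le: "q ^ (2 * (k choose 2)) / qfac q k \<le> q ^ (k choose 2) / qinf q q"
proof -
  have "q ^ (2 * (k choose 2)) * (1 / qfac q k) \<le> q ^ (k choose 2) * (1 / qinf q q)"
    using q qinf_q_pos[OF q] by (intro mult_mono power_decreasing inverse_qfac_le) (auto simp: qfac_nonneg[OF q])
  thus ?thesis by simp
qed

lemma summable_gauss_bounded:
  assumes "\<And>k. \<bar>c k\<bar> \<le> B"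
  shows "summable (\<lambda>k. c k * (q ^ (2 * (k choose 2)) / qfac q k * y ^ k))"
proof (rule summable_comparison_test'[where N = 0])
  show "summable (\<lambda>k. B / qinf q q * (q ^ (k choose 2) * \<bar>y\<bar> ^ k))"
    by (intro summable_mult summable_gauss q)
  fix k
  have B: "0 \<le> B" using assms[of 0] by linarith
  have "norm (c k * (q ^ (2 * (k choose 2)) / qfac q k * y ^ k)) = \<bar>c k\<bar> * (q ^ (2 * (k choose 2)) / qfac q k * \<bar>y\<bar> ^ k)"
    using q by (simp add: abs_mult power_abs qfac_nonneg[OF q])
  also have "\<dots> \<le> B * (q ^ (k choose 2) / qinf q q * \<bar>y\<bar> ^ k)"
    using q B qinf_q_pos[OF q] by (intro mult_mono assms gauss_coeff_le) (auto simp: qfac_nonneg[OF q] less_imp_le)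
  finally show "norm (c k * (q ^ (2 * (k choose 2)) / qfac q k * y ^ k)) \<le> B / qinf q q * (q ^ (k choose 2) * \<bar>y\<bar> ^ k)"
    by simp
qed

lemma summable_ramanujan: "summable (\<lambda>k. q ^ (2 * (k choose 2)) / qfac q k * y ^ k)"
  using summable_gauss_bounded[of "\<lambda>_. 1" 1 y] by simp

text \<open>\<open>gauss_series \<beta> y\<close> is \<open>(\<beta>; q)\<^sub>\<infinity>\<close> times \<open>\<^sub>0\<phi>\<^sub>1(-; \<beta>; q, y)\<close>, an entire function of both variables.\<close>

definition gauss_series :: "real \<Rightarrow> real \<Rightarrow> real" where
  "gauss_series \<beta> y = (\<Sum>k. qinf q (\<beta> * q ^ k) * (q ^ (2 * (k choose 2)) / qfac q k * y ^ k))"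

lemma gauss_series_0: "gauss_series 0 y = ramanujan y"
  by (simp add: gauss_series_def ramanujan_def qinf_0[OF q])

lemma bounded_qinf_q_power: "\<exists>B. \<forall>k. \<bar>qinf q (\<beta> * q ^ k)\<bar> \<le> B"
proof -
  have "(\<lambda>k. \<beta> * q ^ k) \<longlonglongrightarrow> 0" using of_real_q_power_tendsto_0[OF q, of \<beta>] by simp
  from isCont_tendsto_compose[OF isCont_qinf[OF q] this]
  have "Bseq (\<lambda>k. qinf q (\<beta> * q ^ k))" by (intro convergent_imp_Bseq) (auto simp: convergent_def)
  thus ?thesis by (auto simp: Bseq_def)
qed

lemma summable_gauss_series:
  "summable (\<lambda>k. qinf q (\<beta> * q ^ k) * (q ^ (2 * (k choose 2)) / qfac q k * y ^ k))"
proof -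
  obtain B where "\<And>k. \<bar>qinf q (\<beta> * q ^ k)\<bar> \<le> B" using bounded_qinf_q_power[of \<beta>] by blast
  thus ?thesis by (rule summable_gauss_bounded)
qed

text \<open>The difference of y^k and (y q)^k supplies \<open>1 - q ^ k\<close>, which cancels in
  the q-factorial and shifts the index. This relation and \<open>gauss_series_shift\<close> generate
  all contiguous relations used later.\<close>

lemma gauss_series_diff: "gauss_series \<beta> y - gauss_series \<beta> (y * q) = y * gauss_series (\<beta> * q) (y * q\<^sup>2)"
proof -
  let ?t = "\<lambda>k y. qinf q (\<beta> * q ^ k) * (q ^ (2 * (k choose 2)) / qfac q k * y ^ k)"
  have sd: "summable (\<lambda>k. ?t k y - ?t k (y * q))" by (intro summable_diff summable_gauss_series)
  have "gauss_series \<beta> y - gauss_series \<beta> (y * q) = (\<Sum>k. ?t k y - ?t k (y * q))"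
    unfolding gauss_series_def by (intro suminf_diff summable_gauss_series)
  also have "\<dots> = (\<Sum>k. ?t (Suc k) y - ?t (Suc k) (y * q))"
    using suminf_split_head[OF sd] by simp
  also have "\<dots> = (\<Sum>k. y * (qinf q (\<beta> * q * q ^ k) * (q ^ (2 * (k choose 2)) / qfac q k * (y * q\<^sup>2) ^ k)))"
  proof (rule suminf_cong)
    fix k
    have ne: "1 - q ^ Suc k \<noteq> 0" using q_power_less_1[OF q, of k] by linarith
    have "?t (Suc k) y - ?t (Suc k) (y * q) =
       qinf q (\<beta> * q ^ Suc k) * (q ^ (2 * (Suc k choose 2)) * ((1 - q ^ Suc k) / qfac q (Suc k)) * y ^ Suc k)"
      by (simp add: power_mult_distrib algebra_simps diff_divide_distrib)
    also have "\<dots> = qinf q (\<beta> * q ^ Suc k) * (q ^ (2 * (k choose 2)) * (q\<^sup>2) ^ k * (1 / qfac q k) * y ^ Suc k)"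
    proof -
      have "(1 - q ^ Suc k) / qfac q (Suc k) = 1 / qfac q k"
        using ne by (simp add: qfac_Suc del: power_Suc)
      moreover have "q ^ (2 * (Suc k choose 2)) = q ^ (2 * (k choose 2)) * (q\<^sup>2) ^ k"
        by (simp add: Suc_choose_2 power_add algebra_simps flip: power_mult)
      ultimately show ?thesis by (simp only:)
    qed
    finally show "?t (Suc k) y - ?t (Suc k) (y * q) =
        y * (qinf q (\<beta> * q * q ^ k) * (q ^ (2 * (k choose 2)) / qfac q k * (y * q\<^sup>2) ^ k))"
      by (simp add: power_mult_distrib mult_ac)
  qed
  also have "\<dots> = y * gauss_series (\<beta> * q) (y * q\<^sup>2)"
    unfolding gauss_series_def by (intro suminf_mult summable_gauss_series)
  finally show ?thesis .
qed

text \<open>One factor is split off (\<beta> q^k; q)_inf; its q^k is absorbed into the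
  argument.\<close>

lemma gauss_series_shift: "gauss_series \<beta> y = gauss_series (\<beta> * q) y - \<beta> * gauss_series (\<beta> * q) (y * q)"
proof -
  let ?t = "\<lambda>k y. qinf q (\<beta> * q * q ^ k) * (q ^ (2 * (k choose 2)) / qfac q k * y ^ k)"
  have "gauss_series \<beta> y = (\<Sum>k. ?t k y - \<beta> * ?t k (y * q))"
    unfolding gauss_series_def
  proof (rule suminf_cong)
    fix k
    have "qinf q (\<beta> * q ^ k) = (1 - \<beta> * q ^ k) * qinf q (\<beta> * q * q ^ k)"
      by (subst qinf_rec[OF q]) (simp add: mult_ac)
    moreover have "(1 - \<beta> * q ^ k) * A * (T * y ^ k) = A * (T * y ^ k) - \<beta> * (A * (T * (y * q) ^ k))" for A T
      by (simp add: power_mult_distrib algebra_simps)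
    ultimately show "qinf q (\<beta> * q ^ k) * (q ^ (2 * (k choose 2)) / qfac q k * y ^ k) = ?t k y - \<beta> * ?t k (y * q)"
      by (simp only:)
  qed
  also have "\<dots> = suminf (\<lambda>k. ?t k y) - (\<Sum>k. \<beta> * ?t k (y * q))"
    by (intro suminf_diff[symmetric] summable_gauss_series summable_mult)
  also have "(\<Sum>k. \<beta> * ?t k (y * q)) = \<beta> * gauss_series (\<beta> * q) (y * q)"
    unfolding gauss_series_def by (intro suminf_mult summable_gauss_series)
  finally show ?thesis by (simp add: gauss_series_def)
qed

lemma ramanujan_rec: "ramanujan y = ramanujan (y * q) + y * ramanujan (y * q\<^sup>2)"
  using gauss_series_diff[of 0 y] by (simp add: gauss_series_0)

lemma ramanujan_mono:
  assumes "0 \<le> y" "y \<le> y'" shows "ramanujan y \<le> ramanujan y'"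
  unfolding ramanujan_def using assms q
  by (intro suminf_le summable_ramanujan mult_left_mono power_mono) (auto simp: qfac_nonneg[OF q])

lemma ramanujan_nonneg: "0 \<le> y \<Longrightarrow> 0 \<le> ramanujan y"
  unfolding ramanujan_def using q
  by (intro suminf_nonneg summable_ramanujan) (auto simp: qfac_nonneg[OF q])

lemma isCont_ramanujan_0: "isCont ramanujan 0"
  unfolding ramanujan_def[abs_def]
  by (rule isCont_powser[where K = 1]) (use summable_ramanujan[of 1] in auto)

lemma ramanujan_0 [simp]: "ramanujan 0 = 1"
  unfolding ramanujan_def by (subst powser_zero) simp

section \<open>Expansion of (c exp(i theta), c exp(-i theta); q)_inf in q-Hermite
  polynomials\<close>

text \<open>The coefficient of \<open>eta n\<close> in the expansion of
  \<open>askey_pair q c\<close>, valid for every real c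
  (\<open>askey_pair_expansion\<close>).\<close>

definition pair_coeff :: "nat \<Rightarrow> real \<Rightarrow> real" where
  "pair_coeff n c = (- c) ^ n * q ^ (n choose 2) * ramanujan (c\<^sup>2 * q ^ n)"

lemma abs_pair_coeff_le:
  assumes "\<bar>c\<bar> \<le> C"
  shows "\<bar>pair_coeff n c\<bar> \<le> q ^ (n choose 2) * C ^ n * ramanujan (C\<^sup>2)"
proof -
  have "c\<^sup>2 * q ^ n \<le> C\<^sup>2 * 1"
    using assms q by (intro mult_mono q_power_le_1 abs_le_square_iff[THEN iffD1]) auto
  hence "ramanujan (c\<^sup>2 * q ^ n) \<le> ramanujan (C\<^sup>2)"
    using q by (intro ramanujan_mono) auto
  hence "\<bar>c\<bar> ^ n * q ^ (n choose 2) * ramanujan (c\<^sup>2 * q ^ n) \<le> C ^ n * q ^ (n choose 2) * ramanujan (C\<^sup>2)"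
    using assms q by (intro mult_mono power_mono ramanujan_nonneg) auto
  moreover have "0 \<le> ramanujan (c\<^sup>2 * q ^ n)" using q by (intro ramanujan_nonneg) auto
  ultimately show ?thesis using q by (simp add: pair_coeff_def abs_mult power_abs mult_ac)
qed

lemma summable_pair_coeff:
  assumes "\<And>n. \<bar>v n\<bar> \<le> A * 2 ^ n"
  shows "summable (\<lambda>n. pair_coeff n c * v n)"
proof (rule summable_comparison_test'[where N = 0])
  show "summable (\<lambda>n. ramanujan (\<bar>c\<bar>\<^sup>2) * A * (q ^ (n choose 2) * (2 * \<bar>c\<bar>) ^ n))"
    by (intro summable_mult summable_gauss q)
  fix n
  have "norm (pair_coeff n c * v n) \<le> (q ^ (n choose 2) * \<bar>c\<bar> ^ n * ramanujan (\<bar>c\<bar>\<^sup>2)) * (A * 2 ^ n)"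
    using q unfolding real_norm_def abs_mult
    by (intro mult_mono abs_pair_coeff_le assms mult_nonneg_nonneg ramanujan_nonneg) auto
  thus "norm (pair_coeff n c * v n) \<le> ramanujan (\<bar>c\<bar>\<^sup>2) * A * (q ^ (n choose 2) * (2 * \<bar>c\<bar>) ^ n)"
    by (simp add: power_mult_distrib mult_ac)
qed

text \<open>Multiplication by 1 - 2 c x + c^2 acting on coefficients: the terms with indices n - 1
  and n + 1 come from transposing \<open>eta_three_term\<close>. With Y = c^2 q^n the identity
  reduces to \<open>ramanujan_rec\<close> at Y and at Y q.\<close>

lemma pair_coeff_rec:
  "pair_coeff n c = (1 + c\<^sup>2) * pair_coeff n (c * q)
     - c * ((1 - q ^ n) * pair_coeff (n - 1) (c * q) + pair_coeff (Suc n) (c * q))"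
proof -
  define Y where "Y = c\<^sup>2 * q ^ n"
  define Q where "Q = (- c) ^ n * q ^ (n choose 2)"
  have 0: "pair_coeff n c = Q * ramanujan Y" by (simp add: pair_coeff_def Q_def Y_def)
  have 1: "pair_coeff n (c * q) = Q * q ^ n * ramanujan (Y * q\<^sup>2)"
  proof -
    have "(- (c * q)) ^ n = (- c) ^ n * q ^ n" by (simp flip: power_mult_distrib)
    moreover have "(c * q)\<^sup>2 * q ^ n = Y * q\<^sup>2" by (simp add: Y_def power_mult_distrib)
    ultimately show ?thesis by (simp add: pair_coeff_def Q_def)
  qed
  have 2: "c * pair_coeff (Suc n) (c * q) = - Q * q * q ^ n * Y * ramanujan (Y * q ^ 3)"
  proof -
    have "(- (c * q)) ^ Suc n = - (c * q) * ((- c) ^ n * q ^ n)"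
      by (simp flip: power_mult_distrib)
    moreover have "(c * q)\<^sup>2 * q ^ Suc n = Y * q ^ 3"
      by (simp add: Y_def power_mult_distrib power3_eq_cube power2_eq_square)
    moreover have "q ^ (Suc n choose 2) = q ^ n * q ^ (n choose 2)" by (simp add: Suc_choose_2 power_add)
    ultimately show ?thesis
      unfolding pair_coeff_def by (simp only:) (simp add: Q_def Y_def power2_eq_square)
  qed
  have 3: "c * ((1 - q ^ n) * pair_coeff (n - 1) (c * q)) = - (1 - q ^ n) * Q * ramanujan (Y * q)"
  proof (cases n)
    case (Suc k)
    have "(- c) ^ n * q ^ (n choose 2) = - c * ((- (c * q)) ^ k * q ^ (k choose 2))"
      unfolding Suc by (simp add: Suc_choose_2 power_add flip: power_mult_distrib)
    moreover have "(c * q)\<^sup>2 * q ^ k = Y * q"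
      by (simp add: Y_def Suc power_mult_distrib power2_eq_square)
    ultimately have "pair_coeff (n - 1) (c * q) = (- (c * q)) ^ k * q ^ (k choose 2) * ramanujan (Y * q)"
      and "Q = - c * ((- (c * q)) ^ k * q ^ (k choose 2))"
      unfolding pair_coeff_def Q_def by (simp_all add: Suc)
    thus ?thesis by (simp add: algebra_simps)
  qed simp
  have 4: "ramanujan Y = ramanujan (Y * q) + Y * ramanujan (Y * q\<^sup>2)" by (rule ramanujan_rec)
  have 5: "ramanujan (Y * q) = ramanujan (Y * q\<^sup>2) + Y * q * ramanujan (Y * q ^ 3)"
    using ramanujan_rec[of "Y * q"] by (simp add: power2_eq_square power3_eq_cube mult.assoc)
  have "(1 + c\<^sup>2) * pair_coeff n (c * q) - c * ((1 - q ^ n) * pair_coeff (n - 1) (c * q) + pair_coeff (Suc n) (c * q)) =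
     Q * (q ^ n * ramanujan (Y * q\<^sup>2) + Y * ramanujan (Y * q\<^sup>2) + (1 - q ^ n) * ramanujan (Y * q) + q ^ n * (Y * q * ramanujan (Y * q ^ 3)))"
    unfolding distrib_left[of c] 1 2 3 by (simp add: Y_def algebra_simps)
  also have "Y * q * ramanujan (Y * q ^ 3) = ramanujan (Y * q) - ramanujan (Y * q\<^sup>2)" using 5 by simp
  also have "Q * (q ^ n * ramanujan (Y * q\<^sup>2) + Y * ramanujan (Y * q\<^sup>2) + (1 - q ^ n) * ramanujan (Y * q) + q ^ n * (ramanujan (Y * q) - ramanujan (Y * q\<^sup>2)))
     = Q * (ramanujan (Y * q) + Y * ramanujan (Y * q\<^sup>2))" by (simp add: algebra_simps)
  also have "\<dots> = pair_coeff n c" unfolding 0 4 ..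
  finally show ?thesis ..
qed

lemma abs_eta_le_exp:
  assumes "x \<in> {-1..1}" shows "\<bar>eta n x\<bar> \<le> (1 / qinf q q)\<^sup>2 * 2 ^ n"
proof -
  have "real (Suc n) \<le> 2 ^ n" by (metis Suc_leI less_exp of_nat_le_iff of_nat_numeral of_nat_power)
  hence "real (Suc n) * (1 / qinf q q)\<^sup>2 \<le> 2 ^ n * (1 / qinf q q)\<^sup>2" by (intro mult_right_mono) auto
  thus ?thesis using abs_eta_le[OF assms, of n] by (simp add: mult.commute)
qed

lemma summable_pair_eta:
  assumes "x \<in> {-1..1}" shows "summable (\<lambda>n. pair_coeff n c * eta n x)"
  by (rule summable_pair_coeff) (rule abs_eta_le_exp[OF assms])

lemma askey_pair_tendsto:
  assumes x: "x \<in> {-1..1}"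
  shows "(\<lambda>n. \<Prod>j<n. 1 - 2 * (c * q ^ j) * x + (c * q ^ j)\<^sup>2) \<longlonglongrightarrow> askey_pair q c x"
proof -
  have "(\<lambda>n. (cmod (\<Prod>j<n. 1 - of_real c * cis (arccos x) * of_real q ^ j))\<^sup>2) \<longlonglongrightarrow> askey_pair q c x"
    unfolding askey_pair_def by (intro tendsto_power tendsto_norm qinf_tendsto q)
  moreover have "(cmod (\<Prod>j<n. 1 - of_real c * cis (arccos x) * of_real q ^ j))\<^sup>2 =
      (\<Prod>j<n. 1 - 2 * (c * q ^ j) * x + (c * q ^ j)\<^sup>2)" for n
  proof -
    have "(cmod (1 - of_real c * cis (arccos x) * of_real q ^ j))\<^sup>2 = 1 - 2 * (c * q ^ j) * x + (c * q ^ j)\<^sup>2" for j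
      using cmod_one_minus_cis[of "c * q ^ j" "arccos x"] x by (simp add: mult_ac)
    thus ?thesis by (simp add: prod_norm[symmetric] prod_power_distrib)
  qed
  ultimately show ?thesis by simp
qed

text \<open>For fixed x both sides satisfy the same q-difference equation in c and tend to 1 as c
  runs through c q^N. The coefficients are thus verified rather than derived from the
  product.\<close>

lemma askey_pair_expansion:
  assumes x: "x \<in> {-1..1}"
  shows "(\<lambda>n. pair_coeff n c * eta n x) sums askey_pair q c x"
proof -
  define f where "f = (\<lambda>c. \<Sum>n. pair_coeff n c * eta n x)"
  let ?K = "(1 / qinf q q)\<^sup>2"
  have rec: "f c = (1 - 2 * c * x + c\<^sup>2) * f (c * q)" for c
  proof -
    let ?g = "\<lambda>n. pair_coeff n (c * q)"
    have s0: "summable (\<lambda>n. ?g n * eta n x)" by (rule summable_pair_eta[OF x])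
    have s1: "summable (\<lambda>n. ?g n * ((1 - q ^ Suc n) * eta (Suc n) x))"
    proof (rule summable_pair_coeff)
      fix n
      have "\<bar>(1 - q ^ Suc n) * eta (Suc n) x\<bar> \<le> 1 * (?K * 2 ^ Suc n)"
        using q q_power_less_1[OF q, of n] unfolding abs_mult
        by (intro mult_mono abs_eta_le_exp[OF x]) (auto simp del: power_Suc)
      thus "\<bar>(1 - q ^ Suc n) * eta (Suc n) x\<bar> \<le> (?K * 2) * 2 ^ n" by simp
    qed
    have s2: "summable (\<lambda>n. ?g n * (if n = 0 then 0 else eta (n - 1) x))"
    proof (rule summable_pair_coeff)
      fix n
      show "\<bar>if n = 0 then 0 else eta (n - 1) x\<bar> \<le> ?K * 2 ^ n"
      proof (cases n)
        case (Suc k)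
        have "\<bar>eta k x\<bar> \<le> ?K * 2 ^ k" by (rule abs_eta_le_exp[OF x])
        also have "\<dots> \<le> ?K * 2 ^ n" using Suc by (intro mult_left_mono) auto
        finally show ?thesis using Suc by simp
      qed simp
    qed
    have s1': "summable (\<lambda>n. (1 - q ^ n) * pair_coeff (n - 1) (c * q) * eta n x)"
      by (subst summable_Suc_iff[symmetric]) (use s1 in \<open>simp add: mult_ac del: power_Suc\<close>)
    have s2': "summable (\<lambda>n. ?g (Suc n) * eta n x)"
      using s2 by (subst (asm) summable_Suc_iff[symmetric]) simp
    have e1: "(\<Sum>n. ?g n * ((1 - q ^ Suc n) * eta (Suc n) x)) = (\<Sum>n. (1 - q ^ n) * pair_coeff (n - 1) (c * q) * eta n x)"
      using suminf_split_head[OF s1'] by (simp add: mult_ac del: power_Suc)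
    have e2: "(\<Sum>n. ?g n * (if n = 0 then 0 else eta (n - 1) x)) = (\<Sum>n. ?g (Suc n) * eta n x)"
      using suminf_split_head[OF s2] by simp
    have "2 * x * f (c * q) = (\<Sum>n. 2 * x * (?g n * eta n x))"
      unfolding f_def by (intro suminf_mult[symmetric] s0)
    also have "\<dots> = (\<Sum>n. ?g n * ((1 - q ^ Suc n) * eta (Suc n) x) + ?g n * (if n = 0 then 0 else eta (n - 1) x))"
    proof (rule suminf_cong)
      fix n
      have "2 * x * (?g n * eta n x) = ?g n * (2 * x * eta n x)" by simp
      also have "\<dots> = ?g n * ((1 - q ^ Suc n) * eta (Suc n) x) + ?g n * (if n = 0 then 0 else eta (n - 1) x)"
        unfolding eta_three_term by (rule distrib_left)
      finally show "2 * x * (?g n * eta n x) = ?g n * ((1 - q ^ Suc n) * eta (Suc n) x) + ?g n * (if n = 0 then 0 else eta (n - 1) x)" .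
    qed
    also have "\<dots> = (\<Sum>n. (1 - q ^ n) * pair_coeff (n - 1) (c * q) * eta n x) + (\<Sum>n. ?g (Suc n) * eta n x)"
      unfolding e1[symmetric] e2[symmetric] by (intro suminf_add[symmetric] s1 s2)
    finally have A: "2 * x * f (c * q) = (\<Sum>n. (1 - q ^ n) * pair_coeff (n - 1) (c * q) * eta n x) + (\<Sum>n. ?g (Suc n) * eta n x)" .
    have "f c = (\<Sum>n. (1 + c\<^sup>2) * (?g n * eta n x) - c * ((1 - q ^ n) * pair_coeff (n - 1) (c * q) * eta n x + ?g (Suc n) * eta n x))"
      unfolding f_def by (rule suminf_cong, subst pair_coeff_rec) (simp add: algebra_simps)
    also have "\<dots> = (\<Sum>n. (1 + c\<^sup>2) * (?g n * eta n x)) - (\<Sum>n. c * ((1 - q ^ n) * pair_coeff (n - 1) (c * q) * eta n x + ?g (Suc n) * eta n x))"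
      by (intro suminf_diff[symmetric] summable_mult summable_add s0 s1' s2')
    also have "(\<Sum>n. (1 + c\<^sup>2) * (?g n * eta n x)) = (1 + c\<^sup>2) * f (c * q)"
      unfolding f_def by (intro suminf_mult s0)
    also have "(\<Sum>n. c * ((1 - q ^ n) * pair_coeff (n - 1) (c * q) * eta n x + ?g (Suc n) * eta n x)) = c * (2 * x * f (c * q))"
      unfolding A by (subst suminf_mult, intro summable_add s1' s2', subst suminf_add[OF s1' s2']) simp
    finally show ?thesis by (simp add: algebra_simps)
  qed
  \<comment> \<open>The limit is taken under the sum by Tannery's theorem. The majorant is
    independent of N because \<open>abs_pair_coeff_le\<close> is monotone in the modulus of the
    parameter; only the term n = 0 survives.\<close>
  have lim: "(\<lambda>N. f (c * q ^ N)) \<longlonglongrightarrow> (\<Sum>n. if n = 0 then 1 else 0)"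
  proof -
    let ?M = "\<lambda>n. ramanujan (\<bar>c\<bar>\<^sup>2) * ?K * (q ^ (n choose 2) * (2 * \<bar>c\<bar>) ^ n)"
    have c0: "(\<lambda>N. c * q ^ N) \<longlonglongrightarrow> 0" using of_real_q_power_tendsto_0[OF q, of c] by simp
    have 1: "(\<lambda>N. pair_coeff n (c * q ^ N) * eta n x) \<longlonglongrightarrow> (if n = 0 then 1 else 0)" for n
    proof -
      have "(\<lambda>N. (c * q ^ N)\<^sup>2 * q ^ n) \<longlonglongrightarrow> 0\<^sup>2 * q ^ n" by (intro tendsto_intros c0)
      hence "(\<lambda>N. ramanujan ((c * q ^ N)\<^sup>2 * q ^ n)) \<longlonglongrightarrow> ramanujan 0"
        by (intro isCont_tendsto_compose[OF isCont_ramanujan_0]) simp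
      hence "(\<lambda>N. (- (c * q ^ N)) ^ n * q ^ (n choose 2) * ramanujan ((c * q ^ N)\<^sup>2 * q ^ n) * eta n x)
          \<longlonglongrightarrow> (- 0) ^ n * q ^ (n choose 2) * ramanujan 0 * eta n x"
        by (intro tendsto_mult tendsto_const tendsto_power tendsto_minus c0)
      thus ?thesis by (cases n) (auto simp: pair_coeff_def eta_def)
    qed
    have "norm (pair_coeff n (c * q ^ N) * eta n x) \<le> ?M n" for n N
    proof -
      have "\<bar>c * q ^ N\<bar> \<le> \<bar>c\<bar> * 1"
        using q unfolding abs_mult by (intro mult_left_mono) (auto simp: power_le_one)
      hence "\<bar>c * q ^ N\<bar> \<le> \<bar>c\<bar>" by simp
      from abs_pair_coeff_le[OF this, of n]
      have "norm (pair_coeff n (c * q ^ N) * eta n x) \<le> (q ^ (n choose 2) * \<bar>c\<bar> ^ n * ramanujan (\<bar>c\<bar>\<^sup>2)) * (?K * 2 ^ n)"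
        using q unfolding real_norm_def abs_mult
        by (intro mult_mono abs_eta_le_exp[OF x] mult_nonneg_nonneg ramanujan_nonneg) (auto simp: abs_mult)
      thus ?thesis by (simp add: power_mult_distrib mult_ac)
    qed
    hence 2: "\<forall>\<^sub>F (n, N) in at_top \<times>\<^sub>F sequentially. norm (pair_coeff n (c * q ^ N) * eta n x) \<le> ?M n"
      by (intro always_eventually) auto
    have 3: "summable ?M" by (intro summable_mult summable_gauss q)
    from tannerys_theorem[OF 1 2 3] show ?thesis unfolding f_def by simp
  qed
  have "f (c * q ^ 0) = askey_pair q c x"
  proof (rule prod_functional_equation[of "\<lambda>n. f (c * q ^ n)"])
    show "f (c * q ^ n) = (1 - 2 * (c * q ^ n) * x + (c * q ^ n)\<^sup>2) * f (c * q ^ Suc n)" for n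
      by (subst rec) (simp add: mult_ac)
    show "(\<lambda>n. f (c * q ^ n)) \<longlonglongrightarrow> 1"
      using lim suminf_finite[of "{0::nat}" "\<lambda>n. if n = 0 then 1 else (0::real)"] by simp
    show "(\<lambda>n. \<Prod>j<n. 1 - 2 * (c * q ^ j) * x + (c * q ^ j)\<^sup>2) \<longlonglongrightarrow> askey_pair q c x"
      by (rule askey_pair_tendsto[OF x])
  qed
  thus ?thesis using summable_sums[OF summable_pair_eta[OF x, of c]] by (simp add: f_def)
qed

end

section \<open>Integrals of Al-Salam--Chihara polynomials\<close>

text \<open>Connects the parameters a and aq, in preparation for the Christoffel formula. In the
  induction step \<open>?A n x\<close> is eliminated by the recurrence A2, and the claim becomes a
  polynomial identity, linear in two consecutive \<open>?A\<close>.\<close>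

lemma asc_poly_step_down:
  "asc_poly q a b (Suc n) x = asc_poly q (a * q) b (Suc n) x - a * (1 - q ^ Suc n) * asc_poly q (a * q) b n x"
proof (induction n rule: induct_nat_012)
  case 0
  show ?case by (simp add: algebra_simps)
next
  case 1
  show ?case by (simp add: algebra_simps power2_eq_square)
next
  case (ge2 n)
  let ?A = "asc_poly q (a * q) b" and ?r = "q ^ Suc n"
  have A2: "?A (Suc (Suc n)) x = (2 * x - (a * q + b) * ?r) * ?A (Suc n) x - (1 - ?r) * (1 - a * b * ?r) * ?A n x"
    by (simp add: algebra_simps)
  have A3: "?A (Suc (Suc (Suc n))) x = (2 * x - (a * q + b) * (?r * q)) * ?A (Suc (Suc n)) x
      - (1 - ?r * q) * (1 - a * b * (?r * q)) * ?A (Suc n) x"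
    by (simp add: algebra_simps)
  have "asc_poly q a b (Suc (Suc (Suc n))) x = (2 * x - (a + b) * (?r * q)) * asc_poly q a b (Suc (Suc n)) x
      - (1 - ?r * q) * (1 - a * b * ?r) * asc_poly q a b (Suc n) x"
    by (simp add: algebra_simps)
  also have "\<dots> = (2 * x - (a + b) * (?r * q)) * (?A (Suc (Suc n)) x - a * (1 - ?r * q) * ?A (Suc n) x)
      - (1 - ?r * q) * (1 - a * b * ?r) * ?A (Suc n) x + a * (1 - ?r * q) * ((1 - ?r) * (1 - a * b * ?r) * ?A n x)"
    unfolding ge2 by (simp add: algebra_simps)
  also have "(1 - ?r) * (1 - a * b * ?r) * ?A n x = (2 * x - (a * q + b) * ?r) * ?A (Suc n) x - ?A (Suc (Suc n)) x"
    using A2 by linarith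
  also have "(2 * x - (a + b) * (?r * q)) * (?A (Suc (Suc n)) x - a * (1 - ?r * q) * ?A (Suc n) x)
      - (1 - ?r * q) * (1 - a * b * ?r) * ?A (Suc n) x
      + a * (1 - ?r * q) * ((2 * x - (a * q + b) * ?r) * ?A (Suc n) x - ?A (Suc (Suc n)) x)
      = (2 * x - (a * q + b) * (?r * q)) * ?A (Suc (Suc n)) x - (1 - ?r * q) * (1 - a * b * (?r * q)) * ?A (Suc n) x
        - a * (1 - ?r * q * q) * ?A (Suc (Suc n)) x"
    by algebra
  also have "\<dots> = ?A (Suc (Suc (Suc n))) x - a * (1 - ?r * q * q) * ?A (Suc (Suc n)) x"
    unfolding A3 ..
  finally show ?case by (simp add: mult_ac)
qed

text \<open>Multiplication by the first factor of \<open>(a e\<^sup>i\<^sup>\<theta>, a e\<^sup>-\<^sup>i\<^sup>\<theta>; q)\<^sub>\<infinity>\<close> is the Christoffel transform from \<open>a\<close> to \<open>aq\<close>.\<close>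

lemma asc_poly_christoffel:
  "(1 - 2 * a * x + a\<^sup>2) * asc_poly q (a * q) b n x =
     (1 - a * b * q ^ n) * asc_poly q a b n x - a * asc_poly q a b (Suc n) x"
proof (cases n)
  case 0
  show ?thesis unfolding 0 by (simp add: algebra_simps power2_eq_square)
next
  case (Suc k)
  let ?A = "asc_poly q (a * q) b" and ?r = "q ^ n"
  have A2: "?A (Suc n) x = (2 * x - (a * q + b) * ?r) * ?A n x - (1 - ?r) * (1 - a * b * ?r) * ?A k x"
    unfolding Suc by (simp add: algebra_simps)
  have "(1 - a * b * ?r) * asc_poly q a b n x - a * asc_poly q a b (Suc n) x =
      (1 - a * b * ?r) * ?A n x - a * ((1 - ?r) * (1 - a * b * ?r) * ?A k x) - a * ?A (Suc n) x + a\<^sup>2 * (1 - ?r * q) * ?A n x"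
    unfolding asc_poly_step_down[of q a b n x] unfolding Suc asc_poly_step_down[of q a b k x]
    by (simp del: asc_poly.simps) algebra
  also have "(1 - ?r) * (1 - a * b * ?r) * ?A k x = (2 * x - (a * q + b) * ?r) * ?A n x - ?A (Suc n) x"
    using A2 by linarith
  also have "(1 - a * b * ?r) * ?A n x - a * ((2 * x - (a * q + b) * ?r) * ?A n x - ?A (Suc n) x) - a * ?A (Suc n) x + a\<^sup>2 * (1 - ?r * q) * ?A n x
     = (1 - 2 * a * x + a\<^sup>2) * ?A n x"
    by algebra
  finally show ?thesis ..
qed

context
  fixes q :: real
  assumes q: "0 < q" "q < 1"
begin

lemma summable_Suc_power:
  assumes "\<bar>t\<bar> < 1" shows "summable (\<lambda>n. real (Suc n) * \<bar>t\<bar> ^ n)"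
  using geometric_deriv_sums[of "\<bar>t\<bar>"] assms by (auto simp: sums_iff)

lemma eta_orthogonal:
  "(LINT x|mu_measure q 0 0. asc_poly q 0 0 n x * eta q m x) = (if m = n then 1 else 0)"
proof -
  have "(LINT x|mu_measure q 0 0. asc_poly q 0 0 n x * eta q m x) =
     (LINT x|mu_measure q 0 0. (1 / qfac q m) * (asc_poly q 0 0 n x * asc_poly q 0 0 m x))"
    by (simp add: eta_def[OF q])
  also have "\<dots> = (1 / qfac q m) * (LINT x|mu_measure q 0 0. (asc_poly q 0 0 n x * asc_poly q 0 0 m x))"
    by (rule integral_mult_right_zero)
  finally show ?thesis by (simp add: hermite_orthogonal[OF q] qfac_nonzero[OF q])
qed

lemma askey_pair_nonzero: "\<bar>t\<bar> < 1 \<Longrightarrow> askey_pair q t x \<noteq> 0"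
  using askey_pair_pos[OF q, of t x] by linarith

lemma sums_integral_mu:
  fixes f :: "nat \<Rightarrow> real \<Rightarrow> real"
  assumes f: "\<And>n. continuous_on {-1..1} (f n)" and g: "continuous_on {-1..1} g"
    and bound: "\<And>n x. x \<in> {-1..1} \<Longrightarrow> \<bar>f n x\<bar> \<le> B n" and "summable B"
    and F: "\<And>x. x \<in> {-1..1} \<Longrightarrow> (\<lambda>n. f n x) sums F x"
  shows "(\<lambda>n. LINT x|mu_measure q 0 0. f n x * g x) sums (LINT x|mu_measure q 0 0. F x * g x)"
proof -
  interpret finite_measure "mu_measure q 0 0" by (rule finite_mu_measure[OF q]) auto
  have "compact (g ` {-1..1})" by (intro compact_continuous_image g) simp
  then obtain C where C: "\<And>x. x \<in> {-1..1} \<Longrightarrow> \<bar>g x\<bar> \<le> C"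
    by (metis bounded_iff compact_imp_bounded imageI real_norm_def)
  have "(\<lambda>n. LINT x|mu_measure q 0 0. f n x * g x) sums (LINT x|mu_measure q 0 0. (\<Sum>n. f n x * g x))"
  proof (rule sums_integral_dominated)
    show "(\<lambda>x. f n x * g x) \<in> borel_measurable (mu_measure q 0 0)" for n
      by (intro measurable_mu_continuous continuous_intros continuous_on_subset[OF f] continuous_on_subset[OF g]) (auto simp: q)
    show "norm (f n x * g x) \<le> B n * C" if "x \<in> space (mu_measure q 0 0)" for n x
    proof -
      have "x \<in> {-1..1}" using that by auto
      thus ?thesis unfolding real_norm_def abs_mult
        using bound[of x n] C[of x] by (intro mult_mono) auto
    qed
    show "summable (\<lambda>n. B n * C)" using \<open>summable B\<close> by (rule summable_mult2)
  qed
  also have "(LINT x|mu_measure q 0 0. (\<Sum>n. f n x * g x)) = (LINT x|mu_measure q 0 0. F x * g x)"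
    by (intro Bochner_Integration.integral_cong refl) (auto simp: sums_iff intro!: sums_unique[symmetric] sums_mult2 F)
  finally show ?thesis .
qed

lemma sums_integral_inverse_pair:
  assumes t: "\<bar>t\<bar> < 1" and g: "continuous_on {-1..1} g"
  shows "(\<lambda>n. t ^ n * (LINT x|mu_measure q 0 0. eta q n x * g x)) sums (LINT x|mu_measure q 0 0. g x / askey_pair q t x)"
proof -
  have "(\<lambda>n. LINT x|mu_measure q 0 0. (t ^ n * eta q n x) * g x) sums (LINT x|mu_measure q 0 0. (1 / askey_pair q t x) * g x)"
  proof (rule sums_integral_mu)
    show "\<bar>t ^ n * eta q n x\<bar> \<le> (1 / qinf q q)\<^sup>2 * (real (Suc n) * \<bar>t\<bar> ^ n)" if "x \<in> {-1..1}" for n x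
    proof -
      have "\<bar>t ^ n * eta q n x\<bar> \<le> \<bar>t\<bar> ^ n * (real (Suc n) * (1 / qinf q q)\<^sup>2)"
        unfolding abs_mult power_abs by (intro mult_left_mono abs_eta_le[OF q that]) auto
      thus ?thesis by (simp add: mult_ac)
    qed
    show "summable (\<lambda>n. (1 / qinf q q)\<^sup>2 * (real (Suc n) * \<bar>t\<bar> ^ n))"
      by (intro summable_mult summable_Suc_power t)
  qed (auto intro!: continuous_intros continuous_on_eta[OF q] hermite_generating_function[OF q] t g)
  moreover have "(LINT x|mu_measure q 0 0. (t ^ n * eta q n x) * g x) = t ^ n * (LINT x|mu_measure q 0 0. eta q n x * g x)" for n
    unfolding mult.assoc by (rule integral_mult_right_zero)
  ultimately show ?thesis by simp
qed

lemma integral_hermite_inverse_pair: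
  assumes "\<bar>t\<bar> < 1"
  shows "(LINT x|mu_measure q 0 0. asc_poly q 0 0 n x / askey_pair q t x) = t ^ n"
proof -
  have "(\<lambda>m. t ^ m * (LINT x|mu_measure q 0 0. eta q m x * asc_poly q 0 0 n x)) sums
      (LINT x|mu_measure q 0 0. asc_poly q 0 0 n x / askey_pair q t x)"
    by (intro sums_integral_inverse_pair assms continuous_intros)
  moreover have "t ^ m * (LINT x|mu_measure q 0 0. eta q m x * asc_poly q 0 0 n x) = (if m = n then t ^ n else 0)" for m
    using eta_orthogonal[of n m] by (simp add: mult.commute)
  ultimately have "(\<lambda>m. if m = n then t ^ n else 0) sums (LINT x|mu_measure q 0 0. asc_poly q 0 0 n x / askey_pair q t x)"
    by simp
  moreover have "(\<lambda>m. if m = n then t ^ n else 0) sums t ^ n"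
    using sums_single[of n "\<lambda>_. t ^ n"] by simp
  ultimately show ?thesis by (rule sums_unique2)
qed

lemma integral_eta_inverse_pair:
  assumes "\<bar>t\<bar> < 1"
  shows "(LINT x|mu_measure q 0 0. eta q n x * (1 / askey_pair q t x)) = t ^ n / qfac q n"
proof -
  have "(LINT x|mu_measure q 0 0. eta q n x * (1 / askey_pair q t x)) =
      (LINT x|mu_measure q 0 0. (1 / qfac q n) * (asc_poly q 0 0 n x / askey_pair q t x))"
    by (simp add: eta_def[OF q])
  also have "\<dots> = (1 / qfac q n) * (LINT x|mu_measure q 0 0. (asc_poly q 0 0 n x / askey_pair q t x))"
    by (rule integral_mult_right_zero)
  finally show ?thesis by (simp add: integral_hermite_inverse_pair[OF assms])
qed

lemma continuous_on_inverse_pair: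
  "\<bar>t\<bar> < 1 \<Longrightarrow> continuous_on {-1..1} (\<lambda>x. 1 / askey_pair q t x)"
  by (intro continuous_intros continuous_on_askey_pair[OF q]) (auto simp: askey_pair_nonzero)

text \<open>Expanding the factor of a by the generating function leaves the series of (ab)^n / (q;
  q)_n, which is Euler's reciprocal series.\<close>

lemma integral_inverse_pairs:
  assumes a: "\<bar>a\<bar> < 1" and b: "\<bar>b\<bar> < 1"
  shows "(LINT x|mu_measure q 0 0. 1 / (askey_pair q a x * askey_pair q b x)) = 1 / qinf q (a * b)"
proof -
  have "(\<lambda>n. a ^ n * (LINT x|mu_measure q 0 0. eta q n x * (1 / askey_pair q b x))) sums
      (LINT x|mu_measure q 0 0. (1 / askey_pair q b x) / askey_pair q a x)"
    by (intro sums_integral_inverse_pair a continuous_on_inverse_pair b)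
  hence "(\<lambda>n. 1 / qfac q n * (a * b) ^ n) sums (LINT x|mu_measure q 0 0. 1 / (askey_pair q a x * askey_pair q b x))"
    unfolding integral_eta_inverse_pair[OF b] by (simp add: power_mult_distrib mult.commute)
  moreover have "(\<lambda>n. 1 / qfac q n * (a * b) ^ n) sums (1 / qinf q (a * b))"
    using euler_inverse_sums[OF q, of "a * b"] abs_mult_less[OF a b] by (simp add: abs_mult)
  ultimately show ?thesis by (rule sums_unique2)
qed

text \<open>Expanding the numerator and integrating against the reciprocal denominator gives the
  series of \<open>pair_coeff q n c * b ^ n / qfac q n\<close>. Written as a double series over n
  and the index k of Ramanujan's function, its sum over n is Euler's series for (b c q^k; q)_inf,
  which leaves the series defining \<open>gauss_series\<close>.\<close>

lemma integral_pair_quotient: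
  assumes b: "\<bar>b\<bar> < 1"
  shows "(LINT x|mu_measure q 0 0. askey_pair q c x / askey_pair q b x) = gauss_series q (b * c) (c\<^sup>2)"
proof -
  let ?K = "(1 / qinf q q)\<^sup>2"
  have "(\<lambda>n. LINT x|mu_measure q 0 0. (pair_coeff q n c * eta q n x) * (1 / askey_pair q b x)) sums
      (LINT x|mu_measure q 0 0. askey_pair q c x * (1 / askey_pair q b x))"
  proof (rule sums_integral_mu)
    show "\<bar>pair_coeff q n c * eta q n x\<bar> \<le> \<bar>pair_coeff q n c * (?K * 2 ^ n)\<bar>" if "x \<in> {-1..1}" for n x
    proof -
      have "\<bar>eta q n x\<bar> \<le> \<bar>?K * 2 ^ n\<bar>" using abs_eta_le_exp[OF q that, of n] by simp
      thus ?thesis unfolding abs_mult[of "pair_coeff q n c"] by (rule mult_left_mono) simp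
    qed
    show "summable (\<lambda>n. \<bar>pair_coeff q n c * (?K * 2 ^ n)\<bar>)"
    proof -
      \<comment> \<open>Absolute summability follows from plain summability at the parameter - |c|,
        where all coefficients are nonnegative.\<close>
      have "summable (\<lambda>n. pair_coeff q n (- c) * (?K * 2 ^ n))" if "c \<ge> 0"
        by (rule summable_pair_coeff[OF q, where A = ?K]) simp
      moreover have "summable (\<lambda>n. pair_coeff q n c * (?K * 2 ^ n))" if "c \<le> 0"
        by (rule summable_pair_coeff[OF q, where A = ?K]) simp
      moreover have "\<bar>pair_coeff q n c\<bar> = pair_coeff q n (- \<bar>c\<bar>)" for n
        using q ramanujan_nonneg[OF q, of "c\<^sup>2 * q ^ n"] by (simp add: pair_coeff_def[OF q] abs_mult power_abs)
      ultimately show ?thesis by (cases "c \<ge> 0") (auto simp: abs_mult)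
    qed
  qed (auto intro!: continuous_intros continuous_on_eta[OF q] askey_pair_expansion[OF q] continuous_on_inverse_pair b)
  hence 1: "(\<lambda>n. pair_coeff q n c * (b ^ n / qfac q n)) sums (LINT x|mu_measure q 0 0. askey_pair q c x / askey_pair q b x)"
    unfolding mult.assoc integral_mult_right_zero integral_eta_inverse_pair[OF b] by simp
  let ?f = "\<lambda>n k. (euler_coeff q n * (b * c * q ^ k) ^ n) * (q ^ (2 * (k choose 2)) / qfac q k * (c\<^sup>2) ^ k)"
  have "(\<lambda>n. \<Sum>k. ?f n k) sums (\<Sum>k. \<Sum>n. ?f n k)"
  proof (rule suminf_swap_dominated)
    fix n k
    have "\<bar>b * c * q ^ k\<bar> \<le> \<bar>b * c\<bar> * 1"
      using q unfolding abs_mult[of "b * c"] by (intro mult_left_mono) (auto simp: power_le_one)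
    hence "\<bar>euler_coeff q n * (b * c * q ^ k) ^ n\<bar> \<le> \<bar>euler_coeff q n\<bar> * \<bar>b * c\<bar> ^ n"
      unfolding abs_mult[of "euler_coeff q n"] power_abs by (intro mult_left_mono power_mono) auto
    hence "\<bar>euler_coeff q n * (b * c * q ^ k) ^ n\<bar> * \<bar>q ^ (2 * (k choose 2)) / qfac q k * (c\<^sup>2) ^ k\<bar>
       \<le> (\<bar>euler_coeff q n\<bar> * \<bar>b * c\<bar> ^ n) * \<bar>q ^ (2 * (k choose 2)) / qfac q k * (c\<^sup>2) ^ k\<bar>"
      by (rule mult_right_mono) simp
    thus "\<bar>?f n k\<bar> \<le> (\<bar>euler_coeff q n\<bar> * \<bar>b * c\<bar> ^ n) * (q ^ (2 * (k choose 2)) / qfac q k * (c\<^sup>2) ^ k)"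
      using q unfolding abs_mult[of "euler_coeff q n * (b * c * q ^ k) ^ n"] by (simp add: abs_mult qfac_nonneg[OF q])
    show "summable (\<lambda>n. \<bar>euler_coeff q n\<bar> * \<bar>b * c\<bar> ^ n)" by (rule summable_abs_euler_coeff[OF q])
    show "summable (\<lambda>k. q ^ (2 * (k choose 2)) / qfac q k * (c\<^sup>2) ^ k)" by (rule summable_ramanujan[OF q])
  qed (use q in \<open>auto simp: qfac_nonneg[OF q]\<close>)
  moreover have "(\<Sum>n. ?f n k) = qinf q (b * c * q ^ k) * (q ^ (2 * (k choose 2)) / qfac q k * (c\<^sup>2) ^ k)" for k
    using euler_sums[OF q, of "b * c * q ^ k"] by (intro sums_unique[symmetric] sums_mult2) simp
  moreover have "(\<Sum>k. ?f n k) = pair_coeff q n c * (b ^ n / qfac q n)" for n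
  proof -
    have "?f n k = (- c) ^ n * q ^ (n choose 2) * (b ^ n / qfac q n) * (q ^ (2 * (k choose 2)) / qfac q k * (c\<^sup>2 * q ^ n) ^ k)" for k
    proof -
      have "(b * c * q ^ k) ^ n = b ^ n * c ^ n * (q ^ n) ^ k"
        by (simp add: power_mult_distrib mult.commute flip: power_mult)
      moreover have "(- c) ^ n = (- 1) ^ n * c ^ n" by (rule power_minus)
      ultimately show ?thesis by (simp add: euler_coeff_def[OF q] power_mult_distrib[of "c\<^sup>2"])
    qed
    hence "(\<Sum>k. ?f n k) = (- c) ^ n * q ^ (n choose 2) * (b ^ n / qfac q n) * ramanujan q (c\<^sup>2 * q ^ n)"
      unfolding ramanujan_def[OF q] by (simp only: suminf_mult[OF summable_ramanujan[OF q]])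
    thus ?thesis by (simp add: pair_coeff_def[OF q])
  qed
  ultimately have "(\<lambda>n. pair_coeff q n c * (b ^ n / qfac q n)) sums gauss_series q (b * c) (c\<^sup>2)"
    unfolding gauss_series_def[OF q] by (simp only:)
  thus ?thesis using 1 sums_unique2 by blast
qed

text \<open>Passing from a to aq multiplies the weight by 1 - 2 a x + a^2, so the Christoffel
  formula expresses the integral at (aq, n) through those at (a, n) and (a, n + 1). The induction is
  on n for all a at once. For the first step the total masses at a and aq differ exactly by the
  factor 1 - ab.\<close>

lemma integral_asc_inverse_pairs:
  assumes "a \<noteq> 0" "\<bar>a\<bar> < 1" and b: "\<bar>b\<bar> < 1"
  shows "(LINT x|mu_measure q 0 0. 1 / (askey_pair q a x * askey_pair q b x) * asc_poly q a b n x) =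
     (if n = 0 then 1 / qinf q (a * b) else 0)"
  using assms(1,2)
proof (induction n arbitrary: a)
  case 0
  thus ?case by (simp add: integral_inverse_pairs b)
next
  case (Suc n)
  let ?w = "\<lambda>a x. 1 / (askey_pair q a x * askey_pair q b x)"
  let ?I = "\<lambda>a n. LINT x|mu_measure q 0 0. ?w a x * asc_poly q a b n x"
  have "\<bar>a * q\<bar> \<le> \<bar>a\<bar> * 1" using q unfolding abs_mult by (intro mult_left_mono) auto
  hence aq: "a * q \<noteq> 0" "\<bar>a * q\<bar> < 1" using Suc.prems q by auto
  have alg: "w * (K * u - c * v) = K * (w * u) - c * (w * v)" for w K u c v :: real
    by (simp add: algebra_simps)
  have int: "integrable (mu_measure q 0 0) (\<lambda>x. ?w a x * asc_poly q a b n x)" for n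
    using Suc.prems b by (intro integrable_mu_continuous q continuous_intros continuous_on_askey_pair[OF q]) (auto simp: askey_pair_nonzero)
  have "?I (a * q) n = (LINT x|mu_measure q 0 0. (1 - a * b * q ^ n) * (?w a x * asc_poly q a b n x) - a * (?w a x * asc_poly q a b (Suc n) x))"
  proof (intro Bochner_Integration.integral_cong refl)
    fix x assume "x \<in> space (mu_measure q 0 0)"
    hence x: "x \<in> {-1..1}" by auto
    have T: "askey_pair q a x = (1 - 2 * a * x + a\<^sup>2) * askey_pair q (a * q) x" by (rule askey_pair_rec[OF q x])
    hence ne: "1 - 2 * a * x + a\<^sup>2 \<noteq> 0" using askey_pair_nonzero[OF Suc.prems(2), of x] by auto
    have "?w (a * q) x = ?w a x * (1 - 2 * a * x + a\<^sup>2)" unfolding T using ne by simp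
    hence "?w (a * q) x * asc_poly q (a * q) b n x = ?w a x * ((1 - 2 * a * x + a\<^sup>2) * asc_poly q (a * q) b n x)"
      by (simp only: mult.assoc)
    also have "\<dots> = (1 - a * b * q ^ n) * (?w a x * asc_poly q a b n x) - a * (?w a x * asc_poly q a b (Suc n) x)"
      unfolding asc_poly_christoffel by (rule alg)
    finally show "?w (a * q) x * asc_poly q (a * q) b n x = (1 - a * b * q ^ n) * (?w a x * asc_poly q a b n x) - a * (?w a x * asc_poly q a b (Suc n) x)" .
  qed
  also have "\<dots> = (1 - a * b * q ^ n) * ?I a n - a * ?I a (Suc n)"
    by (subst Bochner_Integration.integral_diff, (rule integrable_mult_right, rule int)+, simp only: integral_mult_right_zero)
  finally have eq: "a * ?I a (Suc n) = (1 - a * b * q ^ n) * ?I a n - ?I (a * q) n" by linarith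
  have "(1 - a * b * q ^ n) * ?I a n = ?I (a * q) n"
  proof (cases "n = 0")
    case True
    have "\<bar>a * b\<bar> < 1" using abs_mult_less[OF Suc.prems(2) b] by (simp add: abs_mult)
    hence "1 - a * b \<noteq> 0" by auto
    thus ?thesis
      unfolding Suc.IH[OF Suc.prems] Suc.IH[OF aq] using True qinf_rec[OF q, of "a * b"]
      by (simp add: mult_ac)
  next
    case False
    thus ?thesis unfolding Suc.IH[OF Suc.prems] Suc.IH[OF aq] by simp
  qed
  thus ?case using eq Suc.prems by simp
qed

text \<open>Passing from a to aq changes q/a to 1/a and thus prepends a factor to the numerator;
  multiplied by a^2 it is again 1 - 2 a x + a^2. The induction is the one of
  \<open>integral_asc_inverse_pairs\<close>, but the resulting combination is now evaluated by
  contiguous relations of \<open>gauss_series\<close>.\<close>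

lemma integral_asc_pair_quotient:
  assumes "a \<noteq> 0" and b: "\<bar>b\<bar> < 1"
  shows "(LINT x|mu_measure q 0 0. askey_pair q (q / a) x / askey_pair q b x * asc_poly q a b n x) =
     (- a) ^ n * q ^ (n choose 2) * gauss_series q (q * b / a) (q\<^sup>2 / (a\<^sup>2 * q ^ n))"
  using assms(1)
proof (induction n arbitrary: a)
  case 0
  show ?case using integral_pair_quotient[OF b, of "q / a"] by (simp add: power_divide mult.commute)
next
  case (Suc n)
  let ?w = "\<lambda>a x. askey_pair q (q / a) x / askey_pair q b x"
  let ?I = "\<lambda>a n. LINT x|mu_measure q 0 0. ?w a x * asc_poly q a b n x"
  have a0: "a \<noteq> 0" by fact
  have aq: "a * q \<noteq> 0" using a0 q by auto
  have alg: "w * (K * u - c * v) = K * (w * u) - c * (w * v)" for w K u c v :: real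
    by (simp add: algebra_simps)
  have int: "integrable (mu_measure q 0 0) (\<lambda>x. ?w a x * asc_poly q a b n x)" for n
    using b by (intro integrable_mu_continuous q continuous_intros continuous_on_askey_pair[OF q]) (auto simp: askey_pair_nonzero)
  have "a\<^sup>2 * ?I (a * q) n = (LINT x|mu_measure q 0 0. a\<^sup>2 * (?w (a * q) x * asc_poly q (a * q) b n x))"
    by (rule integral_mult_right_zero[symmetric])
  also have "\<dots> = (LINT x|mu_measure q 0 0. (1 - a * b * q ^ n) * (?w a x * asc_poly q a b n x) - a * (?w a x * asc_poly q a b (Suc n) x))"
  proof (intro Bochner_Integration.integral_cong refl)
    fix x assume "x \<in> space (mu_measure q 0 0)"
    hence x: "x \<in> {-1..1}" by auto
    have "askey_pair q (q / (a * q)) x = (1 - 2 * (1 / a) * x + (1 / a)\<^sup>2) * askey_pair q (q / a) x"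
      using askey_pair_rec[OF q x, of "1 / a"] q by simp
    hence "a\<^sup>2 * askey_pair q (q / (a * q)) x = (a\<^sup>2 * (1 - 2 * (1 / a) * x + (1 / a)\<^sup>2)) * askey_pair q (q / a) x"
      by (simp only: mult.assoc)
    also have "a\<^sup>2 * (1 - 2 * (1 / a) * x + (1 / a)\<^sup>2) = 1 - 2 * a * x + a\<^sup>2"
      using a0 by (simp add: field_simps power2_eq_square)
    finally have T: "a\<^sup>2 * askey_pair q (q / (a * q)) x = (1 - 2 * a * x + a\<^sup>2) * askey_pair q (q / a) x" .
    have "a\<^sup>2 * (?w (a * q) x * asc_poly q (a * q) b n x) = (a\<^sup>2 * askey_pair q (q / (a * q)) x) / askey_pair q b x * asc_poly q (a * q) b n x"
      by simp
    also have "\<dots> = ?w a x * ((1 - 2 * a * x + a\<^sup>2) * asc_poly q (a * q) b n x)"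
      unfolding T by (simp only: times_divide_eq_left times_divide_eq_right mult_ac)
    also have "\<dots> = (1 - a * b * q ^ n) * (?w a x * asc_poly q a b n x) - a * (?w a x * asc_poly q a b (Suc n) x)"
      unfolding asc_poly_christoffel by (rule alg)
    finally show "a\<^sup>2 * (?w (a * q) x * asc_poly q (a * q) b n x) = (1 - a * b * q ^ n) * (?w a x * asc_poly q a b n x) - a * (?w a x * asc_poly q a b (Suc n) x)" .
  qed
  also have "\<dots> = (1 - a * b * q ^ n) * ?I a n - a * ?I a (Suc n)"
    by (subst Bochner_Integration.integral_diff, (rule integrable_mult_right, rule int)+, simp only: integral_mult_right_zero)
  finally have eq: "a * ?I a (Suc n) = (1 - a * b * q ^ n) * ?I a n - a\<^sup>2 * ?I (a * q) n" by linarith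
  define \<beta> where "\<beta> = q * b / a"
  define y where "y = q\<^sup>2 / (a\<^sup>2 * q ^ n)"
  let ?G = "gauss_series q"
  have y0: "y \<noteq> 0" using a0 q by (simp add: y_def)
  have IH1: "?I a n = (- a) ^ n * q ^ (n choose 2) * ?G \<beta> y"
    unfolding \<beta>_def y_def by (rule Suc.IH[OF a0])
  have IH2: "?I (a * q) n = (- a) ^ n * q ^ (n choose 2) * q ^ n * ?G (\<beta> / q) (y / q\<^sup>2)"
  proof -
    have "q * b / (a * q) = \<beta> / q" "q\<^sup>2 / ((a * q)\<^sup>2 * q ^ n) = y / q\<^sup>2" "(- (a * q)) ^ n = (- a) ^ n * q ^ n"
      using q a0 by (simp_all add: \<beta>_def y_def power_mult_distrib flip: power_mult_distrib[of "- a" q])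
    thus ?thesis using Suc.IH[OF aq] by (simp add: mult_ac)
  qed
  have r1: "?G (\<beta> / q) (y / q\<^sup>2) = ?G \<beta> (y / q\<^sup>2) - \<beta> / q * ?G \<beta> (y / q)"
    using gauss_series_shift[OF q, of "\<beta> / q" "y / q\<^sup>2"] q by (simp add: power2_eq_square)
  have r2: "?G \<beta> (y / q\<^sup>2) = ?G \<beta> (y / q) + y / q\<^sup>2 * ?G (\<beta> * q) y"
    using gauss_series_diff[OF q, of \<beta> "y / q\<^sup>2"] q by (simp add: power2_eq_square)
  have r3: "?G \<beta> (y / q) = ?G \<beta> y + y / q * ?G (\<beta> * q) (y * q)"
    using gauss_series_diff[OF q, of \<beta> "y / q"] q by (simp add: power2_eq_square)
  have r4: "?G \<beta> y = ?G (\<beta> * q) y - \<beta> * ?G (\<beta> * q) (y * q)" by (rule gauss_series_shift[OF q])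
  have c1: "a * b * q ^ n = \<beta> * q / y" "a\<^sup>2 * q ^ n = q\<^sup>2 / y"
    using a0 q by (simp_all add: \<beta>_def y_def field_simps power2_eq_square)
  \<comment> \<open>This relation makes the two induction hypotheses combine to a single value at y
    / q. The parameter \<beta> / q is removed by r1, the arguments are raised to y and y q by r2 and
    r3 at the cost of the parameter \<beta> q, and r4 recombines those terms.\<close>
  have key: "(1 - \<beta> * q / y) * ?G \<beta> y - q\<^sup>2 / y * ?G (\<beta> / q) (y / q\<^sup>2) = - (q\<^sup>2 / y) * ?G \<beta> (y / q)"
  proof -
    have "q\<^sup>2 / y * (?G (\<beta> / q) (y / q\<^sup>2) - ?G \<beta> (y / q)) = ?G (\<beta> * q) y - \<beta> * q / y * ?G \<beta> (y / q)"
      unfolding r1 r2 using y0 q by (simp add: field_simps power2_eq_square)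
    also have "\<dots> = ?G (\<beta> * q) y - \<beta> * ?G (\<beta> * q) (y * q) - \<beta> * q / y * ?G \<beta> y"
      unfolding r3 using y0 q by (simp add: field_simps)
    also have "\<dots> = (1 - \<beta> * q / y) * ?G \<beta> y"
      unfolding r4[symmetric] by (simp add: algebra_simps)
    finally show ?thesis by (simp add: algebra_simps)
  qed
  have "a * ?I a (Suc n) = (- a) ^ n * q ^ (n choose 2) * ((1 - \<beta> * q / y) * ?G \<beta> y - (a\<^sup>2 * q ^ n) * ?G (\<beta> / q) (y / q\<^sup>2))"
    unfolding eq IH1 IH2 c1(1)[symmetric] by (simp add: algebra_simps)
  also have "\<dots> = (- a) ^ n * q ^ (n choose 2) * (- (a\<^sup>2 * q ^ n) * ?G \<beta> (y / q))"
    unfolding c1 key ..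
  also have "\<dots> = a * ((- a) ^ Suc n * q ^ (Suc n choose 2) * ?G \<beta> (y / q))"
    by (simp add: Suc_choose_2 power_add power2_eq_square mult_ac)
  finally have "?I a (Suc n) = (- a) ^ Suc n * q ^ (Suc n choose 2) * ?G \<beta> (y / q)"
    using a0 by (simp only: mult_cancel_left) simp
  moreover have "y / q = q\<^sup>2 / (a\<^sup>2 * q ^ Suc n)" by (simp add: y_def mult_ac)
  ultimately show ?case by (simp only: \<beta>_def)
qed

lemma asc_orthogonal:
  assumes a: "a \<noteq> 0" "\<bar>a\<bar> < 1" and b: "\<bar>b\<bar> < 1"
  shows "(LINT x|mu_measure q a b. asc_poly q a b m x * asc_poly q a b n x) =
    (if m = n then qpoch [q, a * b] q n else 0)"
proof -
  define p where "p = (\<lambda>n. qfac q n * (\<Prod>j<n. 1 - a * b * q ^ j))"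
  let ?G = "\<lambda>m n. if m = n then p n / qinf q (a * b) else 0"
  have pS: "p (Suc n) = (1 - q ^ Suc n) * (1 - a * b * q ^ n) * p n" for n
    by (simp add: p_def qfac_Suc mult_ac)
  have ab: "\<bar>a * b\<bar> < 1" using abs_mult_less[OF a(2) b] by (simp add: abs_mult)
  have "(LINT x|mu_measure q 0 0. 1 / (askey_pair q a x * askey_pair q b x) * (asc_poly q a b m x * asc_poly q a b n x)) = ?G m n"
  proof (rule asc_gram_unique[OF q])
    show "continuous_on {-1..1} (\<lambda>x. 1 / (askey_pair q a x * askey_pair q b x))"
      using a b by (intro continuous_intros continuous_on_askey_pair[OF q]) (auto simp: askey_pair_nonzero)
    fix m n
    show "?G (Suc m) n + (a + b) * q ^ m * ?G m n + (1 - q ^ m) * (1 - a * b * q ^ (m - 1)) * ?G (m - 1) n =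
      ?G m (Suc n) + (a + b) * q ^ n * ?G m n + (1 - q ^ n) * (1 - a * b * q ^ (n - 1)) * ?G m (n - 1)"
      by (cases m; cases n) (auto simp: pS mult_ac)
    show "(LINT x|mu_measure q 0 0. 1 / (askey_pair q a x * askey_pair q b x) * asc_poly q a b n x) = ?G 0 n"
      by (subst integral_asc_inverse_pairs[OF a b]) (simp add: p_def)
  qed
  moreover have "(LINT x|mu_measure q a b. asc_poly q a b m x * asc_poly q a b n x) =
     qinf q (a * b) * (LINT x|mu_measure q 0 0. (asc_poly q a b m x * asc_poly q a b n x) / (askey_pair q a x * askey_pair q b x))"
    by (intro integral_mu_eq_hermite q a b continuous_intros)
  ultimately show ?thesis
    using qinf_nonzero[OF q, of "a * b"] ab by (simp add: p_def qpoch_def qfac_def)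
qed

text \<open>Apart from powers of q, the claimed entry depends on m and n only through m + n. The
  symmetric recurrence therefore involves \<open>gauss_series\<close> at three arguments y / q, y
  and y q only, and follows from one three-term relation between them.\<close>

lemma asc_pair_quotient_matrix:
  assumes a: "a \<noteq> 0" and b: "\<bar>b\<bar> < 1"
  shows "(LINT x|mu_measure q 0 0. askey_pair q (q / a) x / askey_pair q b x * (asc_poly q a b m x * asc_poly q a b n x)) =
    (- a) ^ (m + n) * q ^ ((m choose 2) + (n choose 2)) * gauss_series q (q * b / a) (q\<^sup>2 / (a\<^sup>2 * q ^ (m + n)))"
    (is "_ = ?G m n")
proof (rule asc_gram_unique[OF q])
  show "continuous_on {-1..1} (\<lambda>x. askey_pair q (q / a) x / askey_pair q b x)"
    using b by (intro continuous_intros continuous_on_askey_pair[OF q]) (auto simp: askey_pair_nonzero)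
  show "(LINT x|mu_measure q 0 0. askey_pair q (q / a) x / askey_pair q b x * asc_poly q a b n x) = ?G 0 n" for n
    using integral_asc_pair_quotient[OF a b, of n] by simp
  fix m n
  show "?G (Suc m) n + (a + b) * q ^ m * ?G m n + (1 - q ^ m) * (1 - a * b * q ^ (m - 1)) * ?G (m - 1) n =
      ?G m (Suc n) + (a + b) * q ^ n * ?G m n + (1 - q ^ n) * (1 - a * b * q ^ (n - 1)) * ?G m (n - 1)"
  proof (cases "m + n = 0")
    case False
    define N where "N = m + n - 1"
    have N: "m + n = Suc N" using False by (simp add: N_def)
    define \<beta> where "\<beta> = q * b / a"
    define y where "y = q\<^sup>2 / (a\<^sup>2 * q ^ (m + n))"
    define A where "A = (- a) ^ N * q ^ ((m choose 2) + (n choose 2))"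
    let ?S = "gauss_series q \<beta>"
    have q0: "q \<noteq> 0" using q by simp
    have yS: "q\<^sup>2 / (a\<^sup>2 * q ^ (Suc (m + n))) = y / q" by (simp add: y_def mult_ac)
    have yP: "q\<^sup>2 / (a\<^sup>2 * q ^ N) = y * q" using q0 by (simp add: y_def N)
    have down: "(1 - q ^ k) * (1 - a * b * q ^ (k - 1)) * ((- a) ^ (k - 1 + l) * q ^ ((k - 1 choose 2) + (l choose 2)) * gauss_series q (q * b / a) (q\<^sup>2 / (a\<^sup>2 * q ^ (k - 1 + l))))
       = A * ((1 - q ^ k) * (q / q ^ k - a * b) * ?S (y * q))"
      if "k + l = m + n" "(k choose 2) + (l choose 2) = (m choose 2) + (n choose 2)" for k l
    proof (cases k)
      case (Suc i)
      have il: "k - 1 + l = N" using that(1) Suc by (simp add: N_def)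
      have "q ^ ((m choose 2) + (n choose 2)) = q ^ i * q ^ ((i choose 2) + (l choose 2))"
        unfolding that(2)[symmetric] by (simp add: Suc Suc_choose_2 power_add)
      hence "A * (q / q ^ k - a * b) = (- a) ^ N * q ^ ((i choose 2) + (l choose 2)) * (1 - a * b * q ^ i)"
        using q0 unfolding A_def by (simp add: Suc field_simps)
      thus ?thesis unfolding il yP \<beta>_def[symmetric] using Suc by (simp add: mult_ac)
    qed simp
    have up: "(- a) ^ (Suc (m + n)) * q ^ ((Suc k choose 2) + (l choose 2)) * gauss_series q (q * b / a) (q\<^sup>2 / (a\<^sup>2 * q ^ (Suc (m + n))))
       = A * (a\<^sup>2 * q ^ k * ?S (y / q))"
      if "(k choose 2) + (l choose 2) = (m choose 2) + (n choose 2)" for k l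
    proof -
      have "q ^ ((Suc k choose 2) + (l choose 2)) = q ^ k * q ^ ((m choose 2) + (n choose 2))"
        unfolding that[symmetric] by (simp add: Suc_choose_2 power_add)
      moreover have "(- a) ^ Suc (m + n) = (- a) ^ N * a\<^sup>2" by (simp add: N power2_eq_square mult_ac)
      ultimately show ?thesis unfolding yS \<beta>_def[symmetric] A_def by (simp only: mult_ac)
    qed
    have mid: "?G m n = - a * A * ?S y" unfolding A_def \<beta>_def y_def N by simp
    \<comment> \<open>The three-term relation in the argument: eliminate the parameter \<beta> q
      from two instances of \<open>gauss_series_diff\<close> and one of
      \<open>gauss_series_shift\<close>.\<close>
    have rel: "a\<^sup>2 * ?S (y / q) = a * (a + b) * ?S y - (a * b - q / (q ^ m * q ^ n)) * ?S (y * q)"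
    proof -
      have r1: "?S (y / q) - ?S y = y / q * gauss_series q (\<beta> * q) (y * q)"
        using gauss_series_diff[OF q, of \<beta> "y / q"] q0 by (simp add: power2_eq_square)
      have r2: "?S y - ?S (y * q) = y * gauss_series q (\<beta> * q) (y * q\<^sup>2)" by (rule gauss_series_diff[OF q])
      have r3: "?S (y * q) = gauss_series q (\<beta> * q) (y * q) - \<beta> * gauss_series q (\<beta> * q) (y * q\<^sup>2)"
        using gauss_series_shift[OF q, of \<beta> "y * q"] by (simp add: power2_eq_square mult.assoc)
      have "?S (y / q) - ?S y = \<beta> / q * (?S y - ?S (y * q)) + y / q * ?S (y * q)"
        unfolding r1 r2 unfolding r3 using q0 by (simp add: field_simps)
      moreover have "a\<^sup>2 * (\<beta> / q) = a * b" "a\<^sup>2 * (y / q) = q / (q ^ m * q ^ n)"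
        using q0 a by (simp_all add: \<beta>_def y_def power_add power2_eq_square field_simps)
      ultimately have "a\<^sup>2 * (?S (y / q) - ?S y) = a * b * (?S y - ?S (y * q)) + q / (q ^ m * q ^ n) * ?S (y * q)"
        by (metis distrib_left mult.assoc)
      thus ?thesis by (simp add: algebra_simps power2_eq_square)
    qed
    have GS: "?G (Suc m) n = A * (a\<^sup>2 * q ^ m * ?S (y / q))" using up[of m n] by simp
    have GS': "?G m (Suc n) = A * (a\<^sup>2 * q ^ n * ?S (y / q))" using up[of n m] by (simp add: add.commute)
    have GP: "(1 - q ^ m) * (1 - a * b * q ^ (m - 1)) * ?G (m - 1) n = A * ((1 - q ^ m) * (q / q ^ m - a * b) * ?S (y * q))"
      by (rule down) auto
    have GP': "(1 - q ^ n) * (1 - a * b * q ^ (n - 1)) * ?G m (n - 1) = A * ((1 - q ^ n) * (q / q ^ n - a * b) * ?S (y * q))"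
      using down[of n m] by (simp add: add.commute)
    \<comment> \<open>With M = q^m and L = q^n this is one side of the recurrence. After
      \<open>rel\<close> has removed the value at y / q, the result is symmetric in M and L, so the
      side with m and n exchanged has the same value.\<close>
    have id: "A * (a\<^sup>2 * M * P) + (a + b) * M * (- a * A * S) + A * ((1 - M) * (q / M - a * b) * T)
       = A * ((q / M + q / L - a * b - q) * T)"
      if "M \<noteq> 0" "L \<noteq> 0" "a\<^sup>2 * P = a * (a + b) * S - (a * b - q / (M * L)) * T" for M L P S T
    proof -
      define U V W where "U = q / M" and "V = q / L" and "W = q / (M * L)"
      have "M * U = q" "M * W = V" using that(1,2) by (simp_all add: U_def V_def W_def)
      have "a\<^sup>2 * P = a * (a + b) * S - (a * b - W) * T" unfolding W_def by (rule that(3))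
      hence "A * M * (a\<^sup>2 * P) = A * M * (a * (a + b) * S - (a * b - W) * T)" by (rule arg_cong)
      also have "\<dots> = A * (M * (a * (a + b) * S) - a * b * M * T + (M * W) * T)"
        by (simp add: algebra_simps)
      finally have "A * (a\<^sup>2 * M * P) = A * (M * (a * (a + b) * S) - a * b * M * T + V * T)"
        unfolding \<open>M * W = V\<close> by (simp add: mult_ac)
      moreover have "A * ((1 - M) * (U - a * b) * T) = A * ((U - a * b - q + a * b * M) * T)"
        using \<open>M * U = q\<close> by (simp add: algebra_simps)
      ultimately show ?thesis unfolding U_def[symmetric] V_def[symmetric] by (simp add: algebra_simps)
    qed
    have rel': "a\<^sup>2 * ?S (y / q) = a * (a + b) * ?S y - (a * b - q / (q ^ n * q ^ m)) * ?S (y * q)"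
      using rel by (simp only: mult.commute)
    have nz: "q ^ m \<noteq> 0" "q ^ n \<noteq> 0" using q0 by auto
    show ?thesis
      unfolding GS GS' GP GP' mid id[OF nz rel] id[OF nz(2,1) rel'] by (simp only: add.commute)
  qed simp
qed

end

section \<open>Complex L2 spaces\<close>

lemma L2D: "f \<in> L2 M \<Longrightarrow> f \<in> borel_measurable M" "f \<in> L2 M \<Longrightarrow> integrable M (\<lambda>x. (cmod (f x))\<^sup>2)"
  by (auto simp: L2_def)

lemma borel_measurable_cnj': "f \<in> borel_measurable M \<Longrightarrow> (\<lambda>x. cnj (f x)) \<in> borel_measurable M"
  by (rule borel_measurable_continuous_on[where f = cnj]) (intro continuous_intros)

lemma cmod_add_sq_le: "(cmod (a + b))\<^sup>2 \<le> 2 * (cmod a)\<^sup>2 + 2 * (cmod b)\<^sup>2"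
proof -
  have "(cmod (a + b))\<^sup>2 \<le> (cmod a + cmod b)\<^sup>2" by (intro power_mono norm_triangle_ineq) auto
  moreover have "0 \<le> (cmod a - cmod b)\<^sup>2" by simp
  ultimately show ?thesis by (simp add: power2_eq_square algebra_simps)
qed

lemma L2_zero [simp]: "(\<lambda>x. 0) \<in> L2 M"
  by (simp add: L2_def)

lemma L2_add: assumes "f \<in> L2 M" "g \<in> L2 M" shows "(\<lambda>x. f x + g x) \<in> L2 M"
proof -
  have [measurable]: "f \<in> borel_measurable M" "g \<in> borel_measurable M" using assms by (auto simp: L2D)
  have "integrable M (\<lambda>x. 2 * (cmod (f x))\<^sup>2 + 2 * (cmod (g x))\<^sup>2)"
    using assms by (intro Bochner_Integration.integrable_add integrable_mult_right L2D)
  hence "integrable M (\<lambda>x. (cmod (f x + g x))\<^sup>2)"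
    by (rule Bochner_Integration.integrable_bound) (auto intro!: AE_I2 order_trans[OF cmod_add_sq_le])
  thus ?thesis by (simp add: L2_def)
qed

lemma L2_scale: assumes "f \<in> L2 M" shows "(\<lambda>x. c * f x) \<in> L2 M"
  using assms by (auto simp: L2_def norm_mult power_mult_distrib)

lemma L2_minus: assumes "f \<in> L2 M" "g \<in> L2 M" shows "(\<lambda>x. f x - g x) \<in> L2 M"
  using L2_add[OF assms(1) L2_scale[OF assms(2), of "- 1"]] by simp

lemma L2_sum: "(\<And>i. i \<in> I \<Longrightarrow> f i \<in> L2 M) \<Longrightarrow> (\<lambda>x. \<Sum>i\<in>I. f i x) \<in> L2 M"
  by (induction I rule: infinite_finite_induct) (auto intro: L2_add)

lemma L2_mult_bounded:
  assumes f: "f \<in> L2 M" and g: "g \<in> borel_measurable M" and B: "AE x in M. cmod (g x) \<le> B"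
  shows "(\<lambda>x. g x * f x) \<in> L2 M"
proof -
  have [measurable]: "f \<in> borel_measurable M" "g \<in> borel_measurable M" using f g by (auto simp: L2D)
  have i: "integrable M (\<lambda>x. B\<^sup>2 * (cmod (f x))\<^sup>2)" using f by (intro integrable_mult_right L2D)
  have m: "(\<lambda>x. (cmod (g x * f x))\<^sup>2) \<in> borel_measurable M" by measurable
  have "AE x in M. norm ((cmod (g x * f x))\<^sup>2) \<le> norm (B\<^sup>2 * (cmod (f x))\<^sup>2)"
    using B
  proof eventually_elim
    case (elim x)
    hence "(cmod (g x))\<^sup>2 \<le> B\<^sup>2" by (intro power_mono) auto
    thus ?case by (simp add: norm_mult power_mult_distrib mult_right_mono)
  qed
  from Bochner_Integration.integrable_bound[OF i m this] show ?thesis by (simp add: L2_def)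
qed

lemma L2_inner_integrable:
  assumes "f \<in> L2 M" "g \<in> L2 M" shows "integrable M (\<lambda>x. cnj (f x) * g x)"
proof -
  have [measurable]: "f \<in> borel_measurable M" "g \<in> borel_measurable M" using assms by (auto simp: L2D)
  have "integrable M (\<lambda>x. (cmod (f x))\<^sup>2 + (cmod (g x))\<^sup>2)"
    using assms by (intro Bochner_Integration.integrable_add L2D)
  thus ?thesis
  proof (rule Bochner_Integration.integrable_bound)
    show "AE x in M. norm (cnj (f x) * g x) \<le> norm ((cmod (f x))\<^sup>2 + (cmod (g x))\<^sup>2)"
    proof (rule AE_I2)
      fix x
      have "0 \<le> (cmod (f x) - cmod (g x))\<^sup>2" by simp
      hence "2 * (cmod (f x) * cmod (g x)) \<le> (cmod (f x))\<^sup>2 + (cmod (g x))\<^sup>2"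
        by (simp add: power2_eq_square algebra_simps)
      moreover have "0 \<le> cmod (f x) * cmod (g x)" by simp
      ultimately have "cmod (f x) * cmod (g x) \<le> (cmod (f x))\<^sup>2 + (cmod (g x))\<^sup>2" by linarith
      thus "norm (cnj (f x) * g x) \<le> norm ((cmod (f x))\<^sup>2 + (cmod (g x))\<^sup>2)"
        by (simp add: norm_mult)
    qed
  qed (intro borel_measurable_times borel_measurable_cnj' L2D assms)
qed

lemma L2_inner_add_right:
  "f \<in> L2 M \<Longrightarrow> g \<in> L2 M \<Longrightarrow> h \<in> L2 M \<Longrightarrow> L2_inner M f (\<lambda>x. g x + h x) = L2_inner M f g + L2_inner M f h"
  unfolding L2_inner_def
  by (simp add: distrib_left Bochner_Integration.integral_add L2_inner_integrable)

lemma L2_inner_diff_right: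
  "f \<in> L2 M \<Longrightarrow> g \<in> L2 M \<Longrightarrow> h \<in> L2 M \<Longrightarrow> L2_inner M f (\<lambda>x. g x - h x) = L2_inner M f g - L2_inner M f h"
  unfolding L2_inner_def
  by (simp add: right_diff_distrib Bochner_Integration.integral_diff L2_inner_integrable)

lemma L2_inner_scale_right: "L2_inner M f (\<lambda>x. c * g x) = c * L2_inner M f g"
  unfolding L2_inner_def by (simp add: mult.left_commute)

lemma L2_inner_cnj: "cnj (L2_inner M f g) = L2_inner M g f"
  unfolding L2_inner_def by (subst Bochner_Integration.integral_cnj[symmetric]) (simp add: mult.commute)

lemma L2_inner_sum_right:
  assumes "f \<in> L2 M" "\<And>i. i \<in> I \<Longrightarrow> g i \<in> L2 M"
  shows "L2_inner M f (\<lambda>x. \<Sum>i\<in>I. g i x) = (\<Sum>i\<in>I. L2_inner M f (g i))"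
  using assms(2)
proof (induction I rule: infinite_finite_induct)
  case (insert i I)
  have "L2_inner M f (\<lambda>x. \<Sum>i\<in>insert i I. g i x) = L2_inner M f (\<lambda>x. g i x + (\<Sum>i\<in>I. g i x))"
    using insert.hyps by simp
  also have "\<dots> = L2_inner M f (g i) + L2_inner M f (\<lambda>x. \<Sum>i\<in>I. g i x)"
    using insert.prems by (intro L2_inner_add_right assms(1) L2_sum) auto
  finally show ?case using insert by simp
qed (simp_all add: L2_inner_def)

lemma L2_inner_add_left:
  "f \<in> L2 M \<Longrightarrow> g \<in> L2 M \<Longrightarrow> h \<in> L2 M \<Longrightarrow> L2_inner M (\<lambda>x. g x + h x) f = L2_inner M g f + L2_inner M h f"
  by (subst (1 2 3) L2_inner_cnj[symmetric]) (simp only: L2_inner_add_right complex_cnj_add)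

lemma L2_norm_nonneg [simp]: "0 \<le> L2_norm M f"
  by (simp add: L2_norm_def)

lemma L2_norm_sq: "(L2_norm M f)\<^sup>2 = (LINT x|M. (cmod (f x))\<^sup>2)"
  by (simp add: L2_norm_def)

lemma L2_inner_self: "L2_inner M f f = of_real ((L2_norm M f)\<^sup>2)"
  unfolding L2_norm_sq L2_inner_def integral_complex_of_real[symmetric]
  by (simp only: complex_norm_square mult.commute)

lemma L2_norm_eq_0_iff:
  assumes "f \<in> L2 M" shows "L2_norm M f = 0 \<longleftrightarrow> (AE x in M. f x = 0)"
proof -
  have "L2_norm M f = 0 \<longleftrightarrow> (LINT x|M. (cmod (f x))\<^sup>2) = 0" by (simp add: L2_norm_def)
  also have "\<dots> \<longleftrightarrow> (AE x in M. (cmod (f x))\<^sup>2 = 0)"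
    by (rule integral_nonneg_eq_0_iff_AE) (auto intro: L2D assms)
  finally show ?thesis by simp
qed

lemma L2_norm_cong_AE:
  assumes "f \<in> L2 M" "g \<in> L2 M" "AE x in M. f x = g x" shows "L2_norm M f = L2_norm M g"
proof -
  have [measurable]: "f \<in> borel_measurable M" "g \<in> borel_measurable M" using assms by (auto simp: L2D)
  have "(LINT x|M. (cmod (f x))\<^sup>2) = (LINT x|M. (cmod (g x))\<^sup>2)"
    using assms(3) by (intro integral_cong_AE) auto
  thus ?thesis by (simp add: L2_norm_def)
qed

lemma L2_inner_cong_AE:
  assumes "f \<in> L2 M" "g \<in> L2 M" "h \<in> L2 M" "AE x in M. g x = h x" shows "L2_inner M f g = L2_inner M f h"
proof -
  have [measurable]: "f \<in> borel_measurable M" "g \<in> borel_measurable M" "h \<in> borel_measurable M" using assms by (auto simp: L2D)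
  show ?thesis unfolding L2_inner_def
    using assms(4) by (intro integral_cong_AE borel_measurable_times borel_measurable_cnj' L2D assms) auto
qed

lemma L2_norm_scale: "L2_norm M (\<lambda>x. c * f x) = cmod c * L2_norm M f"
  by (simp add: L2_norm_def norm_mult power_mult_distrib real_sqrt_mult)

lemma L2_norm_add_sq:
  assumes "f \<in> L2 M" "g \<in> L2 M"
  shows "(L2_norm M (\<lambda>x. f x + g x))\<^sup>2 = (L2_norm M f)\<^sup>2 + (L2_norm M g)\<^sup>2 + 2 * Re (L2_inner M f g)"
proof -
  have "complex_of_real ((L2_norm M (\<lambda>x. f x + g x))\<^sup>2) = L2_inner M f f + L2_inner M f g + (L2_inner M g f + L2_inner M g g)"
    unfolding L2_inner_self[symmetric] using assms by (simp add: L2_inner_add_left L2_inner_add_right L2_add)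
  also have "L2_inner M g f = cnj (L2_inner M f g)" by (simp add: L2_inner_cnj)
  finally have "Re (of_real ((L2_norm M (\<lambda>x. f x + g x))\<^sup>2)) = Re (L2_inner M f f + L2_inner M f g + (cnj (L2_inner M f g) + L2_inner M g g))"
    by (rule arg_cong)
  thus ?thesis unfolding L2_inner_self by simp
qed

lemma L2_Cauchy_Schwarz:
  assumes f: "f \<in> L2 M" and g: "g \<in> L2 M"
  shows "cmod (L2_inner M f g) \<le> L2_norm M f * L2_norm M g"
proof (cases "L2_norm M f = 0")
  case True
  hence "AE x in M. f x = 0" using f by (simp add: L2_norm_eq_0_iff)
  hence "L2_inner M g f = L2_inner M g (\<lambda>x. 0)" by (intro L2_inner_cong_AE f g) auto
  hence "L2_inner M g f = 0" by (simp add: L2_inner_def)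
  hence "L2_inner M f g = 0" by (metis L2_inner_cnj complex_cnj_zero)
  thus ?thesis by simp
next
  case False
  hence pos: "0 < (L2_norm M f)\<^sup>2" by simp
  \<comment> \<open>The coefficient making g + c f orthogonal to f; the norm of this combination is
    the smallest possible.\<close>
  define c where "c = - L2_inner M f g / of_real ((L2_norm M f)\<^sup>2)"
  have "0 \<le> (L2_norm M (\<lambda>x. g x + c * f x))\<^sup>2" by simp
  also have "\<dots> = (L2_norm M g)\<^sup>2 + (cmod c)\<^sup>2 * (L2_norm M f)\<^sup>2 + 2 * Re (c * L2_inner M g f)"
    using f g by (subst L2_norm_add_sq) (auto simp: L2_scale L2_norm_scale L2_inner_scale_right power_mult_distrib)
  also have "c * L2_inner M g f = - of_real ((cmod (L2_inner M f g))\<^sup>2 / (L2_norm M f)\<^sup>2)"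
  proof -
    have "c * cnj (L2_inner M f g) = - ((L2_inner M f g * cnj (L2_inner M f g)) / of_real ((L2_norm M f)\<^sup>2))"
      by (simp add: c_def)
    also have "L2_inner M f g * cnj (L2_inner M f g) = of_real ((cmod (L2_inner M f g))\<^sup>2)"
      by (rule complex_norm_square[symmetric])
    finally show ?thesis by (simp only: of_real_divide of_real_minus L2_inner_cnj)
  qed
  also have "(cmod c)\<^sup>2 * (L2_norm M f)\<^sup>2 = (cmod (L2_inner M f g))\<^sup>2 / (L2_norm M f)\<^sup>2"
  proof -
    have "cmod c = cmod (L2_inner M f g) / (L2_norm M f)\<^sup>2"
      unfolding c_def norm_divide norm_minus_cancel norm_of_real by simp
    thus ?thesis using pos by (simp add: power_divide power2_eq_square)
  qed
  finally have "(cmod (L2_inner M f g))\<^sup>2 / (L2_norm M f)\<^sup>2 \<le> (L2_norm M g)\<^sup>2" by simp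
  hence "(cmod (L2_inner M f g))\<^sup>2 \<le> (L2_norm M f * L2_norm M g)\<^sup>2"
    using pos by (simp add: field_simps power_mult_distrib)
  thus ?thesis by (rule power2_le_imp_le) simp
qed

lemma L2_norm_triangle:
  assumes f: "f \<in> L2 M" and g: "g \<in> L2 M"
  shows "L2_norm M (\<lambda>x. f x + g x) \<le> L2_norm M f + L2_norm M g"
proof (rule power2_le_imp_le)
  have "Re (L2_inner M f g) \<le> L2_norm M f * L2_norm M g"
    using L2_Cauchy_Schwarz[OF f g] complex_Re_le_cmod order_trans by blast
  thus "(L2_norm M (\<lambda>x. f x + g x))\<^sup>2 \<le> (L2_norm M f + L2_norm M g)\<^sup>2"
    unfolding L2_norm_add_sq[OF f g] by (simp add: power2_eq_square algebra_simps)
qed simp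

lemma L2_norm_minus_commute: "L2_norm M (\<lambda>x. f x - g x) = L2_norm M (\<lambda>x. g x - f x)"
  by (simp add: L2_norm_def norm_minus_commute)

lemma L2_norm_triangle3:
  assumes "f \<in> L2 M" "g \<in> L2 M" "h \<in> L2 M"
  shows "L2_norm M (\<lambda>x. f x - h x) \<le> L2_norm M (\<lambda>x. f x - g x) + L2_norm M (\<lambda>x. g x - h x)"
  using L2_norm_triangle[OF L2_minus[OF assms(1,2)] L2_minus[OF assms(2,3)]] by simp

lemma (in finite_measure) L2_const: "(\<lambda>x. c) \<in> L2 M"
  by (simp add: L2_def)

lemma (in finite_measure) L2_imp_integral_norm_le:
  assumes f: "f \<in> L2 M"
  shows "integrable M f" and "(LINT x|M. cmod (f x)) \<le> sqrt (measure M (space M)) * L2_norm M f"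
proof -
  have [measurable]: "f \<in> borel_measurable M" using f by (auto simp: L2D)
  have g: "(\<lambda>x. of_real (cmod (f x))) \<in> L2 M" using f by (auto simp: L2_def)
  have "integrable M (\<lambda>x. cnj 1 * (of_real (cmod (f x))))"
    by (rule L2_inner_integrable[OF L2_const g])
  hence "integrable M (\<lambda>x. norm (complex_of_real (cmod (f x))))" by (intro integrable_norm) simp
  hence "integrable M (\<lambda>x. cmod (f x))" by simp
  thus "integrable M f" by (subst (asm) integrable_norm_iff) auto
  have "of_real (LINT x|M. cmod (f x)) = L2_inner M (\<lambda>x. 1) (\<lambda>x. of_real (cmod (f x)))"
    by (simp add: L2_inner_def integral_complex_of_real)
  hence "\<bar>LINT x|M. cmod (f x)\<bar> = cmod (L2_inner M (\<lambda>x. 1) (\<lambda>x. of_real (cmod (f x))))"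
    by (metis norm_of_real)
  also have "\<dots> \<le> L2_norm M (\<lambda>x. 1) * L2_norm M (\<lambda>x. of_real (cmod (f x)))"
    by (intro L2_Cauchy_Schwarz L2_const g)
  finally show "(LINT x|M. cmod (f x)) \<le> sqrt (measure M (space M)) * L2_norm M f"
    by (simp add: L2_norm_def)
qed

text \<open>The Riesz--Fischer theorem: a fast subsequence converges almost everywhere, and Fatou's lemma identifies the limit.\<close>

lemma (in finite_measure) L2_complete:
  assumes s: "\<And>n. s n \<in> L2 M"
    and Cauchy: "\<And>\<epsilon>. \<epsilon> > 0 \<Longrightarrow> \<exists>N. \<forall>m\<ge>N. \<forall>n\<ge>N. L2_norm M (\<lambda>x. s m x - s n x) < \<epsilon>"
  shows "\<exists>f\<in>L2 M. (\<lambda>n. L2_norm M (\<lambda>x. s n x - f x)) \<longlonglongrightarrow> 0"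
proof -
  have [measurable]: "s n \<in> borel_measurable M" for n using s by (auto simp: L2D)
  define K where "K = (\<lambda>j::nat. SOME N. \<forall>m\<ge>N. \<forall>n\<ge>N. L2_norm M (\<lambda>x. s m x - s n x) < (1/2) ^ j)"
  have K: "L2_norm M (\<lambda>x. s m x - s n x) < (1/2) ^ j" if "m \<ge> K j" "n \<ge> K j" for j m n
  proof -
    have "\<exists>N. \<forall>m\<ge>N. \<forall>n\<ge>N. L2_norm M (\<lambda>x. s m x - s n x) < (1/2) ^ j" by (rule Cauchy) simp
    hence "\<forall>m\<ge>K j. \<forall>n\<ge>K j. L2_norm M (\<lambda>x. s m x - s n x) < (1/2) ^ j" unfolding K_def by (rule someI_ex)
    thus ?thesis using that by blast
  qed
  \<comment> \<open>The maximum over all i up to j dominates every earlier threshold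
    \<open>K i\<close>; the chosen K itself need not be monotone.\<close>
  define r where "r = (\<lambda>j. Max (K ` {..j}))"
  have r_ge: "K i \<le> r j" if "i \<le> j" for i j unfolding r_def using that by (intro Max_ge) auto
  let ?d = "\<lambda>j x. s (r (Suc j)) x - s (r j) x"
  have d_L2: "?d j \<in> L2 M" for j by (intro L2_minus s)
  have sums: "summable (\<lambda>j. LINT x|M. norm (?d j x))"
  proof (rule summable_comparison_test'[where N = 0])
    show "summable (\<lambda>j. sqrt (measure M (space M)) * (1/2) ^ j)" by (intro summable_mult summable_geometric) simp
    fix j
    have "(LINT x|M. cmod (?d j x)) \<le> sqrt (measure M (space M)) * L2_norm M (?d j)"
      by (rule L2_imp_integral_norm_le(2)[OF d_L2])
    also have "\<dots> \<le> sqrt (measure M (space M)) * (1/2) ^ j"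
      by (intro mult_left_mono less_imp_le[OF K]) (auto intro: r_ge)
    finally show "norm (LINT x|M. norm (?d j x)) \<le> sqrt (measure M (space M)) * (1/2) ^ j" by simp
  qed
  have "AE x in M. summable (\<lambda>j. norm (?d j x))"
  proof -
    have "(\<integral>\<^sup>+x. (\<Sum>j. ennreal (norm (?d j x))) \<partial>M) = (\<Sum>j. \<integral>\<^sup>+x. ennreal (norm (?d j x)) \<partial>M)"
      by (rule nn_integral_suminf) measurable
    also have "\<dots> = (\<Sum>j. ennreal (LINT x|M. norm (?d j x)))"
      by (intro suminf_cong nn_integral_eq_integral integrable_norm L2_imp_integral_norm_le(1)[OF d_L2]) auto
    also have "\<dots> = ennreal (\<Sum>j. LINT x|M. norm (?d j x))"
      by (rule suminf_ennreal2[OF _ sums]) auto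
    finally have "(\<integral>\<^sup>+x. (\<Sum>j. ennreal (norm (?d j x))) \<partial>M) \<noteq> \<infinity>" by simp
    hence "AE x in M. (\<Sum>j. ennreal (norm (?d j x))) \<noteq> \<infinity>"
      by (intro nn_integral_noteq_infinite) measurable
    thus ?thesis
      by eventually_elim (auto intro!: summable_suminf_not_top)
  qed
  hence conv: "AE x in M. convergent (\<lambda>j. s (r j) x)"
  proof eventually_elim
    case (elim x)
    hence "summable (\<lambda>j. ?d j x)" by (rule summable_norm_cancel)
    hence "convergent (\<lambda>n. \<Sum>j<n. ?d j x)" by (simp add: summable_iff_convergent)
    moreover have "(\<Sum>j<n. ?d j x) = s (r n) x - s (r 0) x" for n by (rule sum_lessThan_telescope)
    ultimately have "convergent (\<lambda>n. s (r n) x - s (r 0) x)" by simp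
    from convergent_add[OF this convergent_const[of "s (r 0) x"]] show ?case by simp
  qed
  define f where "f = (\<lambda>x. lim (\<lambda>j. s (r j) x))"
  have [measurable]: "f \<in> borel_measurable M" unfolding f_def by measurable
  have lim: "AE x in M. (\<lambda>j. s (r j) x) \<longlonglongrightarrow> f x"
    using conv by eventually_elim (simp add: f_def convergent_LIMSEQ_iff)
  \<comment> \<open>Along the subsequence with j at least i both indices exceed \<open>K i\<close>,
    so the Cauchy bound holds for every member and passes to the limit f.\<close>
  have fatou: "(\<integral>\<^sup>+x. ennreal ((cmod (f x - s n x))\<^sup>2) \<partial>M) \<le> ennreal (((1/2) ^ i)\<^sup>2)" if "n \<ge> K i" for n i
  proof -
    have "(\<integral>\<^sup>+x. ennreal ((cmod (f x - s n x))\<^sup>2) \<partial>M) = (\<integral>\<^sup>+x. liminf (\<lambda>j. ennreal ((cmod (s (r j) x - s n x))\<^sup>2)) \<partial>M)"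
    proof (rule nn_integral_cong_AE)
      show "AE x in M. ennreal ((cmod (f x - s n x))\<^sup>2) = liminf (\<lambda>j. ennreal ((cmod (s (r j) x - s n x))\<^sup>2))"
        using lim
      proof eventually_elim
        case (elim x)
        hence "(\<lambda>j. ennreal ((cmod (s (r j) x - s n x))\<^sup>2)) \<longlonglongrightarrow> ennreal ((cmod (f x - s n x))\<^sup>2)"
          by (intro tendsto_intros)
        from lim_imp_Liminf[OF _ this] show ?case by simp
      qed
    qed
    also have "\<dots> \<le> liminf (\<lambda>j. \<integral>\<^sup>+x. ennreal ((cmod (s (r j) x - s n x))\<^sup>2) \<partial>M)"
      by (rule nn_integral_liminf) measurable
    also have "\<dots> \<le> liminf (\<lambda>j::nat. ennreal (((1/2) ^ i)\<^sup>2))"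
    proof (rule Liminf_mono)
      show "\<forall>\<^sub>F j in sequentially. (\<integral>\<^sup>+x. ennreal ((cmod (s (r j) x - s n x))\<^sup>2) \<partial>M) \<le> ennreal (((1/2) ^ i)\<^sup>2)"
      proof (rule eventually_sequentiallyI[of i])
        fix j assume "i \<le> j"
        have "(\<integral>\<^sup>+x. ennreal ((cmod (s (r j) x - s n x))\<^sup>2) \<partial>M) = ennreal ((L2_norm M (\<lambda>x. s (r j) x - s n x))\<^sup>2)"
          unfolding L2_norm_sq by (intro nn_integral_eq_integral L2D L2_minus s) auto
        also have "\<dots> \<le> ennreal (((1/2) ^ i)\<^sup>2)"
          using K[OF r_ge[OF \<open>i \<le> j\<close>] that] by (intro ennreal_leI power_mono) auto
        finally show "(\<integral>\<^sup>+x. ennreal ((cmod (s (r j) x - s n x))\<^sup>2) \<partial>M) \<le> ennreal (((1/2) ^ i)\<^sup>2)" .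
      qed
    qed
    also have "\<dots> = ennreal (((1/2) ^ i)\<^sup>2)" by (simp add: Liminf_const)
    finally show ?thesis .
  qed
  have fs: "(\<lambda>x. f x - s n x) \<in> L2 M \<and> L2_norm M (\<lambda>x. f x - s n x) \<le> (1/2) ^ i" if "n \<ge> K i" for n i
  proof -
    have "integrable M (\<lambda>x. (cmod (f x - s n x))\<^sup>2)"
    proof (rule integrableI_bounded)
      have "(\<integral>\<^sup>+x. ennreal (norm ((cmod (f x - s n x))\<^sup>2)) \<partial>M) \<le> ennreal (((1/2) ^ i)\<^sup>2)" using fatou[OF that] by simp
      thus "(\<integral>\<^sup>+x. ennreal (norm ((cmod (f x - s n x))\<^sup>2)) \<partial>M) < \<infinity>" by (rule order_le_less_trans) simp
    qed measurable
    hence L: "(\<lambda>x. f x - s n x) \<in> L2 M" by (simp add: L2_def)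
    have "ennreal ((L2_norm M (\<lambda>x. f x - s n x))\<^sup>2) = (\<integral>\<^sup>+x. ennreal ((cmod (f x - s n x))\<^sup>2) \<partial>M)"
      unfolding L2_norm_sq by (intro nn_integral_eq_integral[symmetric] L2D L) auto
    also have "\<dots> \<le> ennreal (((1/2) ^ i)\<^sup>2)" by (rule fatou[OF that])
    finally have "(L2_norm M (\<lambda>x. f x - s n x))\<^sup>2 \<le> ((1/2) ^ i)\<^sup>2" by (simp add: ennreal_le_iff)
    hence "L2_norm M (\<lambda>x. f x - s n x) \<le> (1/2) ^ i" by (rule power2_le_imp_le) simp
    thus ?thesis using L by simp
  qed
  have "f \<in> L2 M" using L2_add[OF conjunct1[OF fs[OF order_refl, of 0]] s[of "K 0"]] by simp
  moreover have "(\<lambda>n. L2_norm M (\<lambda>x. s n x - f x)) \<longlonglongrightarrow> 0"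
  proof (rule LIMSEQ_I)
    fix \<epsilon> :: real assume "\<epsilon> > 0"
    then obtain i where i: "(1/2) ^ i < \<epsilon>" using real_arch_pow_inv[of \<epsilon> "1/2"] by auto
    show "\<exists>N. \<forall>n\<ge>N. norm (L2_norm M (\<lambda>x. s n x - f x) - 0) < \<epsilon>"
    proof (intro exI allI impI)
      fix n assume "n \<ge> K i"
      from fs[OF this] i show "norm (L2_norm M (\<lambda>x. s n x - f x) - 0) < \<epsilon>"
        by (simp add: L2_norm_minus_commute[of M "s n"])
    qed
  qed
  ultimately show ?thesis by blast
qed

section \<open>Square-summable sequences and unitary maps\<close>

lemma ell2_iff: "f \<in> L2 ell2_measure \<longleftrightarrow> summable (\<lambda>n. (cmod (f n))\<^sup>2)"
  by (simp add: L2_def integrable_count_space_nat_iff)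

lemma ell2_norm_sq: "f \<in> L2 ell2_measure \<Longrightarrow> (L2_norm ell2_measure f)\<^sup>2 = (\<Sum>n. (cmod (f n))\<^sup>2)"
  unfolding L2_norm_sq by (rule integral_count_space_nat) (rule L2D)

lemma L2_bounded_linear_mem: "L2_bounded_linear M V N W T \<Longrightarrow> f \<in> V \<Longrightarrow> T f \<in> W"
  unfolding L2_bounded_linear_def by blast

lemma L2_bounded_linear_add:
  "L2_bounded_linear M V N W T \<Longrightarrow> f \<in> V \<Longrightarrow> g \<in> V \<Longrightarrow> AE x in N. T (\<lambda>y. f y + g y) x = T f x + T g x"
  unfolding L2_bounded_linear_def by blast

lemma L2_bounded_linear_scale:
  "L2_bounded_linear M V N W T \<Longrightarrow> f \<in> V \<Longrightarrow> AE x in N. T (\<lambda>y. c * f y) x = c * T f x"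
  unfolding L2_bounded_linear_def by blast

text \<open>Polarisation. Norms of sums give the real part of the inner product; replacing g by - i
  g turns the imaginary part into a real part.\<close>

lemma L2_unitaryI:
  assumes lin: "L2_bounded_linear M (L2 M) N (L2 N) U"
    and norm: "\<And>f. f \<in> L2 M \<Longrightarrow> L2_norm N (U f) = L2_norm M f"
    and surj: "\<And>g. g \<in> L2 N \<Longrightarrow> \<exists>f\<in>L2 M. AE x in N. U f x = g x"
  shows "L2_unitary M N U"
proof -
  have U: "U f \<in> L2 N" if "f \<in> L2 M" for f by (rule L2_bounded_linear_mem[OF lin that])
  have Re: "Re (L2_inner N (U f) (U g)) = Re (L2_inner M f g)" if f: "f \<in> L2 M" and g: "g \<in> L2 M" for f g
  proof -
    have "(L2_norm N (\<lambda>x. U f x + U g x))\<^sup>2 = (L2_norm M (\<lambda>x. f x + g x))\<^sup>2"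
    proof -
      have "L2_norm N (\<lambda>x. U f x + U g x) = L2_norm N (U (\<lambda>x. f x + g x))"
        by (intro L2_norm_cong_AE[symmetric] L2_add U f g L2_bounded_linear_add[OF lin])
      thus ?thesis using norm[OF L2_add[OF f g]] by simp
    qed
    thus ?thesis using L2_norm_add_sq[OF U[OF f] U[OF g]] L2_norm_add_sq[OF f g] norm[OF f] norm[OF g] by simp
  qed
  have "L2_inner N (U f) (U g) = L2_inner M f g" if f: "f \<in> L2 M" and g: "g \<in> L2 M" for f g
  proof (rule complex_eqI)
    show "Re (L2_inner N (U f) (U g)) = Re (L2_inner M f g)" by (rule Re[OF f g])
    have ig: "(\<lambda>x. - \<i> * g x) \<in> L2 M" by (rule L2_scale[OF g])
    have "L2_inner N (U f) (U (\<lambda>x. - \<i> * g x)) = L2_inner N (U f) (\<lambda>x. - \<i> * U g x)"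
    proof (rule L2_inner_cong_AE)
      show "AE x in N. U (\<lambda>x. - \<i> * g x) x = - \<i> * U g x" by (rule L2_bounded_linear_scale[OF lin g])
    qed (intro U f ig L2_scale g)+
    hence "Re (- \<i> * L2_inner N (U f) (U g)) = Re (- \<i> * L2_inner M f g)"
      using Re[OF f ig] by (simp only: L2_inner_scale_right)
    thus "Im (L2_inner N (U f) (U g)) = Im (L2_inner M f g)" by simp
  qed
  thus ?thesis unfolding L2_unitary_def using lin surj by blast
qed

text \<open>Completing the square in each coefficient. The last sum vanishes for the Fourier
  coefficients, so their partial sums are at least as good as any other combination of the same
  length.\<close>

lemma L2_orthonormal_approx:
  fixes e :: "nat \<Rightarrow> 'a \<Rightarrow> complex"
  assumes e: "\<And>n. e n \<in> L2 M" and orth: "\<And>m n. L2_inner M (e m) (e n) = (if m = n then 1 else 0)" and f: "f \<in> L2 M"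
  shows "(L2_norm M (\<lambda>x. f x - (\<Sum>k<n. c k * e k x)))\<^sup>2 =
    (L2_norm M f)\<^sup>2 - (\<Sum>k<n. (cmod (L2_inner M (e k) f))\<^sup>2) + (\<Sum>k<n. (cmod (c k - L2_inner M (e k) f))\<^sup>2)"
proof (induction n)
  case 0
  show ?case by simp
next
  case (Suc n)
  let ?g = "\<lambda>x. f x - (\<Sum>k<n. c k * e k x)" and ?a = "L2_inner M (e n) f"
  have sm: "(\<lambda>x. \<Sum>k<n. c k * e k x) \<in> L2 M" by (intro L2_sum L2_scale e)
  have g: "?g \<in> L2 M" by (intro L2_minus f sm)
  have "L2_inner M (e n) ?g = ?a - (\<Sum>k<n. c k * L2_inner M (e n) (e k))"
    by (simp add: L2_inner_diff_right e f sm L2_inner_sum_right L2_scale L2_inner_scale_right)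
  also have "(\<Sum>k<n. c k * L2_inner M (e n) (e k)) = 0" by (intro sum.neutral) (auto simp: orth)
  finally have eg: "L2_inner M ?g (e n) = cnj ?a" using L2_inner_cnj[of M "e n" ?g] by simp
  have nen: "L2_norm M (e n) = 1"
  proof -
    have "complex_of_real ((L2_norm M (e n))\<^sup>2) = of_real 1" unfolding L2_inner_self[symmetric] orth by simp
    hence "(L2_norm M (e n))\<^sup>2 = 1" by (simp only: of_real_eq_iff)
    thus ?thesis by (simp add: power2_eq_1_iff) (metis L2_norm_nonneg neg_0_le_iff_le not_one_le_zero)
  qed
  have "(\<lambda>x. f x - (\<Sum>k<Suc n. c k * e k x)) = (\<lambda>x. ?g x + (- c n) * e n x)" by (simp add: algebra_simps)
  hence "(L2_norm M (\<lambda>x. f x - (\<Sum>k<Suc n. c k * e k x)))\<^sup>2 = (L2_norm M ?g)\<^sup>2 + ((cmod (c n))\<^sup>2 + 2 * Re (- c n * cnj ?a))"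
    by (simp only: L2_norm_add_sq[OF g L2_scale[OF e]] L2_norm_scale L2_inner_scale_right eg nen) simp
  also have "(cmod (c n))\<^sup>2 + 2 * Re (- c n * cnj ?a) = (cmod (c n - ?a))\<^sup>2 - (cmod ?a)\<^sup>2"
    unfolding cmod_power2 by (simp add: power2_eq_square algebra_simps)
  finally show ?case using Suc by simp
qed

text \<open>Totality supplies some good approximation, and optimality of the Fourier coefficients
  turns it into Parseval's identity. For surjectivity the partial sums with prescribed coefficients
  form a Cauchy sequence, whose limit exists by \<open>L2_complete\<close> and has these
  coefficients by Cauchy--Schwarz.\<close>

lemma (in finite_measure) L2_basis_unitary:
  assumes e: "\<And>n. e n \<in> L2 M" and orth: "\<And>m n. L2_inner M (e m) (e n) = (if m = n then 1 else 0)"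
    and total: "\<And>f \<epsilon>. f \<in> L2 M \<Longrightarrow> \<epsilon> > 0 \<Longrightarrow> \<exists>n c. L2_norm M (\<lambda>x. f x - (\<Sum>k<n. c k * e k x)) < \<epsilon>"
  shows "L2_unitary M ell2_measure (\<lambda>f n. L2_inner M (e n) f)"
proof -
  let ?V = "\<lambda>f n. L2_inner M (e n) f"
  have approx: "(\<Sum>k<n. (cmod (?V f k))\<^sup>2) = (L2_norm M f)\<^sup>2 - (L2_norm M (\<lambda>x. f x - (\<Sum>k<n. ?V f k * e k x)))\<^sup>2"
    if "f \<in> L2 M" for f n
    using L2_orthonormal_approx[OF e orth that, where n = n and c = "?V f"] by simp
  have parseval: "(\<lambda>k. (cmod (?V f k))\<^sup>2) sums (L2_norm M f)\<^sup>2" if f: "f \<in> L2 M" for f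
  proof -
    have mono: "incseq (\<lambda>n. \<Sum>k<n. (cmod (?V f k))\<^sup>2)"
      by (intro incseq_SucI) simp
    have "(\<lambda>n. \<Sum>k<n. (cmod (?V f k))\<^sup>2) \<longlonglongrightarrow> (L2_norm M f)\<^sup>2"
    proof (rule LIMSEQ_I)
      fix r :: real assume "r > 0"
      then obtain n c where nc: "L2_norm M (\<lambda>x. f x - (\<Sum>k<n. c k * e k x)) < sqrt r"
        using total[OF f, of "sqrt r"] by auto
      have "(L2_norm M (\<lambda>x. f x - (\<Sum>k<n. c k * e k x)))\<^sup>2 < (sqrt r)\<^sup>2"
        using nc by (intro power_strict_mono) auto
      hence "(L2_norm M (\<lambda>x. f x - (\<Sum>k<n. c k * e k x)))\<^sup>2 < r" using \<open>r > 0\<close> by simp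
      moreover have "0 \<le> (\<Sum>k<n. (cmod (c k - ?V f k))\<^sup>2)" by (intro sum_nonneg) simp
      ultimately have *: "(L2_norm M f)\<^sup>2 - (\<Sum>k<n. (cmod (?V f k))\<^sup>2) < r"
        using L2_orthonormal_approx[OF e orth f, where n = n and c = c] by linarith
      show "\<exists>N. \<forall>m\<ge>N. norm ((\<Sum>k<m. (cmod (?V f k))\<^sup>2) - (L2_norm M f)\<^sup>2) < r"
      proof (intro exI allI impI)
        fix m assume "m \<ge> n"
        hence "(\<Sum>k<n. (cmod (?V f k))\<^sup>2) \<le> (\<Sum>k<m. (cmod (?V f k))\<^sup>2)" using mono by (auto simp: incseq_def)
        moreover have "(\<Sum>k<m. (cmod (?V f k))\<^sup>2) \<le> (L2_norm M f)\<^sup>2" using approx[OF f, of m] by simp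
        ultimately show "norm ((\<Sum>k<m. (cmod (?V f k))\<^sup>2) - (L2_norm M f)\<^sup>2) < r" using * by simp
      qed
    qed
    thus ?thesis by (simp add: sums_def)
  qed
  have V: "?V f \<in> L2 ell2_measure" if "f \<in> L2 M" for f
    using parseval[OF that] by (simp add: ell2_iff sums_iff)
  have norm: "L2_norm ell2_measure (?V f) = L2_norm M f" if "f \<in> L2 M" for f
    using ell2_norm_sq[OF V[OF that]] parseval[OF that] by (simp add: sums_iff power2_eq_iff_nonneg)
  show ?thesis
  proof (rule L2_unitaryI)
    show "L2_bounded_linear M (L2 M) ell2_measure (L2 ell2_measure) ?V"
      unfolding L2_bounded_linear_def
      by (auto intro!: V exI[of _ 1] simp: norm L2_inner_add_right e L2_inner_scale_right AE_count_space)
    show "L2_norm ell2_measure (?V f) = L2_norm M f" if "f \<in> L2 M" for f by (rule norm[OF that])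
    fix c assume "c \<in> L2 ell2_measure"
    hence c: "summable (\<lambda>k. (cmod (c k))\<^sup>2)" by (simp add: ell2_iff)
    define s where "s = (\<lambda>n x. \<Sum>k<n. c k * e k x)"
    have s: "s n \<in> L2 M" for n unfolding s_def by (intro L2_sum L2_scale e)
    have Vs: "?V (s n) k = (if k < n then c k else 0)" for n k
    proof -
      have "?V (s n) k = (\<Sum>i<n. if k = i then c i else 0)"
        unfolding s_def by (simp add: L2_inner_sum_right e L2_scale L2_inner_scale_right orth if_distrib cong: if_cong)
      thus ?thesis by simp
    qed
    have diff: "(L2_norm M (\<lambda>x. s m x - s n x))\<^sup>2 = (\<Sum>k\<in>{n..<m}. (cmod (c k))\<^sup>2)" if "n \<le> m" for m n
    proof -
      have "(\<lambda>k. (cmod (?V (\<lambda>x. s m x - s n x) k))\<^sup>2) sums (L2_norm M (\<lambda>x. s m x - s n x))\<^sup>2"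
        by (intro parseval L2_minus s)
      moreover have "(\<lambda>k. (cmod (?V (\<lambda>x. s m x - s n x) k))\<^sup>2) = (\<lambda>k. if k \<in> {n..<m} then (cmod (c k))\<^sup>2 else 0)"
        using that by (auto simp: fun_eq_iff L2_inner_diff_right e s Vs)
      ultimately show ?thesis using sums_If_finite_set[of "{n..<m}" "\<lambda>k. (cmod (c k))\<^sup>2"] sums_unique2 by force
    qed
    have "\<exists>N. \<forall>m\<ge>N. \<forall>n\<ge>N. L2_norm M (\<lambda>x. s m x - s n x) < \<epsilon>" if "\<epsilon> > 0" for \<epsilon>
    proof -
      have "\<epsilon>\<^sup>2 > 0" using that by simp
      then obtain N where N: "\<And>m n. m \<ge> N \<Longrightarrow> norm (\<Sum>k\<in>{m..<n}. (cmod (c k))\<^sup>2) < \<epsilon>\<^sup>2"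
        using c unfolding summable_Cauchy by meson
      have *: "L2_norm M (\<lambda>x. s m x - s n x) < \<epsilon>" if "n \<ge> N" "n \<le> m" for m n
      proof -
        have "(L2_norm M (\<lambda>x. s m x - s n x))\<^sup>2 < \<epsilon>\<^sup>2" unfolding diff[OF that(2)] using N[OF that(1), of m] by simp
        thus ?thesis using \<open>\<epsilon> > 0\<close> by (simp add: power2_less_imp_less)
      qed
      show ?thesis
      proof (intro exI allI impI)
        fix m n assume "m \<ge> N" "n \<ge> N"
        thus "L2_norm M (\<lambda>x. s m x - s n x) < \<epsilon>"
          using *[of n m] *[of m n] L2_norm_minus_commute[of M "s m" "s n"] by (cases "n \<le> m") auto
      qed
    qed
    from L2_complete[OF s this] obtain f where f: "f \<in> L2 M" "(\<lambda>n. L2_norm M (\<lambda>x. s n x - f x)) \<longlonglongrightarrow> 0" by blast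
    have "?V f k = c k" for k
    proof -
      have "(\<lambda>n. ?V (s n) k - ?V f k) \<longlonglongrightarrow> 0"
      proof (rule Lim_null_comparison)
        show "\<forall>\<^sub>F n in sequentially. norm (?V (s n) k - ?V f k) \<le> L2_norm M (e k) * L2_norm M (\<lambda>x. s n x - f x)"
          using L2_Cauchy_Schwarz[OF e[of k] L2_minus[OF s f(1)]]
          by (intro always_eventually allI) (simp add: L2_inner_diff_right e s f)
        show "(\<lambda>n. L2_norm M (e k) * L2_norm M (\<lambda>x. s n x - f x)) \<longlonglongrightarrow> 0"
          using tendsto_mult_left[OF f(2)] by simp
      qed
      moreover have "(\<lambda>n. ?V (s n) k - ?V f k) \<longlonglongrightarrow> c k - ?V f k"
      proof (rule tendsto_eventually)
        show "\<forall>\<^sub>F n in sequentially. ?V (s n) k - ?V f k = c k - ?V f k"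
          by (rule eventually_sequentiallyI[of "Suc k"]) (simp add: Vs)
      qed
      ultimately have "0 = c k - ?V f k" by (rule LIMSEQ_unique)
      thus ?thesis by simp
    qed
    hence "AE k in ell2_measure. ?V f k = c k" by simp
    thus "\<exists>f\<in>L2 M. AE k in ell2_measure. ?V f k = c k" using f(1) by blast
  qed
qed

lemma L2_unitary_linear: "L2_unitary M N U \<Longrightarrow> L2_bounded_linear M (L2 M) N (L2 N) U"
  unfolding L2_unitary_def by blast

lemma L2_unitary_inner:
  "L2_unitary M N U \<Longrightarrow> f \<in> L2 M \<Longrightarrow> g \<in> L2 M \<Longrightarrow> L2_inner N (U f) (U g) = L2_inner M f g"
  unfolding L2_unitary_def by blast

lemma L2_unitary_mem: "L2_unitary M N U \<Longrightarrow> f \<in> L2 M \<Longrightarrow> U f \<in> L2 N"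
  by (rule L2_bounded_linear_mem[OF L2_unitary_linear])

lemma L2_unitary_norm:
  assumes "L2_unitary M N U" "f \<in> L2 M" shows "L2_norm N (U f) = L2_norm M f"
proof -
  have "complex_of_real ((L2_norm N (U f))\<^sup>2) = of_real ((L2_norm M f)\<^sup>2)"
    unfolding L2_inner_self[symmetric] by (rule L2_unitary_inner[OF assms(1,2,2)])
  hence "(L2_norm N (U f))\<^sup>2 = (L2_norm M f)\<^sup>2" by (simp only: of_real_eq_iff)
  thus ?thesis by (simp add: power2_eq_iff_nonneg)
qed

lemma L2_bounded_linear_diff:
  assumes U: "L2_bounded_linear M (L2 M) N W U" and "f \<in> L2 M" "g \<in> L2 M"
  shows "AE x in N. U (\<lambda>y. f y - g y) x = U f x - U g x"
proof -
  have "AE x in N. U (\<lambda>y. f y + (- 1) * g y) x = U f x + U (\<lambda>y. (- 1) * g y) x"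
    by (rule L2_bounded_linear_add[OF U assms(2) L2_scale[OF assms(3)]])
  moreover have "AE x in N. U (\<lambda>y. (- 1) * g y) x = (- 1) * U g x"
    by (rule L2_bounded_linear_scale[OF U assms(3)])
  ultimately show ?thesis by eventually_elim simp
qed

text \<open>Preimages are unique only almost everywhere, so the inverse is obtained by choice. Its
  linearity and the second inversion law then follow from injectivity of V up to null sets.\<close>

lemma L2_unitary_inverse:
  assumes V: "L2_unitary M N V"
  obtains U where "L2_unitary N M U" "\<And>g. g \<in> L2 N \<Longrightarrow> AE x in N. V (U g) x = g x"
    "\<And>f. f \<in> L2 M \<Longrightarrow> AE x in M. U (V f) x = f x"
proof -
  define U where "U = (\<lambda>g. SOME f. f \<in> L2 M \<and> (AE x in N. V f x = g x))"
  have lin: "L2_bounded_linear M (L2 M) N (L2 N) V" using V unfolding L2_unitary_def by blast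
  have VL: "V f \<in> L2 N" if "f \<in> L2 M" for f by (rule L2_bounded_linear_mem[OF lin that])
  have U: "U g \<in> L2 M \<and> (AE x in N. V (U g) x = g x)" if "g \<in> L2 N" for g
  proof -
    have "\<exists>f. f \<in> L2 M \<and> (AE x in N. V f x = g x)" using V that unfolding L2_unitary_def by blast
    thus ?thesis unfolding U_def by (rule someI_ex)
  qed
  have inj: "AE x in M. f x = g x" if "f \<in> L2 M" "g \<in> L2 M" "AE x in N. V f x = V g x" for f g
  proof -
    have "AE x in N. V (\<lambda>y. f y - g y) x = 0"
      using L2_bounded_linear_diff[OF lin that(1,2)] that(3) by eventually_elim simp
    hence "L2_norm N (V (\<lambda>y. f y - g y)) = 0" using that by (subst L2_norm_eq_0_iff) (auto intro: VL L2_minus)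
    hence "L2_norm M (\<lambda>y. f y - g y) = 0" using L2_unitary_norm[OF V L2_minus[OF that(1,2)]] by simp
    thus ?thesis using L2_minus[OF that(1,2)] by (simp add: L2_norm_eq_0_iff)
  qed
  have norm: "L2_norm M (U g) = L2_norm N g" if "g \<in> L2 N" for g
  proof -
    have "L2_norm M (U g) = L2_norm N (V (U g))" using L2_unitary_norm[OF V] U[OF that] by simp
    also have "\<dots> = L2_norm N g" by (rule L2_norm_cong_AE) (use U[OF that] VL that in auto)
    finally show ?thesis .
  qed
  have UV: "AE x in M. U (V f) x = f x" if "f \<in> L2 M" for f
    using U[OF VL[OF that]] that by (intro inj) auto
  have "L2_unitary N M U"
  proof (rule L2_unitaryI)
    show "L2_bounded_linear N (L2 N) M (L2 M) U"
      unfolding L2_bounded_linear_def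
    proof (intro conjI ballI allI exI[of _ 1])
      fix f g assume fg: "f \<in> L2 N" "g \<in> L2 N"
      show "AE x in M. U (\<lambda>y. f y + g y) x = U f x + U g x"
      proof (rule inj)
        have "AE x in N. V (\<lambda>y. U f y + U g y) x = V (U f) x + V (U g) x"
          using U fg by (intro L2_bounded_linear_add[OF lin]) auto
        moreover have "AE x in N. V (U f) x = f x" "AE x in N. V (U g) x = g x"
          "AE x in N. V (U (\<lambda>y. f y + g y)) x = f x + g x" using U fg L2_add by auto
        ultimately show "AE x in N. V (U (\<lambda>y. f y + g y)) x = V (\<lambda>x. U f x + U g x) x" by eventually_elim simp
      qed (use U fg in \<open>auto intro: L2_add\<close>)
    next
      fix c f assume f: "f \<in> L2 N"
      show "AE x in M. U (\<lambda>y. c * f y) x = c * U f x"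
      proof (rule inj)
        have "AE x in N. V (\<lambda>y. c * U f y) x = c * V (U f) x"
          using U f by (intro L2_bounded_linear_scale[OF lin]) auto
        moreover have "AE x in N. V (U f) x = f x" "AE x in N. V (U (\<lambda>y. c * f y)) x = c * f x"
          using U f L2_scale by auto
        ultimately show "AE x in N. V (U (\<lambda>y. c * f y)) x = V (\<lambda>x. c * U f x) x" by eventually_elim simp
      qed (use U f in \<open>auto intro: L2_scale\<close>)
    qed (use U norm in auto)
    show "\<exists>g\<in>L2 N. AE x in M. U g x = f x" if "f \<in> L2 M" for f
      using UV[OF that] VL[OF that] by blast
  qed (rule norm)
  thus ?thesis using that U UV by blast
qed

section \<open>Operators unitarily equivalent to a multiplication operator\<close>

lemma (in finite_measure) integrable_indicator_real:
  "A \<in> sets M \<Longrightarrow> integrable M (\<lambda>x. indicator A x :: real)"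
  by (intro integrable_real_indicator) (metis emeasure_finite infinity_ennreal_def top.not_eq_extremum)+

lemma ell2_AE [simp]: "(AE x in ell2_measure. P x) \<longleftrightarrow> (\<forall>x. P x)"
  by (simp add: AE_count_space)

lemma L2_norm_mult_le:
  assumes f: "f \<in> L2 M" and w: "w \<in> borel_measurable M" and B: "AE x in M. cmod (w x) \<le> B" and "0 \<le> B"
  shows "L2_norm M (\<lambda>x. w x * f x) \<le> B * L2_norm M f"
proof -
  have wf: "(\<lambda>x. w x * f x) \<in> L2 M" by (rule L2_mult_bounded[OF f w B])
  have "(LINT x|M. (cmod (w x * f x))\<^sup>2) \<le> (LINT x|M. B\<^sup>2 * (cmod (f x))\<^sup>2)"
  proof (rule integral_mono_AE)
    show "integrable M (\<lambda>x. (cmod (w x * f x))\<^sup>2)" by (rule L2D(2)[OF wf])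
    show "integrable M (\<lambda>x. B\<^sup>2 * (cmod (f x))\<^sup>2)" by (intro integrable_mult_right L2D(2)[OF f])
    show "AE x in M. (cmod (w x * f x))\<^sup>2 \<le> B\<^sup>2 * (cmod (f x))\<^sup>2"
      using B
    proof eventually_elim
      case (elim x)
      hence "(cmod (w x))\<^sup>2 \<le> B\<^sup>2" by (intro power_mono) auto
      thus ?case by (simp add: norm_mult power_mult_distrib mult_right_mono)
    qed
  qed
  hence "(L2_norm M (\<lambda>x. w x * f x))\<^sup>2 \<le> (B * L2_norm M f)\<^sup>2"
    by (simp add: L2_norm_sq power_mult_distrib)
  thus ?thesis by (rule power2_le_imp_le) (simp add: \<open>0 \<le> B\<close>)
qed

lemma ell2_std_basis [simp]: "std_basis m \<in> L2 ell2_measure"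
proof -
  have "summable (\<lambda>n. (cmod (std_basis m n))\<^sup>2)"
    by (rule summable_finite[of "{m}"]) (auto simp: std_basis_def)
  thus ?thesis by (simp add: ell2_iff)
qed

lemma ell2_inner_std_basis:
  assumes "f \<in> L2 ell2_measure" shows "L2_inner ell2_measure (std_basis m) f = f m"
proof -
  have "L2_inner ell2_measure (std_basis m) f = (\<Sum>n. cnj (std_basis m n) * f n)"
    unfolding L2_inner_def by (rule integral_count_space_nat) (rule L2_inner_integrable[OF ell2_std_basis assms])
  also have "\<dots> = f m"
    using suminf_finite[of "{m}" "\<lambda>n. cnj (std_basis m n) * f n"] by (auto simp: std_basis_def)
  finally show ?thesis .
qed

lemma ell2_truncation:
  assumes f: "f \<in> L2 ell2_measure"
  shows "(\<lambda>N. L2_norm ell2_measure (\<lambda>n. f n - (\<Sum>k<N. f k * std_basis k n))) \<longlonglongrightarrow> 0"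
proof -
  have s: "summable (\<lambda>n. (cmod (f n))\<^sup>2)" using f by (simp add: ell2_iff)
  have eq: "(L2_norm ell2_measure (\<lambda>n. f n - (\<Sum>k<N. f k * std_basis k n)))\<^sup>2 = (\<Sum>n. (cmod (f (n + N)))\<^sup>2)" for N
  proof -
    have e: "f n - (\<Sum>k<N. f k * std_basis k n) = (if n < N then 0 else f n)" for n
      by (simp add: std_basis_def if_distrib cong: if_cong)
    have m: "(\<lambda>n. f n - (\<Sum>k<N. f k * std_basis k n)) \<in> L2 ell2_measure"
      by (intro L2_minus f L2_sum L2_scale ell2_std_basis)
    have "(L2_norm ell2_measure (\<lambda>n. f n - (\<Sum>k<N. f k * std_basis k n)))\<^sup>2 = (\<Sum>n. (cmod (if n < N then 0 else f n))\<^sup>2)"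
      using ell2_norm_sq[OF m] unfolding e .
    also have "\<dots> = (\<Sum>n. (cmod (if n + N < N then 0 else f (n + N)))\<^sup>2) + (\<Sum>n<N. (cmod (if n < N then 0 else f n))\<^sup>2)"
      by (rule suminf_split_initial_segment) (use m in \<open>simp only: ell2_iff e\<close>)
    finally show ?thesis by simp
  qed
  have "(\<lambda>N. \<Sum>n. (cmod (f (n + N)))\<^sup>2) \<longlonglongrightarrow> 0" by (rule suminf_exist_split2[OF s])
  hence "(\<lambda>N. sqrt ((L2_norm ell2_measure (\<lambda>n. f n - (\<Sum>k<N. f k * std_basis k n)))\<^sup>2)) \<longlonglongrightarrow> sqrt 0"
    unfolding eq by (rule tendsto_real_sqrt)
  thus ?thesis by simp
qed

lemma L2_bounded_linear_sum:
  assumes T: "L2_bounded_linear M (L2 M) ell2_measure W T" and f: "\<And>k. f k \<in> L2 M"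
  shows "T (\<lambda>x. \<Sum>k<N::nat. c k * f k x) n = (\<Sum>k<N. c k * T (f k) n)"
proof (induction N)
  case 0
  have "T (\<lambda>y. 0 * f 0 y) n = 0 * T (f 0) n"
    using L2_bounded_linear_scale[OF T f[of 0], of 0] by simp
  thus ?case by simp
next
  case (Suc N)
  have "T (\<lambda>x. (\<Sum>k<N. c k * f k x) + c N * f N x) n = T (\<lambda>x. \<Sum>k<N. c k * f k x) n + T (\<lambda>x. c N * f N x) n"
  proof -
    have "(\<lambda>x. \<Sum>k<N. c k * f k x) \<in> L2 M" by (intro L2_sum L2_scale f)
    from L2_bounded_linear_add[OF T this L2_scale[OF f, of "c N" N]] show ?thesis by (simp only: ell2_AE)
  qed
  moreover have "T (\<lambda>x. c N * f N x) n = c N * T (f N) n"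
    using L2_bounded_linear_scale[OF T f[of N], of "c N"] by simp
  ultimately show ?case using Suc by simp
qed

lemma ell2_component_le:
  assumes "f \<in> L2 ell2_measure" shows "cmod (f m) \<le> L2_norm ell2_measure f"
proof -
  have "L2_norm ell2_measure (std_basis m) = 1"
  proof -
    have "complex_of_real ((L2_norm ell2_measure (std_basis m))\<^sup>2) = of_real 1"
      unfolding L2_inner_self[symmetric] by (simp add: ell2_inner_std_basis) (simp add: std_basis_def)
    hence "(L2_norm ell2_measure (std_basis m))\<^sup>2 = 1" by (simp only: of_real_eq_iff)
    thus ?thesis using L2_norm_nonneg[of ell2_measure "std_basis m"] by (simp add: power2_eq_1_iff)
  qed
  thus ?thesis using L2_Cauchy_Schwarz[OF ell2_std_basis assms, of m] by (simp add: ell2_inner_std_basis assms)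
qed

text \<open>Boundedness makes the value at f the limit of the values at truncations of f, and each
  coordinate is bounded by the norm, so every coordinate of the image is computed from the matrix.
  Equality is pointwise because the counting measure has no nonempty null set.\<close>

lemma has_matrix_unique:
  assumes S: "has_matrix S A" and T: "has_matrix T A" and f: "f \<in> L2 ell2_measure"
  shows "S f = T f"
proof
  fix m
  have lim: "(\<lambda>N. \<Sum>k<N. f k * A m k) \<longlonglongrightarrow> R f m" if R: "has_matrix R A" for R
  proof -
    have lin: "L2_bounded_linear ell2_measure (L2 ell2_measure) ell2_measure (L2 ell2_measure) R"
      using R by (simp add: has_matrix_def L2_bounded_op_def)
    then obtain C where C: "\<And>g. g \<in> L2 ell2_measure \<Longrightarrow> L2_norm ell2_measure (R g) \<le> C * L2_norm ell2_measure g"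
      unfolding L2_bounded_linear_def by blast
    have Rb: "R (std_basis k) m = A m k" for k
      using R ell2_inner_std_basis[OF L2_bounded_linear_mem[OF lin ell2_std_basis], of m k]
      by (simp add: has_matrix_def)
    have t: "(\<lambda>n. \<Sum>k<N. f k * std_basis k n) \<in> L2 ell2_measure" for N
      by (intro L2_sum L2_scale ell2_std_basis)
    have bound: "cmod (R f m - (\<Sum>k<N. f k * A m k)) \<le> C * L2_norm ell2_measure (\<lambda>n. f n - (\<Sum>k<N. f k * std_basis k n))" for N
    proof -
      have d: "(\<lambda>n. f n - (\<Sum>k<N. f k * std_basis k n)) \<in> L2 ell2_measure" by (intro L2_minus f t)
      have "R (\<lambda>n. f n - (\<Sum>k<N. f k * std_basis k n)) m = R f m - (\<Sum>k<N. f k * A m k)"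
        using L2_bounded_linear_diff[OF lin f t[of N]] L2_bounded_linear_sum[OF lin ell2_std_basis, where N = N and c = f and n = m] by (simp add: Rb)
      thus ?thesis using ell2_component_le[OF L2_bounded_linear_mem[OF lin d], of m] C[OF d] by simp
    qed
    have "(\<lambda>N. (\<Sum>k<N. f k * A m k) - R f m) \<longlonglongrightarrow> 0"
    proof (rule Lim_null_comparison)
      show "\<forall>\<^sub>F N in sequentially. norm ((\<Sum>k<N. f k * A m k) - R f m) \<le> C * L2_norm ell2_measure (\<lambda>n. f n - (\<Sum>k<N. f k * std_basis k n))"
        using bound by (intro always_eventually allI) (simp add: norm_minus_commute)
      show "(\<lambda>N. C * L2_norm ell2_measure (\<lambda>n. f n - (\<Sum>k<N. f k * std_basis k n))) \<longlonglongrightarrow> 0"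
        using tendsto_mult_left[OF ell2_truncation[OF f], of C] by simp
    qed
    thus ?thesis by (simp add: LIM_zero_iff)
  qed
  show "S f m = T f m" by (rule LIMSEQ_unique[OF lim[OF S] lim[OF T]])
qed

section \<open>A multiplication operator conjugated to the sequence space\<close>

context
  fixes M :: "'a measure" and V :: "('a \<Rightarrow> complex) \<Rightarrow> nat \<Rightarrow> complex" and U :: "(nat \<Rightarrow> complex) \<Rightarrow> 'a \<Rightarrow> complex"
  assumes fin: "finite_measure M"
    and V: "L2_unitary M ell2_measure V" and U: "L2_unitary ell2_measure M U"
    and VU: "\<And>g. g \<in> L2 ell2_measure \<Longrightarrow> V (U g) = g"
    and UV: "\<And>f. f \<in> L2 M \<Longrightarrow> AE x in M. U (V f) x = f x"
begin

lemmas V_mem = L2_unitary_mem[OF V]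
lemmas U_mem = L2_unitary_mem[OF U]
lemmas V_norm = L2_unitary_norm[OF V]
lemmas U_norm = L2_unitary_norm[OF U]

lemma V_add: "f \<in> L2 M \<Longrightarrow> g \<in> L2 M \<Longrightarrow> V (\<lambda>x. f x + g x) n = V f n + V g n"
  using L2_bounded_linear_add[OF L2_unitary_linear[OF V], of f g] by simp

lemma V_scale: "f \<in> L2 M \<Longrightarrow> V (\<lambda>x. c * f x) n = c * V f n"
  using L2_bounded_linear_scale[OF L2_unitary_linear[OF V], of f c] by simp

lemma V_diff: "f \<in> L2 M \<Longrightarrow> g \<in> L2 M \<Longrightarrow> V (\<lambda>x. f x - g x) n = V f n - V g n"
  using L2_bounded_linear_diff[OF L2_unitary_linear[OF V], of f g] by simp

lemma V_cong:
  assumes "f \<in> L2 M" "g \<in> L2 M" "AE x in M. f x = g x" shows "V f = V g"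
proof
  fix n
  have "L2_norm ell2_measure (V (\<lambda>x. f x - g x)) = 0"
    using assms L2_norm_eq_0_iff[OF L2_minus[OF assms(1,2)]] by (simp add: V_norm L2_minus)
  hence "AE n in ell2_measure. V (\<lambda>x. f x - g x) n = 0"
    using assms L2_norm_eq_0_iff[OF V_mem[OF L2_minus[OF assms(1,2)]]] by simp
  hence "V (\<lambda>x. f x - g x) n = 0" by simp
  thus "V f n = V g n" using V_diff[OF assms(1,2)] by simp
qed

definition mult_conj :: "('a \<Rightarrow> complex) \<Rightarrow> (nat \<Rightarrow> complex) \<Rightarrow> nat \<Rightarrow> complex" where
  "mult_conj w g = V (\<lambda>x. w x * U g x)"

context
  fixes w :: "'a \<Rightarrow> complex" and C :: real
  assumes w: "w \<in> borel_measurable M" and C: "AE x in M. cmod (w x) \<le> C"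
begin

lemma mult_L2: "f \<in> L2 M \<Longrightarrow> (\<lambda>x. w x * f x) \<in> L2 M"
  by (rule L2_mult_bounded[OF _ w C])

lemma mult_conj_V: "f \<in> L2 M \<Longrightarrow> mult_conj w (V f) = V (\<lambda>x. w x * f x)"
  unfolding mult_conj_def
proof (rule V_cong)
  assume f: "f \<in> L2 M"
  show "AE x in M. w x * U (V f) x = w x * f x" using UV[OF f] by eventually_elim simp
qed (auto intro!: mult_L2 U_mem V_mem)

lemma mult_conj_mem: "g \<in> L2 ell2_measure \<Longrightarrow> mult_conj w g \<in> L2 ell2_measure"
  unfolding mult_conj_def by (intro V_mem mult_L2 U_mem)

lemma U_mult_conj: "g \<in> L2 ell2_measure \<Longrightarrow> AE x in M. U (mult_conj w g) x = w x * U g x"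
  unfolding mult_conj_def by (intro UV mult_L2 U_mem)

lemma mult_conj_norm_le:
  assumes "g \<in> L2 ell2_measure" "0 \<le> C" shows "L2_norm ell2_measure (mult_conj w g) \<le> C * L2_norm ell2_measure g"
proof -
  have "L2_norm ell2_measure (mult_conj w g) = L2_norm M (\<lambda>x. w x * U g x)"
    unfolding mult_conj_def by (intro V_norm mult_L2 U_mem assms)
  also have "\<dots> \<le> C * L2_norm M (U g)" by (intro L2_norm_mult_le U_mem assms w C)
  finally show ?thesis by (simp add: U_norm assms)
qed

lemma mult_conj_bounded: "L2_bounded_op ell2_measure (mult_conj w)"
  unfolding L2_bounded_op_def L2_bounded_linear_def
proof (intro conjI ballI allI)
  fix f g :: "nat \<Rightarrow> complex" assume fg: "f \<in> L2 ell2_measure" "g \<in> L2 ell2_measure"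
  have "mult_conj w (\<lambda>y. f y + g y) = V (\<lambda>x. w x * U f x + w x * U g x)"
    unfolding mult_conj_def
  proof (rule V_cong)
    show "AE x in M. w x * U (\<lambda>y. f y + g y) x = w x * U f x + w x * U g x"
      using L2_bounded_linear_add[OF L2_unitary_linear[OF U] fg] by eventually_elim (simp add: distrib_left)
  qed (intro mult_L2 U_mem L2_add fg)+
  thus "AE x in ell2_measure. mult_conj w (\<lambda>y. f y + g y) x = mult_conj w f x + mult_conj w g x"
    by (simp add: mult_conj_def V_add mult_L2 U_mem fg)
next
  fix c and f :: "nat \<Rightarrow> complex" assume f: "f \<in> L2 ell2_measure"
  have "mult_conj w (\<lambda>y. c * f y) = V (\<lambda>x. c * (w x * U f x))"
    unfolding mult_conj_def
  proof (rule V_cong)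
    show "AE x in M. w x * U (\<lambda>y. c * f y) x = c * (w x * U f x)"
      using L2_bounded_linear_scale[OF L2_unitary_linear[OF U] f, of c] by eventually_elim simp
  qed (intro mult_L2 U_mem L2_scale f)+
  thus "AE x in ell2_measure. mult_conj w (\<lambda>y. c * f y) x = c * mult_conj w f x"
    by (simp add: mult_conj_def V_scale mult_L2 U_mem f)
next
  show "mult_conj w f \<in> L2 ell2_measure" if "f \<in> L2 ell2_measure" for f by (rule mult_conj_mem[OF that])
  \<comment> \<open>For the zero measure the bound C could be negative.\<close>
  have "AE x in M. cmod (w x) \<le> \<bar>C\<bar>" using C by eventually_elim linarith
  hence "L2_norm ell2_measure (mult_conj w f) \<le> \<bar>C\<bar> * L2_norm ell2_measure f" if "f \<in> L2 ell2_measure" for f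
    using that L2_norm_mult_le[OF U_mem[OF that] w, of "\<bar>C\<bar>"]
    by (simp add: mult_conj_def V_norm mult_L2 U_mem U_norm)
  thus "\<exists>C. \<forall>f\<in>L2 ell2_measure. L2_norm ell2_measure (mult_conj w f) \<le> C * L2_norm ell2_measure f" by blast
qed

lemma mult_conj_inner:
  assumes "f \<in> L2 ell2_measure" "g \<in> L2 ell2_measure"
  shows "L2_inner ell2_measure f (mult_conj w g) = (LINT x|M. w x * (cnj (U f x) * U g x))"
proof -
  have "L2_inner ell2_measure (V (U f)) (mult_conj w g) = L2_inner M (U f) (\<lambda>x. w x * U g x)"
    unfolding mult_conj_def by (intro L2_unitary_inner[OF V] U_mem mult_L2 assms)
  thus ?thesis by (simp add: VU assms L2_inner_def mult_ac)
qed

end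

context
  fixes h :: "'a \<Rightarrow> real" and B :: real and H :: "(nat \<Rightarrow> complex) \<Rightarrow> (nat \<Rightarrow> complex)"
  assumes h [measurable]: "h \<in> borel_measurable M" and hB: "\<And>x. x \<in> space M \<Longrightarrow> \<bar>h x\<bar> \<le> B"
    and H: "\<And>f. f \<in> L2 ell2_measure \<Longrightarrow> H f = mult_conj (\<lambda>x. of_real (h x)) f"
begin

lemma multiplier_fun_measurable: "(\<lambda>x. complex_of_real (h x)) \<in> borel_measurable M"
  by measurable

lemma multiplier_fun_bound: "AE x in M. cmod (complex_of_real (h x)) \<le> B"
  using hB by (intro AE_I2) simp

lemmas multiplier_fun_L2 = mult_L2[OF multiplier_fun_measurable multiplier_fun_bound]

lemma mult_conj_real_V: "f \<in> L2 M \<Longrightarrow> H (V f) = V (\<lambda>x. of_real (h x) * f x)"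
  by (simp add: H V_mem mult_conj_V[OF multiplier_fun_measurable multiplier_fun_bound])

lemma mult_conj_unitarily_equivalent:
  assumes "\<And>x. x \<in> space M \<Longrightarrow> g x = of_real (h x)"
  shows "L2_unitarily_equivalent ell2_measure H M (mult_op g)"
  unfolding L2_unitarily_equivalent_def
proof (intro exI[of _ U] conjI ballI U)
  fix f assume f: "f \<in> L2 ell2_measure"
  have "AE x in M. U (H f) x = of_real (h x) * U f x"
    using U_mult_conj[OF multiplier_fun_measurable multiplier_fun_bound f] H[OF f] by simp
  moreover have "AE x in M. g x = of_real (h x)" by (intro AE_I2 assms)
  ultimately show "AE x in M. U (H f) x = mult_op g (U f) x"
    by eventually_elim (simp add: mult_op_def)
qed

section \<open>Spectral resolution, norm and spectrum\<close>

definition level_indicator :: "real set \<Rightarrow> 'a \<Rightarrow> complex" where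
  "level_indicator A = (\<lambda>x. of_real (indicator A (h x)))"

definition pvm :: "real set \<Rightarrow> (nat \<Rightarrow> complex) \<Rightarrow> (nat \<Rightarrow> complex)" where
  "pvm A = mult_conj (level_indicator A)"

lemma level_indicator_measurable: "A \<in> sets borel \<Longrightarrow> level_indicator A \<in> borel_measurable M"
proof -
  assume "A \<in> sets borel"
  hence "(\<lambda>x. indicator A (h x) :: real) \<in> borel_measurable M"
    by (intro measurable_compose[OF h borel_measurable_indicator])
  thus ?thesis unfolding level_indicator_def by measurable
qed

lemma level_indicator_bound: "AE x in M. cmod (level_indicator A x) \<le> 1"
  unfolding level_indicator_def by (intro AE_I2) (simp add: indicator_def)

lemma pvm_inner:
  assumes "A \<in> sets borel" "f \<in> L2 ell2_measure" "g \<in> L2 ell2_measure"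
  shows "L2_inner ell2_measure f (pvm A g) = (LINT x|M. level_indicator A x * (cnj (U f x) * U g x))"
  unfolding pvm_def by (rule mult_conj_inner[OF level_indicator_measurable[OF assms(1)] level_indicator_bound assms(2,3)])

lemma pvm_projection_valued: "projection_valued_measure ell2_measure pvm"
  unfolding projection_valued_measure_def
proof (intro conjI ballI allI impI)
  fix A :: "real set" assume A: "A \<in> sets borel"
  note lm = level_indicator_measurable[OF A] level_indicator_bound[of A]
  show "L2_bounded_op ell2_measure (pvm A)" unfolding pvm_def by (rule mult_conj_bounded[OF lm])
  fix f assume f: "f \<in> L2 ell2_measure"
  have "pvm A (pvm A f) = V (\<lambda>x. level_indicator A x * (level_indicator A x * U f x))"
    unfolding pvm_def mult_conj_def[of _ f] by (intro mult_conj_V[OF lm] mult_L2[OF lm] U_mem f)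
  also have "(\<lambda>x. level_indicator A x * (level_indicator A x * U f x)) = (\<lambda>x. level_indicator A x * U f x)"
    by (simp add: level_indicator_def indicator_def fun_eq_iff)
  finally show "AE x in ell2_measure. pvm A (pvm A f) x = pvm A f x"
    by (simp add: pvm_def mult_conj_def)
  fix g assume g: "g \<in> L2 ell2_measure"
  have "L2_inner ell2_measure (pvm A f) g = cnj (L2_inner ell2_measure g (pvm A f))"
    by (rule L2_inner_cnj[symmetric])
  also have "\<dots> = (LINT x|M. cnj (level_indicator A x * (cnj (U g x) * U f x)))"
    unfolding pvm_inner[OF A g f] by (rule Bochner_Integration.integral_cnj[symmetric])
  also have "\<dots> = L2_inner ell2_measure f (pvm A g)"
    unfolding pvm_inner[OF A f g] by (simp add: level_indicator_def mult_ac)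
  finally show "L2_inner ell2_measure (pvm A f) g = L2_inner ell2_measure f (pvm A g)" .
next
  fix f assume f: "f \<in> L2 ell2_measure"
  have "level_indicator UNIV = (\<lambda>x. 1)" by (simp add: level_indicator_def)
  thus "AE x in ell2_measure. pvm UNIV f x = f x" by (simp add: pvm_def mult_conj_def VU f)
next
  fix A :: "nat \<Rightarrow> real set" and f g
  assume A: "range A \<subseteq> sets borel" and disj: "disjoint_family A" and f: "f \<in> L2 ell2_measure" and g: "g \<in> L2 ell2_measure"
  let ?k = "\<lambda>x. cnj (U f x) * U g x"
  have Ai: "A i \<in> sets borel" for i using A by auto
  have UA: "(\<Union>i. A i) \<in> sets borel" using A by auto
  have k: "integrable M ?k" by (intro L2_inner_integrable U_mem f g)
  hence [measurable]: "?k \<in> borel_measurable M" by simp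
  have [measurable]: "level_indicator (A i) \<in> borel_measurable M" "level_indicator (\<Union>i. A i) \<in> borel_measurable M" for i
    using level_indicator_measurable[OF Ai] level_indicator_measurable[OF UA] by auto
  have ind: "(\<lambda>i. indicator (A i) y :: real) sums indicator (\<Union>i. A i) y" for y
    using disj by (intro indicator_sums) (auto simp: disjoint_family_on_def)
  \<comment> \<open>Countable additivity by dominated convergence: partial sums of indicators of
    disjoint sets stay below 1, so |?k| dominates.\<close>
  have "(\<lambda>n. LINT x|M. (\<Sum>i<n. level_indicator (A i) x) * ?k x) \<longlonglongrightarrow> (LINT x|M. level_indicator (\<Union>i. A i) x * ?k x)"
  proof (rule integral_dominated_convergence)
    show "integrable M (\<lambda>x. norm (?k x))" using k by (rule integrable_norm)
    show "AE x in M. (\<lambda>n. (\<Sum>i<n. level_indicator (A i) x) * ?k x) \<longlonglongrightarrow> level_indicator (\<Union>i. A i) x * ?k x"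
    proof (rule AE_I2, rule tendsto_mult[OF _ tendsto_const])
      fix x
      have "(\<lambda>i. complex_of_real (indicator (A i) (h x))) sums of_real (indicator (\<Union>i. A i) (h x))"
        using ind by (rule sums_of_real)
      thus "(\<lambda>n. \<Sum>i<n. level_indicator (A i) x) \<longlonglongrightarrow> level_indicator (\<Union>i. A i) x"
        by (simp add: sums_def level_indicator_def)
    qed
    fix n
    show "AE x in M. norm ((\<Sum>i<n. level_indicator (A i) x) * ?k x) \<le> norm (?k x)"
    proof (rule AE_I2)
      fix x
      have "(\<Sum>i<n. indicator (A i) (h x) :: real) \<le> indicator (\<Union>i. A i) (h x)"
        using sum_le_suminf[OF sums_summable[OF ind[of "h x"]], of "{..<n}"] sums_unique[OF ind[of "h x"]] by simp
      also have "\<dots> \<le> (1::real)" by (simp add: indicator_def)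
      finally have "(\<Sum>i<n. indicator (A i) (h x) :: real) \<le> 1" .
      moreover have "(\<Sum>i<n. level_indicator (A i) x) = of_real (\<Sum>i<n. indicator (A i) (h x))"
        by (simp add: level_indicator_def)
      moreover have "0 \<le> (\<Sum>i<n. indicator (A i) (h x) :: real)" by (intro sum_nonneg) simp
      ultimately have "norm (\<Sum>i<n. level_indicator (A i) x) \<le> 1" by (simp only: norm_of_real abs_of_nonneg)
      thus "norm ((\<Sum>i<n. level_indicator (A i) x) * ?k x) \<le> norm (?k x)"
        unfolding norm_mult by (intro mult_left_le_one_le) auto
    qed
  qed measurable
  also have "(\<lambda>n. LINT x|M. (\<Sum>i<n. level_indicator (A i) x) * ?k x) = (\<lambda>n. \<Sum>i<n. LINT x|M. level_indicator (A i) x * ?k x)"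
  proof
    fix n
    have "integrable M (\<lambda>x. level_indicator (A i) x * ?k x)" for i
    proof (rule Bochner_Integration.integrable_bound[OF k])
      show "AE x in M. norm (level_indicator (A i) x * ?k x) \<le> norm (?k x)"
        using level_indicator_bound[of "A i"]
        by eventually_elim (simp add: norm_mult mult_left_le_one_le)
    qed measurable
    thus "(LINT x|M. (\<Sum>i<n. level_indicator (A i) x) * ?k x) = (\<Sum>i<n. LINT x|M. level_indicator (A i) x * ?k x)"
      unfolding sum_distrib_right by (intro Bochner_Integration.integral_sum)
  qed
  finally show "(\<lambda>i. L2_inner ell2_measure f (pvm (A i) g)) sums L2_inner ell2_measure f (pvm (\<Union>i. A i) g)"
    unfolding sums_def pvm_inner[OF Ai f g] pvm_inner[OF UA f g] .
qed

text \<open>Reduces spectral integrals and absolute continuity to statements about h on M: U carries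
  f to a function with squared modulus the density of the distribution of h.\<close>

lemma spectral_measure_pvm:
  assumes f: "f \<in> L2 ell2_measure"
  shows "spectral_measure_at ell2_measure pvm f = distr (density M (\<lambda>x. ennreal ((cmod (U f x))\<^sup>2))) borel h"
proof -
  let ?D = "distr (density M (\<lambda>x. ennreal ((cmod (U f x))\<^sup>2))) borel h"
  have [measurable]: "U f \<in> borel_measurable M" by (rule L2D(1)[OF U_mem[OF f]])
  have eq: "ennreal (Re (L2_inner ell2_measure f (pvm A f))) = emeasure ?D A" if A: "A \<in> sets borel" for A
  proof -
    have "L2_inner ell2_measure f (pvm A f) = (LINT x|M. complex_of_real (indicator A (h x) * (cmod (U f x))\<^sup>2))"
      unfolding pvm_inner[OF A f f]
      by (intro Bochner_Integration.integral_cong refl)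
         (simp only: level_indicator_def of_real_mult complex_norm_square mult.commute)
    hence "Re (L2_inner ell2_measure f (pvm A f)) = (LINT x|M. indicator A (h x) * (cmod (U f x))\<^sup>2)"
      by (simp only: integral_complex_of_real Re_complex_of_real)
    also have "ennreal \<dots> = (\<integral>\<^sup>+x. ennreal (indicator A (h x) * (cmod (U f x))\<^sup>2) \<partial>M)"
    proof (rule nn_integral_eq_integral[symmetric])
      have [measurable]: "(\<lambda>x. indicator A (h x) :: real) \<in> borel_measurable M"
        by (rule measurable_compose[OF h borel_measurable_indicator[OF A]])
      have m: "(\<lambda>x. indicator A (h x) * (cmod (U f x))\<^sup>2) \<in> borel_measurable M" by measurable
      show "integrable M (\<lambda>x. indicator A (h x) * (cmod (U f x))\<^sup>2)"
        by (rule Bochner_Integration.integrable_bound[OF L2D(2)[OF U_mem[OF f]] m]) (auto simp: indicator_def)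
    qed (auto simp: indicator_def)
    also have "\<dots> = (\<integral>\<^sup>+x. ennreal ((cmod (U f x))\<^sup>2) * indicator (h -` A \<inter> space M) x \<partial>M)"
      by (intro nn_integral_cong) (auto simp: indicator_def)
    also have "\<dots> = emeasure (density M (\<lambda>x. ennreal ((cmod (U f x))\<^sup>2))) (h -` A \<inter> space M)"
    proof (rule emeasure_density[symmetric])
      show "h -` A \<inter> space M \<in> sets M" by (rule measurable_sets[OF h A])
    qed measurable
    also have "\<dots> = emeasure ?D A"
    proof -
      have "h \<in> measurable (density M (\<lambda>x. ennreal ((cmod (U f x))\<^sup>2))) borel" using h by simp
      from emeasure_distr[OF this A] show ?thesis by simp
    qed
    finally show ?thesis .
  qed
  have "spectral_measure_at ell2_measure pvm f = measure_of UNIV (sets borel) (emeasure ?D)"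
    unfolding spectral_measure_at_def
    by (rule measure_of_eq) (auto simp: eq sets.sigma_sets_eq[of borel, simplified])
  also have "\<dots> = ?D" using measure_of_of_measure[of ?D] by simp
  finally show ?thesis .
qed

lemma spectral_resolution_pvm: "spectral_resolution ell2_measure H pvm"
  unfolding spectral_resolution_def
proof (intro conjI ballI pvm_projection_valued)
  fix f assume f: "f \<in> L2 ell2_measure"
  have [measurable]: "U f \<in> borel_measurable M" by (rule L2D(1)[OF U_mem[OF f]])
  let ?p = "\<lambda>x. (cmod (U f x))\<^sup>2"
  have int: "integrable M (\<lambda>x. ?p x * h x)"
  proof (rule Bochner_Integration.integrable_bound)
    show "integrable M (\<lambda>x. B * ?p x)" by (intro integrable_mult_right L2D(2)[OF U_mem[OF f]])
    show "AE x in M. norm (?p x * h x) \<le> norm (B * ?p x)"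
    proof (rule AE_I2)
      fix x assume "x \<in> space M"
      hence "\<bar>h x\<bar> \<le> \<bar>B\<bar>" using hB[of x] by linarith
      thus "norm (?p x * h x) \<le> norm (B * ?p x)" by (simp add: abs_mult mult.commute mult_right_mono)
    qed
  qed measurable
  show "integrable (spectral_measure_at ell2_measure pvm f) (\<lambda>t. t)"
    unfolding spectral_measure_pvm[OF f] using int
    by (subst integrable_distr_eq) (auto simp: integrable_density)
  have "L2_inner ell2_measure f (H f) = (LINT x|M. complex_of_real (?p x * h x))"
    unfolding H[OF f] mult_conj_inner[OF multiplier_fun_measurable multiplier_fun_bound f f]
    by (intro Bochner_Integration.integral_cong refl) (simp only: of_real_mult complex_norm_square mult_ac)
  also have "\<dots> = of_real (LINT x|M. ?p x * h x)" by (rule integral_complex_of_real)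
  also have "(LINT x|M. ?p x * h x) = (LINT t|spectral_measure_at ell2_measure pvm f. t)"
    unfolding spectral_measure_pvm[OF f]
    by (subst integral_distr) (auto simp: integral_density)
  finally show "L2_inner ell2_measure f (H f) = of_real (LINT t|spectral_measure_at ell2_measure pvm f. t)" .
qed

text \<open>A Lebesgue null set pulls back under h to a null set of M, hence to one of the measure
  with density |U f|^2, whose image is the spectral measure of f.\<close>

lemma mult_conj_ac_subspace:
  assumes ac: "\<And>A. A \<in> null_sets lborel \<Longrightarrow> h -` A \<inter> space M \<in> null_sets M"
  shows "ac_subspace ell2_measure H = L2 ell2_measure"
proof -
  have "absolutely_continuous lborel (spectral_measure_at ell2_measure pvm f)" if f: "f \<in> L2 ell2_measure" for f
    unfolding absolutely_continuous_def spectral_measure_pvm[OF f]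
  proof
    fix A :: "real set" assume A: "A \<in> null_sets lborel"
    have [measurable]: "U f \<in> borel_measurable M" by (rule L2D(1)[OF U_mem[OF f]])
    have Ab: "A \<in> sets borel" using A by (auto simp: null_sets_def)
    have "h -` A \<inter> space M \<in> null_sets (density M (\<lambda>x. ennreal ((cmod (U f x))\<^sup>2)))"
      using absolutely_continuousI_density[of "\<lambda>x. ennreal ((cmod (U f x))\<^sup>2)" M] ac[OF A]
      by (auto simp: absolutely_continuous_def)
    thus "A \<in> null_sets (distr (density M (\<lambda>x. ennreal ((cmod (U f x))\<^sup>2))) borel h)"
      using Ab by (subst null_sets_distr_iff) auto
  qed
  thus ?thesis unfolding ac_subspace_def using spectral_resolution_pvm by blast
qed

text \<open>The upper bound is pointwise. For the lower one the normalised indicator of the set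
  where |h| is within \<epsilon> of B serves as test function.\<close>

lemma mult_conj_opnorm:
  assumes ess: "\<And>\<epsilon>. \<epsilon> > 0 \<Longrightarrow> measure M {x \<in> space M. \<bar>\<bar>h x\<bar> - B\<bar> < \<epsilon>} > 0" and B0: "0 \<le> B"
  shows "L2_opnorm ell2_measure H = B"
  unfolding L2_opnorm_def
proof (rule cSup_eq_non_empty)
  have z: "(\<lambda>x. 0) \<in> {f \<in> L2 ell2_measure. L2_norm ell2_measure f \<le> 1}" by (simp add: L2_norm_def)
  thus "(\<lambda>f. L2_norm ell2_measure (H f)) ` {f \<in> L2 ell2_measure. L2_norm ell2_measure f \<le> 1} \<noteq> {}" by blast
  show "y \<le> B" if yin: "y \<in> (\<lambda>f. L2_norm ell2_measure (H f)) ` {f \<in> L2 ell2_measure. L2_norm ell2_measure f \<le> 1}" for y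
  proof -
    obtain f where f: "f \<in> L2 ell2_measure" "L2_norm ell2_measure f \<le> 1" "y = L2_norm ell2_measure (H f)" using yin by blast
    have "y \<le> B * L2_norm ell2_measure f"
      unfolding f(3) H[OF f(1)] by (rule mult_conj_norm_le[OF multiplier_fun_measurable multiplier_fun_bound f(1) B0])
    also have "\<dots> \<le> B * 1" using B0 f(2) by (intro mult_left_mono)
    finally show ?thesis by simp
  qed
  fix y assume y: "\<And>z. z \<in> (\<lambda>f. L2_norm ell2_measure (H f)) ` {f \<in> L2 ell2_measure. L2_norm ell2_measure f \<le> 1} \<Longrightarrow> z \<le> y"
  interpret finite_measure M by (rule fin)
  have y0: "0 \<le> y" using y[OF imageI[OF z]] L2_norm_nonneg order_trans by blast
  show "B \<le> y"
  proof (rule field_le_epsilon)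
    fix \<epsilon> :: real assume \<epsilon>: "\<epsilon> > 0"
    show "B \<le> y + \<epsilon>"
    \<comment> \<open>The squares below can be compared only if B - \<epsilon> is nonnegative;
      otherwise the claim is trivial.\<close>
    proof (cases "B \<le> \<epsilon>")
      case False
      define A where "A = {x \<in> space M. \<bar>\<bar>h x\<bar> - B\<bar> < \<epsilon>}"
      have A [measurable]: "A \<in> sets M" unfolding A_def by measurable
      define g :: "'a \<Rightarrow> complex" where "g = (\<lambda>x. of_real (indicator A x / sqrt (measure M A)))"
      have mA: "measure M A > 0" using ess[OF \<epsilon>] by (simp add: A_def)
      have g2: "(cmod (g x))\<^sup>2 = indicator A x / measure M A" for x
        using mA by (simp add: g_def norm_divide power_divide indicator_def)
      have g: "g \<in> L2 M"
        unfolding L2_def mem_Collect_eq g2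
      proof
        show "g \<in> borel_measurable M" unfolding g_def by measurable
        show "integrable M (\<lambda>x. indicator A x / measure M A)"
          by (intro Bochner_Integration.integrable_divide integrable_indicator_real A)
      qed
      have ng: "L2_norm M g = 1"
        unfolding L2_norm_def g2 using mA A by simp
      have "(B - \<epsilon>)\<^sup>2 * (LINT x|M. (cmod (g x))\<^sup>2) = (LINT x|M. (B - \<epsilon>)\<^sup>2 * (cmod (g x))\<^sup>2)" by simp
      also have "\<dots> \<le> (LINT x|M. (cmod (of_real (h x) * g x))\<^sup>2)"
      proof (rule integral_mono)
        show "integrable M (\<lambda>x. (B - \<epsilon>)\<^sup>2 * (cmod (g x))\<^sup>2)" by (intro integrable_mult_right L2D(2)[OF g])
        show "integrable M (\<lambda>x. (cmod (of_real (h x) * g x))\<^sup>2)" by (rule L2D(2)[OF multiplier_fun_L2[OF g]])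
        fix x
        show "(B - \<epsilon>)\<^sup>2 * (cmod (g x))\<^sup>2 \<le> (cmod (of_real (h x) * g x))\<^sup>2"
        proof (cases "x \<in> A")
          case True
          hence "B - \<epsilon> \<le> \<bar>h x\<bar>" by (auto simp: A_def)
          hence "(B - \<epsilon>)\<^sup>2 \<le> \<bar>h x\<bar>\<^sup>2" using False by (intro power_mono) auto
          thus ?thesis by (simp add: norm_mult power_mult_distrib mult_right_mono)
        qed (simp add: g_def)
      qed
      finally have "(B - \<epsilon>)\<^sup>2 * (L2_norm M g)\<^sup>2 \<le> (L2_norm M (\<lambda>x. of_real (h x) * g x))\<^sup>2"
        by (simp only: L2_norm_sq)
      hence sq: "(B - \<epsilon>)\<^sup>2 \<le> (L2_norm M (\<lambda>x. of_real (h x) * g x))\<^sup>2"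
        unfolding ng by simp
      have "B - \<epsilon> \<le> L2_norm M (\<lambda>x. of_real (h x) * g x)"
        by (rule power2_le_imp_le[OF sq L2_norm_nonneg])
      also have "\<dots> = L2_norm ell2_measure (H (V g))" by (simp add: mult_conj_real_V g V_norm multiplier_fun_L2)
      also have "\<dots> \<le> y" by (intro y imageI) (simp add: V_mem V_norm g ng)
      finally show ?thesis by simp
    qed (use y0 in linarith)
  qed
qed

text \<open>For s in S the indicator of the set where h is close to s is an approximate
  eigenfunction, contradicting a bounded inverse. A point z outside the closed set S has a positive
  distance \<delta> from it, so multiplication by 1 / (h - z) is bounded and inverts.\<close>

lemma mult_conj_spectrum:
  assumes S: "closed S" and hS: "\<And>x. x \<in> space M \<Longrightarrow> h x \<in> S"
    and ess: "\<And>s \<epsilon>. s \<in> S \<Longrightarrow> \<epsilon> > 0 \<Longrightarrow> measure M {x \<in> space M. \<bar>h x - s\<bar> < \<epsilon>} > 0"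
  shows "L2_spectrum ell2_measure H = complex_of_real ` S"
proof (intro equalityI subsetI)
  fix z assume z: "z \<in> complex_of_real ` S"
  then obtain s where s: "s \<in> S" "z = of_real s" by blast
  show "z \<in> L2_spectrum ell2_measure H"
    unfolding L2_spectrum_def L2_spectrum_on_def mem_Collect_eq
  proof
    assume "\<exists>R. L2_bounded_linear ell2_measure (L2 ell2_measure) ell2_measure (L2 ell2_measure) R \<and>
            (\<forall>f\<in>L2 ell2_measure. AE x in ell2_measure. R (\<lambda>y. H f y - z * f y) x = f x) \<and>
            (\<forall>f\<in>L2 ell2_measure. AE x in ell2_measure. H (R f) x - z * R f x = f x)"
    then obtain R where R: "L2_bounded_linear ell2_measure (L2 ell2_measure) ell2_measure (L2 ell2_measure) R"
      and R': "\<forall>f\<in>L2 ell2_measure. AE x in ell2_measure. R (\<lambda>y. H f y - z * f y) x = f x" by blast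
    have inv: "R (\<lambda>y. H f y - z * f y) = f" if "f \<in> L2 ell2_measure" for f
      using bspec[OF R' that] unfolding ell2_AE by (intro ext) blast
    obtain C where C: "\<And>f. f \<in> L2 ell2_measure \<Longrightarrow> L2_norm ell2_measure (R f) \<le> C * L2_norm ell2_measure f"
      using R unfolding L2_bounded_linear_def by blast
    \<comment> \<open>Chosen so that the product of the bound of the inverse and the error of the
      approximate eigenfunction is below 1, whatever the sign of C.\<close>
    define \<epsilon> where "\<epsilon> = 1 / (2 * (\<bar>C\<bar> + 1))"
    have \<epsilon>: "\<epsilon> > 0" "\<bar>C\<bar> * \<epsilon> < 1" by (auto simp: \<epsilon>_def field_simps)
    interpret finite_measure M by (rule fin)
    define A where "A = {x \<in> space M. \<bar>h x - s\<bar> < \<epsilon>}"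
    have A [measurable]: "A \<in> sets M" unfolding A_def by measurable
    have mA: "measure M A > 0" using ess[OF s(1) \<epsilon>(1)] by (simp add: A_def)
    define g :: "'a \<Rightarrow> complex" where "g = (\<lambda>x. of_real (indicator A x))"
    have g2: "(cmod (g x))\<^sup>2 = indicator A x" for x by (simp add: g_def indicator_def)
    have g: "g \<in> L2 M"
      unfolding L2_def mem_Collect_eq g2 using integrable_indicator_real[OF A] by (auto simp: g_def)
    have ng: "L2_norm M g > 0" unfolding L2_norm_def g2 using mA A by simp
    define w where "w = (\<lambda>x. complex_of_real (indicator A x * (h x - s)))"
    have "L2_norm M (\<lambda>x. w x * g x) \<le> \<epsilon> * L2_norm M g"
    proof (rule L2_norm_mult_le[OF g])
      show "w \<in> borel_measurable M" unfolding w_def by measurable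
      show "AE x in M. cmod (w x) \<le> \<epsilon>" using \<epsilon> by (intro AE_I2) (auto simp: w_def A_def indicator_def simp flip: of_real_diff)
    qed (use \<epsilon> in auto)
    moreover have "(\<lambda>x. w x * g x) = (\<lambda>x. of_real (h x) * g x - z * g x)"
      by (auto simp: w_def g_def s indicator_def fun_eq_iff)
    moreover have "V (\<lambda>x. of_real (h x) * g x - z * g x) = (\<lambda>n. H (V g) n - z * V g n)"
      by (intro ext) (simp add: V_diff V_scale multiplier_fun_L2 g L2_scale mult_conj_real_V)
    ultimately have *: "L2_norm ell2_measure (\<lambda>n. H (V g) n - z * V g n) \<le> \<epsilon> * L2_norm M g"
      using V_norm[OF L2_minus[OF multiplier_fun_L2[OF g] L2_scale[OF g, of z]]] by simp
    have m: "(\<lambda>n. H (V g) n - z * V g n) \<in> L2 ell2_measure"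
      by (intro L2_minus L2_scale V_mem g) (simp add: mult_conj_real_V g V_mem multiplier_fun_L2)
    have "L2_norm M g = L2_norm ell2_measure (R (\<lambda>n. H (V g) n - z * V g n))"
      by (simp add: inv V_mem g V_norm)
    also have "\<dots> \<le> C * L2_norm ell2_measure (\<lambda>n. H (V g) n - z * V g n)" by (rule C[OF m])
    also have "\<dots> \<le> \<bar>C\<bar> * (\<epsilon> * L2_norm M g)" using * by (intro mult_mono) auto
    also have "\<dots> < L2_norm M g" using \<epsilon>(2) ng by simp
    finally show False by simp
  qed
next
  fix z assume z: "z \<in> L2_spectrum ell2_measure H"
  show "z \<in> complex_of_real ` S"
  proof (rule ccontr)
    assume nz: "z \<notin> complex_of_real ` S"
    have "closed (complex_of_real ` S)"
      by (rule closed_injective_linear_image[OF S]) (auto simp: inj_on_def linear_of_real)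
    hence "open (- complex_of_real ` S)" by (simp add: open_Compl)
    then obtain \<delta> where \<delta>: "\<delta> > 0" "ball z \<delta> \<subseteq> - complex_of_real ` S"
      using nz by (elim openE[of _ z]) auto
    have far: "cmod (of_real (h x) - z) \<ge> \<delta>" if "x \<in> space M" for x
    proof (rule ccontr)
      assume "\<not> \<delta> \<le> cmod (of_real (h x) - z)"
      hence "of_real (h x) \<in> ball z \<delta>" by (simp add: dist_norm norm_minus_commute)
      thus False using \<delta>(2) hS[OF that] by blast
    qed
    define w where "w = (\<lambda>x. 1 / (complex_of_real (h x) - z))"
    have w: "w \<in> borel_measurable M" unfolding w_def by measurable
    have wb: "AE x in M. cmod (w x) \<le> 1 / \<delta>"
    proof (rule AE_I2)
      fix x assume "x \<in> space M"
      from far[OF this] \<delta>(1) show "cmod (w x) \<le> 1 / \<delta>"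
        by (simp add: w_def norm_divide divide_le_eq_1 frac_le)
    qed
    have wz: "AE x in M. (of_real (h x) - z) * w x = 1"
    proof (rule AE_I2)
      fix x assume "x \<in> space M"
      from far[OF this] \<delta>(1) have "of_real (h x) - z \<noteq> 0" by auto
      thus "(of_real (h x) - z) * w x = 1" by (simp add: w_def)
    qed
    have "mult_conj w (\<lambda>y. H f y - z * f y) = f" and "H (mult_conj w f) n - z * mult_conj w f n = f n"
      if f: "f \<in> L2 ell2_measure" for f n
    proof -
      have Uf: "U f \<in> L2 M" by (rule U_mem[OF f])
      have 1: "(\<lambda>y. H f y - z * f y) = V (\<lambda>x. of_real (h x) * U f x - z * U f x)"
        using mult_conj_real_V[OF Uf] by (intro ext) (simp add: V_diff V_scale multiplier_fun_L2 Uf L2_scale VU f)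
      have "mult_conj w (\<lambda>y. H f y - z * f y) = V (\<lambda>x. w x * (of_real (h x) * U f x - z * U f x))"
        unfolding 1 by (intro mult_conj_V[OF w wb] L2_minus multiplier_fun_L2 L2_scale Uf)
      also have "\<dots> = V (U f)"
      proof (rule V_cong)
        show "AE x in M. w x * (of_real (h x) * U f x - z * U f x) = U f x"
          using wz
        proof eventually_elim
          case (elim x)
          have "w x * (of_real (h x) * U f x - z * U f x) = ((of_real (h x) - z) * w x) * U f x" by (simp add: algebra_simps)
          thus ?case unfolding elim by simp
        qed
      qed (intro mult_L2[OF w wb] L2_minus multiplier_fun_L2 L2_scale Uf)+
      finally show "mult_conj w (\<lambda>y. H f y - z * f y) = f" by (simp add: VU f)
      have wU: "(\<lambda>x. w x * U f x) \<in> L2 M" by (rule mult_L2[OF w wb Uf])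
      have "H (mult_conj w f) n - z * mult_conj w f n = V (\<lambda>x. of_real (h x) * (w x * U f x) - z * (w x * U f x)) n"
        unfolding mult_conj_def by (simp add: mult_conj_real_V wU V_diff V_scale multiplier_fun_L2 L2_scale)
      also have "V (\<lambda>x. of_real (h x) * (w x * U f x) - z * (w x * U f x)) = V (U f)"
      proof (rule V_cong)
        show "AE x in M. of_real (h x) * (w x * U f x) - z * (w x * U f x) = U f x"
          using wz
        proof eventually_elim
          case (elim x)
          have "of_real (h x) * (w x * U f x) - z * (w x * U f x) = ((of_real (h x) - z) * w x) * U f x" by (simp add: algebra_simps)
          thus ?case unfolding elim by simp
        qed
      qed (intro L2_minus multiplier_fun_L2 L2_scale wU Uf)+
      finally show "H (mult_conj w f) n - z * mult_conj w f n = f n" by (simp add: VU f)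
    qed
    moreover have "L2_bounded_linear ell2_measure (L2 ell2_measure) ell2_measure (L2 ell2_measure) (mult_conj w)"
      using mult_conj_bounded[OF w wb] by (simp only: L2_bounded_op_def)
    ultimately have "\<exists>R. L2_bounded_linear ell2_measure (L2 ell2_measure) ell2_measure (L2 ell2_measure) R \<and>
            (\<forall>f\<in>L2 ell2_measure. AE x in ell2_measure. R (\<lambda>y. H f y - z * f y) x = f x) \<and>
            (\<forall>f\<in>L2 ell2_measure. AE x in ell2_measure. H (R f) x - z * R f x = f x)"
      by (intro exI[of _ "mult_conj w"]) (simp only: ell2_AE, simp)
    thus False using z unfolding L2_spectrum_def L2_spectrum_on_def by blast
  qed
qed

text \<open>The cyclic vector is the image of the constant function 1: powers of H applied to it
  correspond to powers of h.\<close>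

lemma mult_conj_simple_spectrum:
  assumes dense: "\<And>f \<epsilon>. f \<in> L2 M \<Longrightarrow> \<epsilon> > 0 \<Longrightarrow> \<exists>n c. L2_norm M (\<lambda>x. f x - (\<Sum>k<n. c k * of_real (h x) ^ k)) < \<epsilon>"
  shows "simple_spectrum ell2_measure H"
  unfolding simple_spectrum_def
proof (intro bexI ballI allI impI)
  interpret finite_measure M by (rule fin)
  have one: "(\<lambda>x. 1) \<in> L2 M" by (rule L2_const)
  show "V (\<lambda>x. 1) \<in> L2 ell2_measure" by (rule V_mem[OF one])
  have hk: "(\<lambda>x. of_real (h x) ^ k) \<in> L2 M" for k
    by (induction k) (auto intro: multiplier_fun_L2 one)
  have pow: "(H ^^ k) (V (\<lambda>x. 1)) = V (\<lambda>x. of_real (h x) ^ k)" for k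
    by (induction k) (simp_all add: mult_conj_real_V hk)
  fix g and \<epsilon> :: real assume g: "g \<in> L2 ell2_measure" and "\<epsilon> > 0"
  from dense[OF U_mem[OF g] this(2)] obtain n c
    where nc: "L2_norm M (\<lambda>x. U g x - (\<Sum>k<n. c k * of_real (h x) ^ k)) < \<epsilon>" by blast
  have s: "(\<lambda>x. \<Sum>k<n. c k * of_real (h x) ^ k) \<in> L2 M" by (intro L2_sum L2_scale hk)
  have "(\<lambda>x. g x - (\<Sum>k<n. c k * (H ^^ k) (V (\<lambda>x. 1)) x)) = V (\<lambda>x. U g x - (\<Sum>k<n. c k * of_real (h x) ^ k))"
    using L2_bounded_linear_sum[OF L2_unitary_linear[OF V] hk, where N = n and c = c]
    by (intro ext) (simp add: V_diff[OF U_mem[OF g] s] VU g pow)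
  hence "L2_norm ell2_measure (\<lambda>x. g x - (\<Sum>k<n. c k * (H ^^ k) (V (\<lambda>x. 1)) x)) < \<epsilon>"
    using nc V_norm[OF L2_minus[OF U_mem[OF g] s]] by simp
  thus "\<exists>n c. L2_norm ell2_measure (\<lambda>x. g x - (\<Sum>k<n. c k * (H ^^ k) (V (\<lambda>x. 1)) x)) < \<epsilon>" by blast
qed

end

end

section \<open>Density of the polynomials in a monotone function\<close>

lemma L2_dominated_convergence:
  fixes f :: "'a \<Rightarrow> complex" and F :: "nat \<Rightarrow> 'a \<Rightarrow> complex" and w :: "'a \<Rightarrow> real"
  assumes F: "\<And>n. F n \<in> borel_measurable M" and f: "f \<in> borel_measurable M"
    and w: "integrable M (\<lambda>x. (w x)\<^sup>2)"
    and bF: "\<And>n. AE x in M. cmod (F n x) \<le> w x" and bf: "AE x in M. cmod (f x) \<le> w x"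
    and lim: "AE x in M. (\<lambda>n. F n x) \<longlonglongrightarrow> f x"
  shows "(\<lambda>n. L2_norm M (\<lambda>x. f x - F n x)) \<longlonglongrightarrow> 0"
proof -
  note [measurable] = F f
  have "(\<lambda>n. LINT x|M. (cmod (f x - F n x))\<^sup>2) \<longlonglongrightarrow> (LINT x|M. 0)"
  proof (rule integral_dominated_convergence)
    show "integrable M (\<lambda>x. 4 * (w x)\<^sup>2)" by (intro integrable_mult_right w)
    show "AE x in M. (\<lambda>n. (cmod (f x - F n x))\<^sup>2) \<longlonglongrightarrow> 0"
      using lim
    proof eventually_elim
      case (elim x)
      have "(\<lambda>n. (cmod (f x - F n x))\<^sup>2) \<longlonglongrightarrow> (cmod (f x - f x))\<^sup>2" by (intro tendsto_intros elim)
      thus ?case by simp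
    qed
    fix n
    show "AE x in M. norm ((cmod (f x - F n x))\<^sup>2) \<le> 4 * (w x)\<^sup>2"
      using bF[of n] bf
    proof eventually_elim
      case (elim x)
      have "cmod (f x - F n x) \<le> 2 * w x" using norm_triangle_ineq4[of "f x" "F n x"] elim by linarith
      hence "(cmod (f x - F n x))\<^sup>2 \<le> (2 * w x)\<^sup>2" by (intro power_mono) auto
      thus ?case by (simp add: power_mult_distrib)
    qed
  qed measurable
  hence "(\<lambda>n. sqrt (LINT x|M. (cmod (f x - F n x))\<^sup>2)) \<longlonglongrightarrow> sqrt 0"
    by (intro tendsto_real_sqrt) simp
  thus ?thesis by (simp add: L2_norm_def)
qed

lemma L2_cong_space:
  assumes "\<And>x. x \<in> space M \<Longrightarrow> f x = g x" shows "f \<in> L2 M \<longleftrightarrow> g \<in> L2 M"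
proof -
  have "f \<in> borel_measurable M \<longleftrightarrow> g \<in> borel_measurable M" using assms by (rule measurable_cong)
  moreover have "integrable M (\<lambda>x. (cmod (f x))\<^sup>2) \<longleftrightarrow> integrable M (\<lambda>x. (cmod (g x))\<^sup>2)"
    using assms by (intro Bochner_Integration.integrable_cong) auto
  ultimately show ?thesis by (simp add: L2_def)
qed

lemma L2_norm_cong_space:
  assumes "\<And>x. x \<in> space M \<Longrightarrow> f x = g x" shows "L2_norm M f = L2_norm M g"
proof -
  have "(LINT x|M. (cmod (f x))\<^sup>2) = (LINT x|M. (cmod (g x))\<^sup>2)"
    using assms by (intro Bochner_Integration.integral_cong) auto
  thus ?thesis by (simp add: L2_norm_def)
qed

definition poly_closure :: "'a measure \<Rightarrow> ('a \<Rightarrow> real) \<Rightarrow> ('a \<Rightarrow> complex) set" where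
  "poly_closure M \<phi> = {f \<in> L2 M. \<forall>\<epsilon>>0. \<exists>p. L2_norm M (\<lambda>x. f x - poly p (of_real (\<phi> x))) < \<epsilon>}"

context finite_measure
begin

context
  fixes \<phi> :: "'a \<Rightarrow> real" and B :: real
  assumes phi [measurable]: "\<phi> \<in> borel_measurable M" and phiB: "\<And>x. x \<in> space M \<Longrightarrow> \<bar>\<phi> x\<bar> \<le> B"
begin

lemma L2_poly: "(\<lambda>x. poly p (complex_of_real (\<phi> x))) \<in> L2 M"
proof (induction p)
  case 0
  show ?case by simp
next
  case (pCons a p)
  have "(\<lambda>x. of_real (\<phi> x) * poly p (of_real (\<phi> x))) \<in> L2 M"
  proof (rule L2_mult_bounded[OF pCons(2)])
    show "(\<lambda>x. complex_of_real (\<phi> x)) \<in> borel_measurable M" by measurable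
    show "AE x in M. cmod (complex_of_real (\<phi> x)) \<le> B" using phiB by (intro AE_I2) simp
  qed
  from L2_add[OF L2_const[of a] this] show ?case by simp
qed

lemma poly_closure_L2: "f \<in> poly_closure M \<phi> \<Longrightarrow> f \<in> L2 M"
  by (simp add: poly_closure_def)

lemma poly_closureD: "f \<in> poly_closure M \<phi> \<Longrightarrow> \<epsilon> > 0 \<Longrightarrow> \<exists>p. L2_norm M (\<lambda>x. f x - poly p (of_real (\<phi> x))) < \<epsilon>"
  by (simp add: poly_closure_def)

lemma poly_closureI:
  assumes "f \<in> L2 M" "\<And>\<epsilon>. \<epsilon> > 0 \<Longrightarrow> \<exists>p. L2_norm M (\<lambda>x. f x - poly p (of_real (\<phi> x))) < \<epsilon>"
  shows "f \<in> poly_closure M \<phi>"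
  using assms by (simp add: poly_closure_def)

lemma poly_closure_poly: "(\<lambda>x. poly p (of_real (\<phi> x))) \<in> poly_closure M \<phi>"
  by (rule poly_closureI[OF L2_poly]) (auto intro!: exI[of _ p] simp: L2_norm_def)

lemma poly_closure_limit:
  assumes f: "f \<in> L2 M" and g: "\<And>n::nat. g n \<in> poly_closure M \<phi>" and lim: "(\<lambda>n. L2_norm M (\<lambda>x. f x - g n x)) \<longlonglongrightarrow> 0"
  shows "f \<in> poly_closure M \<phi>"
proof (rule poly_closureI[OF f])
  fix \<epsilon> :: real assume "\<epsilon> > 0"
  hence "\<forall>\<^sub>F n in sequentially. L2_norm M (\<lambda>x. f x - g n x) < \<epsilon> / 2"
    using lim by (intro order_tendstoD) auto
  then obtain n where n: "L2_norm M (\<lambda>x. f x - g n x) < \<epsilon> / 2" by (auto simp: eventually_sequentially)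
  obtain p where p: "L2_norm M (\<lambda>x. g n x - poly p (of_real (\<phi> x))) < \<epsilon> / 2"
    using poly_closureD[OF g[of n], of "\<epsilon> / 2"] \<open>\<epsilon> > 0\<close> by auto
  have "L2_norm M (\<lambda>x. f x - poly p (of_real (\<phi> x))) < \<epsilon>"
    using L2_norm_triangle3[OF f poly_closure_L2[OF g[of n]] L2_poly[of p]] n p by linarith
  thus "\<exists>p. L2_norm M (\<lambda>x. f x - poly p (of_real (\<phi> x))) < \<epsilon>" by blast
qed

lemma poly_closure_add:
  assumes f: "f \<in> poly_closure M \<phi>" and g: "g \<in> poly_closure M \<phi>"
  shows "(\<lambda>x. f x + g x) \<in> poly_closure M \<phi>"
proof (rule poly_closureI)
  show "(\<lambda>x. f x + g x) \<in> L2 M" by (intro L2_add poly_closure_L2 f g)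
  fix \<epsilon> :: real assume "\<epsilon> > 0"
  obtain p where p: "L2_norm M (\<lambda>x. f x - poly p (of_real (\<phi> x))) < \<epsilon> / 2"
    using poly_closureD[OF f, of "\<epsilon> / 2"] \<open>\<epsilon> > 0\<close> by auto
  obtain r where r: "L2_norm M (\<lambda>x. g x - poly r (of_real (\<phi> x))) < \<epsilon> / 2"
    using poly_closureD[OF g, of "\<epsilon> / 2"] \<open>\<epsilon> > 0\<close> by auto
  have "(\<lambda>x. (f x - poly p (of_real (\<phi> x))) + (g x - poly r (of_real (\<phi> x)))) = (\<lambda>x. f x + g x - poly (p + r) (of_real (\<phi> x)))"
    by (simp add: fun_eq_iff)
  hence "L2_norm M (\<lambda>x. f x + g x - poly (p + r) (of_real (\<phi> x))) < \<epsilon>"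
    using L2_norm_triangle[OF L2_minus[OF poly_closure_L2[OF f] L2_poly[of p]] L2_minus[OF poly_closure_L2[OF g] L2_poly[of r]]] p r
    by simp
  thus "\<exists>p. L2_norm M (\<lambda>x. f x + g x - poly p (of_real (\<phi> x))) < \<epsilon>" by blast
qed

lemma poly_closure_scale:
  assumes f: "f \<in> poly_closure M \<phi>"
  shows "(\<lambda>x. c * f x) \<in> poly_closure M \<phi>"
proof (rule poly_closureI)
  show "(\<lambda>x. c * f x) \<in> L2 M" by (intro L2_scale poly_closure_L2 f)
  fix \<epsilon> :: real assume \<epsilon>: "\<epsilon> > 0"
  hence "\<epsilon> / (cmod c + 1) > 0" by (intro divide_pos_pos) (auto intro: add_nonneg_pos)
  then obtain p where p: "L2_norm M (\<lambda>x. f x - poly p (of_real (\<phi> x))) < \<epsilon> / (cmod c + 1)"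
    using poly_closureD[OF f] by blast
  have c1: "cmod c + 1 > 0" by (intro add_nonneg_pos) auto
  have "(\<lambda>x. c * f x - poly (smult c p) (of_real (\<phi> x))) = (\<lambda>x. c * (f x - poly p (of_real (\<phi> x))))"
    by (simp add: fun_eq_iff right_diff_distrib)
  hence "L2_norm M (\<lambda>x. c * f x - poly (smult c p) (of_real (\<phi> x))) = cmod c * L2_norm M (\<lambda>x. f x - poly p (of_real (\<phi> x)))"
    by (simp only: L2_norm_scale)
  also have "\<dots> \<le> cmod c * (\<epsilon> / (cmod c + 1))" using p by (intro mult_left_mono) auto
  also have "\<dots> < (cmod c + 1) * (\<epsilon> / (cmod c + 1))"
    using \<epsilon> c1 by (intro mult_strict_right_mono) auto
  also have "\<dots> = \<epsilon>" using c1 by simp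
  finally show "\<exists>p. L2_norm M (\<lambda>x. c * f x - poly p (of_real (\<phi> x))) < \<epsilon>" by blast
qed

lemma poly_closure_zero: "(\<lambda>x. 0) \<in> poly_closure M \<phi>"
  using poly_closure_poly[of 0] by simp

lemma poly_closure_one: "(\<lambda>x. 1) \<in> poly_closure M \<phi>"
  using poly_closure_poly[of 1] by simp

lemma poly_closure_sum: "(\<And>i. i \<in> I \<Longrightarrow> f i \<in> poly_closure M \<phi>) \<Longrightarrow> (\<lambda>x. \<Sum>i\<in>I. f i x) \<in> poly_closure M \<phi>"
  by (induction I rule: infinite_finite_induct) (auto intro: poly_closure_add poly_closure_zero)

lemma poly_closure_cong:
  assumes "f \<in> poly_closure M \<phi>" "\<And>x. x \<in> space M \<Longrightarrow> f x = g x" shows "g \<in> poly_closure M \<phi>"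
proof (rule poly_closureI)
  show "g \<in> L2 M" using poly_closure_L2[OF assms(1)] L2_cong_space[of M f g] assms(2) by blast
  fix \<epsilon> :: real assume "\<epsilon> > 0"
  then obtain p where p: "L2_norm M (\<lambda>x. f x - poly p (of_real (\<phi> x))) < \<epsilon>" using poly_closureD[OF assms(1)] by blast
  have "L2_norm M (\<lambda>x. f x - poly p (of_real (\<phi> x))) = L2_norm M (\<lambda>x. g x - poly p (of_real (\<phi> x)))"
    by (rule L2_norm_cong_space) (simp add: assms(2))
  thus "\<exists>p. L2_norm M (\<lambda>x. g x - poly p (of_real (\<phi> x))) < \<epsilon>" using p by auto
qed

text \<open>Weierstrass approximation on [-B, B]; uniform closeness implies closeness in norm since
  the measure is finite.\<close>

lemma poly_closure_continuous:
  fixes u :: "real \<Rightarrow> real"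
  assumes u: "continuous_on UNIV u"
  shows "(\<lambda>x. of_real (u (\<phi> x))) \<in> poly_closure M \<phi>"
proof (rule poly_closureI)
  have um [measurable]: "(\<lambda>x. u (\<phi> x)) \<in> borel_measurable M"
    by (rule measurable_compose[OF phi borel_measurable_continuous_onI[OF u]])
  have "compact (u ` {-B..B})" by (intro compact_continuous_image continuous_on_subset[OF u]) auto
  then obtain C where C: "\<And>t. t \<in> {-B..B} \<Longrightarrow> \<bar>u t\<bar> \<le> C"
    by (metis bounded_iff compact_imp_bounded imageI real_norm_def)
  have "(\<lambda>x. complex_of_real (u (\<phi> x)) * 1) \<in> L2 M"
  proof (rule L2_mult_bounded[OF L2_const])
    show "(\<lambda>x. complex_of_real (u (\<phi> x))) \<in> borel_measurable M" by measurable
    show "AE x in M. cmod (complex_of_real (u (\<phi> x))) \<le> C"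
    proof (rule AE_I2)
      fix x assume "x \<in> space M"
      hence "\<phi> x \<in> {-B..B}" using phiB[of x] by auto
      thus "cmod (complex_of_real (u (\<phi> x))) \<le> C" using C by simp
    qed
  qed
  thus uL: "(\<lambda>x. complex_of_real (u (\<phi> x))) \<in> L2 M" by simp
  fix \<epsilon> :: real assume \<epsilon>: "\<epsilon> > 0"
  \<comment> \<open>The norm of 1 converts the uniform error into the L2 error. The divisor N + 1 is
    positive even for the zero measure and makes the final inequality strict.\<close>
  define N where "N = L2_norm M (\<lambda>x. 1)"
  have N1: "N + 1 > 0" unfolding N_def by (intro add_nonneg_pos) auto
  hence e: "\<epsilon> / (N + 1) > 0" using \<epsilon> by simp
  obtain g where g: "real_polynomial_function g" "\<And>t. t \<in> {-B..B} \<Longrightarrow> \<bar>u t - g t\<bar> < \<epsilon> / (N + 1)"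
    using Stone_Weierstrass_real_polynomial_function[of "{-B..B}" u "\<epsilon> / (N + 1)"] e continuous_on_subset[OF u]
    by (metis compact_Icc subset_UNIV)
  obtain a n where gn: "g = (\<lambda>x. \<Sum>i\<le>n::nat. a i * x ^ i)"
    using real_polynomial_function_imp_sum[OF g(1)] by blast
  define p where "p = (\<Sum>i\<le>n. monom (complex_of_real (a i)) i)"
  have p: "poly p (of_real t) = of_real (g t)" for t
    by (simp add: p_def gn poly_sum poly_monom)
  have "L2_norm M (\<lambda>x. of_real (u (\<phi> x)) - poly p (of_real (\<phi> x))) = L2_norm M (\<lambda>x. (of_real (u (\<phi> x)) - poly p (of_real (\<phi> x))) * 1)"
    by simp
  also have "\<dots> \<le> \<epsilon> / (N + 1) * L2_norm M (\<lambda>x. 1)"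
  proof (rule L2_norm_mult_le[OF L2_const])
    show "(\<lambda>x. of_real (u (\<phi> x)) - poly p (complex_of_real (\<phi> x))) \<in> borel_measurable M"
      by (rule L2D(1)[OF L2_minus[OF uL L2_poly]])
    show "AE x in M. cmod (of_real (u (\<phi> x)) - poly p (of_real (\<phi> x))) \<le> \<epsilon> / (N + 1)"
    proof (rule AE_I2)
      fix x assume "x \<in> space M"
      hence "\<phi> x \<in> {-B..B}" using phiB[of x] by auto
      thus "cmod (of_real (u (\<phi> x)) - poly p (of_real (\<phi> x))) \<le> \<epsilon> / (N + 1)"
        using g(2)[of "\<phi> x"] unfolding p of_real_diff[symmetric] norm_of_real by linarith
    qed
  qed (use e in linarith)
  also have "\<dots> < \<epsilon> / (N + 1) * (N + 1)" unfolding N_def[symmetric] using e by (intro mult_strict_left_mono) auto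
  also have "\<dots> = \<epsilon>" using N1 by simp
  finally show "\<exists>p. L2_norm M (\<lambda>x. of_real (u (\<phi> x)) - poly p (of_real (\<phi> x))) < \<epsilon>" by blast
qed

lemma poly_closure_indicator_atMost:
  "(\<lambda>x. complex_of_real (indicator {..t} (\<phi> x))) \<in> poly_closure M \<phi>"
proof -
  \<comment> \<open>For positive j a ramp that is 1 up to t and 0 from t + 1/j on, so these
    continuous functions tend pointwise to the indicator of the half-line.\<close>
  define u where "u = (\<lambda>(j::nat) s. max 0 (min 1 (1 - real j * (s - t))))"
  have uc: "(\<lambda>x. complex_of_real (u j (\<phi> x))) \<in> poly_closure M \<phi>" for j
    unfolding u_def by (intro poly_closure_continuous continuous_intros)
  have [measurable]: "(\<lambda>x. indicator {..t} (\<phi> x) :: real) \<in> borel_measurable M"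
    by (rule measurable_compose[OF phi borel_measurable_indicator]) simp
  have m: "(\<lambda>x. complex_of_real (indicator {..t} (\<phi> x))) \<in> borel_measurable M" by measurable
  have b: "cmod (complex_of_real (indicator {..t} (\<phi> x))) \<le> 1" for x by (simp add: indicator_def)
  have "(\<lambda>x. complex_of_real (indicator {..t} (\<phi> x)) * 1) \<in> L2 M"
    by (rule L2_mult_bounded[OF L2_const m, of 1]) (rule AE_I2, rule b)
  hence L: "(\<lambda>x. complex_of_real (indicator {..t} (\<phi> x))) \<in> L2 M" by simp
  show ?thesis
  proof (rule poly_closure_limit[OF L uc])
    show "(\<lambda>j. L2_norm M (\<lambda>x. of_real (indicator {..t} (\<phi> x)) - of_real (u j (\<phi> x)))) \<longlonglongrightarrow> 0"
    proof (rule L2_dominated_convergence[where w = "\<lambda>_. 1"])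
      show "(\<lambda>x. complex_of_real (u j (\<phi> x))) \<in> borel_measurable M" for j
        by (rule L2D(1)[OF poly_closure_L2[OF uc]])
      show "AE x in M. cmod (complex_of_real (u j (\<phi> x))) \<le> 1" for j
        by (intro AE_I2) (simp add: u_def)
      show "AE x in M. (\<lambda>j. complex_of_real (u j (\<phi> x))) \<longlonglongrightarrow> of_real (indicator {..t} (\<phi> x))"
      proof (intro AE_I2 tendsto_of_real)
        fix x
        show "(\<lambda>j. u j (\<phi> x)) \<longlonglongrightarrow> indicator {..t} (\<phi> x)"
        proof (cases "\<phi> x \<le> t")
          case True
          have "u j (\<phi> x) = 1" for j
          proof -
            have "real j * (\<phi> x - t) \<le> 0" using True by (intro mult_nonneg_nonpos) auto
            thus ?thesis by (simp add: u_def)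
          qed
          thus ?thesis using True by simp
        next
          case False
          then obtain J where J: "1 < real J * (\<phi> x - t)" using reals_Archimedean3[of "\<phi> x - t"] by auto
          have "\<forall>\<^sub>F j in sequentially. u j (\<phi> x) = 0"
          proof (rule eventually_sequentiallyI[of J])
            fix j assume "J \<le> j"
            hence "real J * (\<phi> x - t) \<le> real j * (\<phi> x - t)" using False by (intro mult_right_mono) auto
            thus "u j (\<phi> x) = 0" using J by (simp add: u_def)
          qed
          thus ?thesis using False by (simp add: tendsto_eventually)
        qed
      qed
    qed (use m b in auto)
  qed
qed

text \<open>Dynkin's argument: the closure is stable under complements and, by dominated
  convergence, under countable disjoint unions.\<close>

lemma poly_closure_indicator_sigma:
  assumes G: "Int_stable G" "G \<subseteq> Pow (space M)" "sets M = sigma_sets (space M) G"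
    and basic: "\<And>A. A \<in> G \<Longrightarrow> (\<lambda>x. complex_of_real (indicator A x)) \<in> poly_closure M \<phi>"
    and A: "A \<in> sets M"
  shows "(\<lambda>x. complex_of_real (indicator A x)) \<in> poly_closure M \<phi>"
proof -
  have "A \<in> sigma_sets (space M) G" using A G(3) by simp
  from G(1,2) this show ?thesis
  proof (induction rule: sigma_sets_induct_disjoint)
    case (basic A)
    thus ?case by (rule assms(4))
  next
    case empty
    show ?case using poly_closure_zero by simp
  next
    case (compl A)
    have "(\<lambda>x. 1 + (- 1) * complex_of_real (indicator A x)) \<in> poly_closure M \<phi>"
      by (rule poly_closure_add[OF poly_closure_one poly_closure_scale[OF compl(2)]])
    thus ?case by (rule poly_closure_cong) (auto simp: indicator_def)
  next
    case (union A)
    have Am: "A i \<in> sets M" for i using union(2) G(3) by auto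
    have UA [measurable]: "(\<Union>i. A i) \<in> sets M" using Am by blast
    let ?F = "\<lambda>n x. \<Sum>i<n. complex_of_real (indicator (A i) x)"
    have F: "?F n \<in> poly_closure M \<phi>" for n :: nat by (intro poly_closure_sum union(3))
    have ind: "(\<lambda>i. indicator (A i) x :: real) sums indicator (\<Union>i. A i) x" for x
      using union(1) by (intro indicator_sums) (auto simp: disjoint_family_on_def)
    have bF: "cmod (?F n x) \<le> 1" for n x
    proof -
      have "(\<Sum>i<n. indicator (A i) x :: real) \<le> indicator (\<Union>i. A i) x"
        using sum_le_suminf[OF sums_summable[OF ind[of x]], of "{..<n}"] sums_unique[OF ind[of x]] by simp
      also have "\<dots> \<le> (1::real)" by (simp add: indicator_def)
      finally have "(\<Sum>i<n. indicator (A i) x :: real) \<le> 1" .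
      moreover have "?F n x = of_real (\<Sum>i<n. indicator (A i) x)" by simp
      moreover have "0 \<le> (\<Sum>i<n. indicator (A i) x :: real)" by (intro sum_nonneg) simp
      ultimately show ?thesis by (simp only: norm_of_real abs_of_nonneg)
    qed
    have m: "(\<lambda>x. complex_of_real (indicator (\<Union>i. A i) x)) \<in> borel_measurable M" by measurable
    have b: "cmod (complex_of_real (indicator (\<Union>i. A i) x)) \<le> 1" for x by (simp add: indicator_def)
    have "(\<lambda>x. complex_of_real (indicator (\<Union>i. A i) x) * 1) \<in> L2 M"
      by (rule L2_mult_bounded[OF L2_const m, of 1]) (rule AE_I2, rule b)
    hence L: "(\<lambda>x. complex_of_real (indicator (\<Union>i. A i) x)) \<in> L2 M" by simp
    show ?case
    proof (rule poly_closure_limit[OF L F])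
      show "(\<lambda>n. L2_norm M (\<lambda>x. of_real (indicator (\<Union>i. A i) x) - ?F n x)) \<longlonglongrightarrow> 0"
      proof (rule L2_dominated_convergence[where w = "\<lambda>_. 1"])
        show "?F n \<in> borel_measurable M" for n by (rule L2D(1)[OF poly_closure_L2[OF F]])
        show "AE x in M. (\<lambda>n. ?F n x) \<longlonglongrightarrow> of_real (indicator (\<Union>i. A i) x)"
          using sums_of_real[OF ind] by (intro AE_I2) (simp add: sums_def)
        show "AE x in M. cmod (?F n x) \<le> 1" for n by (rule AE_I2) (rule bF)
        show "AE x in M. cmod (complex_of_real (indicator (\<Union>i. A i) x)) \<le> 1" by (rule AE_I2) (rule b)
      qed (use m in auto)
    qed
  qed
qed

text \<open>Simple functions converge to f pointwise and below a multiple of |f|, hence in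
  norm.\<close>

lemma poly_closure_eq_L2:
  assumes ind: "\<And>A. A \<in> sets M \<Longrightarrow> (\<lambda>x. complex_of_real (indicator A x)) \<in> poly_closure M \<phi>"
  shows "poly_closure M \<phi> = L2 M"
proof (intro equalityI subsetI)
  fix f assume f: "f \<in> L2 M"
  have fm: "f \<in> borel_measurable M" by (rule L2D(1)[OF f])
  obtain F where "\<forall>i. simple_function M (F i)" "\<forall>x\<in>space M. (\<lambda>i. F i x) \<longlonglongrightarrow> f x"
    "\<forall>i. \<forall>x\<in>space M. dist (F i x) 0 \<le> 2 * dist (f x) 0"
    using borel_measurable_implies_sequence_metric[OF fm, of 0] by blast
  hence F: "\<And>i. simple_function M (F i)" "\<And>x. x \<in> space M \<Longrightarrow> (\<lambda>i. F i x) \<longlonglongrightarrow> f x"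
    "\<And>i x. x \<in> space M \<Longrightarrow> norm (F i x) \<le> 2 * norm (f x)"
    by (simp_all add: dist_norm)
  have Fc: "F i \<in> poly_closure M \<phi>" for i
  proof -
    have "(\<lambda>x. complex_of_real (indicator (F i -` {y} \<inter> space M) x)) \<in> poly_closure M \<phi>" for y
      by (rule ind[OF simple_functionD(2)[OF F(1)]])
    hence s1: "(\<lambda>x. y * complex_of_real (indicator (F i -` {y} \<inter> space M) x)) \<in> poly_closure M \<phi>" for y
      by (intro poly_closure_scale[where c = y])
    have sum: "(\<lambda>x. \<Sum>y\<in>F i ` space M. y * complex_of_real (indicator (F i -` {y} \<inter> space M) x)) \<in> poly_closure M \<phi>"
    proof (rule poly_closure_sum)
      fix y
      show "(\<lambda>x. y * complex_of_real (indicator (F i -` {y} \<inter> space M) x)) \<in> poly_closure M \<phi>" by (rule s1)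
    qed
    show ?thesis
    proof (rule poly_closure_cong[OF sum])
      fix x assume x: "x \<in> space M"
      have "(\<Sum>y\<in>F i ` space M. y * complex_of_real (indicator (F i -` {y} \<inter> space M) x)) =
          (\<Sum>y\<in>F i ` space M. indicator (F i -` {y} \<inter> space M) x *\<^sub>R y)"
        by (intro sum.cong refl) (simp only: scaleR_conv_of_real mult.commute)
      also have "\<dots> = F i x"
        by (rule simple_function_indicator_representation_banach[OF F(1) x, symmetric])
      finally show "(\<Sum>y\<in>F i ` space M. y * complex_of_real (indicator (F i -` {y} \<inter> space M) x)) = F i x" .
    qed
  qed
  show "f \<in> poly_closure M \<phi>"
  proof (rule poly_closure_limit[OF f Fc])
    show "(\<lambda>i. L2_norm M (\<lambda>x. f x - F i x)) \<longlonglongrightarrow> 0"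
    proof (rule L2_dominated_convergence[where w = "\<lambda>x. 2 * cmod (f x)"])
      show "F i \<in> borel_measurable M" for i by (rule L2D(1)[OF poly_closure_L2[OF Fc]])
      have "integrable M (\<lambda>x. 4 * (cmod (f x))\<^sup>2)" by (intro integrable_mult_right L2D(2)[OF f])
      thus "integrable M (\<lambda>x. (2 * cmod (f x))\<^sup>2)" by (simp add: power_mult_distrib)
    qed (use F fm in \<open>auto intro!: AE_I2\<close>)
  qed
qed (rule poly_closure_L2)

end

end

lemma poly_closure_uminus: "poly_closure M (\<lambda>x. - \<phi> x) \<subseteq> poly_closure M \<phi>"
proof
  fix f assume f: "f \<in> poly_closure M (\<lambda>x. - \<phi> x)"
  have "\<exists>p. L2_norm M (\<lambda>x. f x - poly p (of_real (\<phi> x))) < \<epsilon>" if "\<epsilon> > 0" for \<epsilon>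
  proof -
    obtain p where "L2_norm M (\<lambda>x. f x - poly p (of_real (- \<phi> x))) < \<epsilon>"
      using f \<open>\<epsilon> > 0\<close> unfolding poly_closure_def by blast
    moreover have "poly p (of_real (- \<phi> x)) = poly (pcompose p [:0, - 1:]) (of_real (\<phi> x))" for x
      by (simp add: poly_pcompose)
    ultimately show ?thesis by (intro exI[of _ "pcompose p [:0, - 1:]"]) simp
  qed
  thus "f \<in> poly_closure M \<phi>" using f by (simp add: poly_closure_def)
qed

text \<open>Strict monotonicity identifies the level set of \<phi> below its value at c with the
  half-line up to c. Hence indicators of half-lines lie in the closure; their traces on (-1, 1) are
  stable under intersection and generate the Borel sets.\<close>

lemma poly_closure_strict_mono:
  fixes M :: "real measure" and \<phi> :: "real \<Rightarrow> real"
  assumes fin: "finite_measure M" and sp: "space M = {-1<..<1}" and st: "sets M = sets (restrict_space borel {-1<..<1})"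
    and phi: "\<phi> \<in> borel_measurable M" and B: "\<And>x. x \<in> {-1<..<1} \<Longrightarrow> \<bar>\<phi> x\<bar> \<le> B"
    and mono: "strict_mono_on {-1<..<1} \<phi>"
  shows "poly_closure M \<phi> = L2 M"
proof -
  interpret finite_measure M by (rule fin)
  have B': "\<And>x. x \<in> space M \<Longrightarrow> \<bar>\<phi> x\<bar> \<le> B" using B sp by simp
  define G where "G = (\<inter>) {-1<..<1::real} ` range (\<lambda>a. {..a})"
  have "sets M = (\<inter>) {-1<..<1} ` sets borel" unfolding st by (simp add: sets_restrict_space)
  also have "sets (borel :: real measure) = sigma_sets UNIV (range (\<lambda>a. {..a}))"
    by (subst borel_eq_atMost) (rule sets_measure_of, simp)
  also have "(\<inter>) {-1<..<1} ` sigma_sets UNIV (range (\<lambda>a. {..a})) = sigma_sets {-1<..<1} G"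
    unfolding G_def
  proof (rule sigma_sets_Int)
    have "{-1<..<1::real} \<in> sets borel" by simp
    thus "{-1<..<1::real} \<in> sigma_sets UNIV (range (\<lambda>a. {..a}))"
      by (subst (asm) borel_eq_atMost) (simp add: sets_measure_of)
  qed simp
  finally have sG: "sets M = sigma_sets (space M) G" by (simp add: sp)
  have Gs: "Int_stable G"
  proof (rule Int_stableI)
    fix S T assume "S \<in> G" "T \<in> G"
    then obtain c d where "S = {-1<..<1} \<inter> {..c}" "T = {-1<..<1} \<inter> {..d}" by (auto simp: G_def)
    hence "S \<inter> T = {-1<..<1} \<inter> {..min c d}" by auto
    thus "S \<inter> T \<in> G" by (auto simp: G_def)
  qed
  have basic: "(\<lambda>x. complex_of_real (indicator A x)) \<in> poly_closure M \<phi>" if AG: "A \<in> G" for A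
  proof -
    obtain c where c: "A = {-1<..<1} \<inter> {..c}" using AG by (auto simp: G_def)
    consider "c \<le> -1" | "c \<ge> 1" | "c \<in> {-1<..<1}" by force
    thus ?thesis
    proof cases
      case 1
      hence "A = {}" using c by auto
      thus ?thesis using poly_closure_zero[OF phi B'] by simp
    next
      case 2
      show ?thesis
        by (rule poly_closure_cong[OF phi B' poly_closure_one[OF phi B']]) (use c 2 sp in auto)
    next
      case 3
      show ?thesis
      proof (rule poly_closure_cong[OF phi B' poly_closure_indicator_atMost[OF phi B', of "\<phi> c"]])
        fix x assume "x \<in> space M"
        hence x: "x \<in> {-1<..<1}" by (simp add: sp)
        have "\<phi> x \<le> \<phi> c \<longleftrightarrow> x \<le> c" using strict_mono_on_less_eq[OF mono] x 3 by blast
        thus "complex_of_real (indicator {..\<phi> c} (\<phi> x)) = complex_of_real (indicator A x)"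
          using x c by (auto simp: indicator_def)
      qed auto
    qed
  qed
  have GP: "G \<subseteq> Pow (space M)" by (auto simp: G_def sp)
  have all: "(\<lambda>x. complex_of_real (indicator A x)) \<in> poly_closure M \<phi>" if AM: "A \<in> sets M" for A
  proof (rule poly_closure_indicator_sigma[where \<phi> = \<phi> and B = B and G = G])
    show "\<bar>\<phi> x\<bar> \<le> B" if "x \<in> space M" for x by (rule B'[OF that])
  qed (fact phi Gs GP sG AM basic)+
  show ?thesis
  proof (rule poly_closure_eq_L2[where \<phi> = \<phi> and B = B])
    show "\<bar>\<phi> x\<bar> \<le> B" if "x \<in> space M" for x by (rule B'[OF that])
    show "(\<lambda>x. complex_of_real (indicator A x)) \<in> poly_closure M \<phi>" if "A \<in> sets M" for A
      by (rule all[OF that])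
  qed (fact phi)
qed

section \<open>Diagonalization of the matrix\<close>

context
  fixes q :: real
  assumes q: "0 < q" "q < 1"
begin

section \<open>Monotonicity of the theta product\<close>

text \<open>Each factor depends on t and x only through t x and t^2. A negative a is thereby reduced
  to |a| with x reflected.\<close>

lemma askey_pair_sgn:
  assumes "t \<noteq> 0" and x: "x \<in> {-1..1}"
  shows "askey_pair q t x = askey_pair q \<bar>t\<bar> (sgn t * x)"
proof -
  have sx: "sgn t * x \<in> {-1..1}" using x assms(1) by (cases "t > 0") auto
  have t: "\<bar>t\<bar> * sgn t = t" by (simp add: abs_mult_sgn)
  have "1 - 2 * (\<bar>t\<bar> * q ^ j) * (sgn t * x) + (\<bar>t\<bar> * q ^ j)\<^sup>2 = 1 - 2 * (t * q ^ j) * x + (t * q ^ j)\<^sup>2" for j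
  proof -
    have "2 * (\<bar>t\<bar> * q ^ j) * (sgn t * x) = 2 * ((\<bar>t\<bar> * sgn t) * q ^ j) * x" by (simp only: mult_ac)
    thus ?thesis unfolding t by (simp only: power_mult_distrib power2_abs)
  qed
  hence "(\<lambda>n. \<Prod>j<n. 1 - 2 * (t * q ^ j) * x + (t * q ^ j)\<^sup>2) \<longlonglongrightarrow> askey_pair q \<bar>t\<bar> (sgn t * x)"
    using askey_pair_tendsto[OF q sx, of "\<bar>t\<bar>"] by (simp only:)
  thus ?thesis by (rule LIMSEQ_unique[OF askey_pair_tendsto[OF q x, of t]])
qed

text \<open>With s = t q^j each factor is at least (1 - s)^2 on the interval and decreases in x;
  products of nonnegative decreasing factors decrease.\<close>

lemma askey_pair_antimono:
  assumes "0 \<le> t" "x \<le> y" and x: "x \<in> {-1..1}" and y: "y \<in> {-1..1}"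
  shows "askey_pair q t y \<le> askey_pair q t x"
proof (rule LIMSEQ_le[OF askey_pair_tendsto[OF q y] askey_pair_tendsto[OF q x]])
  show "\<exists>N. \<forall>n\<ge>N. (\<Prod>j<n. 1 - 2 * (t * q ^ j) * y + (t * q ^ j)\<^sup>2) \<le> (\<Prod>j<n. 1 - 2 * (t * q ^ j) * x + (t * q ^ j)\<^sup>2)"
  proof (intro exI allI impI prod_mono conjI)
    fix j :: nat
    have s: "0 \<le> t * q ^ j" using q assms(1) by simp
    have "(t * q ^ j) * y \<le> (t * q ^ j) * 1" using s y by (intro mult_left_mono) auto
    moreover have "0 \<le> (1 - t * q ^ j)\<^sup>2" by simp
    ultimately show "0 \<le> 1 - 2 * (t * q ^ j) * y + (t * q ^ j)\<^sup>2" by (simp add: power2_eq_square algebra_simps)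
    have "(t * q ^ j) * x \<le> (t * q ^ j) * y" using s assms(2) by (rule mult_left_mono[rotated])
    thus "1 - 2 * (t * q ^ j) * y + (t * q ^ j)\<^sup>2 \<le> 1 - 2 * (t * q ^ j) * x + (t * q ^ j)\<^sup>2" by simp
  qed
qed

text \<open>A vanishing factor would force the unit-circle point to be real, which happens only at
  the endpoints. This covers parameters of any size, as needed for q/a.\<close>

lemma askey_pair_pos_interior:
  assumes x: "x \<in> {-1<..<1}" shows "0 < askey_pair q t x"
proof -
  have "qinf q (of_real t * cis (arccos x)) \<noteq> 0"
  proof
    assume "qinf q (of_real t * cis (arccos x)) = 0"
    then obtain j where j: "of_real t * cis (arccos x) * of_real q ^ j = 1" using qinf_eq_0_iff[OF q] by blast
    hence "of_real (t * q ^ j) * cis (arccos x) = 1" by (simp add: mult_ac)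
    hence "Im (of_real (t * q ^ j) * cis (arccos x)) = 0" by simp
    hence "t * q ^ j * sin (arccos x) = 0" by simp
    moreover have "sin (arccos x) \<noteq> 0"
      using arccos_lt_bounded[of x] x sin_gt_zero[of "arccos x"] by auto
    ultimately have "t = 0" using q by simp
    thus False using j by simp
  qed
  thus ?thesis by (simp add: askey_pair_def)
qed

lemma askey_pair_one: "askey_pair q t 1 = (qinf q t)\<^sup>2"
  by (simp add: askey_pair_def qinf_of_real[OF q])

lemma askey_pair_minus_one: "askey_pair q t (- 1) = (qinf q (- t))\<^sup>2"
  using qinf_of_real[OF q, of "- t", where 'a = complex] by (simp add: askey_pair_def)

text \<open>This is |theta(\<alpha> exp(i arccos x))|^2 for the theta function theta(z) = (z, q/z;
  q)_inf, the part of h that depends on x.\<close>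

definition theta_prod :: "real \<Rightarrow> real \<Rightarrow> real" where
  "theta_prod \<alpha> x = askey_pair q \<alpha> x * askey_pair q (q / \<alpha>) x"

lemma theta_prod_nonneg: "0 \<le> theta_prod \<alpha> x"
  unfolding theta_prod_def by (intro mult_nonneg_nonneg askey_pair_nonneg q)

text \<open>The product is f g with f linear of slope - 2 \<alpha> and both factors nonnegative and
  decreasing. For u below v the difference is 2 \<alpha> g(u) (v - u) plus the nonnegative term f(v)
  (g(u) - g(v)). If the fixed point x is the larger one, g at the other point is at least g(x), so
  the constant g(x) works on both sides.\<close>

lemma theta_prod_expansive:
  assumes \<alpha>: "0 < \<alpha>" and x: "x \<in> {-1..1}" and y: "y \<in> {-1..1}"
  shows "2 * \<alpha> * (askey_pair q (\<alpha> * q) x * askey_pair q (q / \<alpha>) x) * \<bar>x - y\<bar> \<le> \<bar>theta_prod \<alpha> x - theta_prod \<alpha> y\<bar>"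
    and "x \<le> y \<Longrightarrow> theta_prod \<alpha> y \<le> theta_prod \<alpha> x"
proof -
  define f where "f = (\<lambda>x. 1 - 2 * \<alpha> * x + \<alpha>\<^sup>2)"
  define g where "g = (\<lambda>x. askey_pair q (\<alpha> * q) x * askey_pair q (q / \<alpha>) x)"
  have tp: "theta_prod \<alpha> z = f z * g z" if "z \<in> {-1..1}" for z
    unfolding theta_prod_def f_def g_def by (subst askey_pair_rec[OF q that]) simp
  have f0: "0 \<le> f z" if "z \<in> {-1..1}" for z
  proof -
    have "\<alpha> * z \<le> \<alpha> * 1" using \<alpha> that by (intro mult_left_mono) auto
    moreover have "0 \<le> (1 - \<alpha>)\<^sup>2" by simp
    ultimately show ?thesis by (simp add: f_def power2_eq_square algebra_simps)
  qed
  have g0: "0 \<le> g z" for z unfolding g_def by (intro mult_nonneg_nonneg askey_pair_nonneg q)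
  have gm: "g v \<le> g u" if "u \<le> v" "u \<in> {-1..1}" "v \<in> {-1..1}" for u v
    unfolding g_def using that \<alpha> q by (intro mult_mono askey_pair_antimono askey_pair_nonneg) auto
  have key: "2 * \<alpha> * g u * (v - u) \<le> theta_prod \<alpha> u - theta_prod \<alpha> v" if "u \<le> v" "u \<in> {-1..1}" "v \<in> {-1..1}" for u v
  proof -
    have "theta_prod \<alpha> u - theta_prod \<alpha> v = 2 * \<alpha> * g u * (v - u) + f v * (g u - g v)"
      unfolding tp[OF that(2)] tp[OF that(3)] f_def by (simp add: algebra_simps)
    moreover have "0 \<le> f v * (g u - g v)" using f0[OF that(3)] gm[OF that] by simp
    ultimately show ?thesis by linarith
  qed
  show "x \<le> y \<Longrightarrow> theta_prod \<alpha> y \<le> theta_prod \<alpha> x"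
  proof -
    assume xy: "x \<le> y"
    have "0 \<le> 2 * \<alpha> * g x * (y - x)" using \<alpha> g0[of x] xy by simp
    thus ?thesis using key[OF xy x y] by linarith
  qed
  have "2 * \<alpha> * g x * \<bar>x - y\<bar> \<le> \<bar>theta_prod \<alpha> x - theta_prod \<alpha> y\<bar>"
  proof (cases "x \<le> y")
    case True
    thus ?thesis using key[OF True x y] by (simp add: abs_if)
  next
    case False
    hence yx: "y \<le> x" by simp
    have "2 * \<alpha> * g x * (x - y) \<le> 2 * \<alpha> * g y * (x - y)"
      using gm[OF yx y x] \<alpha> yx by (intro mult_right_mono mult_left_mono) auto
    also have "\<dots> \<le> theta_prod \<alpha> y - theta_prod \<alpha> x" by (rule key[OF yx y x])
    finally show ?thesis using yx by (simp add: abs_if)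
  qed
  thus "2 * \<alpha> * (askey_pair q (\<alpha> * q) x * askey_pair q (q / \<alpha>) x) * \<bar>x - y\<bar> \<le> \<bar>theta_prod \<alpha> x - theta_prod \<alpha> y\<bar>"
    by (simp add: g_def)
qed

lemma continuous_on_theta_prod: "continuous_on {-1..1} (theta_prod \<alpha>)"
  unfolding theta_prod_def[abs_def] by (intro continuous_intros continuous_on_askey_pair[OF q])

section \<open>The multiplier and the matrix entries\<close>

definition multiplier :: "real \<Rightarrow> real \<Rightarrow> real \<Rightarrow> real" where
  "multiplier a b x = askey_pair q a x * askey_pair q (q / a) x / (qinf q (a * b) * qinf q (q * b / a))"

lemma h_fun_eq: "h_fun q a b x = of_real (multiplier a b x)"
proof -
  let ?z = "cis (arccos x)"
  have c: "of_real a * cis (- arccos x) = cnj (of_real a * ?z)" "of_real q * cis (- arccos x) / of_real a = cnj (of_real (q / a) * ?z)"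
    "of_real q * ?z / of_real a = of_real (q / a) * ?z"
    by (simp_all add: cis_cnj)
  have n: "cnj (qinf q w) * qinf q w = of_real ((cmod (qinf q w))\<^sup>2)" for w :: complex
    unfolding complex_norm_square by (rule mult.commute)
  have "h_fun q a b x = (cnj (qinf q (of_real a * ?z)) * qinf q (of_real a * ?z)) * (cnj (qinf q (of_real (q / a) * ?z)) * qinf q (of_real (q / a) * ?z))
      / of_real (qinf q (a * b) * qinf q (q * b / a))"
    unfolding h_fun_def Let_def qpoch_inf_eq_qinf_real qpoch_inf_eq_qinf_complex c by (simp add: qinf_cnj[OF q, symmetric])
  thus ?thesis unfolding n multiplier_def askey_pair_def by simp
qed

lemma continuous_on_multiplier: "continuous_on {-1..1} (multiplier a b)"
proof -
  have "continuous_on {-1..1} (\<lambda>x. 1 / (qinf q (a * b) * qinf q (q * b / a)) * (askey_pair q a x * askey_pair q (q / a) x))"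
    by (intro continuous_intros continuous_on_askey_pair[OF q])
  thus ?thesis by (rule continuous_on_eq) (simp add: multiplier_def)
qed

lemma multiplier_eq:
  assumes "a \<noteq> 0" and x: "x \<in> {-1..1}"
  shows "multiplier a b x = 1 / (qinf q (a * b) * qinf q (q * b / a)) * theta_prod \<bar>a\<bar> (sgn a * x)"
proof -
  have "q / a \<noteq> 0" "\<bar>q / a\<bar> = q / \<bar>a\<bar>" "sgn (q / a) = sgn a"
    using assms(1) q by (simp_all add: sgn_divide)
  hence "askey_pair q (q / a) x = askey_pair q (q / \<bar>a\<bar>) (sgn a * x)"
    using askey_pair_sgn[of "q / a", OF _ x] by (simp only: not_False_eq_True)
  thus ?thesis
    unfolding multiplier_def theta_prod_def askey_pair_sgn[OF assms] by simp
qed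

lemma multiplier_integral:
  assumes a: "a \<noteq> 0" "\<bar>a\<bar> < 1" and b: "\<bar>b\<bar> < 1" and nd: "qinf q (q * b / a) \<noteq> 0"
  shows "(LINT x|mu_measure q a b. multiplier a b x * (asc_poly q a b m x * asc_poly q a b n x)) =
    (- a) ^ (m + n) * q ^ ((m choose 2) + (n choose 2)) * (gauss_series q (q * b / a) (q\<^sup>2 / (a\<^sup>2 * q ^ (m + n))) / qinf q (q * b / a))"
proof -
  let ?K = "1 / (qinf q (a * b) * qinf q (q * b / a))"
  have ab: "\<bar>a * b\<bar> < 1" using abs_mult_less[OF a(2) b] by (simp add: abs_mult)
  have "(LINT x|mu_measure q a b. multiplier a b x * (asc_poly q a b m x * asc_poly q a b n x)) =
     qinf q (a * b) * (LINT x|mu_measure q 0 0. multiplier a b x * (asc_poly q a b m x * asc_poly q a b n x) / (askey_pair q a x * askey_pair q b x))"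
    by (intro integral_mu_eq_hermite q a b continuous_intros continuous_on_multiplier)
  also have "(LINT x|mu_measure q 0 0. multiplier a b x * (asc_poly q a b m x * asc_poly q a b n x) / (askey_pair q a x * askey_pair q b x)) =
     (LINT x|mu_measure q 0 0. ?K * (askey_pair q (q / a) x / askey_pair q b x * (asc_poly q a b m x * asc_poly q a b n x)))"
    using askey_pair_nonzero[OF q a(2)] by (intro Bochner_Integration.integral_cong refl) (simp add: multiplier_def)
  also have "\<dots> = ?K * (LINT x|mu_measure q 0 0. askey_pair q (q / a) x / askey_pair q b x * (asc_poly q a b m x * asc_poly q a b n x))"
    by (rule integral_mult_right_zero)
  finally show ?thesis
    unfolding asc_pair_quotient_matrix[OF q a(1) b] using qinf_nonzero[OF q, of "a * b"] ab nd by simp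
qed

text \<open>Uses 1 / (\<beta>; q)_k = (\<beta> q^k; q)_inf / (\<beta>; q)_inf. The assumption says
  precisely that the last denominator is nonzero.\<close>

lemma phi_0_1_eq_gauss_series:
  assumes nd: "\<And>k. \<beta> * q ^ k \<noteq> 1"
  shows "phi_0_1 \<beta> q z = gauss_series q \<beta> z / qinf q \<beta>"
proof -
  have summand: "q ^ (k * (k - 1)) * z ^ k / (qpoch [\<beta>] q k * qpoch [q] q k) =
      qinf q (\<beta> * q ^ k) * (q ^ (2 * (k choose 2)) / qfac q k * z ^ k) / qinf q \<beta>" for k
  proof -
    have e: "k * (k - 1) = 2 * (k choose 2)" using square_choose_2[of k] by (simp add: diff_mult_distrib2)
    have "qinf q \<beta> \<noteq> 0" using qinf_eq_0_iff[OF q, of \<beta>] nd by auto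
    moreover have "qinf q \<beta> = qpoch [\<beta>] q k * qinf q (\<beta> * q ^ k)"
      using qinf_split[OF q, of \<beta> k] by (simp add: qpoch_def)
    ultimately have "qinf q (\<beta> * q ^ k) / qinf q \<beta> = 1 / qpoch [\<beta>] q k" by (metis div_by_1 mult.right_neutral mult_eq_0_iff nonzero_divide_mult_cancel_right)
    hence "qinf q (\<beta> * q ^ k) * (q ^ (2 * (k choose 2)) / qfac q k * z ^ k) / qinf q \<beta> = 1 / qpoch [\<beta>] q k * (q ^ (2 * (k choose 2)) / qfac q k * z ^ k)"
      by (metis times_divide_eq_left)
    thus ?thesis unfolding e qpoch_single_q by (simp add: mult.commute)
  qed
  have "phi_0_1 \<beta> q z = (\<Sum>k. qinf q (\<beta> * q ^ k) * (q ^ (2 * (k choose 2)) / qfac q k * z ^ k) / qinf q \<beta>)"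
    unfolding phi_0_1_def summand ..
  also have "\<dots> = gauss_series q \<beta> z / qinf q \<beta>"
    unfolding gauss_series_def[OF q] by (rule suminf_divide[OF summable_gauss_series[OF q]])
  finally show ?thesis .
qed

lemma qpoch_ab_pos:
  assumes "\<bar>c\<bar> < 1" shows "0 < qpoch [q, c] q n"
proof -
  have "0 < 1 - c * q ^ j" for j
  proof -
    have "\<bar>c * q ^ j\<bar> \<le> \<bar>c\<bar> * 1" using q unfolding abs_mult by (intro mult_left_mono) (auto simp: power_le_one)
    thus ?thesis using assms by linarith
  qed
  hence "0 < (\<Prod>j<n. 1 - c * q ^ j)" by (intro prod_pos) auto
  moreover have "0 < qfac q n" by (rule qfac_pos[OF q])
  ultimately show ?thesis by (simp add: qpoch_def qfac_def)
qed

lemma H_entry_eq: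
  assumes a: "a \<noteq> 0" "\<bar>a\<bar> < 1" and b: "\<bar>b\<bar> < 1" and nd: "\<And>k. q * b / a * q ^ k \<noteq> 1"
  shows "H_entry q a b m n = (LINT x|mu_measure q a b. multiplier a b x * (asc_poly q a b m x * asc_poly q a b n x))
      / (sqrt (qpoch [q, a * b] q m) * sqrt (qpoch [q, a * b] q n))"
proof -
  have nz: "qinf q (q * b / a) \<noteq> 0" using qinf_eq_0_iff[OF q, of "q * b / a"] nd by auto
  have z: "q powi (2 - int m - int n) / a\<^sup>2 = q\<^sup>2 / (a\<^sup>2 * q ^ (m + n))"
    using q by (simp add: power_int_diff power_add mult_ac)
  show ?thesis
    unfolding H_entry_def multiplier_integral[OF a b nz] z phi_0_1_eq_gauss_series[OF nd] choose_two[symmetric] real_sqrt_mult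
    by simp
qed

definition asc_normalized :: "real \<Rightarrow> real \<Rightarrow> nat \<Rightarrow> real \<Rightarrow> complex" where
  "asc_normalized a b n x = of_real (asc_poly q a b n x / sqrt (qpoch [q, a * b] q n))"

text \<open>The span contains the constants and is closed under multiplication by x, by the
  three-term recurrence solved for x times a polynomial. The coefficients are required to vanish
  from n on so that two representations can be padded to a common length and added.\<close>

lemma poly_asc_span:
  "\<exists>n c. (\<forall>k\<ge>n. c k = 0) \<and> (\<forall>x. poly p (complex_of_real x) = (\<Sum>k<n. c k * of_real (asc_poly q a b k x)))"
proof -
  define Q where "Q = (\<lambda>g. \<exists>n c. (\<forall>k\<ge>n. c k = 0) \<and> (\<forall>x. g x = (\<Sum>k<n. c k * complex_of_real (asc_poly q a b k x))))"
  have Q_add: "Q (\<lambda>x. f x + g x)" if Qf: "Q f" and Qg: "Q g" for f g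
  proof -
    obtain n c where f: "\<forall>k\<ge>n. c k = 0" "\<And>x. f x = (\<Sum>k<n. c k * complex_of_real (asc_poly q a b k x))" using Qf unfolding Q_def by blast
    obtain m d where g: "\<forall>k\<ge>m. d k = 0" "\<And>x. g x = (\<Sum>k<m. d k * complex_of_real (asc_poly q a b k x))" using Qg unfolding Q_def by blast
    have "f x = (\<Sum>k<max n m. c k * complex_of_real (asc_poly q a b k x))" for x
      unfolding f(2) by (rule sum.mono_neutral_left) (use f(1) in auto)
    moreover have "g x = (\<Sum>k<max n m. d k * complex_of_real (asc_poly q a b k x))" for x
      unfolding g(2) by (rule sum.mono_neutral_left) (use g(1) in auto)
    ultimately have "f x + g x = (\<Sum>k<max n m. (c k + d k) * complex_of_real (asc_poly q a b k x))" for x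
      by (simp add: sum.distrib distrib_right)
    moreover have "\<forall>k\<ge>max n m. c k + d k = 0" using f(1) g(1) by auto
    ultimately show ?thesis unfolding Q_def by (intro exI[of _ "max n m"] exI[of _ "\<lambda>k. c k + d k"]) blast
  qed
  have Q_scale: "Q (\<lambda>x. e * f x)" if Qf: "Q f" for e f
  proof -
    obtain n c where f: "\<forall>k\<ge>n. c k = 0" "\<And>x. f x = (\<Sum>k<n. c k * complex_of_real (asc_poly q a b k x))" using Qf unfolding Q_def by blast
    show ?thesis unfolding Q_def
      by (intro exI[of _ n] exI[of _ "\<lambda>k. e * c k"]) (simp add: f sum_distrib_left mult_ac)
  qed
  have Q_asc: "Q (\<lambda>x. complex_of_real (asc_poly q a b k x))" for k
    unfolding Q_def
    by (intro exI[of _ "Suc k"] exI[of _ "\<lambda>i. if i = k then 1 else 0"]) (auto simp: if_distrib cong: if_cong)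
  have Q_0: "Q (\<lambda>x. 0)" unfolding Q_def by (intro exI[of _ 0] exI[of _ "\<lambda>_. 0"]) simp
  have Q_sum: "Q (\<lambda>x. \<Sum>k<n::nat. c k * f k x)" if "\<And>k. Q (f k)" for n c f
    by (induction n) (simp_all add: Q_0 Q_add Q_scale that)
  have Q_x_asc: "Q (\<lambda>x. of_real x * complex_of_real (asc_poly q a b k x))" for k
  proof -
    have "Q (\<lambda>x. 1/2 * (complex_of_real (asc_poly q a b (Suc k) x) + (of_real ((a + b) * q ^ k) * complex_of_real (asc_poly q a b k x)
        + of_real ((1 - q ^ k) * (1 - a * b * q ^ (k - 1))) * complex_of_real (asc_poly q a b (k - 1) x))))"
      by (intro Q_scale Q_add Q_asc)
    moreover have "1/2 * (complex_of_real (asc_poly q a b (Suc k) x) + (of_real ((a + b) * q ^ k) * complex_of_real (asc_poly q a b k x)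
        + of_real ((1 - q ^ k) * (1 - a * b * q ^ (k - 1))) * complex_of_real (asc_poly q a b (k - 1) x))) =
        of_real x * complex_of_real (asc_poly q a b k x)" for x
      by (subst asc_poly_Suc) (simp add: algebra_simps)
    ultimately show ?thesis by simp
  qed
  have Q_x: "Q (\<lambda>x. of_real x * f x)" if Qf: "Q f" for f
  proof -
    obtain n c where f: "\<forall>k\<ge>n. c k = 0" "\<And>x. f x = (\<Sum>k<n. c k * complex_of_real (asc_poly q a b k x))" using Qf unfolding Q_def by blast
    have "(\<lambda>x. of_real x * f x) = (\<lambda>x. \<Sum>k<n. c k * (of_real x * complex_of_real (asc_poly q a b k x)))"
      unfolding f(2) sum_distrib_left by (simp add: mult_ac)
    thus ?thesis using Q_sum[OF Q_x_asc, where n = n and c = c] by simp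
  qed
  have "Q (\<lambda>x. poly p (complex_of_real x))"
  proof (induction p)
    case 0
    show ?case using Q_0 by simp
  next
    case (pCons e p)
    have "Q (\<lambda>x. e * complex_of_real (asc_poly q a b 0 x) + of_real x * poly p (of_real x))"
      by (intro Q_add Q_scale Q_asc Q_x pCons)
    thus ?case by simp
  qed
  thus ?thesis unfolding Q_def .
qed

section \<open>The unitary transform and the range of the multiplier\<close>

context
  fixes a b :: real
  assumes a: "a \<noteq> 0" "\<bar>a\<bar> < 1" and b: "\<bar>b\<bar> < 1" and nd: "\<And>k. q * b / a * q ^ k \<noteq> 1"
begin

abbreviation "\<mu> \<equiv> mu_measure q a b"

lemma abs_ab: "\<bar>a * b\<bar> < 1"
  using abs_mult_less[OF a(2) b] by (simp add: abs_mult)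

lemma qpoch_pos: "0 < qpoch [q, a * b] q n"
  by (rule qpoch_ab_pos[OF abs_ab])

lemma finite_mu: "finite_measure \<mu>"
  by (rule finite_mu_measure[OF q a(2) b])

lemma L2_continuous:
  assumes f: "continuous_on {-1..1} f" shows "f \<in> L2 \<mu>"
proof -
  have "integrable \<mu> (\<lambda>x. (cmod (f x))\<^sup>2)"
    by (intro integrable_mu_continuous q a b continuous_intros f)
  moreover have "f \<in> borel_measurable \<mu>"
    by (intro measurable_mu_continuous continuous_on_subset[OF f]) auto
  ultimately show ?thesis by (simp add: L2_def)
qed

lemma asc_normalized_L2: "asc_normalized a b n \<in> L2 \<mu>"
  unfolding asc_normalized_def[abs_def]
  by (intro L2_continuous continuous_intros) (use qpoch_pos[of n] in auto)

lemma asc_normalized_inner: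
  assumes w: "continuous_on {-1..1} w"
  shows "L2_inner \<mu> (asc_normalized a b m) (\<lambda>x. of_real (w x) * asc_normalized a b n x) =
    of_real ((LINT x|\<mu>. w x * (asc_poly q a b m x * asc_poly q a b n x)) / (sqrt (qpoch [q, a * b] q m) * sqrt (qpoch [q, a * b] q n)))"
proof -
  let ?s = "\<lambda>n. sqrt (qpoch [q, a * b] q n)"
  have "L2_inner \<mu> (asc_normalized a b m) (\<lambda>x. of_real (w x) * asc_normalized a b n x) =
     (LINT x|\<mu>. complex_of_real (w x * (asc_poly q a b m x * asc_poly q a b n x) / (?s m * ?s n)))"
    unfolding L2_inner_def asc_normalized_def by (intro Bochner_Integration.integral_cong refl) simp
  also have "\<dots> = of_real (LINT x|\<mu>. w x * (asc_poly q a b m x * asc_poly q a b n x) / (?s m * ?s n))"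
    by (rule integral_complex_of_real)
  finally show ?thesis by simp
qed

lemma asc_normalized_orthonormal:
  "L2_inner \<mu> (asc_normalized a b m) (asc_normalized a b n) = (if m = n then 1 else 0)"
proof -
  have "L2_inner \<mu> (asc_normalized a b m) (asc_normalized a b n) =
     of_real ((if m = n then qpoch [q, a * b] q n else 0) / (sqrt (qpoch [q, a * b] q m) * sqrt (qpoch [q, a * b] q n)))"
    using asc_normalized_inner[of "\<lambda>_. 1" m n] by (simp add: asc_orthogonal[OF q a b])
  thus ?thesis using qpoch_pos[of n] by (auto simp flip: of_real_mult)
qed

text \<open>Polynomials in x are dense by \<open>poly_closure_strict_mono\<close> for the identity,
  and each is a combination of Al-Salam--Chihara polynomials.\<close>

lemma asc_normalized_total:
  assumes f: "f \<in> L2 \<mu>" and "\<epsilon> > 0"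
  shows "\<exists>n c. L2_norm \<mu> (\<lambda>x. f x - (\<Sum>k<n. c k * asc_normalized a b k x)) < \<epsilon>"
proof -
  have "poly_closure \<mu> (\<lambda>x. x) = L2 \<mu>"
  proof (rule poly_closure_strict_mono[where B = 1])
    show "(\<lambda>x. x) \<in> borel_measurable \<mu>" by (intro measurable_mu_continuous continuous_intros)
  qed (auto simp: finite_mu sets_mu_measure strict_mono_on_def)
  then obtain p where p: "L2_norm \<mu> (\<lambda>x. f x - poly p (of_real x)) < \<epsilon>"
    using f \<open>\<epsilon> > 0\<close> unfolding poly_closure_def by blast
  obtain n c where c: "\<And>x. poly p (complex_of_real x) = (\<Sum>k<n. c k * of_real (asc_poly q a b k x))"
    using poly_asc_span[of p a b] by blast
  have "poly p (complex_of_real x) = (\<Sum>k<n. (c k * of_real (sqrt (qpoch [q, a * b] q k))) * asc_normalized a b k x)" for x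
    unfolding c asc_normalized_def
  proof (rule sum.cong[OF refl])
    fix k
    have "sqrt (qpoch [q, a * b] q k) \<noteq> 0" using qpoch_pos[of k] by simp
    thus "c k * complex_of_real (asc_poly q a b k x) = c k * of_real (sqrt (qpoch [q, a * b] q k)) * of_real (asc_poly q a b k x / sqrt (qpoch [q, a * b] q k))"
      by simp
  qed
  thus ?thesis using p by (intro exI[of _ n] exI[of _ "\<lambda>k. c k * of_real (sqrt (qpoch [q, a * b] q k))"]) simp
qed

abbreviation "asc_transform \<equiv> \<lambda>f n. L2_inner \<mu> (asc_normalized a b n) f"

lemma asc_transform_unitary: "L2_unitary \<mu> ell2_measure asc_transform"
  by (rule finite_measure.L2_basis_unitary[OF finite_mu asc_normalized_L2 asc_normalized_orthonormal asc_normalized_total])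

lemma asc_transform_basis: "asc_transform (asc_normalized a b n) = std_basis n"
  by (auto simp: asc_normalized_orthonormal std_basis_def fun_eq_iff)

abbreviation "\<kappa> \<equiv> 1 / (qinf q (a * b) * qinf q (q * b / a))"

lemma kappa_nonzero: "\<kappa> \<noteq> 0"
proof -
  have "qinf q (q * b / a) \<noteq> 0" using qinf_eq_0_iff[OF q, of "q * b / a"] nd by auto
  moreover have "qinf q (a * b) \<noteq> 0" using abs_ab by (intro qinf_nonzero[OF q]) simp
  ultimately show ?thesis by simp
qed

lemma sgn_a: "\<bar>sgn a\<bar> = 1" "sgn a * sgn a = 1" "x \<in> {-1..1} \<Longrightarrow> sgn a * x \<in> {-1..1}" "x \<in> {-1<..<1} \<Longrightarrow> sgn a * x \<in> {-1<..<1}"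
  using a(1) by (cases "a > 0"; auto)+

text \<open>The constant is positive because \<open>askey_pair\<close> has no zeros in the open
  interval. It gives injectivity as well as the Lipschitz bound for the inverse.\<close>

lemma multiplier_expansive:
  assumes x: "x \<in> {-1<..<1}"
  shows "\<exists>c>0. \<forall>y\<in>{-1<..<1}. c * \<bar>x - y\<bar> \<le> \<bar>multiplier a b x - multiplier a b y\<bar>"
proof -
  let ?X = "sgn a * x"
  define g where "g = 2 * \<bar>a\<bar> * (askey_pair q (\<bar>a\<bar> * q) ?X * askey_pair q (q / \<bar>a\<bar>) ?X)"
  have "g > 0" unfolding g_def using a(1) by (intro mult_pos_pos askey_pair_pos_interior sgn_a x) auto
  show ?thesis
  proof (intro exI[of _ "\<bar>\<kappa>\<bar> * g"] conjI ballI)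
    show "0 < \<bar>\<kappa>\<bar> * g" using \<open>g > 0\<close> kappa_nonzero by (intro mult_pos_pos) auto
    fix y :: real assume y: "y \<in> {-1<..<1}"
    have xy: "x \<in> {-1..1}" "y \<in> {-1..1}" using x y by auto
    have "\<bar>?X - sgn a * y\<bar> = \<bar>x - y\<bar>" using sgn_a(1) by (simp add: abs_mult flip: right_diff_distrib)
    hence "g * \<bar>x - y\<bar> \<le> \<bar>theta_prod \<bar>a\<bar> ?X - theta_prod \<bar>a\<bar> (sgn a * y)\<bar>"
      using theta_prod_expansive(1)[of "\<bar>a\<bar>" ?X "sgn a * y"] a(1) sgn_a(3)[OF xy(1)] sgn_a(3)[OF xy(2)] by (simp add: g_def)
    hence "\<bar>\<kappa>\<bar> * (g * \<bar>x - y\<bar>) \<le> \<bar>\<kappa>\<bar> * \<bar>theta_prod \<bar>a\<bar> ?X - theta_prod \<bar>a\<bar> (sgn a * y)\<bar>"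
      by (rule mult_left_mono) simp
    also have "\<dots> = \<bar>multiplier a b x - multiplier a b y\<bar>"
      unfolding multiplier_eq[OF a(1) xy(1)] multiplier_eq[OF a(1) xy(2)] right_diff_distrib[symmetric] abs_mult ..
    finally show "\<bar>\<kappa>\<bar> * g * \<bar>x - y\<bar> \<le> \<bar>multiplier a b x - multiplier a b y\<bar>" by (simp only: mult.assoc)
  qed
qed

lemma multiplier_inj: "inj_on (multiplier a b) {-1<..<1}"
proof (rule inj_onI)
  fix x y assume x: "x \<in> {-1<..<1}" and y: "y \<in> {-1<..<1}" and eq: "multiplier a b x = multiplier a b y"
  from multiplier_expansive[OF x] obtain c where "c > 0" "c * \<bar>x - y\<bar> \<le> \<bar>multiplier a b x - multiplier a b y\<bar>" using y by blast
  thus "x = y" using eq by (simp add: mult_le_0_iff)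
qed

text \<open>The theta product decreases; a negative a reflects its argument, and \<kappa> may be
  negative since (qb/a; q)_inf has no fixed sign. The direction is decided by the product of the two
  signs.\<close>

lemma multiplier_monotone:
  assumes xy: "x \<in> {-1<..<1}" "y \<in> {-1<..<1}" "x < y"
  shows "if \<kappa> * sgn a < 0 then multiplier a b x < multiplier a b y else multiplier a b y < multiplier a b x"
proof -
  have c: "x \<in> {-1..1}" "y \<in> {-1..1}" using xy by auto
  have ne: "multiplier a b x \<noteq> multiplier a b y" using inj_onD[OF multiplier_inj _ xy(1,2)] xy(3) by auto
  note e = multiplier_eq[OF a(1) c(1)] multiplier_eq[OF a(1) c(2)]
  have m: "sgn a = 1 \<Longrightarrow> theta_prod \<bar>a\<bar> y \<le> theta_prod \<bar>a\<bar> x" "sgn a = - 1 \<Longrightarrow> theta_prod \<bar>a\<bar> (- x) \<le> theta_prod \<bar>a\<bar> (- y)"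
    using theta_prod_expansive(2)[of "\<bar>a\<bar>" x y] theta_prod_expansive(2)[of "\<bar>a\<bar>" "- y" "- x"] a(1) c xy(3) by auto
  have "sgn a = 1 \<or> sgn a = - 1" using a(1) by (auto simp: sgn_if)
  thus ?thesis
  proof
    assume s: "sgn a = 1"
    show ?thesis
    proof (cases "\<kappa> < 0")
      case True
      have "\<kappa> * theta_prod \<bar>a\<bar> x \<le> \<kappa> * theta_prod \<bar>a\<bar> y" using m(1)[OF s] True by (intro mult_left_mono_neg) auto
      hence "multiplier a b x \<le> multiplier a b y" using e s by simp
      thus ?thesis using ne True s by simp
    next
      case False
      have "\<kappa> * theta_prod \<bar>a\<bar> y \<le> \<kappa> * theta_prod \<bar>a\<bar> x" using m(1)[OF s] False by (intro mult_left_mono) auto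
      hence "multiplier a b y \<le> multiplier a b x" using e s by simp
      thus ?thesis using ne False s by simp
    qed
  next
    assume s: "sgn a = - 1"
    show ?thesis
    proof (cases "\<kappa> < 0")
      case True
      have "\<kappa> * theta_prod \<bar>a\<bar> (- y) \<le> \<kappa> * theta_prod \<bar>a\<bar> (- x)" using m(2)[OF s] True by (intro mult_left_mono_neg) auto
      hence "multiplier a b y \<le> multiplier a b x" using e s by simp
      thus ?thesis using ne True s by simp
    next
      case False
      hence "\<kappa> > 0" using kappa_nonzero by linarith
      have "\<kappa> * theta_prod \<bar>a\<bar> (- x) \<le> \<kappa> * theta_prod \<bar>a\<bar> (- y)" using m(2)[OF s] False by (intro mult_left_mono) auto
      hence "multiplier a b x \<le> multiplier a b y" using e s by simp
      thus ?thesis using ne \<open>\<kappa> > 0\<close> s by simp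
    qed
  qed
qed

lemma multiplier_measurable: "multiplier a b \<in> borel_measurable \<mu>"
  by (intro measurable_mu_continuous continuous_on_subset[OF continuous_on_multiplier]) auto

lemma multiplier_in_range:
  assumes x: "x \<in> {-1..1}"
  shows "multiplier a b x \<in> (\<lambda>u. \<kappa> * u) ` {theta_prod \<bar>a\<bar> 1..theta_prod \<bar>a\<bar> (- 1)}"
  unfolding multiplier_eq[OF a(1) x]
proof (rule imageI)
  have "sgn a * x \<in> {-1..1}" by (rule sgn_a(3)[OF x])
  thus "theta_prod \<bar>a\<bar> (sgn a * x) \<in> {theta_prod \<bar>a\<bar> 1..theta_prod \<bar>a\<bar> (- 1)}"
    using theta_prod_expansive(2)[of "\<bar>a\<bar>" "sgn a * x" 1] theta_prod_expansive(2)[of "\<bar>a\<bar>" "-1" "sgn a * x"] a(1) by auto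
qed

lemma multiplier_bound:
  assumes "x \<in> space \<mu>" shows "\<bar>multiplier a b x\<bar> \<le> \<bar>\<kappa>\<bar> * theta_prod \<bar>a\<bar> (- 1)"
proof -
  have x: "x \<in> {-1..1}" using assms by auto
  then obtain u where u: "u \<in> {theta_prod \<bar>a\<bar> 1..theta_prod \<bar>a\<bar> (- 1)}" "multiplier a b x = \<kappa> * u"
    using multiplier_in_range by blast
  have "0 \<le> u" using u(1) theta_prod_nonneg[of "\<bar>a\<bar>" 1] by auto
  thus ?thesis using u unfolding u(2) abs_mult by (intro mult_left_mono) auto
qed

lemma mu_density_pos:
  assumes x: "x \<in> {-1<..<1}" shows "0 < mu_density q a b x"
proof -
  have x': "x \<in> {-1..1}" using x by auto
  have "qinf q (of_real q * cis (2 * arccos x)) \<noteq> 0"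
    using q by (intro qinf_nonzero[OF q]) (simp add: norm_mult)
  moreover have "0 < sqrt (1 - x\<^sup>2)" using x by (simp add: abs_square_less_1 abs_less_iff)
  ultimately have "0 < mu_density q 0 0 x"
    unfolding mu_density_hermite[OF q x'] using qinf_q_pos[OF q] by simp
  moreover have "0 < qinf q (a * b)" using abs_ab by (intro qinf_pos[OF q]) auto
  ultimately show ?thesis
    using askey_pair_pos[OF q a(2)] askey_pair_pos[OF q b] by (subst mu_density_eq[OF q]) simp
qed

lemma mu_measure_interval_pos:
  assumes A: "A \<in> sets \<mu>" and I: "{c<..<d} \<subseteq> A" and cd: "c < d" "{c<..<d} \<subseteq> {-1<..<1}"
  shows "0 < measure \<mu> A"
proof -
  interpret finite_measure \<mu> by (rule finite_mu)
  let ?R = "restrict_space lborel {-1<..<1::real}"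
  have dm: "(\<lambda>x. ennreal (mu_density q a b x)) \<in> borel_measurable ?R"
    using measurable_mu_density[OF q a(2) b] by measurable
  have Im: "{c<..<d} \<in> sets ?R" using cd(2) by (auto simp: sets_restrict_space image_iff intro!: bexI[of _ "{c<..<d}"])
  have "{c<..<d} \<notin> null_sets \<mu>"
  proof
    assume "{c<..<d} \<in> null_sets \<mu>"
    hence "AE x in ?R. x \<in> {c<..<d} \<longrightarrow> ennreal (mu_density q a b x) = 0"
      unfolding mu_measure_def null_sets_density_iff[OF dm] by blast
    moreover have "AE x in ?R. x \<in> {-1<..<1}" by (rule AE_I2) (simp add: space_restrict_space)
    ultimately have "AE x in ?R. x \<notin> {c<..<d}"
    proof eventually_elim
      case (elim x)
      thus ?case using mu_density_pos[of x] by (auto simp: ennreal_eq_0_iff)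
    qed
    hence "{c<..<d} \<in> null_sets ?R" using Im by (subst AE_iff_null_sets) auto
    hence "emeasure lborel {c<..<d} = 0" using cd(2) by (simp add: null_sets_def emeasure_restrict_space)
    thus False using cd(1) by simp
  qed
  moreover have "{c<..<d} \<in> sets \<mu>" using Im by (simp add: mu_measure_def)
  ultimately have "emeasure \<mu> {c<..<d} \<noteq> 0" by (auto simp: null_sets_def)
  hence "0 < measure \<mu> {c<..<d}" by (simp add: emeasure_eq_measure zero_less_measure_iff)
  also have "\<dots> \<le> measure \<mu> A" by (rule finite_measure_mono[OF I A])
  finally show ?thesis .
qed

text \<open>The intermediate value theorem gives a point x of the closed interval where s is
  attained. Even if x is an endpoint, continuity yields an open interval inside (-1, 1) near x, and
  such intervals have positive measure.\<close>

lemma multiplier_ess_range: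
  assumes s: "s \<in> (\<lambda>u. \<kappa> * u) ` {theta_prod \<bar>a\<bar> 1..theta_prod \<bar>a\<bar> (- 1)}" and "\<epsilon> > 0"
  shows "0 < measure \<mu> {x \<in> space \<mu>. \<bar>multiplier a b x - s\<bar> < \<epsilon>}"
proof -
  obtain u where u: "u \<in> {theta_prod \<bar>a\<bar> 1..theta_prod \<bar>a\<bar> (- 1)}" "s = \<kappa> * u" using s by blast
  obtain y where y: "y \<in> {-1..1}" "theta_prod \<bar>a\<bar> y = u"
    using IVT2'[of "theta_prod \<bar>a\<bar>" 1 u "-1"] u(1) continuous_on_theta_prod by auto
  define x where "x = sgn a * y"
  have x: "x \<in> {-1..1}" unfolding x_def by (rule sgn_a(3)[OF y(1)])
  have hx: "multiplier a b x = s"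
  proof -
    have "sgn a * x = y" unfolding x_def mult.assoc[symmetric] sgn_a(2) by simp
    thus ?thesis unfolding multiplier_eq[OF a(1) x] u(2) by (simp add: y)
  qed
  from continuous_on_multiplier[of a b] x \<open>\<epsilon> > 0\<close> obtain \<delta> where \<delta>: "\<delta> > 0"
    "\<And>z. z \<in> {-1..1} \<Longrightarrow> dist z x < \<delta> \<Longrightarrow> dist (multiplier a b z) (multiplier a b x) < \<epsilon>"
    unfolding continuous_on_iff by blast
  let ?A = "{x \<in> space \<mu>. \<bar>multiplier a b x - s\<bar> < \<epsilon>}"
  show ?thesis
  proof (rule mu_measure_interval_pos)
    show "?A \<in> sets \<mu>" using multiplier_measurable by measurable
    show "{max (-1) (x - \<delta>)<..<min 1 (x + \<delta>)} \<subseteq> ?A"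
    proof
      fix z assume z: "z \<in> {max (-1) (x - \<delta>)<..<min 1 (x + \<delta>)}"
      hence "dist z x < \<delta>" "z \<in> {-1..1}" by (auto simp: dist_real_def)
      from \<delta>(2)[OF this(2,1)] z show "z \<in> ?A" by (auto simp: hx dist_real_def)
    qed
    show "max (-1) (x - \<delta>) < min 1 (x + \<delta>)" using x \<delta>(1) by auto
  qed auto
qed

text \<open>The inverse of the multiplier is pointwise Lipschitz and so maps null sets to null sets.\<close>

lemma multiplier_null_preimage:
  assumes A: "A \<in> null_sets lborel"
  shows "multiplier a b -` A \<inter> space \<mu> \<in> null_sets \<mu>"
proof -
  let ?h = "multiplier a b" and ?I = "{-1<..<1::real}"
  define k where "k = inv_into ?I ?h"
  have k: "k (?h x) = x" if "x \<in> ?I" for x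
    unfolding k_def by (rule inv_into_f_f[OF multiplier_inj that])
  have "negligible (k ` (A \<inter> ?h ` ?I))"
  proof (rule negligible_locally_Lipschitz_image)
    have "A \<in> null_sets lebesgue" using A by (simp add: null_sets_completionI)
    hence "negligible A" by (simp add: negligible_iff_null_sets)
    thus "negligible (A \<inter> ?h ` ?I)" by (rule negligible_subset) auto
    fix s assume "s \<in> A \<inter> ?h ` ?I"
    then obtain x where x: "x \<in> ?I" "s = ?h x" by blast
    obtain c where c: "c > 0" "\<And>y. y \<in> ?I \<Longrightarrow> c * \<bar>x - y\<bar> \<le> \<bar>?h x - ?h y\<bar>"
      using multiplier_expansive[OF x(1)] by blast
    show "\<exists>T B. open T \<and> s \<in> T \<and> (\<forall>y\<in>A \<inter> ?h ` ?I \<inter> T. norm (k y - k s) \<le> B * norm (y - s))"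
    \<comment> \<open>The criterion compares only with the fixed point s and lets the Lipschitz
      constant depend on it, so the pointwise constant of \<open>multiplier_expansive\<close>
      suffices, with the whole line as neighbourhood.\<close>
    proof (intro exI[of _ UNIV] exI[of _ "1 / c"] conjI ballI)
      fix t assume "t \<in> A \<inter> ?h ` ?I \<inter> UNIV"
      then obtain y where y: "y \<in> ?I" "t = ?h y" by blast
      have "\<bar>x - y\<bar> \<le> 1 / c * \<bar>?h x - ?h y\<bar>" using c(2)[OF y(1)] c(1) by (simp add: field_simps)
      thus "norm (k t - k s) \<le> 1 / c * norm (t - s)"
        unfolding x(2) y(2) k[OF x(1)] k[OF y(1)] by (simp add: abs_minus_commute)
    qed auto
  qed simp
  moreover have "k ` (A \<inter> ?h ` ?I) = ?h -` A \<inter> ?I"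
    using k by force
  ultimately have neg: "?h -` A \<inter> ?I \<in> null_sets lebesgue" by (simp add: negligible_iff_null_sets)
  have Ab: "A \<in> sets borel" using A by (auto simp: null_sets_def)
  have m: "?h -` A \<inter> ?I \<in> sets (restrict_space lborel ?I)"
    using measurable_sets[OF multiplier_measurable Ab] by (simp add: mu_measure_def space_restrict_space)
  hence mb: "?h -` A \<inter> ?I \<in> sets lborel" by (auto simp: sets_restrict_space)
  have "emeasure lborel (?h -` A \<inter> ?I) = 0" using neg mb by (simp add: null_sets_def emeasure_completion)
  hence "?h -` A \<inter> ?I \<in> null_sets (restrict_space lborel ?I)"
    using m by (simp add: null_sets_def emeasure_restrict_space)
  moreover have "absolutely_continuous (restrict_space lborel ?I) \<mu>"
    unfolding mu_measure_def
    by (rule absolutely_continuousI_density) (use measurable_mu_density[OF q a(2) b] in measurable)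
  ultimately show ?thesis by (auto simp: absolutely_continuous_def)
qed

text \<open>Either the multiplier or its negative is strictly increasing, and both generate the same
  polynomials.\<close>

lemma multiplier_powers_dense:
  assumes f: "f \<in> L2 \<mu>" and "\<epsilon> > 0"
  shows "\<exists>n c. L2_norm \<mu> (\<lambda>x. f x - (\<Sum>k<n. c k * of_real (multiplier a b x) ^ k)) < \<epsilon>"
proof -
  have mm: "(\<lambda>x. - multiplier a b x) \<in> borel_measurable \<mu>" using multiplier_measurable by measurable
  have "f \<in> poly_closure \<mu> (multiplier a b)"
  proof (cases "\<kappa> * sgn a < 0")
    case True
    have "poly_closure \<mu> (multiplier a b) = L2 \<mu>"
    proof (rule poly_closure_strict_mono[OF finite_mu])
      show "strict_mono_on {-1<..<1} (multiplier a b)"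
        using multiplier_monotone True by (intro strict_mono_onI) auto
      show "\<bar>multiplier a b x\<bar> \<le> \<bar>\<kappa>\<bar> * theta_prod \<bar>a\<bar> (- 1)" if "x \<in> {-1<..<1}" for x
        using multiplier_bound[of x] that by simp
    qed (auto simp: sets_mu_measure multiplier_measurable)
    thus ?thesis using f by simp
  next
    case False
    have "poly_closure \<mu> (\<lambda>x. - multiplier a b x) = L2 \<mu>"
    proof (rule poly_closure_strict_mono[OF finite_mu _ _ mm])
      show "strict_mono_on {-1<..<1} (\<lambda>x. - multiplier a b x)"
        using multiplier_monotone False by (intro strict_mono_onI) auto
      show "\<bar>- multiplier a b x\<bar> \<le> \<bar>\<kappa>\<bar> * theta_prod \<bar>a\<bar> (- 1)" if "x \<in> {-1<..<1}" for x
        using multiplier_bound[of x] that by simp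
    qed (auto simp: sets_mu_measure)
    thus ?thesis using f poly_closure_uminus[of \<mu> "multiplier a b"] by auto
  qed
  then obtain p where p: "L2_norm \<mu> (\<lambda>x. f x - poly p (of_real (multiplier a b x))) < \<epsilon>"
    using \<open>\<epsilon> > 0\<close> unfolding poly_closure_def by blast
  thus ?thesis
    unfolding poly_altdef lessThan_Suc_atMost[symmetric] by blast
qed

end

end

text \<open>\<open>nondegenerate\<close> excludes the parameters with (qb/a; q)_inf = 0, where h and
  some term of the series in the matrix entries would have a zero denominator. Existence of a
  bounded operator with the given matrix is part of the claim; since the matrix determines the
  operator on square-summable sequences, the remaining assertions are made for every such H.\<close>

theorem theorem3:
  fixes q a b :: real
  assumes "0 < q" and "q < 1"
    and "0 < \<bar>a\<bar>" and "\<bar>a\<bar> < 1" and "\<bar>b\<bar> < 1"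
    and nondegenerate: "\<And>k::nat. q * b / a * q ^ k \<noteq> 1"
  shows "(\<exists>H. has_matrix H (\<lambda>m n. of_real (H_entry q a b m n))) \<and>
    (\<forall>H. has_matrix H (\<lambda>m n. of_real (H_entry q a b m n)) \<longrightarrow>
      L2_unitarily_equivalent ell2_measure H (mu_measure q a b) (mult_op (h_fun q a b)) \<and>
      simple_spectrum ell2_measure H \<and>
      purely_ac_spectrum ell2_measure H \<and>
      L2_spectrum ell2_measure H = ac_spectrum ell2_measure H \<and>
      ac_spectrum ell2_measure H =
        complex_of_real ` ((\<lambda>u. 1 / qpoch_inf [a * b, q * b / a] q * u) `
          {(qpoch_inf [\<bar>a\<bar>, q / \<bar>a\<bar>] q)\<^sup>2 .. (qpoch_inf [- \<bar>a\<bar>, - (q / \<bar>a\<bar>)] q)\<^sup>2}) \<and>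
      L2_opnorm ell2_measure H =
        (qpoch_inf [- \<bar>a\<bar>, - (q / \<bar>a\<bar>)] q)\<^sup>2 / \<bar>qpoch_inf [a * b, q * b / a] q\<bar>)"
proof -
  note q = assms(1,2)
  have a0: "a \<noteq> 0" using assms(3) by simp
  note ctx = q a0 assms(4,5) nondegenerate
  let ?\<mu> = "mu_measure q a b" and ?P = "asc_normalized q a b" and ?h = "multiplier q a b"
  let ?A = "\<lambda>m n. complex_of_real (H_entry q a b m n)"
  define V where "V = (\<lambda>f n. L2_inner ?\<mu> (?P n) f)"
  have V: "L2_unitary ?\<mu> ell2_measure V" unfolding V_def by (rule asc_transform_unitary[OF ctx])
  obtain U where U: "L2_unitary ell2_measure ?\<mu> U" "\<And>g. g \<in> L2 ell2_measure \<Longrightarrow> AE x in ell2_measure. V (U g) x = g x"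
    and UV: "\<And>f. f \<in> L2 ?\<mu> \<Longrightarrow> AE x in ?\<mu>. U (V f) x = f x"
    using L2_unitary_inverse[OF V] by blast
  have VU: "V (U g) = g" if "g \<in> L2 ell2_measure" for g using U(2)[OF that] by (simp add: fun_eq_iff)
  note un = finite_mu[OF ctx] V U(1) VU UV
  define \<kappa> where "\<kappa> = 1 / (qinf q (a * b) * qinf q (q * b / a))"
  define r where "r = theta_prod q \<bar>a\<bar> (- 1)"
  define S where "S = (\<lambda>u. \<kappa> * u) ` {theta_prod q \<bar>a\<bar> 1..r}"
  have hm: "?h \<in> borel_measurable ?\<mu>" by (rule multiplier_measurable[OF ctx])
  have hB: "\<bar>?h x\<bar> \<le> \<bar>\<kappa>\<bar> * r" if "x \<in> space ?\<mu>" for x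
    unfolding \<kappa>_def r_def by (rule multiplier_bound[OF ctx that])
  define w where "w = (\<lambda>x. complex_of_real (?h x))"
  have w: "w \<in> borel_measurable ?\<mu>" unfolding w_def using hm by measurable
  have wB: "AE x in ?\<mu>. cmod (w x) \<le> \<bar>\<kappa>\<bar> * r" unfolding w_def using hB by (intro AE_I2) simp
  \<comment> \<open>Boundedness of the matrix operator comes from this construction: the conjugated
    multiplication is bounded because h is, and its entries are then compared with
    \<open>H_entry\<close>.\<close>
  define H\<^sub>0 where "H\<^sub>0 = mult_conj V U w"
  have H\<^sub>0: "has_matrix H\<^sub>0 ?A"
    unfolding has_matrix_def
  proof (intro conjI allI)
    show bd: "L2_bounded_op ell2_measure H\<^sub>0" unfolding H\<^sub>0_def by (rule mult_conj_bounded[OF un w wB])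
    fix m n
    have P: "?P n \<in> L2 ?\<mu>" by (rule asc_normalized_L2[OF ctx])
    have Vn: "V (?P n) = std_basis n" unfolding V_def by (rule asc_transform_basis[OF ctx])
    have "H\<^sub>0 (std_basis n) = V (\<lambda>x. w x * ?P n x)"
      unfolding H\<^sub>0_def Vn[symmetric] by (rule mult_conj_V[OF un w wB P])
    moreover have "H\<^sub>0 (std_basis n) \<in> L2 ell2_measure"
      unfolding H\<^sub>0_def by (rule mult_conj_mem[OF un w wB ell2_std_basis])
    ultimately have "L2_inner ell2_measure (std_basis m) (H\<^sub>0 (std_basis n)) = L2_inner ?\<mu> (?P m) (\<lambda>x. of_real (?h x) * ?P n x)"
      by (simp add: ell2_inner_std_basis V_def w_def)
    also have "\<dots> = ?A m n"
      unfolding asc_normalized_inner[OF ctx continuous_on_multiplier[OF q]] H_entry_eq[OF ctx] ..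
    finally show "L2_inner ell2_measure (std_basis m) (H\<^sub>0 (std_basis n)) = ?A m n" .
  qed
  have constants: "qpoch_inf [a * b, q * b / a] q = qinf q (a * b) * qinf q (q * b / a)"
    "(qpoch_inf [\<bar>a\<bar>, q / \<bar>a\<bar>] q)\<^sup>2 = theta_prod q \<bar>a\<bar> 1"
    "(qpoch_inf [- \<bar>a\<bar>, - (q / \<bar>a\<bar>)] q)\<^sup>2 = r"
    by (simp_all add: r_def theta_prod_def[OF q] askey_pair_one[OF q] askey_pair_minus_one[OF q] qpoch_inf_eq_qinf_real power_mult_distrib)
  have r0: "0 \<le> r" unfolding r_def by (rule theta_prod_nonneg[OF q])
  \<comment> \<open>The theta product is largest at - 1, so this is the element of S of greatest
    modulus, whatever the sign of \<kappa>.\<close>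
  have rS: "\<kappa> * r \<in> S"
    using theta_prod_expansive(2)[OF q assms(3), of "-1" 1] by (auto simp: S_def r_def)
  have ess: "0 < measure ?\<mu> {x \<in> space ?\<mu>. \<bar>?h x - s\<bar> < \<epsilon>}" if "s \<in> S" "\<epsilon> > 0" for s \<epsilon>
    using multiplier_ess_range[OF ctx] that unfolding S_def \<kappa>_def r_def by blast
  have "L2_unitarily_equivalent ell2_measure H ?\<mu> (mult_op (h_fun q a b)) \<and> simple_spectrum ell2_measure H \<and>
      purely_ac_spectrum ell2_measure H \<and> L2_spectrum ell2_measure H = ac_spectrum ell2_measure H \<and>
      ac_spectrum ell2_measure H = complex_of_real ` S \<and> L2_opnorm ell2_measure H = \<bar>\<kappa>\<bar> * r"
    if Hm: "has_matrix H ?A" for H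
  proof -
    \<comment> \<open>Agreement with \<open>H\<^sub>0\<close> on square-summable sequences is
      exactly what the results on conjugated multiplications assume.\<close>
    have H: "H f = mult_conj V U (\<lambda>x. of_real (?h x)) f" if "f \<in> L2 ell2_measure" for f
      using has_matrix_unique[OF Hm H\<^sub>0 that] by (simp only: H\<^sub>0_def w_def)
    note mult = un hm hB H
    have ac: "ac_subspace ell2_measure H = L2 ell2_measure"
      by (rule mult_conj_ac_subspace[OF mult multiplier_null_preimage[OF ctx]])
    have cl: "closed S"
      unfolding S_def by (intro compact_imp_closed compact_continuous_image continuous_intros) simp
    have spec: "L2_spectrum ell2_measure H = complex_of_real ` S"
    proof (rule mult_conj_spectrum[OF mult])
      fix x assume "x \<in> space ?\<mu>"
      hence "x \<in> {-1..1}" by auto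
      thus "?h x \<in> S" using multiplier_in_range[OF ctx] unfolding S_def \<kappa>_def r_def by blast
    qed (rule cl ess | assumption)+
    have "L2_opnorm ell2_measure H = \<bar>\<kappa>\<bar> * r"
    proof (rule mult_conj_opnorm[OF mult])
      fix \<epsilon> :: real assume "\<epsilon> > 0"
      interpret finite_measure ?\<mu> by (rule finite_mu[OF ctx])
      note hm[measurable]
      \<comment> \<open>Values of h near \<kappa> r have modulus near |\<kappa>| r, so the essential
        range at this one point gives the positive measure needed for the norm.\<close>
      have "\<bar>\<bar>?h x\<bar> - \<bar>\<kappa>\<bar> * r\<bar> \<le> \<bar>?h x - \<kappa> * r\<bar>" for x
        using abs_triangle_ineq3[of "?h x" "\<kappa> * r"] r0 by (simp add: abs_mult)
      hence "{x \<in> space ?\<mu>. \<bar>?h x - \<kappa> * r\<bar> < \<epsilon>} \<subseteq> {x \<in> space ?\<mu>. \<bar>\<bar>?h x\<bar> - \<bar>\<kappa>\<bar> * r\<bar> < \<epsilon>}"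
        using order_le_less_trans by blast
      hence "measure ?\<mu> {x \<in> space ?\<mu>. \<bar>?h x - \<kappa> * r\<bar> < \<epsilon>} \<le> measure ?\<mu> {x \<in> space ?\<mu>. \<bar>\<bar>?h x\<bar> - \<bar>\<kappa>\<bar> * r\<bar> < \<epsilon>}"
        by (rule finite_measure_mono) measurable
      thus "0 < measure ?\<mu> {x \<in> space ?\<mu>. \<bar>\<bar>?h x\<bar> - \<bar>\<kappa>\<bar> * r\<bar> < \<epsilon>}"
        using ess[OF rS \<open>\<epsilon> > 0\<close>] by linarith
    qed (use r0 in auto)
    moreover have "L2_unitarily_equivalent ell2_measure H ?\<mu> (mult_op (h_fun q a b))"
      by (rule mult_conj_unitarily_equivalent[OF mult h_fun_eq[OF q]])
    moreover have "simple_spectrum ell2_measure H"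
      by (rule mult_conj_simple_spectrum[OF mult multiplier_powers_dense[OF ctx]])
    \<comment> \<open>The absolutely continuous subspace is the whole space, so
      \<open>ac_spectrum\<close> and \<open>L2_spectrum\<close> are the same restriction of
      H.\<close>
    ultimately show ?thesis
      using ac spec unfolding purely_ac_spectrum_def ac_spectrum_def L2_spectrum_def by simp
  qed
  moreover have "\<bar>\<kappa>\<bar> * r = r / \<bar>qinf q (a * b) * qinf q (q * b / a)\<bar>"
    unfolding \<kappa>_def by (simp add: abs_mult)
  ultimately show ?thesis
    unfolding constants S_def \<kappa>_def[symmetric] using H\<^sub>0 by (metis (no_types, lifting))
qed

end
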